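(* The family $(H(t))_{t\ge0}$ is a Feller–Markov semigroup on $(C(A_0),\|\cdot\|_\infty)$, i.e. a strongly continuous, contractive and positive (meaning $f\ge0$ on $A_0$ implies $H(t)f\ge0$ on $A_0$) semigroup of bounded operators. Its generator is the closure $\overline{L_m}$ of the operator $L_m$ with domain $\mathcal T^W$.
   Context: Let $\mathfrak a$ be a finite-dimensional real Euclidean space with inner product $\langle\cdot,\cdot\rangle$, identified with its dual. Let $\Sigma\subset\mathfrak a$ be a (not necessarily reduced) root system with Weyl group $W$ and positive subsystem $\Sigma^+$. Let $m:\Sigma\to[0,\infty)$ be $W$-invariant, $\rho=\frac12\sum_{\alpha\in\Sigma^+}m_\alpha\alpha$, $\lambda_\alpha=\langle\lambda,\alpha\rangle/\langle\alpha,\alpha\rangle$, $\Lambda^+=\{\lambda\in\mathfrak a:\lambda_\alpha\in\mathbb Z_{\ge0}\ \forall\alpha\in\Sigma^+\}$, $\mu\preceq\lambda$ iff $\lambda-\mu\in\mathbb Z_{\ge0}.\Sigma^+$. Let $w_m(x)=\prod_{\alpha\in\Sigma^+}|e^{i\langle\alpha,x\rangle}-e^{-i\langle\alpha,x\rangle}|^{m_\alpha}$, $A_0=\{x\in\mathfrak a:0\le\langle\alpha,x\rangle\le\pi\ \forall\alpha\in\Sigma^+\}$ (closed fundamental alcove), $\langle f,g\rangle_m=\int_{A_0}f\bar g\,w_m\,dx$. For $\lambda\in\Lambda^+$ let $M_\lambda=\sum_{\mu\in W\lambda}e^{i\langle\mu,\cdot\rangle}$; $\mathcal T^W$ denotes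 the linear span of $\{M_\lambda:\lambda\in\Lambda^+\}$ (the $W$-invariant trigonometric polynomials), regarded as functions on $A_0$. Heckman–Opdam polynomials: $P_\lambda=\sum_{\mu\in\Lambda^+,\mu\preceq\lambda}c_{\lambda\mu}M_\mu$, $c_{\lambda\lambda}=1$, $\langle P_\lambda,M_\mu\rangle_m=0$ for $\mu\preceq\lambda$, $\mu\ne\lambda$; $R_\lambda=P_\lambda/P_\lambda(0)$, $r_\lambda=1/\langle R_\lambda,R_\lambda\rangle_m$, $\theta_\lambda=\langle\lambda,\lambda+2\rho\rangle$. Heat kernel $\Gamma_m(x,y,t)=\sum_{\lambda\in\Lambda^+}r_\lambda e^{-\theta_\lambda t}R_\lambda(x)R_\lambda(-y)$; $H(t)f(x)=\int_{A_0}\Gamma_m(x,y,t)f(y)w_m(y)\,dy$ for $t>0$, $H(0)f=f$. The Heckman–Opdam Laplacian is $L_m=\Delta+\sum_{\alpha\in\Sigma^+}m_\alpha\cot\langle\alpha,x\rangle\,\partial_\alpha$ ($\Delta$ the Euclidean Laplacian, $\partial_\alpha$ the directional derivative in direction $\alpha$). *)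

theory Defs
  imports "HOL-Analysis.Analysis"
begin

definition refl_root :: "'a::euclidean_space \<Rightarrow> 'a \<Rightarrow> 'a" where
  "refl_root \<alpha> x = x - (2 * (x \<bullet> \<alpha>) / (\<alpha> \<bullet> \<alpha>)) *\<^sub>R \<alpha>"

definition root_system :: "'a::euclidean_space set \<Rightarrow> bool" where
  "root_system S \<longleftrightarrow> finite S \<and> 0 \<notin> S \<and> span S = UNIV
     \<and> (\<forall>\<alpha>\<in>S. \<forall>\<beta>\<in>S. refl_root \<alpha> \<beta> \<in> S)
     \<and> (\<forall>\<alpha>\<in>S. \<forall>\<beta>\<in>S. 2 * (\<beta> \<bullet> \<alpha>) / (\<alpha> \<bullet> \<alpha>) \<in> \<int>)"

definition positive_subsystem :: "'a::euclidean_space set \<Rightarrow> 'a set \<Rightarrow> bool" where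
  "positive_subsystem S Sp \<longleftrightarrow>
     (\<exists>\<xi>. (\<forall>\<alpha>\<in>S. \<alpha> \<bullet> \<xi> \<noteq> 0) \<and> Sp = {\<alpha>\<in>S. \<alpha> \<bullet> \<xi> > 0})"

inductive_set weyl_group :: "'a::euclidean_space set \<Rightarrow> ('a \<Rightarrow> 'a) set" for S where
  weyl_id: "id \<in> weyl_group S"
| weyl_step: "w \<in> weyl_group S \<Longrightarrow> \<alpha> \<in> S \<Longrightarrow> refl_root \<alpha> \<circ> w \<in> weyl_group S"

definition rho :: "'a::euclidean_space set \<Rightarrow> ('a \<Rightarrow> real) \<Rightarrow> 'a" where
  "rho Sp m = (1/2) *\<^sub>R (\<Sum>\<alpha>\<in>Sp. m \<alpha> *\<^sub>R \<alpha>)"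

definition dominant_weights :: "'a::euclidean_space set \<Rightarrow> 'a set" where
  "dominant_weights Sp = {l. \<forall>\<alpha>\<in>Sp. (l \<bullet> \<alpha>) / (\<alpha> \<bullet> \<alpha>) \<in> \<nat>}"

definition root_le :: "'a::euclidean_space set \<Rightarrow> 'a \<Rightarrow> 'a \<Rightarrow> bool" where
  "root_le Sp \<mu> l \<longleftrightarrow> (\<exists>c::'a \<Rightarrow> nat. l - \<mu> = (\<Sum>\<alpha>\<in>Sp. real (c \<alpha>) *\<^sub>R \<alpha>))"

definition alcove :: "'a::euclidean_space set \<Rightarrow> 'a set" where
  "alcove Sp = {x. \<forall>\<alpha>\<in>Sp. 0 \<le> \<alpha> \<bullet> x \<and> \<alpha> \<bullet> x \<le> pi}"

definition orbit_sum :: "'a::euclidean_space set \<Rightarrow> 'a \<Rightarrow> 'a \<Rightarrow> complex" where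
  "orbit_sum S l x = (\<Sum>\<mu>\<in>(\<lambda>w. w l) ` weyl_group S. exp (\<i> * complex_of_real (\<mu> \<bullet> x)))"

text \<open>Real power with the convention b^0 = 1 (also for b = 0).\<close>
definition pow0 :: "real \<Rightarrow> real \<Rightarrow> real" where
  "pow0 b e = (if e = 0 then 1 else b powr e)"

definition weight_fn :: "'a::euclidean_space set \<Rightarrow> ('a \<Rightarrow> real) \<Rightarrow> 'a \<Rightarrow> real" where
  "weight_fn Sp m x = (\<Prod>\<alpha>\<in>Sp.
     pow0 (norm (exp (\<i> * complex_of_real (\<alpha> \<bullet> x)) - exp (- \<i> * complex_of_real (\<alpha> \<bullet> x)))) (m \<alpha>))"

definition ip_m :: "'a::euclidean_space set \<Rightarrow> ('a \<Rightarrow> real) \<Rightarrow> ('a \<Rightarrow> complex) \<Rightarrow> ('a \<Rightarrow> complex) \<Rightarrow> complex" where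
  "ip_m Sp m f g = (LINT x:alcove Sp|lborel. f x * cnj (g x) * complex_of_real (weight_fn Sp m x))"

definition HO_poly :: "'a::euclidean_space set \<Rightarrow> 'a set \<Rightarrow> ('a \<Rightarrow> real) \<Rightarrow> 'a \<Rightarrow> 'a \<Rightarrow> complex" where
  "HO_poly S Sp m l = (THE P. \<exists>c::'a \<Rightarrow> complex.
       P = (\<lambda>x. \<Sum>\<mu>\<in>{\<mu>\<in>dominant_weights Sp. root_le Sp \<mu> l}. c \<mu> * orbit_sum S \<mu> x)
     \<and> c l = 1
     \<and> (\<forall>\<mu>\<in>dominant_weights Sp. root_le Sp \<mu> l \<and> \<mu> \<noteq> l \<longrightarrow> ip_m Sp m P (orbit_sum S \<mu>) = 0))"

definition HO_R :: "'a::euclidean_space set \<Rightarrow> 'a set \<Rightarrow> ('a \<Rightarrow> real) \<Rightarrow> 'a \<Rightarrow> 'a \<Rightarrow> complex" where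
  "HO_R S Sp m l x = HO_poly S Sp m l x / HO_poly S Sp m l 0"

definition HO_r :: "'a::euclidean_space set \<Rightarrow> 'a set \<Rightarrow> ('a \<Rightarrow> real) \<Rightarrow> 'a \<Rightarrow> complex" where
  "HO_r S Sp m l = 1 / ip_m Sp m (HO_R S Sp m l) (HO_R S Sp m l)"

definition HO_theta :: "'a::euclidean_space set \<Rightarrow> ('a \<Rightarrow> real) \<Rightarrow> 'a \<Rightarrow> real" where
  "HO_theta Sp m l = l \<bullet> (l + 2 *\<^sub>R rho Sp m)"

definition heat_kernel :: "'a::euclidean_space set \<Rightarrow> 'a set \<Rightarrow> ('a \<Rightarrow> real) \<Rightarrow> 'a \<Rightarrow> 'a \<Rightarrow> real \<Rightarrow> complex" where
  "heat_kernel S Sp m x y t = infsum (\<lambda>l. HO_r S Sp m l * complex_of_real (exp (- HO_theta Sp m l * t))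
        * HO_R S Sp m l x * HO_R S Sp m l (- y)) (dominant_weights Sp)"

definition heat_sg :: "'a::euclidean_space set \<Rightarrow> 'a set \<Rightarrow> ('a \<Rightarrow> real) \<Rightarrow> real \<Rightarrow> ('a \<Rightarrow> complex) \<Rightarrow> 'a \<Rightarrow> complex" where
  "heat_sg S Sp m t f x = (if t = 0 then f x else
     (LINT y:alcove Sp|lborel. heat_kernel S Sp m x y t * f y * complex_of_real (weight_fn Sp m y)))"

definition trig_W :: "'a::euclidean_space set \<Rightarrow> 'a set \<Rightarrow> ('a \<Rightarrow> complex) set" where
  "trig_W S Sp = {f. \<exists>F c. finite F \<and> F \<subseteq> dominant_weights Sp
                     \<and> f = (\<lambda>x. \<Sum>l\<in>F. c l * orbit_sum S l x)}"

definition dir_deriv :: "('a::euclidean_space \<Rightarrow> complex) \<Rightarrow> 'a \<Rightarrow> 'a \<Rightarrow> complex" where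
  "dir_deriv f v x = vector_derivative (\<lambda>s::real. f (x + s *\<^sub>R v)) (at 0)"

definition laplacian :: "('a::euclidean_space \<Rightarrow> complex) \<Rightarrow> 'a \<Rightarrow> complex" where
  "laplacian f x = (\<Sum>b\<in>Basis. dir_deriv (\<lambda>y. dir_deriv f b y) b x)"

definition HO_laplacian :: "'a::euclidean_space set \<Rightarrow> ('a \<Rightarrow> real) \<Rightarrow> ('a \<Rightarrow> complex) \<Rightarrow> 'a \<Rightarrow> complex" where
  "HO_laplacian Sp m f x = laplacian f x
     + (\<Sum>\<alpha>\<in>Sp. complex_of_real (m \<alpha> * cot (\<alpha> \<bullet> x)) * dir_deriv f \<alpha> x)"

text \<open>L_m f regarded as a function on the closed alcove: continuous extension from the interior
  (the cot singularities on the walls are removable for W-invariant f).\<close>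
definition HO_laplacian_A0 :: "'a::euclidean_space set \<Rightarrow> ('a \<Rightarrow> real) \<Rightarrow> ('a \<Rightarrow> complex) \<Rightarrow> 'a \<Rightarrow> complex" where
  "HO_laplacian_A0 Sp m f x = Lim (at x within interior (alcove Sp)) (HO_laplacian Sp m f)"

definition supn :: "'a set \<Rightarrow> ('a \<Rightarrow> complex) \<Rightarrow> real" where
  "supn A f = (SUP x\<in>A. norm (f x))"

definition generator_graph :: "'a::topological_space set \<Rightarrow> (real \<Rightarrow> ('a \<Rightarrow> complex) \<Rightarrow> 'a \<Rightarrow> complex)
     \<Rightarrow> (('a \<Rightarrow> complex) \<times> ('a \<Rightarrow> complex)) set" where
  "generator_graph A T = {(f, g). continuous_on A f \<and> continuous_on A g
      \<and> ((\<lambda>t. supn A (\<lambda>x. (T t f x - f x) / complex_of_real t - g x)) \<longlongrightarrow> 0) (at_right 0)}"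

definition closure_graph :: "'a::topological_space set \<Rightarrow> ('a \<Rightarrow> complex) set \<Rightarrow> (('a \<Rightarrow> complex) \<Rightarrow> 'a \<Rightarrow> complex)
     \<Rightarrow> (('a \<Rightarrow> complex) \<times> ('a \<Rightarrow> complex)) set" where
  "closure_graph A D L = {(f, g). continuous_on A f \<and> continuous_on A g
      \<and> (\<exists>F. (\<forall>n. F n \<in> D) \<and> (\<lambda>n. supn A (\<lambda>x. F n x - f x)) \<longlonglongrightarrow> 0
             \<and> (\<lambda>n. supn A (\<lambda>x. L (F n) x - g x)) \<longlonglongrightarrow> 0)}"

end

theory Submission
  imports Defs
begin

text \<open>
  The Heckman--Opdam polynomials are eigenfunctions of \<open>L_m\<close>: integration by parts against the weight
  on a fundamental domain of the coroot lattice makes the Cherednik operators, and hence \<open>L_m\<close>,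
  symmetric, while both are triangular with respect to the dominance order. When \<open>L_m\<close> has the same
  eigenvalue on \<open>P_\<lambda>\<close> and \<open>P_\<mu>\<close>, orthogonality comes from the top eigenvalue of a single
  Cherednik operator in a generic direction. A maximum principle for \<open>L_m\<close> on invariant trigonometric polynomials gives
  contractivity and positivity of the resolvents \<open>(1 - s L_m)\<^sup>-\<^sup>1\<close> on \<open>\<T>\<^sup>W\<close>, and therefore of
  \<open>H t\<close>, which multiplies \<open>P_\<lambda>\<close> by \<open>exp (- \<theta>_\<lambda> t)\<close>. Since \<open>\<T>\<^sup>W\<close> separates the points of
  the alcove, it is dense by Stone--Weierstrass, and everything extends to continuous functions. As
  \<open>1 - L_m\<close> maps \<open>\<T>\<^sup>W\<close> onto itself and generators of contraction semigroups are dissipative,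
  \<open>\<T>\<^sup>W\<close> is a core.
\<close>

section \<open>Reflections and the Weyl group\<close>

text \<open>The operators are handled on characters \<open>chr \<nu>\<close>: the quotient of
  \<open>chr \<nu> - chr (refl_root \<alpha> \<nu>)\<close> by the root factor is a finite signed
  sum over a root string. Cotangents are thereby traded for finite sums, and symmetry reduces to one
  linear relation among the \<open>W\<close>-invariant Fourier coefficients \<open>I \<nu>\<close>
  of the weight. Integrals are taken over the cell where all roots satisfy |\<alpha> . x| < \<pi>,
  not over a lattice parallelepiped: it tiles space under \<pi> times the coroot lattice and is also
  \<open>W\<close>-stable, so translations and reflections are both admissible substitutions. The
  off-diagonal entries of the Laplacian on orbit sums are nonpositive, hence the polynomials have
  nonnegative coefficients. This yields \<open>|R| <= 1\<close> and a lower bound near the origin,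
  from which the norms decay at most polynomially and the heat kernel converges uniformly. The
  maximum principle speaks only about \<open>trig_W\<close>; to carry its consequences over to
  continuous functions before contractivity is available, a crude kernel bound depending on
  \<open>t\<close> is used.\<close>

definition coroot :: "'a::euclidean_space \<Rightarrow> 'a" where
  "coroot \<alpha> = (2 / (\<alpha> \<bullet> \<alpha>)) *\<^sub>R \<alpha>"

lemma refl_root_eq: "refl_root \<alpha> x = x - (x \<bullet> coroot \<alpha>) *\<^sub>R \<alpha>"
  by (simp add: refl_root_def coroot_def)

lemma refl_root_eq': "refl_root \<alpha> x = x - (x \<bullet> \<alpha>) *\<^sub>R coroot \<alpha>"
  by (simp add: refl_root_def coroot_def)

lemma inner_coroot_pos_iff: "\<alpha> \<noteq> 0 \<Longrightarrow> coroot \<alpha> \<bullet> x > 0 \<longleftrightarrow> \<alpha> \<bullet> x > 0"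
  using inner_ge_zero[of \<alpha>] by (auto simp: coroot_def zero_less_divide_iff simp del: inner_ge_zero)

lemma coroot_uminus: "coroot (- \<alpha>) = - coroot \<alpha>"
  by (simp add: coroot_def)

lemma linear_refl_root: "linear (refl_root \<alpha>)"
  by (intro linearI) (auto simp: refl_root_def algebra_simps inner_left_distrib add_divide_distrib)

lemma refl_root_inner: "refl_root \<alpha> x \<bullet> refl_root \<alpha> y = x \<bullet> y"
  by (cases "\<alpha> = 0") (auto simp: refl_root_def inner_diff_left inner_diff_right inner_commute field_simps)

lemma refl_root_invol [simp]: "refl_root \<alpha> (refl_root \<alpha> x) = x"
  by (cases "\<alpha> = 0") (auto simp: refl_root_def inner_diff_left field_simps simp flip: scaleR_add_left)

lemma refl_root_comp_self [simp]: "refl_root \<alpha> \<circ> refl_root \<alpha> = id"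
  by (auto simp: fun_eq_iff)

lemma refl_root_self: "\<alpha> \<noteq> 0 \<Longrightarrow> refl_root \<alpha> \<alpha> = - \<alpha>"
  by (simp add: refl_root_def scaleR_2)

lemma refl_root_uminus: "refl_root (- \<alpha>) = refl_root \<alpha>"
  by (auto simp: fun_eq_iff refl_root_def)

lemma refl_root_scale: "c \<noteq> 0 \<Longrightarrow> refl_root (c *\<^sub>R \<alpha>) = refl_root \<alpha>"
  by (auto simp: fun_eq_iff refl_root_def field_simps)

lemma refl_root_inner_commute: "refl_root \<alpha> x \<bullet> y = x \<bullet> refl_root \<alpha> y"
  using refl_root_inner[of \<alpha> x "refl_root \<alpha> y"] by simp

lemma isometry_coroot:
  assumes "linear w" "\<And>x y. w x \<bullet> w y = x \<bullet> y"
  shows "w (coroot \<alpha>) = coroot (w \<alpha>)"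
  using assms by (simp add: coroot_def linear_scale)

lemma isometry_refl_root:
  assumes "linear w" "\<And>x y. w x \<bullet> w y = x \<bullet> y"
  shows "w (refl_root \<alpha> x) = refl_root (w \<alpha>) (w x)"
  using assms by (simp add: refl_root_def linear_diff linear_scale)

locale root_data =
  fixes S Sp :: "'a::euclidean_space set" and m :: "'a \<Rightarrow> real"
  assumes rs: "root_system S" and pos: "positive_subsystem S Sp"
    and m_nonneg: "\<forall>\<alpha>\<in>S. 0 \<le> m \<alpha>"
    and m_invar: "\<forall>w\<in>weyl_group S. \<forall>\<alpha>\<in>S. m (w \<alpha>) = m \<alpha>"
begin

definition xi :: 'a where
  "xi = (SOME \<xi>. (\<forall>\<alpha>\<in>S. \<alpha> \<bullet> \<xi> \<noteq> 0) \<and> Sp = {\<alpha>\<in>S. \<alpha> \<bullet> \<xi> > 0})"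

lemma xi: "\<alpha> \<in> S \<Longrightarrow> \<alpha> \<bullet> xi \<noteq> 0" and Sp_iff: "\<alpha> \<in> Sp \<longleftrightarrow> \<alpha> \<in> S \<and> \<alpha> \<bullet> xi > 0"
proof -
  have "(\<forall>\<alpha>\<in>S. \<alpha> \<bullet> xi \<noteq> 0) \<and> Sp = {\<alpha>\<in>S. \<alpha> \<bullet> xi > 0}"
    unfolding xi_def by (rule someI_ex) (use pos in \<open>simp add: positive_subsystem_def\<close>)
  then show "\<alpha> \<in> S \<Longrightarrow> \<alpha> \<bullet> xi \<noteq> 0" "\<alpha> \<in> Sp \<longleftrightarrow> \<alpha> \<in> S \<and> \<alpha> \<bullet> xi > 0" by blast+
qed

lemma finite_S: "finite S" and S_nz: "\<alpha> \<in> S \<Longrightarrow> \<alpha> \<noteq> 0" and span_S: "span S = UNIV"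
  and refl_S: "\<alpha> \<in> S \<Longrightarrow> \<beta> \<in> S \<Longrightarrow> refl_root \<alpha> \<beta> \<in> S"
  and int_S: "\<alpha> \<in> S \<Longrightarrow> \<beta> \<in> S \<Longrightarrow> \<beta> \<bullet> coroot \<alpha> \<in> \<int>"
  using rs by (auto simp: root_system_def coroot_def)

lemma Sp_S: "\<alpha> \<in> Sp \<Longrightarrow> \<alpha> \<in> S" and finite_Sp: "finite Sp" and Sp_xi: "\<alpha> \<in> Sp \<Longrightarrow> \<alpha> \<bullet> xi > 0"
  and Sp_nz: "\<alpha> \<in> Sp \<Longrightarrow> \<alpha> \<noteq> 0"
  using S_nz finite_subset[OF _ finite_S, of Sp] by (auto simp: Sp_iff subset_iff)

lemma uminus_S: "\<alpha> \<in> S \<Longrightarrow> - \<alpha> \<in> S"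
  using refl_S[of \<alpha> \<alpha>] refl_root_self S_nz by metis

lemma S_cases: assumes "\<alpha> \<in> S" obtains "\<alpha> \<in> Sp" "- \<alpha> \<notin> Sp" | "- \<alpha> \<in> Sp" "\<alpha> \<notin> Sp"
  using assms xi[of \<alpha>] uminus_S[of \<alpha>] by (auto simp: Sp_iff) linarith

lemma span_Sp: "span Sp = UNIV"
proof -
  have "S \<subseteq> span Sp"
  proof
    fix \<alpha> assume "\<alpha> \<in> S"
    then show "\<alpha> \<in> span Sp"
      by (cases rule: S_cases) (use span_base[of \<alpha> Sp] span_neg[OF span_base[of "- \<alpha>" Sp]] in auto)
  qed
  then show ?thesis using span_S span_mono span_span by (metis subset_antisym top_greatest)
qed

lemma eq_0_if_orthogonal: assumes "\<And>\<alpha>. \<alpha> \<in> Sp \<Longrightarrow> x \<bullet> \<alpha> = 0" shows "x = 0"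
proof -
  have "orthogonal x y" for y
    using orthogonal_to_span[of y Sp x] assms by (simp add: span_Sp orthogonal_def)
  then show ?thesis by (metis orthogonal_self)
qed

lemma eq_if_inner_eq: assumes "\<And>\<alpha>. \<alpha> \<in> Sp \<Longrightarrow> x \<bullet> \<alpha> = y \<bullet> \<alpha>" shows "x = y"
  using eq_0_if_orthogonal[of "x - y"] assms by (simp add: inner_diff_left)

lemma Sp_nonempty: "Sp \<noteq> {}"
proof
  assume "Sp = {}"
  then have "(UNIV :: 'a set) = {0}" using span_Sp by simp
  then show False using nonempty_Basis nonzero_Basis by blast
qed

abbreviation "W \<equiv> weyl_group S"

lemma weyl_linear: "w \<in> W \<Longrightarrow> linear w"
  by (induction rule: weyl_group.induct) (simp_all only: linear_compose linear_refl_root linear_id)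

lemma weyl_inner: "w \<in> W \<Longrightarrow> w x \<bullet> w y = x \<bullet> y"
  by (induction rule: weyl_group.induct) (auto simp: refl_root_inner)

lemma weyl_norm: "w \<in> W \<Longrightarrow> norm (w x) = norm x"
  by (simp add: norm_eq_sqrt_inner weyl_inner)

lemma weyl_S: "w \<in> W \<Longrightarrow> \<alpha> \<in> S \<Longrightarrow> w \<alpha> \<in> S"
  by (induction rule: weyl_group.induct) (auto intro: refl_S)

lemma weyl_comp: "w \<in> W \<Longrightarrow> u \<in> W \<Longrightarrow> w \<circ> u \<in> W"
  by (induction rule: weyl_group.induct) (auto simp: comp_assoc intro: weyl_group.intros)

lemma weyl_refl: "\<alpha> \<in> S \<Longrightarrow> refl_root \<alpha> \<in> W"
  using weyl_step[OF weyl_id] by simp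

lemma weyl_inverse: "w \<in> W \<Longrightarrow> \<exists>u\<in>W. u \<circ> w = id \<and> w \<circ> u = id"
proof (induction rule: weyl_group.induct)
  case weyl_id
  show ?case by (rule bexI[of _ id]) (auto intro: weyl_group.weyl_id)
next
  case (weyl_step w \<alpha>)
  then obtain u where u: "u \<in> W" "u \<circ> w = id" "w \<circ> u = id" by blast
  have "(u \<circ> refl_root \<alpha>) \<circ> (refl_root \<alpha> \<circ> w) = id" "(refl_root \<alpha> \<circ> w) \<circ> (u \<circ> refl_root \<alpha>) = id"
    using u by (auto simp: fun_eq_iff)
  then show ?case using weyl_comp u(1) weyl_refl weyl_step by blast
qed

lemma weyl_bij: "w \<in> W \<Longrightarrow> bij w"
  using weyl_inverse o_bij by blast

lemma weyl_inv: "w \<in> W \<Longrightarrow> inv w \<in> W"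
  using weyl_inverse by (metis inv_unique_comp)

lemma weyl_inv_left [simp]: "w \<in> W \<Longrightarrow> inv w (w x) = x"
  and weyl_inv_right [simp]: "w \<in> W \<Longrightarrow> w (inv w x) = x"
  by (simp_all add: weyl_bij bij_is_inj bij_is_surj surj_f_inv_f)

lemma weyl_inner_inv: "w \<in> W \<Longrightarrow> w x \<bullet> y = x \<bullet> inv w y"
  by (metis weyl_inner weyl_inv_right)

lemma weyl_coroot: "w \<in> W \<Longrightarrow> w (coroot \<alpha>) = coroot (w \<alpha>)"
  by (rule isometry_coroot) (auto simp: weyl_linear weyl_inner)

lemma weyl_eqI: assumes "w \<in> W" "u \<in> W" "\<And>\<alpha>. \<alpha> \<in> S \<Longrightarrow> w \<alpha> = u \<alpha>" shows "w = u"
  using linear_eq_on_span[OF weyl_linear[OF assms(1)] weyl_linear[OF assms(2)], of S] assms(3)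
  by (auto simp: span_S)

text \<open>A Weyl element is determined by its action on the finite spanning set
  \<open>S\<close>.\<close>

lemma finite_W: "finite W"
proof (rule inj_on_finite)
  show "inj_on (\<lambda>w. restrict w S) W"
    by (rule inj_onI, rule weyl_eqI) (auto simp: fun_eq_iff restrict_def split: if_splits)
  show "(\<lambda>w. restrict w S) ` W \<subseteq> (S \<rightarrow>\<^sub>E S)" by (auto simp: weyl_S)
  show "finite (S \<rightarrow>\<^sub>E S)" by (simp add: finite_PiE finite_S)
qed

lemma W_nonempty: "W \<noteq> {}" using weyl_id by blast

lemma sum_weyl_right: assumes "u \<in> W" shows "(\<Sum>w\<in>W. f (w \<circ> u)) = (\<Sum>w\<in>W. f w)"
proof (rule sum.reindex_bij_betw, rule bij_betwI[where g = "\<lambda>w. w \<circ> inv u"])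
  show "(\<lambda>w. w \<circ> u) \<in> W \<rightarrow> W" "(\<lambda>w. w \<circ> inv u) \<in> W \<rightarrow> W"
    using assms weyl_comp weyl_inv by auto
qed (use assms in \<open>auto simp: fun_eq_iff\<close>)

subsection \<open>Simple coroots and the exchange argument\<close>

text \<open>Indecomposability is imposed on coroots, not on roots: if \<alpha> and 2\<alpha> are
  both roots, the coroot of \<alpha> is twice that of 2\<alpha>, so only the longest root on a ray
  can occur. This accommodates non-reduced systems and makes the simple coroots a basis of the
  coroot lattice.\<close>

definition simple :: "'a set" where
  "simple = {\<alpha>\<in>Sp. \<not> (\<exists>\<beta>\<in>Sp. \<exists>\<gamma>\<in>Sp. coroot \<alpha> = coroot \<beta> + coroot \<gamma>)}"

lemma simple_Sp: "\<alpha> \<in> simple \<Longrightarrow> \<alpha> \<in> Sp" and finite_simple: "finite simple"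
  using finite_Sp by (auto simp: simple_def)

lemma coroot_xi: "\<alpha> \<in> Sp \<Longrightarrow> coroot \<alpha> \<bullet> xi > 0"
  using inner_coroot_pos_iff Sp_nz Sp_xi by blast

text \<open>Both summands of a decomposable coroot have smaller positive pairing with
  \<open>xi\<close>, so the induction runs on the number of positive roots whose coroots lie
  lower.\<close>

lemma coroot_nat_combination:
  "\<beta> \<in> Sp \<Longrightarrow> \<exists>c::'a \<Rightarrow> nat. coroot \<beta> = (\<Sum>\<gamma>\<in>simple. real (c \<gamma>) *\<^sub>R coroot \<gamma>)"
proof (induction "card {\<gamma>\<in>Sp. coroot \<gamma> \<bullet> xi < coroot \<beta> \<bullet> xi}" arbitrary: \<beta> rule: less_induct)
  case less
  show ?case
  proof (cases "\<beta> \<in> simple")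
    case True
    have "(\<Sum>\<gamma>\<in>simple. real (if \<gamma> = \<beta> then 1 else 0) *\<^sub>R coroot \<gamma>)
      = (\<Sum>\<gamma>\<in>simple. if \<gamma> = \<beta> then coroot \<gamma> else 0)" by (intro sum.cong) auto
    also have "\<dots> = coroot \<beta>" using True by (simp add: finite_simple)
    finally show ?thesis by (intro exI[of _ "\<lambda>\<gamma>. if \<gamma> = \<beta> then 1 else 0"]) auto
  next
    case False
    then obtain \<gamma> \<delta> where gd: "\<gamma> \<in> Sp" "\<delta> \<in> Sp" "coroot \<beta> = coroot \<gamma> + coroot \<delta>"
      using less.prems by (auto simp: simple_def)
    have lt: "coroot \<gamma> \<bullet> xi < coroot \<beta> \<bullet> xi" "coroot \<delta> \<bullet> xi < coroot \<beta> \<bullet> xi"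
      using coroot_xi gd by (auto simp: inner_add_left)
    have card: "card {\<gamma>'\<in>Sp. coroot \<gamma>' \<bullet> xi < coroot \<epsilon> \<bullet> xi} < card {\<gamma>\<in>Sp. coroot \<gamma> \<bullet> xi < coroot \<beta> \<bullet> xi}"
      if "\<epsilon> \<in> Sp" "coroot \<epsilon> \<bullet> xi < coroot \<beta> \<bullet> xi" for \<epsilon>
      by (rule psubset_card_mono) (use that finite_Sp in auto)
    obtain c d :: "'a \<Rightarrow> nat" where "coroot \<gamma> = (\<Sum>\<gamma>\<in>simple. real (c \<gamma>) *\<^sub>R coroot \<gamma>)"
      "coroot \<delta> = (\<Sum>\<gamma>\<in>simple. real (d \<gamma>) *\<^sub>R coroot \<gamma>)"
      using less.hyps[OF card] gd lt by meson
    then have "coroot \<beta> = (\<Sum>\<gamma>\<in>simple. real ((\<lambda>\<gamma>. c \<gamma> + d \<gamma>) \<gamma>) *\<^sub>R coroot \<gamma>)"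
      using gd(3) by (simp add: scaleR_add_left sum.distrib)
    then show ?thesis by (intro exI[of _ "\<lambda>\<gamma>. c \<gamma> + d \<gamma>"])
  qed
qed

lemma root_coroot_scale: "\<alpha> = ((\<alpha> \<bullet> \<alpha>) / 2) *\<^sub>R coroot \<alpha>"
  by (cases "\<alpha> = 0") (auto simp: coroot_def)

lemma root_nonneg_combination:
  assumes "\<beta> \<in> Sp"
  shows "\<exists>c. (\<forall>\<gamma>. 0 \<le> c \<gamma>) \<and> \<beta> = (\<Sum>\<gamma>\<in>simple. c \<gamma> *\<^sub>R \<gamma>)"
proof -
  obtain c :: "'a \<Rightarrow> nat" where c: "coroot \<beta> = (\<Sum>\<gamma>\<in>simple. real (c \<gamma>) *\<^sub>R coroot \<gamma>)"
    using coroot_nat_combination assms by blast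
  have "\<beta> = ((\<beta> \<bullet> \<beta>) / 2) *\<^sub>R coroot \<beta>" by (rule root_coroot_scale)
  also have "\<dots> = (\<Sum>\<gamma>\<in>simple. ((\<beta> \<bullet> \<beta>) / 2 * real (c \<gamma>) * (2 / (\<gamma> \<bullet> \<gamma>))) *\<^sub>R \<gamma>)"
    unfolding c scaleR_sum_right by (intro sum.cong) (auto simp: coroot_def)
  finally show ?thesis
    by (intro exI[of _ "\<lambda>\<gamma>. (\<beta> \<bullet> \<beta>) / 2 * real (c \<gamma>) * (2 / (\<gamma> \<bullet> \<gamma>))"]) auto
qed

text \<open>At an acute angle both Cartan integers are positive. If one of them is 1, a reflection
  exhibits one of the two coroots as a sum of two positive coroots; if both are at least 2, both
  squared lengths are at most \<alpha> . \<beta>, which forces \<alpha> = \<beta>.\<close>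

lemma simple_obtuse:
  assumes "\<alpha> \<in> simple" "\<beta> \<in> simple" "\<alpha> \<noteq> \<beta>"
  shows "\<alpha> \<bullet> \<beta> \<le> 0"
proof (rule ccontr)
  assume "\<not> \<alpha> \<bullet> \<beta> \<le> 0"
  then have p: "\<alpha> \<bullet> \<beta> > 0" by simp
  have S: "\<alpha> \<in> S" "\<beta> \<in> S" "\<alpha> \<noteq> 0" "\<beta> \<noteq> 0" "\<alpha> \<in> Sp" "\<beta> \<in> Sp"
    using assms simple_Sp Sp_S Sp_nz by auto
  have key: False if "a \<in> simple" "b \<in> simple" "coroot b \<bullet> a = 1" for a b
  proof -
    have ab: "a \<in> Sp" "b \<in> Sp" "a \<in> S" "b \<in> S" using that simple_Sp Sp_S by auto
    have c: "coroot (refl_root a b) = coroot b - coroot a"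
      using weyl_coroot[OF weyl_refl[OF ab(3)], of b] that(3) by (simp add: refl_root_eq')
    have "refl_root a b \<in> S" using refl_S ab by blast
    then show False
    proof (cases rule: S_cases)
      case 1
      then show False using that(2) ab c by (force simp: simple_def)
    next
      case 2
      have "coroot a = coroot b + coroot (- refl_root a b)" using c by (simp add: coroot_uminus)
      then show False using that(1) ab 2 by (force simp: simple_def)
    qed
  qed
  obtain k where k: "\<beta> \<bullet> coroot \<alpha> = of_int k" using int_S[OF S(1,2)] Ints_cases by metis
  obtain l where l: "\<alpha> \<bullet> coroot \<beta> = of_int l" using int_S[OF S(2,1)] Ints_cases by metis
  have "k \<noteq> 1" "l \<noteq> 1" using key assms k l by (auto simp: inner_commute)
  moreover have "real_of_int k > 0" "real_of_int l > 0"
    using k[symmetric] l[symmetric] p S by (auto simp: coroot_def inner_commute)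
  ultimately have kl: "k \<ge> 2" "l \<ge> 2" by auto
  have kk: "of_int k * (\<alpha> \<bullet> \<alpha>) = 2 * (\<alpha> \<bullet> \<beta>)" "of_int l * (\<beta> \<bullet> \<beta>) = 2 * (\<alpha> \<bullet> \<beta>)"
    using k[symmetric] l[symmetric] S by (auto simp: coroot_def inner_commute)
  have "2 * (\<alpha> \<bullet> \<alpha>) \<le> of_int k * (\<alpha> \<bullet> \<alpha>)" "2 * (\<beta> \<bullet> \<beta>) \<le> of_int l * (\<beta> \<bullet> \<beta>)"
    by (rule mult_right_mono; use kl in simp)+
  then have "\<alpha> \<bullet> \<alpha> \<le> \<alpha> \<bullet> \<beta>" "\<beta> \<bullet> \<beta> \<le> \<alpha> \<bullet> \<beta>" using kk by auto
  then have "(\<alpha> - \<beta>) \<bullet> (\<alpha> - \<beta>) \<le> 0" by (simp add: inner_diff_left inner_diff_right inner_commute)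
  then show False using assms(3) by (metis eq_iff_diff_eq_0 inner_eq_zero_iff inner_ge_zero order_antisym)
qed

text \<open>If the image were negative, adding the nonnegative expansions of \<beta> and of minus
  its image would make the part \<open>z\<close> off \<alpha> a multiple of \<alpha>. Obtuseness
  makes the multiple nonpositive, pairing with \<open>xi\<close> then kills every coefficient off
  \<alpha>, and \<beta> is proportional to \<alpha>. Real multiples are excluded because the root
  system may be non-reduced.\<close>

lemma simple_refl_Sp:
  assumes "\<alpha> \<in> simple" "\<beta> \<in> Sp" "\<And>c. c > 0 \<Longrightarrow> \<beta> \<noteq> c *\<^sub>R \<alpha>"
  shows "refl_root \<alpha> \<beta> \<in> Sp"
proof (rule ccontr)
  assume neg: "refl_root \<alpha> \<beta> \<notin> Sp"
  have S: "\<alpha> \<in> Sp" "\<alpha> \<in> S" "\<beta> \<in> S" using assms simple_Sp Sp_S by auto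
  then have "- refl_root \<alpha> \<beta> \<in> Sp" using neg refl_S S_cases by metis
  then obtain d where d: "\<And>\<gamma>. 0 \<le> d \<gamma>" "- refl_root \<alpha> \<beta> = (\<Sum>\<gamma>\<in>simple. d \<gamma> *\<^sub>R \<gamma>)"
    using root_nonneg_combination by blast
  obtain c where c: "\<And>\<gamma>. 0 \<le> c \<gamma>" "\<beta> = (\<Sum>\<gamma>\<in>simple. c \<gamma> *\<^sub>R \<gamma>)"
    using root_nonneg_combination assms(2) by blast
  define z where "z = (\<Sum>\<gamma>\<in>simple - {\<alpha>}. (c \<gamma> + d \<gamma>) *\<^sub>R \<gamma>)"
  define y where "y = (\<Sum>\<gamma>\<in>simple - {\<alpha>}. c \<gamma> *\<^sub>R \<gamma>)"
  have bc: "\<beta> = c \<alpha> *\<^sub>R \<alpha> + y"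
    unfolding c(2) y_def using assms(1) finite_simple by (simp add: sum.remove)
  have "\<beta> - refl_root \<alpha> \<beta> = (\<Sum>\<gamma>\<in>simple. (c \<gamma> + d \<gamma>) *\<^sub>R \<gamma>)"
    using c(2) d(2) by (simp add: scaleR_add_left sum.distrib)
  also have "\<dots> = (c \<alpha> + d \<alpha>) *\<^sub>R \<alpha> + z"
    unfolding z_def using assms(1) finite_simple by (simp add: sum.remove)
  finally have "\<beta> - refl_root \<alpha> \<beta> = (c \<alpha> + d \<alpha>) *\<^sub>R \<alpha> + z" .
  then have z: "z = (\<beta> \<bullet> coroot \<alpha> - (c \<alpha> + d \<alpha>)) *\<^sub>R \<alpha>" (is "z = ?k *\<^sub>R \<alpha>")
    by (simp add: refl_root_eq algebra_simps)
  have "z \<bullet> \<alpha> \<le> 0"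
    unfolding z_def inner_sum_left
    by (intro sum_nonpos) (use simple_obtuse assms(1) c d in \<open>auto intro!: mult_nonneg_nonpos\<close>)
  then have "?k \<le> 0" using z S_nz[OF S(2)] inner_gt_zero_iff[of \<alpha>] by (auto simp: mult_le_0_iff simp del: inner_gt_zero_iff)
  then have "z \<bullet> xi \<le> 0" using z Sp_xi[OF S(1)] by (simp add: mult_nonpos_nonneg)
  moreover have t: "(c \<gamma> + d \<gamma>) * (\<gamma> \<bullet> xi) \<ge> 0" if "\<gamma> \<in> simple - {\<alpha>}" for \<gamma>
    using that c d Sp_xi[of \<gamma>] simple_Sp[of \<gamma>] by simp
  ultimately have "(c \<gamma> + d \<gamma>) * (\<gamma> \<bullet> xi) = 0" if "\<gamma> \<in> simple - {\<alpha>}" for \<gamma>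
    using that sum_nonneg_eq_0_iff[of "simple - {\<alpha>}" "\<lambda>\<gamma>. (c \<gamma> + d \<gamma>) * (\<gamma> \<bullet> xi)"]
      sum_nonneg[of "simple - {\<alpha>}" "\<lambda>\<gamma>. (c \<gamma> + d \<gamma>) * (\<gamma> \<bullet> xi)"] finite_simple
    by (auto simp: z_def inner_sum_left)
  then have "c \<gamma> = 0" if "\<gamma> \<in> simple - {\<alpha>}" for \<gamma>
    using that c(1)[of \<gamma>] d(1)[of \<gamma>] Sp_xi[of \<gamma>] simple_Sp[of \<gamma>] by force
  then have "y = 0" unfolding y_def by (intro sum.neutral) auto
  then have b: "\<beta> = c \<alpha> *\<^sub>R \<alpha>" using bc by simp
  moreover have "c \<alpha> > 0" using b Sp_nz[OF assms(2)] c(1)[of \<alpha>] by (cases "c \<alpha> = 0") (auto simp: less_le)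
  ultimately show False using assms(3) by blast
qed

text \<open>Pairwise obtuse vectors in an open half space are independent: a relation, split by
  sign, equates two nonnegative combinations whose common value \<open>u\<close> satisfies
  \<open>u . u <= 0\<close>, and pairing with \<open>xi\<close> then kills each coefficient.\<close>

lemma independent_simple_coroots: "independent (coroot ` simple)"
proof (rule independent_if_scalars_zero)
  show "finite (coroot ` simple)" using finite_simple by simp
  fix f x assume f: "(\<Sum>x\<in>coroot ` simple. f x *\<^sub>R x) = 0" and x: "x \<in> coroot ` simple"
  let ?P = "{x\<in>coroot ` simple. f x > 0}" and ?N = "{x\<in>coroot ` simple. f x \<le> 0}"
  have fin: "finite ?P" "finite ?N" using finite_simple by auto
  have "coroot ` simple = ?P \<union> ?N" by auto
  then have "(\<Sum>x\<in>?P. f x *\<^sub>R x) + (\<Sum>x\<in>?N. f x *\<^sub>R x) = 0"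
    using f fin by (metis (no_types, lifting) disjoint_iff mem_Collect_eq not_le sum.union_disjoint)
  then have eq: "(\<Sum>x\<in>?P. f x *\<^sub>R x) = (\<Sum>x\<in>?N. (- f x) *\<^sub>R x)"
    by (simp add: sum_negf add_eq_0_iff2)
  define u where "u = (\<Sum>x\<in>?P. f x *\<^sub>R x)"
  have obt: "x \<bullet> y \<le> 0" if xy: "x \<in> ?P" "y \<in> ?N" for x y
  proof -
    obtain a b where "x = coroot a" "y = coroot b" "a \<in> simple" "b \<in> simple"
      using xy by blast
    moreover have "a \<noteq> b" using xy calculation by auto
    ultimately show ?thesis using simple_obtuse[of a b]
      by (auto simp: coroot_def divide_nonpos_nonneg mult_nonneg_nonpos)
  qed
  have "u \<bullet> u = (\<Sum>x\<in>?P. f x *\<^sub>R x) \<bullet> (\<Sum>y\<in>?N. (- f y) *\<^sub>R y)" unfolding u_def using eq by simp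
  also have "\<dots> = (\<Sum>x\<in>?P. \<Sum>y\<in>?N. f x * (- f y) * (x \<bullet> y))"
    by (subst inner_sum_left) (simp add: inner_sum_right mult_ac)
  also have "\<dots> \<le> 0"
  proof (intro sum_nonpos)
    fix x y assume xy: "x \<in> ?P" "y \<in> ?N"
    then have "f x * (- f y) \<ge> 0" by (intro mult_nonneg_nonneg) auto
    then show "f x * (- f y) * (x \<bullet> y) \<le> 0" using obt[OF xy] by (rule mult_nonneg_nonpos)
  qed
  finally have "u = 0" by (metis inner_eq_zero_iff inner_ge_zero order_antisym)
  have xi': "x \<bullet> xi > 0" if "x \<in> coroot ` simple" for x using that coroot_xi simple_Sp by auto
  have "(\<Sum>x\<in>?P. f x * (x \<bullet> xi)) = 0" "(\<Sum>x\<in>?N. - f x * (x \<bullet> xi)) = 0"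
    using \<open>u = 0\<close> eq by (metis (no_types, lifting) inner_scaleR_left inner_sum_left inner_zero_left sum.cong u_def)+
  moreover have "f x * (x \<bullet> xi) \<ge> 0" if "x \<in> ?P" for x using that xi'[of x] by auto
  moreover have "- f x * (x \<bullet> xi) \<ge> 0" if "x \<in> ?N" for x
    using that xi'[of x] by (intro mult_nonneg_nonneg) auto
  ultimately have "\<And>x. x \<in> ?P \<Longrightarrow> f x * (x \<bullet> xi) = 0" "\<And>x. x \<in> ?N \<Longrightarrow> - f x * (x \<bullet> xi) = 0"
    using sum_nonneg_eq_0_iff[OF fin(1), of "\<lambda>x. f x * (x \<bullet> xi)"]
      sum_nonneg_eq_0_iff[OF fin(2), of "\<lambda>x. - f x * (x \<bullet> xi)"] by blast+
  then show "f x = 0" using x xi'[of x] by (cases "f x > 0") force+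
qed

section \<open>Generation of the Weyl group by simple reflections\<close>

fun word :: "'a list \<Rightarrow> 'a \<Rightarrow> 'a" where
  "word [] = id"
| "word (\<alpha> # us) = refl_root \<alpha> \<circ> word us"

lemma word_append: "word (us @ vs) = word us \<circ> word vs"
  by (induction us) (auto simp: comp_assoc)

lemma word_W: "set us \<subseteq> S \<Longrightarrow> word us \<in> W"
  by (induction us) (auto intro: weyl_group.intros)

lemma word_rev: "word (rev us) \<circ> word us = id"
proof (induction us)
  case (Cons a us)
  have "word (rev (a # us)) \<circ> word (a # us) = word (rev us) \<circ> (refl_root a \<circ> refl_root a) \<circ> word us"
    by (simp add: word_append fun_eq_iff)
  also have "\<dots> = id" using Cons by (simp only: refl_root_comp_self comp_id)
  finally show ?case .
qed simp

lemma simple_subset_S: "simple \<subseteq> S" using simple_Sp Sp_S by blast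

text \<open>Among the positive roots reached from \<alpha> by simple reflections, one of least
  height pairs positively with some simple \<gamma>. Reflecting in \<gamma> would lower it further
  unless it is proportional to \<gamma>; conjugating back expresses the reflection in
  \<alpha>.\<close>

lemma refl_word:
  assumes "\<alpha> \<in> S"
  shows "\<exists>us. set us \<subseteq> simple \<and> refl_root \<alpha> = word us"
proof -
  have pos: "\<exists>us. set us \<subseteq> simple \<and> refl_root \<alpha> = word us" if \<alpha>: "\<alpha> \<in> Sp" for \<alpha>
  proof -
    define B where "B = {\<beta>\<in>Sp. \<exists>us. set us \<subseteq> simple \<and> \<beta> = word us \<alpha>}"
    have "finite B" "B \<noteq> {}"
      using finite_Sp \<alpha> by (auto simp: B_def intro!: exI[of _ "[]"])
    then obtain \<beta> where \<beta>: "\<beta> \<in> B" "\<And>\<gamma>. \<gamma> \<in> B \<Longrightarrow> \<beta> \<bullet> xi \<le> \<gamma> \<bullet> xi"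
      using arg_min_if_finite[of B "\<lambda>\<gamma>. \<gamma> \<bullet> xi"] by (metis not_le)
    then obtain us where us: "set us \<subseteq> simple" "\<beta> = word us \<alpha>" "\<beta> \<in> Sp" by (auto simp: B_def)
    obtain c where c: "\<And>\<gamma>. 0 \<le> c \<gamma>" "\<beta> = (\<Sum>\<gamma>\<in>simple. c \<gamma> *\<^sub>R \<gamma>)"
      using root_nonneg_combination us by blast
    have "\<exists>\<gamma>\<in>simple. \<beta> \<bullet> \<gamma> > 0"
    proof (rule ccontr)
      assume n: "\<not> ?thesis"
      have "\<beta> \<bullet> \<beta> = (\<Sum>\<gamma>\<in>simple. c \<gamma> * (\<beta> \<bullet> \<gamma>))" by (subst (2) c(2)) (simp add: inner_sum_right)
      also have "\<dots> \<le> 0" by (intro sum_nonpos mult_nonneg_nonpos) (use c n in \<open>auto simp: not_less\<close>)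
      finally show False using Sp_nz[OF us(3)] by (metis inner_gt_zero_iff not_le)
    qed
    then obtain \<gamma> where \<gamma>: "\<gamma> \<in> simple" "\<beta> \<bullet> \<gamma> > 0" by blast
    have \<gamma>S: "\<gamma> \<in> Sp" "\<gamma> \<in> S" "\<gamma> \<noteq> 0" using \<gamma> simple_Sp Sp_S S_nz by auto
    have "\<exists>c>0. \<beta> = c *\<^sub>R \<gamma>"
    proof (rule ccontr)
      assume "\<not> ?thesis"
      then have "refl_root \<gamma> \<beta> \<in> Sp" using simple_refl_Sp \<gamma> us by blast
      then have "refl_root \<gamma> \<beta> \<in> B" using us \<gamma> by (auto simp: B_def intro!: exI[of _ "\<gamma> # us"])
      then have "\<beta> \<bullet> xi \<le> refl_root \<gamma> \<beta> \<bullet> xi" using \<beta> by blast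
      moreover have "\<beta> \<bullet> coroot \<gamma> * (\<gamma> \<bullet> xi) > 0"
        using \<gamma> inner_coroot_pos_iff[OF \<gamma>S(3), of \<beta>] Sp_xi[OF \<gamma>S(1)] by (intro mult_pos_pos) (auto simp: inner_commute)
      ultimately show False by (simp add: refl_root_eq inner_diff_left)
    qed
    then obtain k where "k > 0" "\<beta> = k *\<^sub>R \<gamma>" by blast
    then have "refl_root \<beta> = refl_root \<gamma>" using refl_root_scale[of k \<gamma>] by simp
    moreover have "word us (refl_root \<alpha> x) = refl_root \<beta> (word us x)" for x
      unfolding us(2) using word_W[of us] us(1) simple_subset_S
      by (intro isometry_refl_root) (auto intro: weyl_linear weyl_inner)
    ultimately have "word us \<circ> refl_root \<alpha> = refl_root \<gamma> \<circ> word us" by (auto simp: fun_eq_iff)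
    then have "word (rev us) \<circ> (word us \<circ> refl_root \<alpha>) = word (rev us) \<circ> (refl_root \<gamma> \<circ> word us)" by simp
    then have "refl_root \<alpha> = word (rev us @ [\<gamma>] @ us)"
      using word_rev[of us] by (simp add: word_append comp_assoc[symmetric])
    then show ?thesis using us \<gamma> by (intro exI[of _ "rev us @ [\<gamma>] @ us"]) auto
  qed
  show ?thesis using assms
    by (cases rule: S_cases) (use pos[of \<alpha>] pos[of "- \<alpha>"] in \<open>auto simp: refl_root_uminus\<close>)
qed

lemma weyl_word: "w \<in> W \<Longrightarrow> \<exists>us. set us \<subseteq> simple \<and> w = word us"
proof (induction rule: weyl_group.induct)
  case weyl_id
  then show ?case by (intro exI[of _ "[]"]) auto
next
  case (weyl_step w \<alpha>)
  obtain us where "set us \<subseteq> simple" "w = word us" using weyl_step by blast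
  moreover obtain vs where "set vs \<subseteq> simple" "refl_root \<alpha> = word vs" using refl_word weyl_step by blast
  ultimately show ?case by (intro exI[of _ "vs @ us"]) (auto simp: word_append)
qed

lemma word_sign_change:
  assumes "set us \<subseteq> simple" "\<alpha> \<in> Sp" "word us \<alpha> \<notin> Sp"
  shows "\<exists>u1 \<beta> u2. us = u1 @ \<beta> # u2 \<and> word u2 \<alpha> \<in> Sp \<and> refl_root \<beta> (word u2 \<alpha>) \<notin> Sp"
  using assms
proof (induction us)
  case (Cons b us)
  show ?case
  proof (cases "word us \<alpha> \<in> Sp")
    case True
    then show ?thesis using Cons.prems by (intro exI[of _ "[]"] exI[of _ b] exI[of _ us]) auto
  next
    case False
    then obtain u1 \<beta> u2 where "us = u1 @ \<beta> # u2" "word u2 \<alpha> \<in> Sp" "refl_root \<beta> (word u2 \<alpha>) \<notin> Sp"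
      using Cons by auto
    then show ?thesis by (intro exI[of _ "b # u1"] exI[of _ \<beta>] exI[of _ u2]) auto
  qed
qed simp

text \<open>Deletion argument: in a shortest word for \<open>w\<close> with last letter \<alpha>,
  the remaining word sends \<alpha> to a negative root, so some letter makes the sign change. That
  letter and the last one cancel, which gives a shorter word.\<close>

lemma weyl_eq_id:
  assumes w: "w \<in> W" and Sp: "\<And>\<alpha>. \<alpha> \<in> Sp \<Longrightarrow> w \<alpha> \<in> Sp"
  shows "w = id"
proof -
  obtain us where us: "set us \<subseteq> simple" "w = word us"
    and min: "\<And>vs. set vs \<subseteq> simple \<and> w = word vs \<Longrightarrow> length us \<le> length vs"
    using ex_has_least_nat[of "\<lambda>us. set us \<subseteq> simple \<and> w = word us" _ length] weyl_word[OF w] by blast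
  show ?thesis
  proof (cases us rule: rev_cases)
    case Nil
    then show ?thesis using us by simp
  next
    case (snoc vs \<alpha>)
    have \<alpha>: "\<alpha> \<in> simple" "\<alpha> \<in> Sp" "\<alpha> \<in> S" "set vs \<subseteq> simple" using us snoc simple_Sp Sp_S by auto
    have "word vs = w \<circ> refl_root \<alpha>" unfolding us(2) snoc word_append by (simp add: comp_assoc)
    then have "word vs \<alpha> = - w \<alpha>"
      using refl_root_self[OF S_nz[OF \<alpha>(3)]] weyl_linear[OF w] by (simp add: linear_neg)
    then have "word vs \<alpha> \<notin> Sp" using Sp_xi[OF Sp[OF \<alpha>(2)]] Sp_xi[of "word vs \<alpha>"] by auto
    then obtain u1 \<beta> u2 where u: "vs = u1 @ \<beta> # u2" "word u2 \<alpha> \<in> Sp" "refl_root \<beta> (word u2 \<alpha>) \<notin> Sp"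
      using word_sign_change \<alpha> by blast
    have b: "\<beta> \<in> simple" "set u2 \<subseteq> simple" using u(1) \<alpha> by auto
    \<comment> \<open>A simple reflection makes only the positive multiples of its own root
      negative.\<close>
    then obtain c where c: "c > 0" "word u2 \<alpha> = c *\<^sub>R \<beta>" using simple_refl_Sp u by blast
    have "word u2 (refl_root \<alpha> x) = refl_root (word u2 \<alpha>) (word u2 x)" for x
      using word_W[of u2] b simple_subset_S
      by (intro isometry_refl_root) (auto intro: weyl_linear weyl_inner)
    then have "word u2 \<circ> refl_root \<alpha> = refl_root \<beta> \<circ> word u2"
      using c refl_root_scale[of c \<beta>] by (auto simp: fun_eq_iff)
    then have "refl_root \<beta> \<circ> word u2 \<circ> refl_root \<alpha> = word u2"
      by (metis comp_assoc refl_root_comp_self comp_id)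
    then have "w = word (u1 @ u2)"
      unfolding us(2) snoc u(1) by (simp add: word_append comp_assoc)
    then show ?thesis using min[of "u1 @ u2"] u(1) snoc us by auto
  qed
qed

subsection \<open>Dominance\<close>

definition dominant :: "'a \<Rightarrow> bool" where
  "dominant x \<longleftrightarrow> (\<forall>\<alpha>\<in>Sp. 0 \<le> \<alpha> \<bullet> x)"

text \<open>The orbit point with the largest pairing with \<open>xi\<close> is dominant, since
  reflecting in a positive root that is negative on it would increase that pairing.\<close>

lemma ex_dominant: "\<exists>w\<in>W. dominant (w x)"
proof -
  obtain w where w: "w \<in> W" "\<And>u. u \<in> W \<Longrightarrow> u x \<bullet> xi \<le> w x \<bullet> xi"
    using arg_min_if_finite[OF finite_W W_nonempty, of "\<lambda>w. - (w x \<bullet> xi)"]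
    by (metis neg_le_iff_le not_le)
  have "0 \<le> \<alpha> \<bullet> w x" if \<alpha>: "\<alpha> \<in> Sp" for \<alpha>
  proof (rule ccontr)
    assume n: "\<not> 0 \<le> \<alpha> \<bullet> w x"
    have "refl_root \<alpha> (w x) \<bullet> xi \<le> w x \<bullet> xi"
      using w(2)[OF weyl_step[OF w(1) Sp_S[OF \<alpha>]]] by simp
    then have "(w x \<bullet> \<alpha>) * (coroot \<alpha> \<bullet> xi) \<ge> 0" by (simp add: refl_root_eq' inner_diff_left)
    then show False using n coroot_xi[OF \<alpha>] by (simp add: zero_le_mult_iff inner_commute)
  qed
  then show ?thesis using w(1) by (auto simp: dominant_def)
qed

text \<open>Among the \<open>u\<close> with \<open>u x = w x\<close>, one maximising
  \<open>u xi . xi\<close> has an inverse preserving \<open>Sp\<close>: a positive root that it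
  sends to a negative one vanishes on \<open>w x\<close>, because both points are dominant, so
  composing with its reflection stays in the set and increases the value.\<close>

lemma dominant_unique:
  assumes "w \<in> W" "dominant x" "dominant (w x)"
  shows "w x = x"
proof -
  define B where "B = {u\<in>W. u x = w x}"
  have "finite B" "B \<noteq> {}" using finite_W assms by (auto simp: B_def)
  then obtain u where u: "u \<in> B" "\<And>v. v \<in> B \<Longrightarrow> v xi \<bullet> xi \<le> u xi \<bullet> xi"
    using arg_min_if_finite[of B "\<lambda>w. - (w xi \<bullet> xi)"] by (metis neg_le_iff_le not_le)
  then have uW: "u \<in> W" "u x = w x" by (auto simp: B_def)
  have "inv u \<alpha> \<in> Sp" if \<alpha>: "\<alpha> \<in> Sp" for \<alpha>
  proof (rule ccontr)
    assume n: "inv u \<alpha> \<notin> Sp"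
    have "inv u \<alpha> \<in> S" using weyl_S weyl_inv uW Sp_S \<alpha> by blast
    then have m: "- inv u \<alpha> \<in> Sp" using n S_cases by blast
    then have "- inv u \<alpha> \<bullet> x \<ge> 0" using assms by (auto simp: dominant_def)
    then have "\<alpha> \<bullet> w x \<le> 0" using uW weyl_inner_inv[OF uW(1), of x \<alpha>] by (simp add: inner_commute)
    then have 0: "\<alpha> \<bullet> w x = 0" using assms \<alpha> by (force simp: dominant_def)
    then have "refl_root \<alpha> \<circ> u \<in> B"
      using uW \<alpha> Sp_S by (auto simp: B_def refl_root_def inner_commute intro: weyl_step)
    then have "refl_root \<alpha> (u xi) \<bullet> xi \<le> u xi \<bullet> xi" using u(2) by fastforce
    then have "(u xi \<bullet> \<alpha>) * (coroot \<alpha> \<bullet> xi) \<ge> 0" by (simp add: refl_root_eq' inner_diff_left)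
    moreover have "u xi \<bullet> \<alpha> < 0" using Sp_xi[OF m] weyl_inner_inv[OF uW(1), of xi \<alpha>] by (simp add: inner_commute)
    ultimately show False using coroot_xi[OF \<alpha>] by (simp add: zero_le_mult_iff)
  qed
  then have "inv u = id" using weyl_eq_id weyl_inv uW by blast
  then have "u = id" using uW weyl_inv_right by (metis eq_id_iff)
  then show ?thesis using uW by simp
qed

lemma weyl_fixes_regular:
  assumes "w \<in> W" "w x = x" "\<And>\<alpha>. \<alpha> \<in> Sp \<Longrightarrow> 0 < \<alpha> \<bullet> x"
  shows "w = id"
proof (rule weyl_eq_id[OF assms(1)])
  fix \<alpha> assume \<alpha>: "\<alpha> \<in> Sp"
  have p: "w \<alpha> \<bullet> x > 0" using weyl_inner[OF assms(1), of \<alpha> x] assms(2,3) \<alpha> by simp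
  have "w \<alpha> \<in> S" using weyl_S assms(1) \<alpha> Sp_S by blast
  then show "w \<alpha> \<in> Sp"
    by (cases rule: S_cases) (use p assms(3)[of "- w \<alpha>"] in auto)
qed

text \<open>A Weyl element permutes positive roots only up to sign; \<open>p\<close> repairs the
  sign, which the evenness of the summand makes invisible.\<close>

lemma sum_prod_Sp_weyl:
  assumes "w \<in> W"
  shows sum_Sp_weyl: "(\<And>\<alpha>. \<alpha> \<in> S \<Longrightarrow> f (- \<alpha>) = f \<alpha>) \<Longrightarrow> (\<Sum>\<alpha>\<in>Sp. f (w \<alpha>)) = (\<Sum>\<alpha>\<in>Sp. f \<alpha> :: 'b::comm_monoid_add)"
    and prod_Sp_weyl: "(\<And>\<alpha>. \<alpha> \<in> S \<Longrightarrow> g (- \<alpha>) = g \<alpha>) \<Longrightarrow> (\<Prod>\<alpha>\<in>Sp. g (w \<alpha>)) = (\<Prod>\<alpha>\<in>Sp. g \<alpha> :: 'c::comm_monoid_mult)"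
proof -
  define p where "p w \<alpha> = (if w \<alpha> \<in> Sp then w \<alpha> else - w \<alpha>)" for w :: "'a \<Rightarrow> 'a" and \<alpha>
  have pS: "p w \<alpha> \<in> Sp" if "w \<in> W" "\<alpha> \<in> Sp" for w \<alpha>
    using that weyl_S Sp_S S_cases by (metis p_def)
  have pp: "p (inv w) (p w \<alpha>) = \<alpha>" if "w \<in> W" "\<alpha> \<in> Sp" for w \<alpha>
    using that linear_neg[OF weyl_linear[OF weyl_inv[OF that(1)]]] S_cases[OF Sp_S[OF that(2)]]
    by (auto simp: p_def)
  have ii: "inv (inv w) = w" using assms weyl_bij inv_inv_eq by blast
  have bij: "bij_betw (p w) Sp Sp"
    by (rule bij_betwI[where g = "p (inv w)"])
       (use pS pp[of w] pp[of "inv w"] assms weyl_inv ii in auto)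
  have pf: "h (p w \<alpha>) = h (w \<alpha>)" if "\<And>\<alpha>. \<alpha> \<in> S \<Longrightarrow> h (- \<alpha>) = h \<alpha>" "\<alpha> \<in> Sp" for h :: "'a \<Rightarrow> 'd" and \<alpha>
    using that weyl_S[OF assms] Sp_S by (auto simp: p_def)
  show "(\<And>\<alpha>. \<alpha> \<in> S \<Longrightarrow> f (- \<alpha>) = f \<alpha>) \<Longrightarrow> (\<Sum>\<alpha>\<in>Sp. f (w \<alpha>)) = (\<Sum>\<alpha>\<in>Sp. f \<alpha>)"
    using sum.reindex_bij_betw[OF bij, of f] by (simp add: pf cong: sum.cong)
  show "(\<And>\<alpha>. \<alpha> \<in> S \<Longrightarrow> g (- \<alpha>) = g \<alpha>) \<Longrightarrow> (\<Prod>\<alpha>\<in>Sp. g (w \<alpha>)) = (\<Prod>\<alpha>\<in>Sp. g \<alpha>)"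
    using prod.reindex_bij_betw[OF bij, of g] by (simp add: pf cong: prod.cong)
qed

lemma m_uminus: "\<alpha> \<in> S \<Longrightarrow> m (- \<alpha>) = m \<alpha>"
  using m_invar weyl_refl refl_root_self S_nz by metis

end

section \<open>Lebesgue measure under isometries\<close>

lemma nn_integral_lborel_translate:
  fixes f :: "'a::euclidean_space \<Rightarrow> ennreal"
  assumes [measurable]: "f \<in> borel_measurable borel"
  shows "(\<integral>\<^sup>+x. f (c + x) \<partial>lborel) = (\<integral>\<^sup>+x. f x \<partial>lborel)"
proof -
  have "(\<integral>\<^sup>+x. f x \<partial>lborel) = (\<integral>\<^sup>+x. f x \<partial>distr lborel borel ((+) c))" by (simp add: lborel_distr_plus)
  also have "\<dots> = (\<integral>\<^sup>+x. f (c + x) \<partial>lborel)" by (subst nn_integral_distr) auto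
  finally show ?thesis ..
qed

lemma nn_integral_lborel_reflect:
  fixes f :: "'a::euclidean_space \<Rightarrow> ennreal"
  assumes [measurable]: "f \<in> borel_measurable borel"
  shows "(\<integral>\<^sup>+x. f (c - x) \<partial>lborel) = (\<integral>\<^sup>+x. f x \<partial>lborel)"
proof -
  have "(lborel :: 'a measure) = distr lborel borel (\<lambda>x. c - x)"
    using lborel_affine[of "-1" c] by (simp add: density_1)
  then have "(\<integral>\<^sup>+x. f x \<partial>lborel) = (\<integral>\<^sup>+x. f x \<partial>distr lborel borel (\<lambda>x. c - x))" by simp
  also have "\<dots> = (\<integral>\<^sup>+x. f (c - x) \<partial>lborel)" by (subst nn_integral_distr) auto
  finally show ?thesis ..
qed

text \<open>Uniqueness of Haar measure: both sides are translation invariant and agree on the unit ball.\<close>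

lemma lborel_distr_isometry:
  fixes w :: "'a::euclidean_space \<Rightarrow> 'a"
  assumes lin: "linear w" and iso: "\<And>x y. w x \<bullet> w y = x \<bullet> y" and bij: "bij w"
  shows "distr lborel borel w = lborel"
proof (rule measure_eqI)
  have "continuous_on UNIV w" using lin linear_continuous_on linear_conv_bounded_linear by blast
  then have w[measurable]: "w \<in> borel_measurable borel" by (rule borel_measurable_continuous_onI)
  have nw: "norm (w x) = norm x" for x by (simp add: norm_eq_sqrt_inner iso)
  fix A assume "A \<in> sets (distr lborel borel w)"
  then have A[measurable]: "A \<in> sets borel" by simp
  define B where "B = ball (0::'a) 1"
  have B[measurable]: "B \<in> sets borel" by (simp add: B_def)
  have wB: "w x \<in> B \<longleftrightarrow> x \<in> B" for x by (simp add: B_def nw)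
  \<comment> \<open>\<open>?J\<close> smears the set with the unit ball. Both orders of integration
    use translation invariance alone; the isometry enters only through \<open>wB\<close>, as the
    ball is mapped to itself.\<close>
  let ?J = "\<integral>\<^sup>+x. \<integral>\<^sup>+y. indicator A (w x) * indicator B (w x + y) \<partial>lborel \<partial>lborel"
  have "?J = (\<integral>\<^sup>+x. indicator A (w x) * emeasure lborel B \<partial>lborel)"
    by (simp add: nn_integral_cmult nn_integral_lborel_translate)
  also have "\<dots> = (\<integral>\<^sup>+x. indicator (w -` A) x * emeasure lborel B \<partial>lborel)"
    by (intro nn_integral_cong) (auto simp: indicator_def)
  also have "\<dots> = emeasure lborel (w -` A) * emeasure lborel B"
    using measurable_sets[OF w A] by (simp add: nn_integral_multc)
  finally have J1: "?J = emeasure lborel (w -` A) * emeasure lborel B" .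
  have inner: "(\<integral>\<^sup>+x. indicator A (w x) * indicator B (w x + y) \<partial>lborel)
      = (\<integral>\<^sup>+x. indicator A (w x - y) * indicator B (w x) \<partial>lborel)" for y
  proof -
    obtain z where z: "w z = y" using bij by (metis bij_pointE)
    have "(\<integral>\<^sup>+x. indicator A (w x - y) * indicator B (w x) \<partial>lborel)
       = (\<integral>\<^sup>+x. indicator A (w (z + x) - y) * indicator B (w (z + x)) \<partial>lborel)"
      by (rule nn_integral_lborel_translate[symmetric]) measurable
    then show ?thesis by (simp add: linear_add[OF lin] z add.commute)
  qed
  have "?J = (\<integral>\<^sup>+y. \<integral>\<^sup>+x. indicator A (w x) * indicator B (w x + y) \<partial>lborel \<partial>lborel)"
    by (rule lborel_pair.Fubini') measurable
  also have "\<dots> = (\<integral>\<^sup>+y. \<integral>\<^sup>+x. indicator A (w x - y) * indicator B (w x) \<partial>lborel \<partial>lborel)"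
    by (simp add: inner)
  also have "\<dots> = (\<integral>\<^sup>+x. \<integral>\<^sup>+y. indicator A (w x - y) * indicator B (w x) \<partial>lborel \<partial>lborel)"
    by (rule lborel_pair.Fubini') measurable
  also have "\<dots> = (\<integral>\<^sup>+x. emeasure lborel A * indicator B x \<partial>lborel)"
    by (intro nn_integral_cong, subst nn_integral_multc)
       (auto simp: nn_integral_lborel_reflect[of "indicator A"] wB indicator_def[of B])
  also have "\<dots> = emeasure lborel A * emeasure lborel B" by (simp add: nn_integral_cmult)
  finally have "emeasure lborel (w -` A) * emeasure lborel B = emeasure lborel A * emeasure lborel B"
    using J1 by simp
  moreover have "emeasure lborel B \<noteq> 0" "emeasure lborel B \<noteq> \<infinity>"
    using emeasure_lborel_ball_finite[of "0::'a" 1] open_not_negligible[of "ball (0::'a) 1"]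
    by (auto simp: B_def negligible_iff_emeasure0 top_unique)
  ultimately have "emeasure lborel (w -` A) = emeasure lborel A"
    by (auto simp: mult.commute[of _ "emeasure lborel B"] ennreal_mult_cancel_left)
  then show "emeasure (distr lborel borel w) A = emeasure lborel A" by (simp add: emeasure_distr)
qed simp

lemma integral_lborel_translate:
  fixes f :: "'a::euclidean_space \<Rightarrow> 'b::{banach, second_countable_topology}"
  assumes [measurable]: "f \<in> borel_measurable borel"
  shows "(LINT x|lborel. f (c + x)) = (LINT x|lborel. f x)"
proof -
  have "(LINT x|lborel. f x) = (LINT x|distr lborel borel ((+) c). f x)" by (simp add: lborel_distr_plus)
  also have "\<dots> = (LINT x|lborel. f (c + x))" by (subst integral_distr) auto
  finally show ?thesis ..
qed

lemma AE_hyperplane: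
  fixes a :: "'a::euclidean_space"
  assumes "a \<noteq> 0"
  shows "AE x in lborel. a \<bullet> x \<noteq> b"
proof -
  have "{x. a \<bullet> x = b} \<in> null_sets lborel"
    using negligible_hyperplane[of a b] assms
    by (simp add: negligible_iff_null_sets null_sets_completion_iff)
  then show ?thesis by (rule AE_I') auto
qed

lemma AE_sin_inner_nonzero:
  fixes a u :: "'a::euclidean_space"
  assumes "a \<noteq> 0"
  shows "AE x in lborel. sin (a \<bullet> (x + u)) \<noteq> 0"
proof -
  have "AE x in lborel. \<forall>k::int. a \<bullet> x \<noteq> of_int k * pi - a \<bullet> u"
    by (subst AE_all_countable) (simp add: AE_hyperplane assms)
  then show ?thesis
    by (rule AE_mp) (auto simp: sin_zero_iff_int2 inner_add_right algebra_simps)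
qed

context root_data
begin

section \<open>The coroot lattice and its fundamental domain\<close>

text \<open>The lattice generated by the coroots. Lists give access to the number of summands, on
  which \<open>Q_minuscule\<close> inducts; negatives are covered because \<open>S\<close> is
  symmetric.\<close>

definition Q :: "'a set" where
  "Q = {v. \<exists>as. set as \<subseteq> S \<and> v = sum_list (map coroot as)}"

lemma Q_0: "0 \<in> Q" by (auto simp: Q_def intro: exI[of _ "[]"])

lemma Q_coroot: "\<alpha> \<in> S \<Longrightarrow> coroot \<alpha> \<in> Q" by (auto simp: Q_def intro!: exI[of _ "[\<alpha>]"])

lemma Q_add: assumes "v \<in> Q" "u \<in> Q" shows "v + u \<in> Q"
proof -
  obtain as bs where "set as \<subseteq> S" "v = sum_list (map coroot as)" "set bs \<subseteq> S" "u = sum_list (map coroot bs)"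
    using assms by (auto simp: Q_def)
  then show ?thesis by (auto simp: Q_def intro!: exI[of _ "as @ bs"])
qed

lemma Q_uminus: assumes "v \<in> Q" shows "- v \<in> Q"
proof -
  obtain as where "set as \<subseteq> S" "v = sum_list (map coroot as)" using assms by (auto simp: Q_def)
  then show ?thesis
    by (intro CollectI[of "\<lambda>v. \<exists>as. set as \<subseteq> S \<and> v = sum_list (map coroot as)", folded Q_def]
              exI[of _ "map uminus as"])
       (auto simp: uminus_S coroot_uminus uminus_sum_list_map comp_def)
qed

lemma Q_int: assumes "v \<in> Q" "\<beta> \<in> S" shows "\<beta> \<bullet> v \<in> \<int>"
proof -
  obtain as where "set as \<subseteq> S" "v = sum_list (map coroot as)" using assms by (auto simp: Q_def)
  then show ?thesis
    by (induction as arbitrary: v) (auto simp: inner_add_right int_S assms(2))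
qed

text \<open>If \<open>v\<close> is a sum of \<open>n\<close> coroots, one of them has pairing 1 with \<open>v\<close>; subtracting it
  is a reflection of \<open>v\<close>, so the bound on the pairings persists while \<open>n\<close> drops.\<close>

lemma Q_minuscule:
  assumes "v \<in> Q" "\<And>\<beta>. \<beta> \<in> S \<Longrightarrow> \<bar>\<beta> \<bullet> v\<bar> \<le> 1"
  shows "v = 0"
proof -
  have "\<forall>v as. length as = n \<longrightarrow> set as \<subseteq> S \<longrightarrow> v = sum_list (map coroot as) \<longrightarrow>
      (\<forall>\<beta>\<in>S. \<bar>\<beta> \<bullet> v\<bar> \<le> 1) \<longrightarrow> v = 0" for n
  proof (induction n rule: less_induct)
    case (less n)
    show ?case
    proof (intro allI impI, rule ccontr)
      fix v as assume as: "length as = n" "set as \<subseteq> S" "v = sum_list (map coroot as)"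
        "\<forall>\<beta>\<in>S. \<bar>\<beta> \<bullet> v\<bar> \<le> 1" and nz: "v \<noteq> 0"
      have "\<exists>\<alpha>\<in>set as. \<alpha> \<bullet> v > 0"
      proof (rule ccontr)
        assume n: "\<not> ?thesis"
        have "sum_list (map coroot bs) \<bullet> v \<le> 0" if "set bs \<subseteq> set as" for bs
          using that
        proof (induction bs)
          case (Cons b bs)
          then have "b \<bullet> v \<le> 0" "b \<in> S" using n as by (auto simp: not_less)
          then have "coroot b \<bullet> v \<le> 0" using inner_coroot_pos_iff[of b v] S_nz by (simp add: not_less[symmetric])
          then show ?case using Cons by (auto simp: inner_add_left)
        qed simp
        from this[of as] have "v \<bullet> v \<le> 0" using as(3) by simp
        then show False using nz by (simp add: not_less[symmetric])
      qed
      then obtain \<alpha> where \<alpha>: "\<alpha> \<in> set as" "\<alpha> \<bullet> v > 0" by blast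
      have "v \<in> Q" using as by (auto simp: Q_def)
      then obtain k where k: "\<alpha> \<bullet> v = of_int k" using Q_int as \<alpha> Ints_cases by (metis subset_iff)
      have "\<bar>\<alpha> \<bullet> v\<bar> \<le> 1" using \<alpha>(1) as(2,4) by blast
      then have "k = 1" using k \<alpha>(2) by simp
      then have one: "v \<bullet> \<alpha> = 1" using k by (simp add: inner_commute)
      let ?v = "refl_root \<alpha> v"
      have "?v = v - coroot \<alpha>" by (simp add: refl_root_eq' one)
      also have "\<dots> = sum_list (map coroot (remove1 \<alpha> as))"
        unfolding as(3) using \<alpha>(1) by (simp add: sum_list_map_remove1)
      finally have v': "?v = sum_list (map coroot (remove1 \<alpha> as))" .
      have len: "length (remove1 \<alpha> as) < n" using \<alpha>(1) as(1)
        by (metis One_nat_def diff_less length_pos_if_in_set length_remove1 zero_less_one)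
      have sub: "set (remove1 \<alpha> as) \<subseteq> S" using as(2) set_remove1_subset by fastforce
      have bd: "\<forall>\<beta>\<in>S. \<bar>\<beta> \<bullet> ?v\<bar> \<le> 1"
        using as \<alpha>(1) refl_S by (auto simp: refl_root_inner_commute[symmetric])
      have "?v = 0" using less.IH[OF len] v' bd sub by blast
      then show False using nz refl_root_invol[of \<alpha> v] linear_0[OF linear_refl_root[of \<alpha>]] by simp
    qed
  qed
  then show ?thesis using assms by (auto simp: Q_def)
qed

text \<open>The integer quotients determine \<open>x\<close>, since the positive roots span, and
  they are bounded. Used with \<open>c \<alpha> = 1\<close> for the coroot lattice and with
  \<open>c \<alpha> = \<alpha> \<bullet> \<alpha>\<close> for weights.\<close>

lemma finite_lattice_bounded:
  assumes c: "\<And>\<alpha>. \<alpha> \<in> Sp \<Longrightarrow> c \<alpha> > 0"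
  shows "finite {x. norm x \<le> R \<and> (\<forall>\<alpha>\<in>Sp. (x \<bullet> \<alpha>) / c \<alpha> \<in> \<int>)}" (is "finite ?X")
proof (rule inj_on_finite)
  define f where "f x = restrict (\<lambda>\<alpha>. \<lfloor>(x \<bullet> \<alpha>) / c \<alpha>\<rfloor>) Sp" for x
  define M where "M = Max ((\<lambda>\<alpha>. R * norm \<alpha> / c \<alpha>) ` Sp)"
  have fl: "(x \<bullet> \<alpha>) = c \<alpha> * of_int (f x \<alpha>)" if "x \<in> ?X" "\<alpha> \<in> Sp" for x \<alpha>
    using that c[of \<alpha>] by (auto simp: f_def elim!: Ints_cases simp: field_simps)
  show "inj_on f ?X"
  proof (rule inj_onI, rule eq_if_inner_eq)
    fix x y \<alpha> assume "x \<in> ?X" "y \<in> ?X" "f x = f y" "\<alpha> \<in> Sp"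
    then show "x \<bullet> \<alpha> = y \<bullet> \<alpha>" using fl[of x \<alpha>] fl[of y \<alpha>] by simp
  qed
  show "f ` ?X \<subseteq> (Sp \<rightarrow>\<^sub>E {-\<lceil>M\<rceil>..\<lceil>M\<rceil>})"
  proof (intro image_subsetI PiE_I)
    fix x \<alpha> assume x: "x \<in> ?X" and \<alpha>: "\<alpha> \<in> Sp"
    have "\<bar>x \<bullet> \<alpha>\<bar> \<le> norm x * norm \<alpha>" by (rule Cauchy_Schwarz_ineq2)
    also have "\<dots> \<le> R * norm \<alpha>" using x by (auto intro: mult_right_mono)
    finally have "\<bar>x \<bullet> \<alpha>\<bar> / c \<alpha> \<le> R * norm \<alpha> / c \<alpha>" using c[OF \<alpha>] by (simp add: divide_right_mono)
    also have "\<dots> \<le> M" unfolding M_def using \<alpha> finite_Sp by (intro Max_ge) auto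
    finally have "\<bar>real_of_int (f x \<alpha>)\<bar> \<le> M" using fl[OF x \<alpha>] c[OF \<alpha>] by (simp add: abs_mult)
    then show "f x \<alpha> \<in> {-\<lceil>M\<rceil>..\<lceil>M\<rceil>}" by (auto simp: abs_le_iff) linarith+
  qed (auto simp: f_def)
  show "finite (Sp \<rightarrow>\<^sub>E {-\<lceil>M\<rceil>..\<lceil>M\<rceil>})" using finite_Sp by (simp add: finite_PiE)
qed

lemma finite_Q_bounded: "finite {v\<in>Q. norm v \<le> R}"
proof (rule finite_subset[OF _ finite_lattice_bounded[of "\<lambda>_. 1" R]])
  have "x \<bullet> \<alpha> \<in> \<int>" if "x \<in> Q" "\<alpha> \<in> Sp" for x \<alpha>
    using Q_int[OF that(1) Sp_S[OF that(2)]] by (simp add: inner_commute)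
  then show "{v \<in> Q. norm v \<le> R} \<subseteq> {x. norm x \<le> R \<and> (\<forall>\<alpha>\<in>Sp. x \<bullet> \<alpha> / 1 \<in> \<int>)}" by auto
qed simp

text \<open>A lattice point nearest to \<open>x\<close> works: comparing it with its neighbour at
  \<open>coroot \<alpha>\<close> is exactly the inequality \<alpha> . z <= \<pi> for the remainder
  \<open>z\<close>.\<close>

lemma ex_Q_closest: "\<exists>v\<in>Q. \<forall>\<alpha>\<in>S. \<bar>\<alpha> \<bullet> (x - pi *\<^sub>R v)\<bar> \<le> pi"
proof -
  let ?N = "{v\<in>Q. norm (x - pi *\<^sub>R v) \<le> norm x}"
  have "?N \<subseteq> {v\<in>Q. norm v \<le> 2 * norm x / pi}"
  proof safe
    fix v assume "norm (x - pi *\<^sub>R v) \<le> norm x"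
    then have "norm (pi *\<^sub>R v) \<le> 2 * norm x"
      using norm_triangle_ineq4[of x "x - pi *\<^sub>R v"] by simp
    then show "norm v \<le> 2 * norm x / pi" by (simp add: field_simps)
  qed
  then have "finite ?N" using finite_Q_bounded finite_subset by blast
  moreover have "0 \<in> ?N" using Q_0 by simp
  ultimately obtain v where v: "v \<in> ?N" "\<And>u. u \<in> ?N \<Longrightarrow> norm (x - pi *\<^sub>R v) \<le> norm (x - pi *\<^sub>R u)"
    using arg_min_if_finite[of ?N "\<lambda>v. norm (x - pi *\<^sub>R v)"] by (metis (no_types, lifting) empty_iff not_le)
  have le: "norm (x - pi *\<^sub>R v) \<le> norm (x - pi *\<^sub>R u)" if "u \<in> Q" for u
    using v that by (cases "u \<in> ?N") auto
  have "\<alpha> \<bullet> (x - pi *\<^sub>R v) \<le> pi" if \<alpha>: "\<alpha> \<in> S" for \<alpha>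
  proof -
    define z where "z = x - pi *\<^sub>R v"
    have "norm z \<le> norm (z - pi *\<^sub>R coroot \<alpha>)"
      using le[of "v + coroot \<alpha>"] v(1) Q_add Q_coroot[OF \<alpha>] by (simp add: z_def algebra_simps)
    then have "z \<bullet> z \<le> (z - pi *\<^sub>R coroot \<alpha>) \<bullet> (z - pi *\<^sub>R coroot \<alpha>)" by (simp add: norm_le)
    then have "2 * pi * (z \<bullet> coroot \<alpha>) \<le> pi * pi * (coroot \<alpha> \<bullet> coroot \<alpha>)"
      by (simp add: inner_diff_left inner_diff_right inner_commute algebra_simps)
    then have "pi * (2 * (z \<bullet> coroot \<alpha>)) \<le> pi * (pi * (coroot \<alpha> \<bullet> coroot \<alpha>))" by (simp only: mult_ac)
    then have "2 * (z \<bullet> coroot \<alpha>) \<le> pi * (coroot \<alpha> \<bullet> coroot \<alpha>)"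
      using pi_gt_zero by (simp only: mult_le_cancel_left_pos)
    moreover have "coroot \<alpha> \<bullet> coroot \<alpha> = 4 / (\<alpha> \<bullet> \<alpha>)" "z \<bullet> coroot \<alpha> = 2 * (z \<bullet> \<alpha>) / (\<alpha> \<bullet> \<alpha>)"
      using S_nz[OF \<alpha>] by (auto simp: coroot_def)
    moreover have "\<alpha> \<bullet> \<alpha> > 0" using S_nz[OF \<alpha>] by simp
    ultimately show ?thesis by (simp add: z_def field_simps inner_commute)
  qed
  from this[of "- _"] this have "\<forall>\<alpha>\<in>S. \<bar>\<alpha> \<bullet> (x - pi *\<^sub>R v)\<bar> \<le> pi"
    using uminus_S by (auto simp: abs_le_iff)
  then show ?thesis using v(1) by blast
qed

text \<open>Translate into the closed cell of \<open>ex_Q_closest\<close>, then move to the dominant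
  chamber by \<open>W\<close>, which permutes the inequalities of the cell.\<close>

lemma ex_alcove: "\<exists>w\<in>W. \<exists>v\<in>Q. w (x - pi *\<^sub>R v) \<in> alcove Sp"
proof -
  obtain v where v: "v \<in> Q" "\<forall>\<alpha>\<in>S. \<bar>\<alpha> \<bullet> (x - pi *\<^sub>R v)\<bar> \<le> pi" using ex_Q_closest by blast
  obtain w where w: "w \<in> W" "dominant (w (x - pi *\<^sub>R v))" using ex_dominant by blast
  have "\<alpha> \<bullet> w (x - pi *\<^sub>R v) \<le> pi" if "\<alpha> \<in> Sp" for \<alpha>
  proof -
    have "\<alpha> \<bullet> w (x - pi *\<^sub>R v) = inv w \<alpha> \<bullet> (x - pi *\<^sub>R v)"
      using weyl_inner_inv[OF w(1)] by (metis inner_commute)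
    then show ?thesis using v(2) weyl_S[OF weyl_inv[OF w(1)] Sp_S[OF that]] by fastforce
  qed
  then have "w (x - pi *\<^sub>R v) \<in> alcove Sp" using w by (auto simp: alcove_def dominant_def)
  then show ?thesis using v w by blast
qed

text \<open>In effect the open Voronoi cell of \<pi> \<open>Q\<close> at the origin. It stands for
  the torus; unlike a parallelepiped it is \<open>W\<close>-invariant.\<close>

definition K :: "'a set" where "K = {x. \<forall>\<alpha>\<in>S. \<bar>\<alpha> \<bullet> x\<bar> < pi}"

definition regular :: "'a \<Rightarrow> bool" where "regular x \<longleftrightarrow> (\<forall>\<alpha>\<in>S. sin (\<alpha> \<bullet> x) \<noteq> 0)"

lemma AE_regular_translate: "AE x in lborel. regular (x + u)"
  unfolding regular_def using finite_S S_nz by (subst AE_finite_all) (auto simp: AE_sin_inner_nonzero)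

lemma AE_regular: "AE x in lborel. regular x"
  using AE_regular_translate[of 0] by simp

lemma open_K: "open K"
proof -
  have "K = (\<Inter>\<alpha>\<in>S. {x. \<bar>\<alpha> \<bullet> x\<bar> < pi})" by (auto simp: K_def)
  also have "open \<dots>" using finite_S by (intro open_INT) (auto intro!: open_Collect_less continuous_intros)
  finally show ?thesis .
qed

lemma bounded_inner_Sp: "bounded {x. \<forall>\<alpha>\<in>Sp. \<bar>\<alpha> \<bullet> x\<bar> \<le> c}"
proof -
  have *: "\<exists>B. \<forall>x. (\<forall>\<alpha>\<in>Sp. \<bar>\<alpha> \<bullet> x\<bar> \<le> c) \<longrightarrow> \<bar>y \<bullet> x\<bar> \<le> B" for y
  proof -
    have "y \<in> span Sp" by (simp add: span_Sp)
    then show ?thesis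
    proof (induction rule: span_induct_alt)
      case base
      then show ?case by auto
    next
      case (step d \<alpha> y)
      then obtain B where B: "\<forall>x. (\<forall>\<alpha>\<in>Sp. \<bar>\<alpha> \<bullet> x\<bar> \<le> c) \<longrightarrow> \<bar>y \<bullet> x\<bar> \<le> B" by blast
      show ?case
      proof (intro exI[of _ "\<bar>d\<bar> * c + B"] allI impI)
        fix x assume "\<forall>\<alpha>\<in>Sp. \<bar>\<alpha> \<bullet> x\<bar> \<le> c"
        then have "\<bar>y \<bullet> x\<bar> \<le> B" "\<bar>\<alpha> \<bullet> x\<bar> \<le> c" using B step by auto
        then have "\<bar>d * (\<alpha> \<bullet> x)\<bar> \<le> \<bar>d\<bar> * c" by (simp add: abs_mult mult_left_mono)
        then show "\<bar>(d *\<^sub>R \<alpha> + y) \<bullet> x\<bar> \<le> \<bar>d\<bar> * c + B" using \<open>\<bar>y \<bullet> x\<bar> \<le> B\<close> by (simp add: inner_add_left)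
      qed
    qed
  qed
  then obtain B where B: "\<And>y x. (\<forall>\<alpha>\<in>Sp. \<bar>\<alpha> \<bullet> x\<bar> \<le> c) \<Longrightarrow> \<bar>y \<bullet> x\<bar> \<le> B y" by metis
  show ?thesis
  proof (rule boundedI[of _ "\<Sum>b\<in>Basis. B b"])
    fix x assume x: "x \<in> {x. \<forall>\<alpha>\<in>Sp. \<bar>\<alpha> \<bullet> x\<bar> \<le> c}"
    have "norm x \<le> (\<Sum>b\<in>Basis. \<bar>x \<bullet> b\<bar>)" by (rule norm_le_l1)
    also have "\<dots> \<le> (\<Sum>b\<in>Basis. B b)"
    proof (rule sum_mono)
      fix b show "\<bar>x \<bullet> b\<bar> \<le> B b" using B[of x b] x by (simp add: inner_commute)
    qed
    finally show "norm x \<le> (\<Sum>b\<in>Basis. B b)" .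
  qed
qed

lemma bounded_K: "bounded K"
  by (rule bounded_subset[OF bounded_inner_Sp[of pi]]) (auto simp: K_def Sp_S intro: less_imp_le)

lemma compact_alcove: "compact (alcove Sp)"
proof -
  have "alcove Sp = (\<Inter>\<alpha>\<in>Sp. {x. 0 \<le> \<alpha> \<bullet> x} \<inter> {x. \<alpha> \<bullet> x \<le> pi})" by (auto simp: alcove_def)
  also have "closed \<dots>" by (intro closed_INT closed_Int ballI closed_Collect_le continuous_intros)
  finally have "closed (alcove Sp)" .
  moreover have "bounded (alcove Sp)"
    by (rule bounded_subset[OF bounded_inner_Sp[of pi]]) (auto simp: alcove_def)
  ultimately show ?thesis by (simp add: compact_eq_bounded_closed)
qed

lemma K_sets [measurable]: "K \<in> sets borel" and alcove_sets [measurable]: "alcove Sp \<in> sets borel"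
  using open_K compact_alcove by (auto intro: borel_closed compact_imp_closed)

lemma set_integrable_bounded:
  fixes F :: "'a \<Rightarrow> complex"
  assumes [measurable]: "F \<in> borel_measurable borel" "A \<in> sets borel" and b: "\<And>x. norm (F x) \<le> B" "bounded A"
  shows "set_integrable lborel A F"
proof -
  have "emeasure lborel A < \<infinity>" using b(2) emeasure_bounded_finite by blast
  then show ?thesis
    unfolding set_integrable_def
    by (intro integrableI_bounded_set_indicator[where B = B]) (use b in auto)
qed

lemma set_integrable_continuous:
  fixes F :: "'a \<Rightarrow> complex"
  assumes "continuous_on UNIV F" "A \<in> sets borel" "bounded A"
  shows "set_integrable lborel A F"
proof -
  have "set_integrable lborel (closure A) F"
    unfolding set_integrable_def using assms(1,3)
    by (intro borel_integrable_compact) (auto intro: continuous_on_subset compact_closure[THEN iffD2])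
  then show ?thesis
    by (rule set_integrable_subset) (use assms(2) closure_subset in auto)
qed

lemma tile_ex: assumes "regular y" shows "\<exists>v\<in>Q. y - pi *\<^sub>R v \<in> K"
proof -
  obtain v where v: "v \<in> Q" "\<forall>\<alpha>\<in>S. \<bar>\<alpha> \<bullet> (y - pi *\<^sub>R v)\<bar> \<le> pi" using ex_Q_closest by blast
  have "\<bar>\<alpha> \<bullet> (y - pi *\<^sub>R v)\<bar> \<noteq> pi" if \<alpha>: "\<alpha> \<in> S" for \<alpha>
  proof
    assume a: "\<bar>\<alpha> \<bullet> (y - pi *\<^sub>R v)\<bar> = pi"
    obtain k where k: "\<alpha> \<bullet> v = of_int k" using Q_int[OF v(1) \<alpha>] Ints_cases by metis
    have "\<alpha> \<bullet> y = of_int (k + 1) * pi \<or> \<alpha> \<bullet> y = of_int (k - 1) * pi"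
      using a k by (auto simp: inner_diff_right abs_if algebra_simps split: if_splits)
    then have "sin (\<alpha> \<bullet> y) = 0" by (auto simp: sin_zero_iff_int2 simp del: of_int_add of_int_diff)
    then show False using assms \<alpha> by (auto simp: regular_def)
  qed
  then have "y - pi *\<^sub>R v \<in> K" using v(2) by (auto simp: K_def less_le)
  then show ?thesis using v by blast
qed

text \<open>The difference of two candidates pairs with each root to an integer of absolute value
  below 2, so \<open>Q_minuscule\<close> applies.\<close>

lemma tile_unique: assumes "v \<in> Q" "u \<in> Q" "y - pi *\<^sub>R v \<in> K" "y - pi *\<^sub>R u \<in> K" shows "v = u"
proof -
  have "v + (- u) = 0"
  proof (rule Q_minuscule)
    show "v + - u \<in> Q" using assms Q_add Q_uminus by blast
    fix \<beta> assume \<beta>: "\<beta> \<in> S"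
    obtain k where k: "\<beta> \<bullet> (v + - u) = of_int k" using Q_int[OF \<open>v + - u \<in> Q\<close> \<beta>] Ints_cases by metis
    have "\<bar>\<beta> \<bullet> (y - pi *\<^sub>R v)\<bar> < pi" "\<bar>\<beta> \<bullet> (y - pi *\<^sub>R u)\<bar> < pi" using assms \<beta> by (auto simp: K_def)
    then have "\<bar>pi * (\<beta> \<bullet> (v + - u))\<bar> < 2 * pi"
      unfolding inner_add_right inner_diff_right inner_minus_right inner_scaleR_right right_diff_distrib by (simp add: algebra_simps)
    then have "pi * \<bar>real_of_int k\<bar> < pi * 2" unfolding k by (simp add: abs_mult)
    then have "\<bar>real_of_int k\<bar> < 2" using pi_gt_zero by (simp only: mult_less_cancel_left_pos)
    then have "\<bar>k\<bar> \<le> 1" by linarith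
    then show "\<bar>\<beta> \<bullet> (v + - u)\<bar> \<le> 1" unfolding k by simp
  qed
  then show ?thesis by simp
qed

text \<open>Almost everywhere the indicators of the shifted tiles add up to 1. Inserting them cuts
  the domain into pieces, each piece is moved by a lattice vector, under which \<open>F\<close> is
  periodic, and the pieces refill \<open>K\<close>.\<close>

lemma integral_K_translate:
  fixes F :: "'a \<Rightarrow> complex"
  assumes F[measurable]: "F \<in> borel_measurable borel" and B: "\<And>x. norm (F x) \<le> B"
    and per: "\<And>x v. v \<in> Q \<Longrightarrow> F (x + pi *\<^sub>R v) = F x"
  shows "(LINT x:K|lborel. F (x + u)) = (LINT x:K|lborel. F x)"
proof -
  obtain R where R: "\<And>x. x \<in> K \<Longrightarrow> norm x \<le> R" using bounded_K by (auto simp: bounded_iff)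
  \<comment> \<open>Only lattice vectors of this size can bring a point of \<open>K + u\<close> back
    into \<open>K\<close>. The bound is symmetric, so \<open>N\<close> is closed under negation,
    which the reassembly uses.\<close>
  define N where "N = {v\<in>Q. norm v \<le> (2 * R + norm u) / pi}"
  have finN: "finite N" unfolding N_def by (rule finite_Q_bounded)
  have one: "(\<Sum>v\<in>N. indicator K (x + s - pi *\<^sub>R v)) = (1::complex)"
    if x: "x \<in> K" "regular (x + s)" "norm s = norm u" for x s
  proof -
    obtain v where v: "v \<in> Q" "x + s - pi *\<^sub>R v \<in> K" using tile_ex[OF x(2)] by blast
    have "norm (pi *\<^sub>R v) \<le> norm (x + s) + norm (x + s - pi *\<^sub>R v)"
      using norm_triangle_ineq4[of "x + s" "x + s - pi *\<^sub>R v"] by simp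
    also have "\<dots> \<le> R + norm u + R" using R[OF v(2)] R[OF x(1)] norm_triangle_ineq[of x s] x(3) by linarith
    finally have "v \<in> N" using v by (simp add: N_def field_simps)
    moreover have "indicator K (x + s - pi *\<^sub>R v') = (0::complex)" if "v' \<in> N - {v}" for v'
      using tile_unique[of v' v "x + s"] that v by (auto simp: N_def indicator_def)
    ultimately show ?thesis using v(2) by (simp add: sum.remove[OF finN])
  qed
  have int: "integrable lborel (\<lambda>x. indicator K x *\<^sub>R (indicator K (x + a) * F (x + b)))" for a b
  proof -
    have "set_integrable lborel K (\<lambda>x. indicator K (x + a) * F (x + b))"
      by (rule set_integrable_bounded[where B = B])
         (auto intro: bounded_K B order_trans[OF norm_ge_zero B[of undefined]] simp: indicator_def)
    then show ?thesis by (simp add: set_integrable_def)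
  qed
  have uN: "uminus ` N = N" using Q_uminus by (force simp: N_def image_iff)
  have "(LINT x:K|lborel. F (x + u))
      = (LINT x|lborel. (\<Sum>v\<in>N. indicator K x *\<^sub>R (indicator K (x + (u - pi *\<^sub>R v)) * F (x + u))))"
    unfolding set_lebesgue_integral_def
  proof (rule integral_cong_AE)
    show "AE x in lborel. indicator K x *\<^sub>R F (x + u)
        = (\<Sum>v\<in>N. indicator K x *\<^sub>R (indicator K (x + (u - pi *\<^sub>R v)) * F (x + u)))"
      using AE_regular_translate[of u]
    proof (rule AE_mp, intro AE_I2 impI)
      fix x assume r: "regular (x + u)"
      show "indicator K x *\<^sub>R F (x + u)
        = (\<Sum>v\<in>N. indicator K x *\<^sub>R (indicator K (x + (u - pi *\<^sub>R v)) * F (x + u)))"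
      proof (cases "x \<in> K")
        case True
        then show ?thesis
          using one[OF True r] by (simp add: sum_distrib_right[symmetric] add_diff_eq)
      qed simp
    qed
  qed auto
  also have "\<dots> = (\<Sum>v\<in>N. LINT x|lborel. indicator K x *\<^sub>R (indicator K (x + (u - pi *\<^sub>R v)) * F (x + u)))"
    by (rule Bochner_Integration.integral_sum) (rule int)
  also have "\<dots> = (\<Sum>v\<in>N. LINT x|lborel. indicator K x *\<^sub>R (indicator K (x + (- u + pi *\<^sub>R v)) * F (x + 0)))"
  proof (rule sum.cong[OF refl])
    fix v assume "v \<in> N"
    then have vQ: "v \<in> Q" by (simp add: N_def)
    let ?c = "- u + pi *\<^sub>R v"
    have "(LINT x|lborel. indicator K x *\<^sub>R (indicator K (x + (u - pi *\<^sub>R v)) * F (x + u)))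
       = (LINT x|lborel. indicator K (?c + x) *\<^sub>R (indicator K ((?c + x) + (u - pi *\<^sub>R v)) * F ((?c + x) + u)))"
      by (rule integral_lborel_translate[symmetric]) measurable
    also have "\<dots> = (LINT x|lborel. indicator K x *\<^sub>R (indicator K (x + ?c) * F (x + 0)))"
    proof (rule Bochner_Integration.integral_cong[OF refl])
      fix x
      have "?c + x + (u - pi *\<^sub>R v) = x" "?c + x + u = x + pi *\<^sub>R v" by simp_all
      then show "indicator K (?c + x) *\<^sub>R (indicator K ((?c + x) + (u - pi *\<^sub>R v)) * F ((?c + x) + u))
          = indicator K x *\<^sub>R (indicator K (x + ?c) * F (x + 0))"
        using per[OF vQ, of x] by (auto simp: indicator_def add.commute)
    qed
    finally show "(LINT x|lborel. indicator K x *\<^sub>R (indicator K (x + (u - pi *\<^sub>R v)) * F (x + u)))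
       = (LINT x|lborel. indicator K x *\<^sub>R (indicator K (x + (- u + pi *\<^sub>R v)) * F (x + 0)))" .
  qed
  also have "\<dots> = (LINT x|lborel. (\<Sum>v\<in>N. indicator K x *\<^sub>R (indicator K (x + (- u + pi *\<^sub>R v)) * F (x + 0))))"
    by (rule Bochner_Integration.integral_sum[symmetric]) (rule int)
  also have "\<dots> = (LINT x:K|lborel. F x)"
    unfolding set_lebesgue_integral_def
  proof (rule integral_cong_AE)
    show "AE x in lborel. (\<Sum>v\<in>N. indicator K x *\<^sub>R (indicator K (x + (- u + pi *\<^sub>R v)) * F (x + 0)))
        = indicator K x *\<^sub>R F x"
      using AE_regular_translate[of "- u"]
    proof (rule AE_mp, intro AE_I2 impI)
      fix x assume r: "regular (x + - u)"
      show "(\<Sum>v\<in>N. indicator K x *\<^sub>R (indicator K (x + (- u + pi *\<^sub>R v)) * F (x + 0)))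
        = indicator K x *\<^sub>R F x"
      proof (cases "x \<in> K")
        case True
        have "(\<Sum>v\<in>N. indicator K (x + (- u + pi *\<^sub>R v))) = (\<Sum>v\<in>N. indicator K (x + - u - pi *\<^sub>R v) :: complex)"
          by (subst uN[symmetric], subst sum.reindex) (auto intro: inj_onI simp: algebra_simps)
        then show ?thesis
          using one[OF True r] True by (simp add: sum_distrib_right[symmetric])
      qed simp
    qed
  qed auto
  finally show ?thesis .
qed

lemma weyl_measurable: "w \<in> W \<Longrightarrow> w \<in> borel_measurable borel"
  using weyl_linear linear_continuous_on linear_conv_bounded_linear
  by (blast intro: borel_measurable_continuous_onI)

lemma integral_weyl:
  fixes f :: "'a \<Rightarrow> 'b::{banach, second_countable_topology}"
  assumes w: "w \<in> W" and [measurable]: "f \<in> borel_measurable borel"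
  shows "(LINT x|lborel. f (w x)) = (LINT x|lborel. f x)"
proof -
  have [measurable]: "w \<in> borel_measurable borel" by (rule weyl_measurable[OF w])
  have "distr lborel borel w = lborel"
    using w by (intro lborel_distr_isometry) (auto simp: weyl_linear weyl_inner weyl_bij)
  then have "(LINT x|lborel. f x) = (LINT x|distr lborel borel w. f x)" by simp
  also have "\<dots> = (LINT x|lborel. f (w x))" by (subst integral_distr) auto
  finally show ?thesis ..
qed

lemma weyl_K: "w \<in> W \<Longrightarrow> w x \<in> K \<longleftrightarrow> x \<in> K"
proof -
  have "w x \<in> K" if "x \<in> K" "w \<in> W" for w x
    unfolding K_def
  proof safe
    fix \<alpha> assume "\<alpha> \<in> S"
    then have "inv w \<alpha> \<in> S" using that weyl_S weyl_inv by blast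
    then show "\<bar>\<alpha> \<bullet> w x\<bar> < pi" using that weyl_inner_inv[OF that(2), of x \<alpha>] by (auto simp: K_def inner_commute)
  qed
  then show "w \<in> W \<Longrightarrow> w x \<in> K \<longleftrightarrow> x \<in> K" using weyl_inv by (metis weyl_inv_left)
qed

lemma integral_K_weyl:
  fixes f :: "'a \<Rightarrow> complex"
  assumes "w \<in> W" and [measurable]: "f \<in> borel_measurable borel"
  shows "(LINT x:K|lborel. f (w x)) = (LINT x:K|lborel. f x)"
proof -
  have "(LINT x:K|lborel. f (w x)) = (LINT x|lborel. indicator K (w x) *\<^sub>R f (w x))"
    unfolding set_lebesgue_integral_def
    by (rule Bochner_Integration.integral_cong) (auto simp: indicator_def weyl_K assms)
  also have "\<dots> = (LINT x:K|lborel. f x)"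
    unfolding set_lebesgue_integral_def
    by (rule integral_weyl[OF assms(1), of "\<lambda>x. indicator K x *\<^sub>R f x"]) measurable
  finally show ?thesis .
qed

lemma regular_weyl: assumes "regular x" "w \<in> W" shows "regular (w x)"
  unfolding regular_def
proof
  fix \<alpha> assume "\<alpha> \<in> S"
  then have "inv w \<alpha> \<in> S" using assms weyl_S weyl_inv by blast
  then show "sin (\<alpha> \<bullet> w x) \<noteq> 0" using assms weyl_inner_inv[OF assms(2), of x \<alpha>] by (auto simp: regular_def inner_commute)
qed

lemma alcove_K: assumes "regular x" shows "x \<in> alcove Sp \<longleftrightarrow> x \<in> K \<and> dominant x"
proof
  assume a: "x \<in> alcove Sp"
  have "\<bar>\<alpha> \<bullet> x\<bar> < pi" if "\<alpha> \<in> Sp" for \<alpha>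
  proof -
    have "\<alpha> \<bullet> x \<noteq> pi" using assms that Sp_S by (force simp: regular_def)
    then show ?thesis using a that by (force simp: alcove_def)
  qed
  note p = this
  have "\<bar>\<alpha> \<bullet> x\<bar> < pi" if "\<alpha> \<in> S" for \<alpha>
    using that
  proof (cases rule: S_cases)
    case 2
    then show ?thesis using p[of "- \<alpha>"] by simp
  qed (use p in blast)
  then show "x \<in> K \<and> dominant x" using a by (auto simp: K_def dominant_def alcove_def)
qed (auto simp: K_def dominant_def alcove_def dest: Sp_S less_imp_le, use Sp_S in fastforce)

text \<open>For regular \<open>x\<close> in \<open>K\<close> exactly one Weyl image lies in the
  alcove: two of them would be related by an element fixing a strictly dominant point.\<close>

lemma integral_K_alcove:
  fixes G :: "'a \<Rightarrow> complex"
  assumes G[measurable]: "G \<in> borel_measurable borel" and B: "set_integrable lborel (alcove Sp) G"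
    and inv: "\<And>w x. w \<in> W \<Longrightarrow> G (w x) = G x"
  shows "(LINT x:K|lborel. G x) = of_nat (card W) * (LINT x:alcove Sp|lborel. G x)"
proof -
  have one: "(\<Sum>w\<in>W. indicator (alcove Sp) (w x)) = (indicator K x :: real)" if r: "regular x" for x
  proof (cases "x \<in> K")
    case True
    obtain w where w: "w \<in> W" "dominant (w x)" using ex_dominant by blast
    have "indicator (alcove Sp) (u x) = (0::real)" if u: "u \<in> W - {w}" for u
    proof (rule ccontr)
      assume "\<not> ?thesis"
      then have d: "dominant (u x)" using alcove_K regular_weyl[OF r, of u] u by (auto simp: indicator_def split: if_splits)
      have uw: "u \<circ> inv w \<in> W" using u w weyl_comp weyl_inv by auto
      have "(u \<circ> inv w) (w x) = w x" using dominant_unique[OF uw w(2)] d w(1) by simp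
      moreover have "0 < \<alpha> \<bullet> w x" if "\<alpha> \<in> Sp" for \<alpha>
        using w(2) that regular_weyl[OF r w(1)] Sp_S by (force simp: dominant_def regular_def less_le)
      ultimately have "u \<circ> inv w = id" using weyl_fixes_regular[OF uw] by blast
      then have "u = w" using w(1) by (metis comp_assoc comp_id id_comp weyl_bij bij_is_inj inv_o_cancel)
      then show False using u by simp
    qed
    moreover have "w x \<in> alcove Sp" using alcove_K[OF regular_weyl[OF r w(1)]] w True weyl_K by blast
    ultimately show ?thesis using True w(1) by (simp add: sum.remove[OF finite_W])
  next
    case False
    then have "w x \<notin> alcove Sp" if "w \<in> W" for w
      using alcove_K[OF regular_weyl[OF r that]] weyl_K that by blast
    then show ?thesis using False by (simp add: indicator_def)
  qed
  have int: "integrable lborel (\<lambda>x. indicator (alcove Sp) (w x) *\<^sub>R G (w x))" if "w \<in> W" for w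
  proof -
    have [measurable]: "w \<in> borel_measurable borel" by (rule weyl_measurable[OF that])
    have "integrable lborel (\<lambda>x. indicator (alcove Sp) x *\<^sub>R G x)"
      using B by (simp add: set_integrable_def)
    then have "integrable (distr lborel borel w) (\<lambda>x. indicator (alcove Sp) x *\<^sub>R G x)"
      using lborel_distr_isometry[of w] that by (simp add: weyl_linear weyl_inner weyl_bij)
    then show ?thesis by (subst (asm) integrable_distr_eq) auto
  qed
  have wm: "w \<in> W \<Longrightarrow> (\<lambda>x. indicator (alcove Sp) (w x) *\<^sub>R G (w x)) \<in> borel_measurable borel" for w
    using int borel_measurable_integrable by fastforce
  have "(LINT x:K|lborel. G x) = (LINT x|lborel. (\<Sum>w\<in>W. indicator (alcove Sp) (w x) *\<^sub>R G (w x)))"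
    unfolding set_lebesgue_integral_def
  proof (rule integral_cong_AE)
    show "AE x in lborel. indicator K x *\<^sub>R G x = (\<Sum>w\<in>W. indicator (alcove Sp) (w x) *\<^sub>R G (w x))"
      using AE_regular
      by (rule AE_mp) (intro AE_I2 impI, simp add: inv one[symmetric] scaleR_sum_left)
    show "(\<lambda>x. \<Sum>w\<in>W. indicator (alcove Sp) (w x) *\<^sub>R G (w x)) \<in> borel_measurable lborel"
      by (rule borel_measurable_sum) (use wm in auto)
  qed auto
  also have "\<dots> = (\<Sum>w\<in>W. LINT x|lborel. indicator (alcove Sp) (w x) *\<^sub>R G (w x))"
    by (rule Bochner_Integration.integral_sum) (rule int)
  also have "\<dots> = (\<Sum>w\<in>W. LINT x|lborel. indicator (alcove Sp) x *\<^sub>R G x)"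
    by (intro sum.cong refl integral_weyl[where f = "\<lambda>x. indicator (alcove Sp) x *\<^sub>R G x"]) auto
  finally show ?thesis by (simp add: set_lebesgue_integral_def)
qed

end

section \<open>Signed integer sums\<close>

text \<open>Oriented sum over the half-open interval from \<open>a\<close> to \<open>b\<close>, in
  analogy with an oriented integral. Concatenation and shifts then hold for all integer bounds, so
  root strings of either sign obey the same algebra.\<close>

definition ssum :: "(int \<Rightarrow> 'b::ab_group_add) \<Rightarrow> int \<Rightarrow> int \<Rightarrow> 'b" where
  "ssum f a b = (if a \<le> b then sum f {a..<b} else - sum f {b..<a})"

lemma ssum_Suc: "ssum f a (b + 1) = ssum f a b + f b"
proof -
  consider "a \<le> b" | "b + 1 \<le> a" by linarith
  then show ?thesis
  proof cases
    case 1
    then have "{a..<b+1} = insert b {a..<b}" by auto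
    then show ?thesis using 1 by (simp add: ssum_def)
  next
    case 2
    then have "{b..<a} = insert b {b+1..<a}" by auto
    then show ?thesis using 2 by (auto simp: ssum_def)
  qed
qed

text \<open>Discrete fundamental theorem of calculus; the shift, reflection and telescoping laws are
  instances of it.\<close>

lemma ssum_unique:
  assumes "\<And>b. g (b + 1) = g b + f b"
  shows "ssum f a b = g b - g a"
proof (induction b rule: int_induct[where k = a])
  case base
  then show ?case by (simp add: ssum_def)
next
  case (step1 i)
  then show ?case by (simp add: ssum_Suc assms)
next
  case (step2 i)
  then show ?case using ssum_Suc[of f a "i - 1"] assms[of "i - 1"] by (simp add: algebra_simps)
qed

lemma ssum_from_0: "ssum f a b = ssum f 0 b - ssum f 0 a"
  by (rule ssum_unique) (rule ssum_Suc)

lemma ssum_add: "ssum f a b + ssum f b c = ssum f a c"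
  unfolding ssum_from_0[of f a b] ssum_from_0[of f b c] ssum_from_0[of f a c] by simp

lemma ssum_shift: "ssum (\<lambda>j. f (j + d)) a b = ssum f (a + d) (b + d)"
proof -
  have "ssum (\<lambda>j. f (j + d)) a b = ssum f 0 (b + d) - ssum f 0 (a + d)"
    by (rule ssum_unique) (metis add.commute add.left_commute ssum_Suc)
  then show ?thesis using ssum_from_0[of f "a + d" "b + d"] by simp
qed

text \<open>Reflection exchanges the closed and the open end of the interval, hence the 1 added to
  both bounds.\<close>

lemma ssum_reflect: "ssum (\<lambda>j. f (c - j)) a b = ssum f (c - b + 1) (c - a + 1)"
proof -
  have "ssum (\<lambda>j. f (c - j)) a b = (- ssum f 0 (c - b + 1)) - (- ssum f 0 (c - a + 1))"
    by (rule ssum_unique[where g = "\<lambda>b. - ssum f 0 (c - b + 1)"]) (simp add: ssum_Suc)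
  then show ?thesis using ssum_from_0[of f "c - b + 1" "c - a + 1"] by simp
qed

lemma ssum_telescope: "ssum (\<lambda>j. g j - g (j + 1)) a b = g a - g b"
  using ssum_unique[of "\<lambda>b. - g b" "\<lambda>j. g j - g (j + 1)" a b] by simp

lemma ssum_hom:
  assumes "\<And>x y. h (x + y) = h x + h y"
  shows "h (ssum f a b) = ssum (\<lambda>j. h (f j)) a b"
proof -
  have "h 0 = 0" using assms[of 0 0] by simp
  then have "ssum (\<lambda>j. h (f j)) a b = h (ssum f a b) - h (ssum f a a)"
    by (intro ssum_unique) (simp add: ssum_Suc assms)
  then show ?thesis using \<open>h 0 = 0\<close> by (simp add: ssum_def)
qed

lemma ssum_cmult: "c * ssum f a b = ssum (\<lambda>j. c * f j :: 'b::ring) a b"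
  by (rule ssum_hom) (rule distrib_left)

lemma ssum_fun_add: "ssum (\<lambda>j. f j + g j) a b = ssum f a b + ssum g a b"
  by (simp add: ssum_def sum.distrib)

lemma ssum_measurable [measurable]:
  fixes f :: "int \<Rightarrow> 'b \<Rightarrow> complex"
  shows "(\<And>j. f j \<in> borel_measurable M) \<Longrightarrow> (\<lambda>x. ssum (\<lambda>j. f j x) a b) \<in> borel_measurable M"
  by (cases "a \<le> b") (auto simp: ssum_def)

lemma ssum_continuous:
  fixes f :: "int \<Rightarrow> 'b::topological_space \<Rightarrow> complex"
  shows "(\<And>j. continuous_on A (f j)) \<Longrightarrow> continuous_on A (\<lambda>x. ssum (\<lambda>j. f j x) a b)"
  by (cases "a \<le> b") (auto simp: ssum_def intro!: continuous_intros)

lemma set_integral_ssum: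
  fixes f :: "int \<Rightarrow> 'b \<Rightarrow> complex"
  assumes "\<And>j. set_integrable M A (f j)"
  shows "(LINT x:A|M. ssum (\<lambda>j. f j x) a b) = ssum (\<lambda>j. LINT x:A|M. f j x) a b"
proof -
  have "(LINT x:A|M. sum (\<lambda>j. f j x) J) = sum (\<lambda>j. LINT x:A|M. f j x) J" for J
    unfolding set_lebesgue_integral_def scaleR_sum_right
    by (rule Bochner_Integration.integral_sum) (use assms in \<open>simp add: set_integrable_def\<close>)
  moreover have "(LINT x:A|M. - g x) = - (LINT x:A|M. g x)" for g :: "'b \<Rightarrow> complex"
    by (simp add: set_lebesgue_integral_def)
  ultimately show ?thesis by (simp add: ssum_def)
qed

section \<open>Characters and the weight function\<close>

definition chr :: "'a::euclidean_space \<Rightarrow> 'a \<Rightarrow> complex" where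
  "chr \<nu> x = cis (\<nu> \<bullet> x)"

lemma orbit_sum_chr: "orbit_sum S l x = (\<Sum>\<mu>\<in>(\<lambda>w. w l) ` weyl_group S. chr \<mu> x)"
  by (simp add: orbit_sum_def chr_def cis_conv_exp)

lemma norm_chr [simp]: "norm (chr \<nu> x) = 1" by (simp add: chr_def)

lemma chr_0 [simp]: "chr 0 x = 1" "chr \<nu> 0 = 1" by (simp_all add: chr_def)

lemma chr_add: "chr (\<nu> + \<kappa>) x = chr \<nu> x * chr \<kappa> x" "chr \<nu> (x + y) = chr \<nu> x * chr \<nu> y"
  by (simp_all add: chr_def inner_add_left inner_add_right cis_mult)

lemma cnj_chr: "cnj (chr \<nu> x) = chr (- \<nu>) x" and chr_minus: "chr \<nu> (- x) = cnj (chr \<nu> x)"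
  by (simp_all add: chr_def cis_cnj)

lemma chr_mult_cnj: "chr \<nu> x * cnj (chr \<kappa> x) = chr (\<nu> - \<kappa>) x"
  by (simp add: cnj_chr chr_add(1)[symmetric])

lemma continuous_chr: "continuous_on A (chr \<nu>)" unfolding chr_def by (intro continuous_intros)

lemma chr_measurable [measurable]: "chr \<nu> \<in> borel_measurable borel"
  by (intro borel_measurable_continuous_onI continuous_chr)

lemma chr_has_vector_derivative:
  "((\<lambda>s. chr \<nu> (x + s *\<^sub>R v)) has_vector_derivative (\<i> * of_real (\<nu> \<bullet> v) * chr \<nu> (x + s *\<^sub>R v))) (at s within A)"
proof -
  have "((\<lambda>s. cis (\<nu> \<bullet> x + s * (\<nu> \<bullet> v))) has_vector_derivative ((\<nu> \<bullet> v) *\<^sub>R (\<i> * cis (\<nu> \<bullet> x + s * (\<nu> \<bullet> v))))) (at s within A)"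
    unfolding has_vector_derivative_complex_iff
    by (auto intro!: derivative_eq_intros)
  then show ?thesis by (simp add: chr_def inner_add_right scaleR_conv_of_real mult_ac)
qed

lemma has_vector_derivative_quotient:
  fixes f :: "real \<Rightarrow> complex"
  assumes "(f has_vector_derivative D) (at 0)"
  shows "((\<lambda>h. (f h - f 0) /\<^sub>R h) \<longlongrightarrow> D) (at 0)"
proof -
  have "((\<lambda>h. norm (f h - f 0 - h *\<^sub>R D) / norm h) \<longlongrightarrow> 0) (at 0)"
    using assms by (simp add: has_vector_derivative_def has_derivative_at)
  then have "((\<lambda>h. norm ((f h - f 0) /\<^sub>R h - D)) \<longlongrightarrow> 0) (at 0)"
  proof (rule Lim_transform_eventually)
    show "\<forall>\<^sub>F h in at 0. norm (f h - f 0 - h *\<^sub>R D) / norm h = norm ((f h - f 0) /\<^sub>R h - D)"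
    proof (rule eventually_mono[OF eventually_at_ball'[OF zero_less_one]])
      fix h :: real assume "h \<in> ball 0 1 \<and> h \<noteq> 0 \<and> h \<in> UNIV"
      then have "(f h - f 0) /\<^sub>R h - D = (f h - f 0 - h *\<^sub>R D) /\<^sub>R h"
        by (simp add: scaleR_diff_right)
      then show "norm (f h - f 0 - h *\<^sub>R D) / norm h = norm ((f h - f 0) /\<^sub>R h - D)"
        by (simp add: divide_inverse mult.commute)
    qed
  qed
  then show ?thesis by (simp add: tendsto_norm_zero_iff LIM_zero_iff)
qed

context root_data
begin

text \<open>The full weight lattice. In the normalisation of \<open>dominant_weights\<close>,
  weights pair with coroots to even integers, so their characters are periodic under \<pi>
  \<open>Q\<close>.\<close>

definition Lam :: "'a set" where "Lam = {l. \<forall>\<alpha>\<in>S. (l \<bullet> \<alpha>) / (\<alpha> \<bullet> \<alpha>) \<in> \<int>}"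

text \<open>The floor only produces an integer type; it is exact on \<open>Lam\<close>.\<close>

definition lev :: "'a \<Rightarrow> 'a \<Rightarrow> int" where "lev \<nu> \<alpha> = \<lfloor>(\<nu> \<bullet> \<alpha>) / (\<alpha> \<bullet> \<alpha>)\<rfloor>"

lemma lev: assumes "\<nu> \<in> Lam" "\<alpha> \<in> S" shows "\<nu> \<bullet> \<alpha> = of_int (lev \<nu> \<alpha>) * (\<alpha> \<bullet> \<alpha>)"
proof -
  obtain k where "(\<nu> \<bullet> \<alpha>) / (\<alpha> \<bullet> \<alpha>) = of_int k" using assms by (auto simp: Lam_def elim: Ints_cases)
  then show ?thesis using S_nz[OF assms(2)] by (simp add: lev_def field_simps)
qed

lemma lev_unique: assumes "\<alpha> \<in> S" "\<nu> \<bullet> \<alpha> = of_int k * (\<alpha> \<bullet> \<alpha>)" shows "lev \<nu> \<alpha> = k"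
  using assms S_nz[OF assms(1)] by (simp add: lev_def)

lemma LamI: assumes "\<And>\<alpha>. \<alpha> \<in> S \<Longrightarrow> \<exists>k::int. \<nu> \<bullet> \<alpha> = of_int k * (\<alpha> \<bullet> \<alpha>)" shows "\<nu> \<in> Lam"
  unfolding Lam_def
proof safe
  fix \<alpha> assume a: "\<alpha> \<in> S"
  then obtain k where "\<nu> \<bullet> \<alpha> = of_int k * (\<alpha> \<bullet> \<alpha>)" using assms by blast
  then have "(\<nu> \<bullet> \<alpha>) / (\<alpha> \<bullet> \<alpha>) = of_int k" using S_nz[OF a] by simp
  then show "(\<nu> \<bullet> \<alpha>) / (\<alpha> \<bullet> \<alpha>) \<in> \<int>" by simp
qed

lemma Lam_0: "0 \<in> Lam" by (simp add: Lam_def)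

lemma Lam_add: "\<nu> \<in> Lam \<Longrightarrow> \<kappa> \<in> Lam \<Longrightarrow> \<nu> + \<kappa> \<in> Lam"
  and Lam_diff: "\<nu> \<in> Lam \<Longrightarrow> \<kappa> \<in> Lam \<Longrightarrow> \<nu> - \<kappa> \<in> Lam"
  and Lam_uminus: "\<nu> \<in> Lam \<Longrightarrow> - \<nu> \<in> Lam"
  by (auto simp: Lam_def inner_add_left inner_diff_left add_divide_distrib diff_divide_distrib)

lemma lev_diff: "\<nu> \<in> Lam \<Longrightarrow> \<kappa> \<in> Lam \<Longrightarrow> \<alpha> \<in> S \<Longrightarrow> lev (\<nu> - \<kappa>) \<alpha> = lev \<nu> \<alpha> - lev \<kappa> \<alpha>"
  by (rule lev_unique) (simp_all add: inner_diff_left lev algebra_simps)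

lemma Lam_root: assumes "\<alpha> \<in> S" shows "(2 * of_int j) *\<^sub>R \<alpha> \<in> Lam"
proof (rule LamI)
  fix \<beta> assume b: "\<beta> \<in> S"
  obtain k where k: "\<alpha> \<bullet> coroot \<beta> = of_int k" using int_S[OF b assms] Ints_cases by metis
  have "2 * (\<alpha> \<bullet> \<beta>) = (\<alpha> \<bullet> coroot \<beta>) * (\<beta> \<bullet> \<beta>)" using S_nz[OF b] by (simp add: coroot_def)
  then have "(2 * of_int j) *\<^sub>R \<alpha> \<bullet> \<beta> = of_int (j * k) * (\<beta> \<bullet> \<beta>)" by (simp add: k)
  then show "\<exists>k. (2 * of_int j) *\<^sub>R \<alpha> \<bullet> \<beta> = of_int k * (\<beta> \<bullet> \<beta>)" by blast
qed

lemma Lam_string: "\<nu> \<in> Lam \<Longrightarrow> \<alpha> \<in> S \<Longrightarrow> \<nu> - (2 * of_int j) *\<^sub>R \<alpha> \<in> Lam"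
  using Lam_diff Lam_root by blast

lemma refl_string: "\<nu> \<in> Lam \<Longrightarrow> \<alpha> \<in> S \<Longrightarrow> refl_root \<alpha> \<nu> = \<nu> - (2 * of_int (lev \<nu> \<alpha>)) *\<^sub>R \<alpha>"
  using S_nz by (simp add: refl_root_def lev)

lemma Lam_weyl: assumes "\<nu> \<in> Lam" "w \<in> W" shows "w \<nu> \<in> Lam"
proof (rule LamI)
  fix \<alpha> assume "\<alpha> \<in> S"
  then have "inv w \<alpha> \<in> S" using weyl_S weyl_inv assms by blast
  then show "\<exists>k. w \<nu> \<bullet> \<alpha> = of_int k * (\<alpha> \<bullet> \<alpha>)"
    using lev[OF assms(1)] weyl_inner_inv[OF assms(2)] weyl_inner[OF weyl_inv[OF assms(2)]] by metis
qed

lemma chr_weyl: "w \<in> W \<Longrightarrow> chr \<nu> (w x) = chr (inv w \<nu>) x"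
  unfolding chr_def by (metis inner_commute weyl_inner_inv)

lemma chr_refl: "chr \<nu> (refl_root \<alpha> x) = chr (refl_root \<alpha> \<nu>) x"
  by (simp add: chr_def refl_root_inner_commute)

lemma chr_periodic: assumes "\<nu> \<in> Lam" "v \<in> Q" shows "chr \<nu> (x + pi *\<^sub>R v) = chr \<nu> x"
proof -
  have "\<exists>k::int. \<nu> \<bullet> v = 2 * of_int k"
  proof -
    obtain as where "set as \<subseteq> S" "v = sum_list (map coroot as)" using assms by (auto simp: Q_def)
    then show ?thesis
    proof (induction as arbitrary: v)
      case Nil
      then show ?case by (auto intro: exI[of _ 0])
    next
      case (Cons a as)
      then obtain k where k: "\<nu> \<bullet> sum_list (map coroot as) = 2 * of_int k" by auto
      have "\<nu> \<bullet> coroot a = 2 * of_int (lev \<nu> a)"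
        using Cons lev[OF assms(1), of a] S_nz[of a] by (simp add: coroot_def)
      then show ?case using k Cons by (intro exI[of _ "k + lev \<nu> a"]) (auto simp: inner_add_right)
    qed
  qed
  then obtain k :: int where "\<nu> \<bullet> v = 2 * of_int k" by blast
  then have "chr \<nu> (pi *\<^sub>R v) = cis (2 * pi * of_int k)" by (simp add: chr_def mult_ac)
  also have "\<dots> = 1" by (rule cis_multiple_2pi) simp
  finally show ?thesis by (simp add: chr_add)
qed

abbreviation str :: "'a \<Rightarrow> 'a \<Rightarrow> int \<Rightarrow> 'a" where
  "str \<nu> \<alpha> j \<equiv> \<nu> - (2 * of_int j) *\<^sub>R \<alpha>"

text \<open>The quotient of \<open>chr \<nu> - chr (refl_root \<alpha> \<nu>)\<close> by
  \<open>chr (2 \<alpha>) - 1\<close>. For negative \<open>lev \<nu> \<alpha>\<close> the signed sum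
  yields minus the string from \<open>lev \<nu> \<alpha> + 1\<close> to 0.\<close>

definition Cs :: "'a \<Rightarrow> 'a \<Rightarrow> 'a \<Rightarrow> complex" where
  "Cs \<alpha> \<nu> x = ssum (\<lambda>j. chr (str \<nu> \<alpha> j) x) 1 (lev \<nu> \<alpha> + 1)"

lemma continuous_Cs: "continuous_on A (Cs \<alpha> \<nu>)"
  unfolding Cs_def by (intro ssum_continuous continuous_chr)

lemma Cs_measurable [measurable]: "Cs \<alpha> \<nu> \<in> borel_measurable borel"
  by (intro borel_measurable_continuous_onI continuous_Cs)

text \<open>Cotangent times the antisymmetric difference of characters, cleared of its denominator.
  A single string step satisfies \<open>tele\<close>, and summation telescopes the left
  side.\<close>

lemma Cs_identity:
  assumes "\<nu> \<in> Lam" "\<alpha> \<in> S"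
  shows "of_real (cos (\<alpha> \<bullet> x)) * (chr \<nu> x - chr (refl_root \<alpha> \<nu>) x)
    = \<i> * of_real (sin (\<alpha> \<bullet> x)) * (2 * Cs \<alpha> \<nu> x + chr \<nu> x - chr (refl_root \<alpha> \<nu>) x)"
proof -
  define a where "a = \<alpha> \<bullet> x"
  define z where "z j = chr (str \<nu> \<alpha> j) x" for j
  have zz: "z j = cis (2 * a) * z (j + 1)" for j
    by (simp add: z_def chr_def cis_mult inner_diff_left a_def algebra_simps)
  have tele: "of_real (cos a) * (z j - z (j + 1)) = \<i> * of_real (sin a) * (z j + z (j + 1))" for j
  proof -
    have "cis (2 * a) - 1 = 2 * \<i> * of_real (sin a) * cis a"
      by (simp add: complex_eq_iff sin_double cos_double_sin power2_eq_square)
    moreover have "cis (2 * a) + 1 = 2 * of_real (cos a) * cis a"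
      by (simp add: complex_eq_iff sin_double cos_double_cos power2_eq_square)
    moreover have "z j - z (j + 1) = (cis (2 * a) - 1) * z (j + 1)" "z j + z (j + 1) = (cis (2 * a) + 1) * z (j + 1)"
      by (simp_all add: zz[of j] algebra_simps)
    ultimately show ?thesis by simp
  qed
  have "of_real (cos a) * (z 0 - z (lev \<nu> \<alpha>)) = of_real (cos a) * ssum (\<lambda>j. z j - z (j + 1)) 0 (lev \<nu> \<alpha>)"
    by (simp add: ssum_telescope)
  also have "\<dots> = ssum (\<lambda>j. \<i> * of_real (sin a) * (z j + z (j + 1))) 0 (lev \<nu> \<alpha>)"
    by (simp add: ssum_cmult tele)
  also have "\<dots> = \<i> * of_real (sin a) * (ssum z 0 (lev \<nu> \<alpha>) + ssum z 1 (lev \<nu> \<alpha> + 1))"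
    using ssum_shift[of z 1 0 "lev \<nu> \<alpha>"] by (simp add: ssum_cmult[symmetric] ssum_fun_add)
  also have "ssum z 0 (lev \<nu> \<alpha>) = ssum z 1 (lev \<nu> \<alpha> + 1) + z 0 - z (lev \<nu> \<alpha>)"
    using ssum_add[of z 0 1 "lev \<nu> \<alpha> + 1"] ssum_Suc[of z 0 "lev \<nu> \<alpha>"] ssum_Suc[of z 0 0]
    by (simp add: ssum_def[of z 0 0] algebra_simps)
  also have "ssum z 1 (lev \<nu> \<alpha> + 1) = Cs \<alpha> \<nu> x" by (simp add: Cs_def z_def[abs_def])
  also have "z 0 = chr \<nu> x" by (simp add: z_def)
  also have "z (lev \<nu> \<alpha>) = chr (refl_root \<alpha> \<nu>) x" by (simp add: z_def refl_string[OF assms])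
  finally show ?thesis by (simp add: a_def algebra_simps)
qed

abbreviation "wt \<equiv> weight_fn Sp m"

lemma wt_eq: "wt x = (\<Prod>\<alpha>\<in>Sp. pow0 (2 * \<bar>sin (\<alpha> \<bullet> x)\<bar>) (m \<alpha>))"
proof -
  have "norm (exp (\<i> * complex_of_real t) - exp (- \<i> * complex_of_real t)) = 2 * \<bar>sin t\<bar>" for t
  proof -
    have "exp (\<i> * complex_of_real t) - exp (- \<i> * complex_of_real t) = cis t - cis (- t)"
      by (simp add: cis_conv_exp)
    also have "\<dots> = Complex 0 (2 * sin t)" by (simp add: complex_eq_iff)
    finally show ?thesis by (simp add: complex_norm real_sqrt_mult)
  qed
  then show ?thesis by (simp add: weight_fn_def)
qed

lemma wt_nonneg: "wt x \<ge> 0" unfolding wt_eq by (intro prod_nonneg) (simp add: pow0_def)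

lemma wt_pos: "regular x \<Longrightarrow> wt x > 0"
  unfolding wt_eq by (intro prod_pos) (auto simp: pow0_def regular_def Sp_S)

lemma continuous_wt: "continuous_on A wt"
  unfolding wt_eq[abs_def]
proof (rule continuous_on_prod)
  fix \<alpha> assume "\<alpha> \<in> Sp"
  then have "m \<alpha> \<ge> 0" using m_nonneg Sp_S by auto
  then show "continuous_on A (\<lambda>x. pow0 (2 * \<bar>sin (\<alpha> \<bullet> x)\<bar>) (m \<alpha>))"
    by (cases "m \<alpha> = 0") (auto simp: pow0_def intro!: continuous_intros continuous_on_powr')
qed

lemma wt_measurable [measurable]: "wt \<in> borel_measurable borel"
  by (intro borel_measurable_continuous_onI continuous_wt)

lemma inner_weyl_right: "w \<in> W \<Longrightarrow> \<alpha> \<bullet> w x = inv w \<alpha> \<bullet> x"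
  by (metis inner_commute weyl_inner_inv)

lemma wt_weyl: assumes "w \<in> W" shows "wt (w x) = wt x"
proof -
  have "wt (w x) = (\<Prod>\<alpha>\<in>Sp. (\<lambda>\<alpha>. pow0 (2 * \<bar>sin (\<alpha> \<bullet> x)\<bar>) (m \<alpha>)) (inv w \<alpha>))"
    unfolding wt_eq using m_invar weyl_inv[OF assms] Sp_S
    by (intro prod.cong) (auto simp: inner_weyl_right assms)
  also have "\<dots> = wt x" unfolding wt_eq
    by (rule prod_Sp_weyl[OF weyl_inv[OF assms]]) (simp add: m_uminus)
  finally show ?thesis .
qed

subsection \<open>A regularised weight\<close>

text \<open>Replaces \<open>2 |sin|\<close> by the square root of
  \<open>4 sin^2 + \<epsilon>\<close>, which is smooth and positive. For small positive
  multiplicities \<open>wt\<close> itself is not differentiable on the walls, so integration by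
  parts is done here first.\<close>

definition weps :: "real \<Rightarrow> 'a \<Rightarrow> real" where
  "weps \<epsilon> x = exp (\<Sum>\<alpha>\<in>Sp. m \<alpha> / 2 * ln (4 * (sin (\<alpha> \<bullet> x))\<^sup>2 + \<epsilon>))"

text \<open>The contribution of \<alpha> to the logarithmic derivative of \<open>weps\<close>; it
  tends to the cotangent as \<epsilon> tends to 0.\<close>

definition ceps :: "real \<Rightarrow> 'a \<Rightarrow> 'a \<Rightarrow> real" where
  "ceps \<epsilon> \<alpha> x = 4 * sin (\<alpha> \<bullet> x) * cos (\<alpha> \<bullet> x) / (4 * (sin (\<alpha> \<bullet> x))\<^sup>2 + \<epsilon>)"

lemma continuous_weps: "\<epsilon> > 0 \<Longrightarrow> continuous_on A (weps \<epsilon>)"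
  unfolding weps_def
  by (intro continuous_intros) (auto simp: add_nonneg_pos intro!: less_imp_neq[symmetric] add_nonneg_pos)

lemma weps_measurable [measurable]: "\<epsilon> > 0 \<Longrightarrow> weps \<epsilon> \<in> borel_measurable borel"
  by (intro borel_measurable_continuous_onI continuous_weps)

lemma ceps_measurable [measurable]: "ceps \<epsilon> \<alpha> \<in> borel_measurable borel"
  unfolding ceps_def by measurable

text \<open>The number 5 bounds \<open>4 sin^2 + \<epsilon>\<close>. The bound is uniform in
  \<epsilon> and supplies the dominating constant for the limit.\<close>

lemma weps_le: assumes "0 < \<epsilon>" "\<epsilon> \<le> 1" shows "weps \<epsilon> x \<le> exp (\<Sum>\<alpha>\<in>Sp. m \<alpha> / 2 * ln 5)"
  unfolding weps_def
proof (subst exp_le_cancel_iff, intro sum_mono mult_left_mono)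
  fix \<alpha> assume "\<alpha> \<in> Sp"
  show "0 \<le> m \<alpha> / 2" using m_nonneg Sp_S[OF \<open>\<alpha> \<in> Sp\<close>] by simp
  have "(sin (\<alpha> \<bullet> x))\<^sup>2 \<le> 1" by (simp add: abs_square_le_1)
  then show "ln (4 * (sin (\<alpha> \<bullet> x))\<^sup>2 + \<epsilon>) \<le> ln 5"
    using assms by (subst ln_le_cancel_iff) (auto intro: add_nonneg_pos)
qed

lemma weps_nonneg: "weps \<epsilon> x \<ge> 0" by (simp add: weps_def)

lemma weps_weyl: assumes "w \<in> W" shows "weps \<epsilon> (w x) = weps \<epsilon> x"
proof -
  have "(\<Sum>\<alpha>\<in>Sp. m \<alpha> / 2 * ln (4 * (sin (\<alpha> \<bullet> w x))\<^sup>2 + \<epsilon>))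
     = (\<Sum>\<alpha>\<in>Sp. (\<lambda>\<alpha>. m \<alpha> / 2 * ln (4 * (sin (\<alpha> \<bullet> x))\<^sup>2 + \<epsilon>)) (inv w \<alpha>))"
    using m_invar weyl_inv[OF assms] Sp_S
    by (intro sum.cong) (auto simp: inner_weyl_right assms)
  also have "\<dots> = (\<Sum>\<alpha>\<in>Sp. m \<alpha> / 2 * ln (4 * (sin (\<alpha> \<bullet> x))\<^sup>2 + \<epsilon>))"
    by (rule sum_Sp_weyl[OF weyl_inv[OF assms]]) (simp add: m_uminus)
  finally show ?thesis by (simp add: weps_def)
qed

lemma weps_periodic: assumes "v \<in> Q" shows "weps \<epsilon> (x + pi *\<^sub>R v) = weps \<epsilon> x"
proof -
  have "(sin (\<alpha> \<bullet> (x + pi *\<^sub>R v)))\<^sup>2 = (sin (\<alpha> \<bullet> x))\<^sup>2" if "\<alpha> \<in> Sp" for \<alpha>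
  proof -
    have "\<alpha> \<bullet> v \<in> \<int>" using Q_int[OF assms Sp_S[OF that]] .
    then obtain k where k: "\<alpha> \<bullet> v = of_int k" using Ints_cases by metis
    have "sin (pi * of_int k) = 0" by (simp add: sin_zero_iff_int2 mult.commute)
    moreover have "(cos (pi * of_int k))\<^sup>2 = 1" using sin_cos_squared_add[of "pi * of_int k"] calculation by simp
    ultimately show ?thesis by (simp add: inner_add_right k sin_add power_mult_distrib)
  qed
  then show ?thesis by (simp add: weps_def)
qed

lemma weps_tendsto:
  assumes "regular x" "\<epsilon> \<longlonglongrightarrow> 0"
  shows "(\<lambda>n. weps (\<epsilon> n) x) \<longlonglongrightarrow> wt x"
proof -
  have nz: "sin (\<alpha> \<bullet> x) \<noteq> 0" if "\<alpha> \<in> Sp" for \<alpha> using assms that Sp_S by (auto simp: regular_def)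
  have "wt x = exp (\<Sum>\<alpha>\<in>Sp. m \<alpha> / 2 * ln (4 * (sin (\<alpha> \<bullet> x))\<^sup>2 + 0))"
    unfolding wt_eq exp_sum[OF finite_Sp]
  proof (rule prod.cong[OF refl])
    fix \<alpha> assume a: "\<alpha> \<in> Sp"
    have "ln (4 * (sin (\<alpha> \<bullet> x))\<^sup>2) = ln ((2 * \<bar>sin (\<alpha> \<bullet> x)\<bar>)\<^sup>2)" by (simp add: power_mult_distrib)
    also have "\<dots> = 2 * ln (2 * \<bar>sin (\<alpha> \<bullet> x)\<bar>)" using nz[OF a] by (subst ln_realpow) auto
    finally show "pow0 (2 * \<bar>sin (\<alpha> \<bullet> x)\<bar>) (m \<alpha>) = exp (m \<alpha> / 2 * ln (4 * (sin (\<alpha> \<bullet> x))\<^sup>2 + 0))"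
      using nz[OF a] by (simp add: pow0_def powr_def)
  qed
  moreover have "(\<lambda>n. weps (\<epsilon> n) x) \<longlonglongrightarrow> exp (\<Sum>\<alpha>\<in>Sp. m \<alpha> / 2 * ln (4 * (sin (\<alpha> \<bullet> x))\<^sup>2 + 0))"
    unfolding weps_def using nz by (intro tendsto_intros assms) auto
  ultimately show ?thesis by simp
qed

lemma weps_derivative:
  assumes "\<epsilon> > 0"
  shows "((\<lambda>s. weps \<epsilon> (x + s *\<^sub>R v)) has_real_derivative
    (weps \<epsilon> (x + s *\<^sub>R v) * (\<Sum>\<alpha>\<in>Sp. m \<alpha> * (\<alpha> \<bullet> v) * ceps \<epsilon> \<alpha> (x + s *\<^sub>R v)))) (at s)"
proof -
  have p: "4 * (sin t)\<^sup>2 + \<epsilon> > 0" for t using assms by (intro add_nonneg_pos) auto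
  have "((\<lambda>s. \<Sum>\<alpha>\<in>Sp. m \<alpha> / 2 * ln (4 * (sin (\<alpha> \<bullet> x + s * (\<alpha> \<bullet> v)))\<^sup>2 + \<epsilon>)) has_real_derivative
     (\<Sum>\<alpha>\<in>Sp. m \<alpha> / 2 * ((8 * sin (\<alpha> \<bullet> x + s * (\<alpha> \<bullet> v)) * (cos (\<alpha> \<bullet> x + s * (\<alpha> \<bullet> v)) * (\<alpha> \<bullet> v)))
        / (4 * (sin (\<alpha> \<bullet> x + s * (\<alpha> \<bullet> v)))\<^sup>2 + \<epsilon>)))) (at s)"
  proof (rule DERIV_sum, rule DERIV_cmult)
    fix \<alpha> assume "\<alpha> \<in> Sp"
    show "((\<lambda>s. ln (4 * (sin (\<alpha> \<bullet> x + s * (\<alpha> \<bullet> v)))\<^sup>2 + \<epsilon>)) has_real_derivative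
      (8 * sin (\<alpha> \<bullet> x + s * (\<alpha> \<bullet> v)) * (cos (\<alpha> \<bullet> x + s * (\<alpha> \<bullet> v)) * (\<alpha> \<bullet> v)))
        / (4 * (sin (\<alpha> \<bullet> x + s * (\<alpha> \<bullet> v)))\<^sup>2 + \<epsilon>)) (at s)"
      by (rule derivative_eq_intros refl | use p in force)+
  qed
  from DERIV_fun_exp[OF this] show ?thesis
    by (simp add: weps_def ceps_def inner_add_right algebra_simps cong: sum.cong)
qed

text \<open>The difference quotients integrate to zero by translation invariance, are bounded by
  \<open>B\<close> through the mean value inequality, and converge to \<open>G\<close>.\<close>

lemma integral_K_derivative:
  fixes F G :: "'a \<Rightarrow> complex"
  assumes F: "F \<in> borel_measurable borel" "\<And>x. norm (F x) \<le> A"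
    and per: "\<And>x v. v \<in> Q \<Longrightarrow> F (x + pi *\<^sub>R v) = F x"
    and d: "\<And>x s. ((\<lambda>s. F (x + s *\<^sub>R v)) has_vector_derivative G (x + s *\<^sub>R v)) (at s)"
    and G: "G \<in> borel_measurable borel" "\<And>x. norm (G x) \<le> B"
  shows "(LINT x:K|lborel. G x) = 0"
proof -
  note [measurable] = F(1) G(1)
  define t where "t n = 1 / real (Suc n)" for n
  have tpos: "t n > 0" for n by (simp add: t_def)
  define f where "f n x = (F (x + t n *\<^sub>R v) - F x) /\<^sub>R t n" for n x
  have fm [measurable]: "f n \<in> borel_measurable borel" for n unfolding f_def by measurable
  have bound: "norm (f n x) \<le> B" for n x
  proof -
    have "norm (F (x + t n *\<^sub>R v) - F (x + 0 *\<^sub>R v)) \<le> B * norm (t n - 0)"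
      by (rule differentiable_bound[of UNIV "\<lambda>s. F (x + s *\<^sub>R v)" "\<lambda>s h. h *\<^sub>R G (x + s *\<^sub>R v)"])
         (auto intro!: onorm_le mult_left_mono G simp: mult.commute[of B]
           intro: has_derivative_at_withinI d[unfolded has_vector_derivative_def])
    moreover have "norm (f n x) = norm (F (x + t n *\<^sub>R v) - F x) / t n"
      using tpos[of n] by (simp add: f_def divide_inverse mult.commute)
    ultimately show ?thesis using tpos[of n] by (simp add: pos_divide_le_eq)
  qed
  have lim: "(\<lambda>n. f n x) \<longlonglongrightarrow> G x" for x
  proof -
    have "((\<lambda>h. (F (x + h *\<^sub>R v) - F x) /\<^sub>R h) \<longlongrightarrow> G x) (at 0)"
      using has_vector_derivative_quotient[OF d[of x 0]] by simp
    moreover have "filterlim t (at 0) sequentially"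
      unfolding filterlim_at t_def using LIMSEQ_Suc[OF lim_1_over_n[where 'a = real]] by (auto simp: lim_1_over_n)
    ultimately show ?thesis unfolding f_def by (rule filterlim_compose)
  qed
  have zero: "(LINT x:K|lborel. f n x) = 0" for n
  proof -
    have i: "set_integrable lborel K (\<lambda>x. F (x + t n *\<^sub>R v))" "set_integrable lborel K F"
      by (rule set_integrable_bounded[where B = A]; use F bounded_K in auto)+
    have "(LINT x:K|lborel. f n x) = (LINT x:K|lborel. F (x + t n *\<^sub>R v) - F x) /\<^sub>R t n"
      unfolding f_def set_lebesgue_integral_def scaleR_left_commute[of _ "inverse (t n)"]
      by (rule integral_scaleR_right)
    also have "\<dots> = 0" using i by (simp add: integral_K_translate[OF F per] set_integral_diff)
    finally show ?thesis .
  qed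
  have "(\<lambda>n. LINT x|lborel. indicator K x *\<^sub>R f n x) \<longlonglongrightarrow> (LINT x|lborel. indicator K x *\<^sub>R G x)"
  proof (rule integral_dominated_convergence)
    show "integrable lborel (\<lambda>x. B * indicator K x)"
      using bounded_K emeasure_bounded_finite by (auto intro!: integrable_mult_right integrable_real_indicator)
    show "AE x in lborel. (\<lambda>n. indicator K x *\<^sub>R f n x) \<longlonglongrightarrow> indicator K x *\<^sub>R G x"
      by (intro AE_I2 tendsto_intros lim)
    show "AE x in lborel. norm (indicator K x *\<^sub>R f n x) \<le> B * indicator K x" for n
      using bound by (auto simp: indicator_def)
  qed auto
  then show ?thesis using zero by (simp add: set_lebesgue_integral_def LIMSEQ_const_iff)
qed

text \<open>Fourier coefficients of the weight on the torus; the inner product of two characters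
  depends only on their difference and is one of these.\<close>

definition I :: "'a \<Rightarrow> complex" where
  "I \<nu> = (LINT x:K|lborel. chr \<nu> x * of_real (wt x))"

end

lemma continuous_eq_0_if_AE:
  fixes f :: "'a::euclidean_space \<Rightarrow> complex"
  assumes "continuous_on UNIV f" "AE x in lborel. f x = 0"
  shows "f x = 0"
proof (rule ccontr)
  assume "f x \<noteq> 0"
  let ?U = "{x. f x \<noteq> 0}"
  have o: "open ?U" using assms(1) by (intro open_Collect_neq) auto
  obtain N where "\<And>x. x \<in> space lborel - N \<Longrightarrow> f x = 0" and N: "N \<in> null_sets lborel"
    using AE_E3[OF assms(2)] by blast
  then have "?U \<subseteq> N" by auto
  moreover have "negligible N" using N by (simp add: negligible_iff_null_sets null_sets_completionI)
  ultimately have "negligible ?U" using negligible_subset by blast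
  then show False using open_not_negligible[OF o] \<open>f x \<noteq> 0\<close> by blast
qed

context root_data
begin

lemma continuous_eq_0_if_regular:
  fixes f :: "'a \<Rightarrow> complex"
  assumes "continuous_on UNIV f" "\<And>x. regular x \<Longrightarrow> f x = 0"
  shows "f x = 0"
  using assms AE_regular by (intro continuous_eq_0_if_AE) auto

section \<open>Integration by parts on the torus\<close>

lemma set_integrable_K: "continuous_on UNIV F \<Longrightarrow> set_integrable lborel K (F :: 'a \<Rightarrow> complex)"
  by (rule set_integrable_continuous) (auto intro: bounded_K)

lemma I_weyl: assumes "w \<in> W" shows "I (w \<nu>) = I \<nu>"
proof -
  have "I (w \<nu>) = (LINT x:K|lborel. chr (w \<nu>) (w x) * of_real (wt (w x)))"
    unfolding I_def by (rule integral_K_weyl[OF assms, symmetric]) measurable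
  then show ?thesis by (simp add: wt_weyl assms chr_weyl I_def)
qed

lemma integral_Cs: "(LINT x:K|lborel. Cs \<alpha> \<nu> x * of_real (wt x)) = ssum (\<lambda>j. I (str \<nu> \<alpha> j)) 1 (lev \<nu> \<alpha> + 1)"
proof -
  have "Cs \<alpha> \<nu> x * of_real (wt x) = ssum (\<lambda>j. chr (str \<nu> \<alpha> j) x * of_real (wt x)) 1 (lev \<nu> \<alpha> + 1)" for x
    unfolding Cs_def by (rule ssum_hom[of "\<lambda>z. z * of_real (wt x)"]) (rule distrib_right)
  then show ?thesis unfolding I_def
    by (simp add: set_integral_ssum set_integrable_K continuous_intros continuous_chr continuous_wt)
qed

lemma continuous_ceps: "\<epsilon> > 0 \<Longrightarrow> continuous_on A (ceps \<epsilon> \<alpha>)"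
  unfolding ceps_def
  by (intro continuous_intros) (auto intro!: less_imp_neq[symmetric] add_nonneg_pos)

lemma ceps_bound: assumes "\<epsilon> > 0" shows "\<bar>ceps \<epsilon> \<alpha> x\<bar> \<le> 4 / \<epsilon>"
proof -
  have p: "4 * (sin (\<alpha> \<bullet> x))\<^sup>2 + \<epsilon> > 0" using assms by (intro add_nonneg_pos) auto
  have "\<bar>sin (\<alpha> \<bullet> x)\<bar> * \<bar>cos (\<alpha> \<bullet> x)\<bar> \<le> 1 * 1" by (intro mult_mono) auto
  then have "\<bar>ceps \<epsilon> \<alpha> x\<bar> \<le> 4 / (4 * (sin (\<alpha> \<bullet> x))\<^sup>2 + \<epsilon>)"
    using p unfolding ceps_def by (simp add: abs_mult divide_right_mono)
  also have "\<dots> \<le> 4 / \<epsilon>" using assms by (intro divide_left_mono) (auto intro!: mult_pos_pos add_nonneg_pos)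
  finally show ?thesis .
qed

lemma integral_K_limit:
  fixes f :: "nat \<Rightarrow> 'a \<Rightarrow> complex"
  assumes [measurable]: "\<And>n. f n \<in> borel_measurable borel" "g \<in> borel_measurable borel"
    and "\<And>x. regular x \<Longrightarrow> (\<lambda>n. f n x) \<longlonglongrightarrow> g x" and "\<And>n x. norm (f n x) \<le> B"
  shows "(\<lambda>n. LINT x:K|lborel. f n x) \<longlonglongrightarrow> (LINT x:K|lborel. g x)"
  unfolding set_lebesgue_integral_def
proof (rule integral_dominated_convergence)
  show "integrable lborel (\<lambda>x. B * indicator K x)"
    using bounded_K emeasure_bounded_finite by (auto intro!: integrable_mult_right integrable_real_indicator)
  show "AE x in lborel. (\<lambda>n. indicator K x *\<^sub>R f n x) \<longlonglongrightarrow> indicator K x *\<^sub>R g x"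
    using AE_regular by (rule AE_mp) (intro AE_I2 impI tendsto_intros assms)
  show "AE x in lborel. norm (indicator K x *\<^sub>R f n x) \<le> B * indicator K x" for n
    using assms(4) by (auto simp: indicator_def)
qed auto

text \<open>The integral of the (unshifted) Cherednik operator in direction \<open>\<xi>\<close>, applied to a character,
  against the weight vanishes: the divergence theorem for the regularised weight, symmetrised under
  each reflection so that the cotangent singularities cancel in the limit.\<close>

lemma integration_by_parts:
  assumes \<nu>: "\<nu> \<in> Lam"
  shows "of_real (\<nu> \<bullet> \<xi>) * I \<nu>
    + (\<Sum>\<alpha>\<in>Sp. of_real (m \<alpha> * (\<alpha> \<bullet> \<xi>)) * ssum (\<lambda>j. I (str \<nu> \<alpha> j)) 1 (lev \<nu> \<alpha> + 1)) = 0"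
proof -
  \<comment> \<open>\<open>U \<alpha>\<close> is half the cotangent times
    \<open>chr \<nu> - chr (refl_root \<alpha> \<nu>)\<close>, extended across the walls by
    \<open>Cs_identity\<close>.\<close>
  define U where "U \<alpha> x = \<i> / 2 * (2 * Cs \<alpha> \<nu> x + chr \<nu> x - chr (refl_root \<alpha> \<nu>) x)" for \<alpha> x
  \<comment> \<open>What remains of \<open>ceps\<close> once its cosine has been turned into a sine
    by \<open>Cs_identity\<close>: a cutoff between 0 and 1 that tends to 1 off the walls.\<close>
  define seps where "seps \<epsilon> \<alpha> x = 4 * (sin (\<alpha> \<bullet> x))\<^sup>2 / (4 * (sin (\<alpha> \<bullet> x))\<^sup>2 + \<epsilon>)" for \<epsilon> \<alpha> and x :: 'a
  define B5 where "B5 = exp (\<Sum>\<alpha>\<in>Sp. m \<alpha> / 2 * ln 5)"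
  have contU: "continuous_on A (U \<alpha>)" for A \<alpha>
    unfolding U_def by (intro continuous_intros continuous_Cs continuous_chr)
  have U_m [measurable]: "U \<alpha> \<in> borel_measurable borel" for \<alpha>
    by (intro borel_measurable_continuous_onI contU)
  have seps_m [measurable]: "seps \<epsilon> \<alpha> \<in> borel_measurable borel" for \<epsilon> \<alpha>
    unfolding seps_def by measurable
  have pos: "4 * (sin t)\<^sup>2 + \<epsilon> > 0" if "\<epsilon> > 0" for t \<epsilon> :: real using that by (intro add_nonneg_pos) auto
  have seps01: "0 \<le> seps \<epsilon> \<alpha> x" "seps \<epsilon> \<alpha> x \<le> 1" if "\<epsilon> > 0" for \<epsilon> \<alpha> x
    using that pos[OF that] by (auto simp: seps_def intro!: divide_nonneg_pos simp: pos_divide_le_eq)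
  have reg: "of_real (\<nu> \<bullet> \<xi>) * \<i> * (LINT x:K|lborel. chr \<nu> x * of_real (weps \<epsilon> x))
     + (\<Sum>\<alpha>\<in>Sp. of_real (m \<alpha> * (\<alpha> \<bullet> \<xi>)) * (LINT x:K|lborel. U \<alpha> x * of_real (seps \<epsilon> \<alpha> x * weps \<epsilon> x))) = 0"
    if \<epsilon>: "0 < \<epsilon>" "\<epsilon> \<le> 1" for \<epsilon>
  proof -
    define D where "D x = (\<Sum>\<alpha>\<in>Sp. m \<alpha> * (\<alpha> \<bullet> \<xi>) * ceps \<epsilon> \<alpha> x)" for x
    define F where "F x = chr \<nu> x * of_real (weps \<epsilon> x)" for x
    define G where "G x = (\<i> * of_real (\<nu> \<bullet> \<xi>) + of_real (D x)) * F x" for x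
    have contF: "continuous_on A F" and contD: "continuous_on A D" for A
      unfolding F_def D_def using \<epsilon>
      by (auto intro!: continuous_intros continuous_chr continuous_weps continuous_ceps)
    have contG: "continuous_on A G" for A
      unfolding G_def by (intro continuous_intros contF contD)
    have normF: "norm (F x) \<le> B5" for x
      using weps_le[OF \<epsilon>] weps_nonneg by (simp add: F_def B5_def norm_mult)
    have "(LINT x:K|lborel. G x) = 0"
    proof (rule integral_K_derivative[of F B5 \<xi> G "(\<bar>\<nu> \<bullet> \<xi>\<bar> + (\<Sum>\<alpha>\<in>Sp. \<bar>m \<alpha> * (\<alpha> \<bullet> \<xi>)\<bar> * (4 / \<epsilon>))) * B5"])
      show "F (x + pi *\<^sub>R v) = F x" if "v \<in> Q" for x v
        using that \<nu> by (simp add: F_def weps_periodic chr_periodic)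
      show "((\<lambda>s. F (x + s *\<^sub>R \<xi>)) has_vector_derivative G (x + s *\<^sub>R \<xi>)) (at s)" for x s
      proof -
        have "((\<lambda>s. complex_of_real (weps \<epsilon> (x + s *\<^sub>R \<xi>))) has_vector_derivative
           of_real (weps \<epsilon> (x + s *\<^sub>R \<xi>) * D (x + s *\<^sub>R \<xi>))) (at s)"
          unfolding D_def using weps_derivative[OF \<epsilon>(1), of x \<xi> s]
          by (intro has_vector_derivative_of_real) (simp add: has_real_derivative_iff_has_vector_derivative)
        from has_vector_derivative_mult[OF chr_has_vector_derivative[of \<nu> x \<xi> s UNIV] this]
        show ?thesis by (simp add: F_def G_def algebra_simps)
      qed
      show "norm (G x) \<le> (\<bar>\<nu> \<bullet> \<xi>\<bar> + (\<Sum>\<alpha>\<in>Sp. \<bar>m \<alpha> * (\<alpha> \<bullet> \<xi>)\<bar> * (4 / \<epsilon>))) * B5" for x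
      proof -
        have "\<bar>D x\<bar> \<le> (\<Sum>\<alpha>\<in>Sp. \<bar>m \<alpha> * (\<alpha> \<bullet> \<xi>) * ceps \<epsilon> \<alpha> x\<bar>)" unfolding D_def by (rule sum_abs)
        also have "\<dots> \<le> (\<Sum>\<alpha>\<in>Sp. \<bar>m \<alpha> * (\<alpha> \<bullet> \<xi>)\<bar> * (4 / \<epsilon>))"
          by (intro sum_mono) (metis abs_ge_zero abs_mult ceps_bound[OF \<epsilon>(1)] mult_left_mono)
        finally have "norm (\<i> * of_real (\<nu> \<bullet> \<xi>) + complex_of_real (D x))
           \<le> \<bar>\<nu> \<bullet> \<xi>\<bar> + (\<Sum>\<alpha>\<in>Sp. \<bar>m \<alpha> * (\<alpha> \<bullet> \<xi>)\<bar> * (4 / \<epsilon>))"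
          by (intro norm_triangle_le) (simp add: norm_mult)
        then show ?thesis unfolding G_def norm_mult
          by (intro mult_mono normF) (auto intro: order_trans[OF norm_ge_zero])
      qed
    qed (auto intro!: normF borel_measurable_continuous_onI contF contG)
    moreover have "(LINT x:K|lborel. G x) = of_real (\<nu> \<bullet> \<xi>) * \<i> * (LINT x:K|lborel. F x)
       + (\<Sum>\<alpha>\<in>Sp. of_real (m \<alpha> * (\<alpha> \<bullet> \<xi>)) * (LINT x:K|lborel. of_real (ceps \<epsilon> \<alpha> x) * F x))"
    proof -
      have i: "set_integrable lborel K (\<lambda>x. of_real (ceps \<epsilon> \<alpha> x) * F x)" for \<alpha>
        by (intro set_integrable_K continuous_intros continuous_ceps contF \<epsilon>)
      have "(LINT x:K|lborel. G x) = (LINT x:K|lborel. of_real (\<nu> \<bullet> \<xi>) * \<i> * F x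
          + (\<Sum>\<alpha>\<in>Sp. of_real (m \<alpha> * (\<alpha> \<bullet> \<xi>)) * (of_real (ceps \<epsilon> \<alpha> x) * F x)))"
        by (rule arg_cong[where f = "\<lambda>f. set_lebesgue_integral lborel K f"])
           (simp add: fun_eq_iff G_def D_def sum_distrib_right sum_distrib_left algebra_simps)
      also have "\<dots> = (LINT x:K|lborel. of_real (\<nu> \<bullet> \<xi>) * \<i> * F x)
         + (LINT x:K|lborel. (\<Sum>\<alpha>\<in>Sp. of_real (m \<alpha> * (\<alpha> \<bullet> \<xi>)) * (of_real (ceps \<epsilon> \<alpha> x) * F x)))"
        by (intro set_integral_add set_integrable_K continuous_intros contF continuous_ceps \<epsilon>)
      also have "(LINT x:K|lborel. (\<Sum>\<alpha>\<in>Sp. of_real (m \<alpha> * (\<alpha> \<bullet> \<xi>)) * (of_real (ceps \<epsilon> \<alpha> x) * F x)))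
         = (\<Sum>\<alpha>\<in>Sp. LINT x:K|lborel. of_real (m \<alpha> * (\<alpha> \<bullet> \<xi>)) * (of_real (ceps \<epsilon> \<alpha> x) * F x))"
        unfolding set_lebesgue_integral_def scaleR_sum_right
        by (rule Bochner_Integration.integral_sum)
           (use set_integrable_mult_right[OF i] in \<open>simp add: set_integrable_def\<close>)
      finally show ?thesis by simp
    qed
    moreover have "(LINT x:K|lborel. of_real (ceps \<epsilon> \<alpha> x) * F x)
       = (LINT x:K|lborel. U \<alpha> x * of_real (seps \<epsilon> \<alpha> x * weps \<epsilon> x))" if a: "\<alpha> \<in> Sp" for \<alpha>
    proof -
      have aS: "\<alpha> \<in> S" and rW: "refl_root \<alpha> \<in> W" using a Sp_S weyl_refl by auto
      let ?A = "LINT x:K|lborel. of_real (ceps \<epsilon> \<alpha> x) * F x"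
      let ?B = "\<lambda>x. of_real (ceps \<epsilon> \<alpha> x) * (chr (refl_root \<alpha> \<nu>) x * of_real (weps \<epsilon> x))"
      have "\<alpha> \<bullet> refl_root \<alpha> x = - (\<alpha> \<bullet> x)" for x
        using refl_root_self[OF S_nz[OF aS]] refl_root_inner_commute[of \<alpha> \<alpha> x] by simp
      then have "of_real (ceps \<epsilon> \<alpha> (refl_root \<alpha> x)) * F (refl_root \<alpha> x) = - ?B x" for x
        by (simp add: ceps_def F_def weps_weyl[OF rW] chr_refl)
      then have "?A = (LINT x:K|lborel. - ?B x)"
        using integral_K_weyl[OF rW, of "\<lambda>x. of_real (ceps \<epsilon> \<alpha> x) * F x"]
          borel_measurable_continuous_onI[OF contF] by simp
      then have "?A = - (LINT x:K|lborel. ?B x)" by (simp add: set_lebesgue_integral_def)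
      \<comment> \<open>Averaging with the reflected integral replaces \<open>chr \<nu>\<close> by
        an antisymmetric difference, whose zero on the wall compensates the pole that
        \<open>ceps\<close> develops.\<close>
      then have "2 * ?A = ?A - (LINT x:K|lborel. ?B x)" by simp
      also have "\<dots> = (LINT x:K|lborel. of_real (ceps \<epsilon> \<alpha> x) * F x - ?B x)"
        by (intro set_integral_diff(2)[symmetric] set_integrable_K continuous_intros contF continuous_ceps
             continuous_chr continuous_weps \<epsilon>)
      also have "\<dots> = (LINT x:K|lborel. 2 * (U \<alpha> x * of_real (seps \<epsilon> \<alpha> x * weps \<epsilon> x)))"
      proof (rule arg_cong[where f = "\<lambda>f. set_lebesgue_integral lborel K f"], rule ext)
        fix x
        define s c d where "s = sin (\<alpha> \<bullet> x)" and "c = cos (\<alpha> \<bullet> x)" and "d = 4 * s\<^sup>2 + \<epsilon>"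
        have "of_real (ceps \<epsilon> \<alpha> x) * F x - ?B x
          = of_real (4 * s / d) * (of_real c * (chr \<nu> x - chr (refl_root \<alpha> \<nu>) x)) * of_real (weps \<epsilon> x)"
          by (simp add: ceps_def F_def s_def c_def d_def algebra_simps diff_divide_distrib)
        also have "\<dots> = of_real (4 * s / d) * (2 * of_real s * U \<alpha> x) * of_real (weps \<epsilon> x)"
          using Cs_identity[OF \<nu> aS, of x] by (simp add: U_def s_def c_def)
        also have "\<dots> = 2 * (U \<alpha> x * of_real (seps \<epsilon> \<alpha> x * weps \<epsilon> x))"
          by (simp add: seps_def s_def d_def power2_eq_square)
        finally show "of_real (ceps \<epsilon> \<alpha> x) * F x - ?B x = 2 * (U \<alpha> x * of_real (seps \<epsilon> \<alpha> x * weps \<epsilon> x))" .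
      qed
      also have "\<dots> = 2 * (LINT x:K|lborel. U \<alpha> x * of_real (seps \<epsilon> \<alpha> x * weps \<epsilon> x))" by simp
      finally show ?thesis by simp
    qed
    ultimately show ?thesis by (simp add: F_def)
  qed
  define \<epsilon> where "\<epsilon> n = 1 / real (Suc n)" for n
  have \<epsilon>: "0 < \<epsilon> n" "\<epsilon> n \<le> 1" for n by (auto simp: \<epsilon>_def)
  have \<epsilon>0: "\<epsilon> \<longlonglongrightarrow> 0" unfolding \<epsilon>_def using LIMSEQ_Suc[OF lim_1_over_n[where 'a = real]] by simp
  note [measurable] = weps_measurable[OF \<epsilon>(1)]
  have B5: "weps (\<epsilon> n) x \<le> B5" for n x using weps_le[OF \<epsilon>] by (simp add: B5_def)
  have l1: "(\<lambda>n. LINT x:K|lborel. chr \<nu> x * of_real (weps (\<epsilon> n) x)) \<longlonglongrightarrow> I \<nu>"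
    unfolding I_def
    by (rule integral_K_limit[where B = B5])
       (auto intro!: tendsto_intros weps_tendsto \<epsilon>0 simp: norm_mult weps_nonneg B5)
  obtain BU where BU: "\<And>\<alpha> x. \<alpha> \<in> Sp \<Longrightarrow> norm (U \<alpha> x) \<le> BU"
  proof -
    have "norm (Cs \<alpha> \<nu> x) \<le> real_of_int \<bar>lev \<nu> \<alpha>\<bar>" for \<alpha> x
    proof (cases "1 \<le> lev \<nu> \<alpha> + 1")
      case True
      then show ?thesis unfolding Cs_def ssum_def
        using sum_norm_le[of "{1..<lev \<nu> \<alpha> + 1}" "\<lambda>j. chr (str \<nu> \<alpha> j) x" "\<lambda>_. 1"] by simp
    next
      case False
      then show ?thesis unfolding Cs_def ssum_def
        using sum_norm_le[of "{lev \<nu> \<alpha> + 1..<1}" "\<lambda>j. chr (str \<nu> \<alpha> j) x" "\<lambda>_. 1"] by simp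
    qed
    note C = this
    have U1: "norm (U \<alpha> x) \<le> real_of_int \<bar>lev \<nu> \<alpha>\<bar> + 1" for \<alpha> x
    proof -
      let ?y = "2 * Cs \<alpha> \<nu> x + chr \<nu> x - chr (refl_root \<alpha> \<nu>) x"
      have "norm ?y \<le> norm (2 * Cs \<alpha> \<nu> x + chr \<nu> x) + 1"
        using norm_triangle_ineq4[of "2 * Cs \<alpha> \<nu> x + chr \<nu> x" "chr (refl_root \<alpha> \<nu>) x"] by simp
      also have "norm (2 * Cs \<alpha> \<nu> x + chr \<nu> x) \<le> 2 * norm (Cs \<alpha> \<nu> x) + 1"
        using norm_triangle_ineq[of "2 * Cs \<alpha> \<nu> x" "chr \<nu> x"] by (simp add: norm_mult)
      finally have "norm ?y \<le> 2 * real_of_int \<bar>lev \<nu> \<alpha>\<bar> + 2" using C[of \<alpha> x] by linarith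
      moreover have "norm (U \<alpha> x) = norm ?y / 2" by (simp add: U_def norm_mult norm_divide)
      ultimately show ?thesis by linarith
    qed
    have "norm (U \<alpha> x) \<le> (\<Sum>\<alpha>\<in>Sp. real_of_int \<bar>lev \<nu> \<alpha>\<bar> + 1)" if "\<alpha> \<in> Sp" for \<alpha> x
      using order_trans[OF U1[of \<alpha> x] member_le_sum[OF that, of "\<lambda>\<alpha>. real_of_int \<bar>lev \<nu> \<alpha>\<bar> + 1"]] finite_Sp
      by simp
    then show ?thesis using that by blast
  qed
  have l2: "(\<lambda>n. LINT x:K|lborel. U \<alpha> x * of_real (seps (\<epsilon> n) \<alpha> x * weps (\<epsilon> n) x))
      \<longlonglongrightarrow> (LINT x:K|lborel. U \<alpha> x * of_real (wt x))" if a: "\<alpha> \<in> Sp" for \<alpha>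
  proof (rule integral_K_limit[where B = "BU * (1 * B5)"])
    show "norm (U \<alpha> x * of_real (seps (\<epsilon> n) \<alpha> x * weps (\<epsilon> n) x)) \<le> BU * (1 * B5)" for n x
      unfolding norm_mult norm_of_real abs_mult using BU[OF a, of x] seps01[OF \<epsilon>(1)] weps_nonneg B5
      by (intro mult_mono) (auto intro: order_trans[OF norm_ge_zero])
    show "(\<lambda>n. U \<alpha> x * of_real (seps (\<epsilon> n) \<alpha> x * weps (\<epsilon> n) x)) \<longlonglongrightarrow> U \<alpha> x * of_real (wt x)" if r: "regular x" for x
    proof -
      have nz: "sin (\<alpha> \<bullet> x) \<noteq> 0" using r a Sp_S by (auto simp: regular_def)
      have "(\<lambda>n. seps (\<epsilon> n) \<alpha> x) \<longlonglongrightarrow> 4 * (sin (\<alpha> \<bullet> x))\<^sup>2 / (4 * (sin (\<alpha> \<bullet> x))\<^sup>2 + 0)"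
        unfolding seps_def using nz by (intro tendsto_intros \<epsilon>0) auto
      then have "(\<lambda>n. seps (\<epsilon> n) \<alpha> x * weps (\<epsilon> n) x) \<longlonglongrightarrow> 1 * wt x"
        using nz by (intro tendsto_mult weps_tendsto[OF r \<epsilon>0]) simp
      then show ?thesis by (intro tendsto_intros) simp
    qed
  qed measurable
  have "(\<lambda>n. of_real (\<nu> \<bullet> \<xi>) * \<i> * (LINT x:K|lborel. chr \<nu> x * of_real (weps (\<epsilon> n) x))
     + (\<Sum>\<alpha>\<in>Sp. of_real (m \<alpha> * (\<alpha> \<bullet> \<xi>)) * (LINT x:K|lborel. U \<alpha> x * of_real (seps (\<epsilon> n) \<alpha> x * weps (\<epsilon> n) x))))
    \<longlonglongrightarrow> of_real (\<nu> \<bullet> \<xi>) * \<i> * I \<nu> + (\<Sum>\<alpha>\<in>Sp. of_real (m \<alpha> * (\<alpha> \<bullet> \<xi>)) * (LINT x:K|lborel. U \<alpha> x * of_real (wt x)))"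
    by (intro tendsto_intros l1 l2)
  then have "of_real (\<nu> \<bullet> \<xi>) * \<i> * I \<nu>
     + (\<Sum>\<alpha>\<in>Sp. of_real (m \<alpha> * (\<alpha> \<bullet> \<xi>)) * (LINT x:K|lborel. U \<alpha> x * of_real (wt x))) = 0"
    using reg[OF \<epsilon>] by (simp add: LIMSEQ_const_iff)
  \<comment> \<open>The two bare characters in \<open>U\<close> integrate to \<open>I \<nu>\<close>
    and \<open>I (refl_root \<alpha> \<nu>)\<close>, which cancel by invariance; only the string sum
    survives.\<close>
  moreover have "(LINT x:K|lborel. U \<alpha> x * of_real (wt x)) = \<i> * ssum (\<lambda>j. I (str \<nu> \<alpha> j)) 1 (lev \<nu> \<alpha> + 1)"
    if a: "\<alpha> \<in> Sp" for \<alpha>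
  proof -
    have rW: "refl_root \<alpha> \<in> W" using a Sp_S weyl_refl by auto
    have i: "set_integrable lborel K (\<lambda>x. chr \<kappa> x * of_real (wt x))" "set_integrable lborel K (\<lambda>x. Cs \<alpha> \<nu> x * of_real (wt x))" for \<kappa>
      by (intro set_integrable_K continuous_intros continuous_chr continuous_Cs continuous_wt)+
    have "(LINT x:K|lborel. U \<alpha> x * of_real (wt x))
       = (LINT x:K|lborel. \<i> * (Cs \<alpha> \<nu> x * of_real (wt x)) + \<i> / 2 * (chr \<nu> x * of_real (wt x)) - \<i> / 2 * (chr (refl_root \<alpha> \<nu>) x * of_real (wt x)))"
      by (rule arg_cong[where f = "\<lambda>f. set_lebesgue_integral lborel K f"])
         (simp add: fun_eq_iff U_def algebra_simps)
    also have "\<dots> = \<i> * (LINT x:K|lborel. Cs \<alpha> \<nu> x * of_real (wt x)) + \<i> / 2 * I \<nu> - \<i> / 2 * I (refl_root \<alpha> \<nu>)"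
      using i by (simp add: I_def set_integral_add set_integral_diff set_integrable_mult_right)
    finally show ?thesis by (simp add: integral_Cs I_weyl[OF rW])
  qed
  ultimately have "\<i> * (of_real (\<nu> \<bullet> \<xi>) * I \<nu>
    + (\<Sum>\<alpha>\<in>Sp. of_real (m \<alpha> * (\<alpha> \<bullet> \<xi>)) * ssum (\<lambda>j. I (str \<nu> \<alpha> j)) 1 (lev \<nu> \<alpha> + 1))) = 0"
    by (simp add: distrib_left sum_distrib_left mult_ac)
  then show ?thesis by simp
qed

end

section \<open>The weighted inner product\<close>

context root_data
begin

text \<open>Taken over \<open>K\<close> rather than the alcove, because the Cherednik operators act
  on functions that are not invariant. On invariant functions it is \<open>card W\<close> times
  \<open>ip_m\<close>.\<close>

definition ip :: "('a \<Rightarrow> complex) \<Rightarrow> ('a \<Rightarrow> complex) \<Rightarrow> complex" where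
  "ip f g = (LINT x:K|lborel. f x * cnj (g x) * of_real (wt x))"

lemma ip_integrable:
  "continuous_on UNIV f \<Longrightarrow> continuous_on UNIV g \<Longrightarrow> set_integrable lborel K (\<lambda>x. f x * cnj (g x) * of_real (wt x))"
  by (intro set_integrable_K continuous_intros continuous_wt)

lemma ip_sum_left:
  assumes "\<And>i. i \<in> J \<Longrightarrow> continuous_on UNIV (f i)" "continuous_on UNIV g"
  shows "ip (\<lambda>x. \<Sum>i\<in>J. c i * f i x) g = (\<Sum>i\<in>J. c i * ip (f i) g)"
proof -
  have "(\<Sum>i\<in>J. c i * f i x) * cnj (g x) * of_real (wt x) = (\<Sum>i\<in>J. c i * (f i x * cnj (g x) * of_real (wt x)))" for x
    by (simp add: sum_distrib_right mult.assoc)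
  then have "ip (\<lambda>x. \<Sum>i\<in>J. c i * f i x) g = (LINT x:K|lborel. (\<Sum>i\<in>J. c i * (f i x * cnj (g x) * of_real (wt x))))"
    by (simp add: ip_def)
  also have "\<dots> = (\<Sum>i\<in>J. LINT x:K|lborel. c i * (f i x * cnj (g x) * of_real (wt x)))"
    unfolding set_lebesgue_integral_def scaleR_sum_right
    by (rule Bochner_Integration.integral_sum)
       (use set_integrable_mult_right[OF ip_integrable[OF assms]] in \<open>simp add: set_integrable_def\<close>)
  finally show ?thesis by (simp add: ip_def)
qed

lemma ip_cnj: "ip g f = cnj (ip f g)"
proof -
  have "ip g f = (LINT x|lborel. cnj (indicator K x *\<^sub>R (f x * cnj (g x) * of_real (wt x))))"
    unfolding ip_def set_lebesgue_integral_def
    by (rule Bochner_Integration.integral_cong) (auto simp: mult_ac)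
  also have "\<dots> = cnj (ip f g)"
    unfolding ip_def set_lebesgue_integral_def by (rule Bochner_Integration.integral_cnj)
  finally show ?thesis .
qed

lemma ip_sum_right:
  assumes "\<And>i. i \<in> J \<Longrightarrow> continuous_on UNIV (f i)" "continuous_on UNIV g"
  shows "ip g (\<lambda>x. \<Sum>i\<in>J. c i * f i x) = (\<Sum>i\<in>J. cnj (c i) * ip g (f i))"
proof -
  have "ip g (\<lambda>x. \<Sum>i\<in>J. c i * f i x) = cnj (ip (\<lambda>x. \<Sum>i\<in>J. c i * f i x) g)" by (rule ip_cnj)
  also have "\<dots> = (\<Sum>i\<in>J. cnj (c i) * cnj (ip (f i) g))" by (simp add: ip_sum_left[OF assms])
  also have "\<dots> = (\<Sum>i\<in>J. cnj (c i) * ip g (f i))" by (rule sum.cong[OF refl]) (simp add: ip_cnj[of g])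
  finally show ?thesis .
qed

lemma ip_chr: "ip (chr \<nu>) (chr \<kappa>) = I (\<nu> - \<kappa>)"
  by (simp add: ip_def I_def chr_mult_cnj)

lemma ip_weyl:
  assumes "w \<in> W" "continuous_on UNIV f" "continuous_on UNIV g" "\<And>x. g (w x) = g x"
  shows "ip (\<lambda>x. f (w x)) g = ip f g"
proof -
  have m: "(\<lambda>x. f x * cnj (g x) * complex_of_real (wt x)) \<in> borel_measurable borel"
    using assms by (intro borel_measurable_continuous_onI continuous_intros continuous_wt)
  show ?thesis
    using integral_K_weyl[OF assms(1) m]
    by (simp add: ip_def assms(4) wt_weyl[OF assms(1)])
qed

lemma ip_eq_ip_m:
  assumes "continuous_on UNIV f" "continuous_on UNIV g"
    "\<And>w x. w \<in> W \<Longrightarrow> f (w x) = f x" "\<And>w x. w \<in> W \<Longrightarrow> g (w x) = g x"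
  shows "ip f g = of_nat (card W) * ip_m Sp m f g"
proof -
  show ?thesis unfolding ip_def ip_m_def
    by (rule integral_K_alcove)
       (auto simp: assms(3,4) wt_weyl intro!: set_integrable_continuous borel_measurable_continuous_onI
         continuous_intros continuous_wt assms compact_imp_bounded compact_alcove)
qed

text \<open>The weight is positive at regular points, so \<open>f\<close> vanishes almost everywhere
  on \<open>K\<close>, then on all of \<open>K\<close> by continuity, and at every regular point by
  periodicity.\<close>

lemma ip_self_eq_0:
  assumes c: "continuous_on UNIV f" and per: "\<And>x v. v \<in> Q \<Longrightarrow> f (x + pi *\<^sub>R v) = f x" and 0: "ip f f = 0"
  shows "f x = 0"
proof -
  have i: "integrable lborel (\<lambda>x. indicator K x *\<^sub>R ((norm (f x))\<^sup>2 * wt x))"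
  proof -
    have "integrable lborel (\<lambda>x. norm (indicator K x *\<^sub>R (f x * cnj (f x) * of_real (wt x))))"
      using ip_integrable[OF c c] by (intro integrable_norm) (simp add: set_integrable_def)
    then show ?thesis using wt_nonneg by (simp add: norm_mult power2_eq_square abs_mult)
  qed
  have sq: "f x * cnj (f x) = (complex_of_real (cmod (f x)))\<^sup>2" for x
    using complex_norm_square[of "f x"] by simp
  have "ip f f = of_real (LINT x|lborel. indicator K x *\<^sub>R ((norm (f x))\<^sup>2 * wt x))"
    unfolding ip_def set_lebesgue_integral_def integral_complex_of_real[symmetric]
    by (rule Bochner_Integration.integral_cong) (simp_all add: scaleR_conv_of_real sq)
  then have z: "(LINT x|lborel. indicator K x *\<^sub>R ((norm (f x))\<^sup>2 * wt x)) = 0" using 0 by simp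
  have "AE x in lborel. indicator K x *\<^sub>R ((norm (f x))\<^sup>2 * wt x) = 0"
    by (rule integral_nonneg_eq_0_iff_AE[OF i, THEN iffD1, OF _ z]) (use wt_nonneg in auto)
  then have "AE x in lborel. indicator K x *\<^sub>R f x = 0"
    using AE_regular by eventually_elim (use wt_pos in \<open>force simp: indicator_def\<close>)
  then obtain N where N: "\<And>x. x \<in> space lborel - N \<Longrightarrow> indicator K x *\<^sub>R f x = 0" "N \<in> null_sets lborel"
    using AE_E3 by blast
  have fK: "f x = 0" if "x \<in> K" for x
  proof (rule ccontr)
    assume "f x \<noteq> 0"
    have o: "open (K \<inter> {x. f x \<noteq> 0})" using c open_K by (intro open_Int open_Collect_neq) auto
    have "K \<inter> {x. f x \<noteq> 0} \<subseteq> N" using N(1) by (auto simp: indicator_def)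
    moreover have "negligible N" using N(2) by (simp add: negligible_iff_null_sets null_sets_completionI)
    ultimately show False using open_not_negligible[OF o] \<open>f x \<noteq> 0\<close> that negligible_subset by blast
  qed
  show ?thesis
  proof (rule continuous_eq_0_if_regular[OF c])
    fix x assume "regular x"
    then obtain v where v: "v \<in> Q" "x - pi *\<^sub>R v \<in> K" using tile_ex by blast
    then show "f x = 0" using per[OF v(1), of "x - pi *\<^sub>R v"] fK by simp
  qed
qed

section \<open>Weights and orbits\<close>

definition orb :: "'a \<Rightarrow> 'a set" where "orb \<nu> = (\<lambda>w. w \<nu>) ` W"

lemma finite_orb: "finite (orb \<nu>)" and orb_self: "\<nu> \<in> orb \<nu>"
  using finite_W weyl_id by (auto simp: orb_def image_iff intro!: bexI[of _ id])

lemma card_orb_pos: "card (orb \<nu>) > 0" using finite_orb orb_self by (auto simp: card_gt_0_iff)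

lemma weyl_orb: "w \<in> W \<Longrightarrow> \<kappa> \<in> orb \<nu> \<Longrightarrow> w \<kappa> \<in> orb \<nu>"
  unfolding orb_def using weyl_comp by (auto simp: image_iff) (metis comp_apply)

lemma orb_weyl: assumes "\<kappa> \<in> orb \<nu>" shows "orb \<kappa> = orb \<nu>"
proof -
  obtain w where w: "w \<in> W" "\<kappa> = w \<nu>" using assms by (auto simp: orb_def)
  have "\<nu> = inv w \<kappa>" using w by simp
  then have "\<nu> \<in> orb \<kappa>" using weyl_inv[OF w(1)] by (auto simp: orb_def)
  then show ?thesis using assms weyl_orb by (auto simp: orb_def)
qed

lemma orb_Lam: "\<nu> \<in> Lam \<Longrightarrow> \<kappa> \<in> orb \<nu> \<Longrightarrow> \<kappa> \<in> Lam"
  using Lam_weyl by (auto simp: orb_def)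

lemma orb_norm: "\<kappa> \<in> orb \<nu> \<Longrightarrow> norm \<kappa> = norm \<nu>"
  using weyl_norm by (auto simp: orb_def)

lemma sum_orb_weyl: assumes "w \<in> W" shows "(\<Sum>\<kappa>\<in>orb \<nu>. f (w \<kappa>)) = (\<Sum>\<kappa>\<in>orb \<nu>. f \<kappa>)"
proof (rule sum.reindex_bij_betw, rule bij_betwI[where g = "inv w"])
  show "w \<in> orb \<nu> \<rightarrow> orb \<nu>" "inv w \<in> orb \<nu> \<rightarrow> orb \<nu>" using weyl_orb assms weyl_inv by auto
qed (use assms in auto)

text \<open>Orbit-stabiliser theorem in averaged form, by counting the double sum over the orbit and
  the group in both orders.\<close>

lemma average_weyl:
  fixes h :: "'a \<Rightarrow> complex"
  shows "(\<Sum>w\<in>W. h (w \<nu>)) / of_nat (card W) = (\<Sum>\<kappa>\<in>orb \<nu>. h \<kappa>) / of_nat (card (orb \<nu>))"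
proof -
  have "(\<Sum>\<kappa>\<in>orb \<nu>. \<Sum>w\<in>W. h (w \<kappa>)) = (\<Sum>w\<in>W. \<Sum>\<kappa>\<in>orb \<nu>. h (w \<kappa>))" by (rule sum.swap)
  also have "\<dots> = of_nat (card W) * (\<Sum>\<kappa>\<in>orb \<nu>. h \<kappa>)" by (simp add: sum_orb_weyl)
  finally have 1: "(\<Sum>\<kappa>\<in>orb \<nu>. \<Sum>w\<in>W. h (w \<kappa>)) = of_nat (card W) * (\<Sum>\<kappa>\<in>orb \<nu>. h \<kappa>)" .
  have "(\<Sum>w\<in>W. h (w \<kappa>)) = (\<Sum>w\<in>W. h (w \<nu>))" if k: "\<kappa> \<in> orb \<nu>" for \<kappa>
  proof -
    obtain u where "u \<in> W" "\<kappa> = u \<nu>" using k by (auto simp: orb_def)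
    then show ?thesis using sum_weyl_right[of u "\<lambda>w. h (w \<nu>)"] by simp
  qed
  then have "(\<Sum>\<kappa>\<in>orb \<nu>. \<Sum>w\<in>W. h (w \<kappa>)) = of_nat (card (orb \<nu>)) * (\<Sum>w\<in>W. h (w \<nu>))" by simp
  moreover have "card W \<noteq> 0" using finite_W W_nonempty by simp
  ultimately show ?thesis using 1 card_orb_pos[of \<nu>] by (simp add: field_simps)
qed

abbreviation "M \<equiv> orbit_sum S"

lemma M_eq: "M \<nu> x = (\<Sum>\<kappa>\<in>orb \<nu>. chr \<kappa> x)" by (simp add: orbit_sum_chr orb_def)

lemma M_orb: "\<kappa> \<in> orb \<nu> \<Longrightarrow> M \<kappa> = M \<nu>" by (simp add: fun_eq_iff M_eq orb_weyl)

lemma continuous_M: "continuous_on A (M \<nu>)"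
  unfolding M_eq[abs_def] by (intro continuous_intros continuous_chr)

lemma M_weyl: "w \<in> W \<Longrightarrow> M \<nu> (w x) = M \<nu> x"
  using sum_orb_weyl[OF weyl_inv, of w "\<lambda>\<kappa>. chr \<kappa> x" \<nu>] by (simp add: M_eq chr_weyl)

lemma M_periodic: "\<nu> \<in> Lam \<Longrightarrow> v \<in> Q \<Longrightarrow> M \<nu> (x + pi *\<^sub>R v) = M \<nu> x"
  by (simp add: M_eq chr_periodic orb_Lam)

lemma average_chr: "(\<Sum>w\<in>W. chr \<nu> (w x)) / of_nat (card W) = M \<nu> x / of_nat (card (orb \<nu>))"
proof -
  have "(\<Sum>w\<in>W. chr \<nu> (w x)) = (\<Sum>w\<in>W. chr (inv w \<nu>) x)" by (simp add: chr_weyl)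
  also have "\<dots> = (\<Sum>w\<in>W. chr (w \<nu>) x)"
    by (rule sum.reindex_bij_betw[of inv, where g = "\<lambda>w. chr (w \<nu>) x"], rule bij_betwI[where g = inv])
       (auto simp: weyl_inv weyl_bij inv_inv_eq)
  finally show ?thesis using average_weyl[of "\<lambda>\<kappa>. chr \<kappa> x" \<nu>] by (simp add: M_eq)
qed

abbreviation "Dom \<equiv> dominant_weights Sp"

lemma dom_iff: "l \<in> Dom \<longleftrightarrow> l \<in> Lam \<and> dominant l"
proof
  assume l: "l \<in> Dom"
  have nn: "\<exists>n::nat. l \<bullet> \<alpha> = of_nat n * (\<alpha> \<bullet> \<alpha>)" if a: "\<alpha> \<in> Sp" for \<alpha>
  proof -
    have "(l \<bullet> \<alpha>) / (\<alpha> \<bullet> \<alpha>) \<in> \<nat>" using l a by (auto simp: dominant_weights_def)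
    then obtain n where "(l \<bullet> \<alpha>) / (\<alpha> \<bullet> \<alpha>) = of_nat n" using Nats_cases by metis
    then show ?thesis using Sp_nz[OF a] by (intro exI[of _ n]) (simp add: field_simps)
  qed
  have "l \<in> Lam"
  proof (rule LamI)
    fix \<alpha> assume "\<alpha> \<in> S"
    then show "\<exists>k::int. l \<bullet> \<alpha> = of_int k * (\<alpha> \<bullet> \<alpha>)"
    proof (cases rule: S_cases)
      case 1
      then obtain n where "l \<bullet> \<alpha> = of_nat n * (\<alpha> \<bullet> \<alpha>)" using nn by blast
      then show ?thesis by (intro exI[of _ "int n"]) simp
    next
      case 2
      then obtain n where "l \<bullet> (- \<alpha>) = of_nat n * (\<alpha> \<bullet> \<alpha>)" using nn[of "- \<alpha>"] by auto
      then show ?thesis by (intro exI[of _ "- int n"]) simp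
    qed
  qed
  moreover have "dominant l"
    unfolding dominant_def
  proof
    fix \<alpha> assume "\<alpha> \<in> Sp"
    then obtain n where "l \<bullet> \<alpha> = of_nat n * (\<alpha> \<bullet> \<alpha>)" using nn by blast
    then show "0 \<le> \<alpha> \<bullet> l" using inner_commute[of \<alpha> l] by simp
  qed
  ultimately show "l \<in> Lam \<and> dominant l" by blast
next
  assume l: "l \<in> Lam \<and> dominant l"
  have "(l \<bullet> \<alpha>) / (\<alpha> \<bullet> \<alpha>) \<in> \<nat>" if a: "\<alpha> \<in> Sp" for \<alpha>
  proof -
    have "(l \<bullet> \<alpha>) / (\<alpha> \<bullet> \<alpha>) \<in> \<int>" using l Sp_S[OF a] by (auto simp: Lam_def)
    moreover have "0 \<le> (l \<bullet> \<alpha>) / (\<alpha> \<bullet> \<alpha>)" using l a by (auto simp: dominant_def inner_commute)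
    ultimately show ?thesis by (simp add: Nats_altdef2)
  qed
  then show "l \<in> Dom" by (auto simp: dominant_weights_def)
qed

lemma dom_Lam: "l \<in> Dom \<Longrightarrow> l \<in> Lam" and dom_dominant: "l \<in> Dom \<Longrightarrow> dominant l" by (auto simp: dom_iff)

lemma ex_dom: assumes "\<nu> \<in> Lam" shows "\<exists>\<mu>\<in>Dom. \<nu> \<in> orb \<mu>"
proof -
  obtain w where w: "w \<in> W" "dominant (w \<nu>)" using ex_dominant by blast
  then have "w \<nu> \<in> Dom" using assms Lam_weyl by (auto simp: dom_iff)
  moreover have "w \<nu> \<in> orb \<nu>" using w by (auto simp: orb_def)
  then have "\<nu> \<in> orb (w \<nu>)" using orb_weyl orb_self by metis
  ultimately show ?thesis by blast
qed

lemma dom_unique: assumes "\<mu> \<in> Dom" "\<mu>' \<in> Dom" "\<mu>' \<in> orb \<mu>" shows "\<mu>' = \<mu>"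
  using assms dominant_unique dom_dominant by (auto simp: orb_def)

lemma orb_disjoint: assumes "\<mu> \<in> Dom" "\<mu>' \<in> Dom" "\<kappa> \<in> orb \<mu>" "\<kappa> \<in> orb \<mu>'" shows "\<mu> = \<mu>'"
  using assms dom_unique orb_weyl orb_self by metis

section \<open>The dominance order, saturated weight sets and root strings\<close>

lemma root_le_refl: "root_le Sp \<mu> \<mu>" by (auto simp: root_le_def intro: exI[of _ "\<lambda>_. 0"])

lemma root_le_trans: assumes "root_le Sp \<mu> \<kappa>" "root_le Sp \<kappa> \<nu>" shows "root_le Sp \<mu> \<nu>"
proof -
  obtain c d :: "'a \<Rightarrow> nat" where "\<kappa> - \<mu> = (\<Sum>\<alpha>\<in>Sp. real (c \<alpha>) *\<^sub>R \<alpha>)" "\<nu> - \<kappa> = (\<Sum>\<alpha>\<in>Sp. real (d \<alpha>) *\<^sub>R \<alpha>)"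
    using assms by (auto simp: root_le_def)
  then have "\<nu> - \<mu> = (\<Sum>\<alpha>\<in>Sp. real (c \<alpha> + d \<alpha>) *\<^sub>R \<alpha>)"
    by (simp add: scaleR_add_left sum.distrib algebra_simps)
  then show ?thesis unfolding root_le_def by (intro exI[of _ "\<lambda>\<alpha>. c \<alpha> + d \<alpha>"])
qed

lemma root_le_add: assumes "\<alpha> \<in> Sp" shows "root_le Sp \<mu> (\<mu> + real n *\<^sub>R \<alpha>)"
proof -
  have "(\<Sum>\<beta>\<in>Sp. real (if \<beta> = \<alpha> then n else 0) *\<^sub>R \<beta>) = (\<Sum>\<beta>\<in>Sp. if \<beta> = \<alpha> then real n *\<^sub>R \<beta> else 0)"
    by (intro sum.cong) auto
  then show ?thesis using assms finite_Sp
    by (auto simp: root_le_def intro!: exI[of _ "\<lambda>\<beta>. if \<beta> = \<alpha> then n else 0"])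
qed

lemma root_le_inner:
  assumes "root_le Sp \<mu> \<nu>" "\<And>\<alpha>. \<alpha> \<in> Sp \<Longrightarrow> 0 \<le> \<alpha> \<bullet> \<eta>"
  shows "\<mu> \<bullet> \<eta> \<le> \<nu> \<bullet> \<eta>"
proof -
  obtain c :: "'a \<Rightarrow> nat" where "\<nu> - \<mu> = (\<Sum>\<alpha>\<in>Sp. real (c \<alpha>) *\<^sub>R \<alpha>)" using assms by (auto simp: root_le_def)
  then have "(\<nu> - \<mu>) \<bullet> \<eta> \<ge> 0" by (simp add: inner_sum_left sum_nonneg assms(2))
  then show ?thesis by (simp add: inner_diff_left)
qed

lemma root_le_inner_strict:
  assumes "root_le Sp \<mu> \<nu>" "\<And>\<alpha>. \<alpha> \<in> Sp \<Longrightarrow> 0 < \<alpha> \<bullet> \<eta>" "\<mu> \<noteq> \<nu>"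
  shows "\<mu> \<bullet> \<eta> < \<nu> \<bullet> \<eta>"
proof -
  obtain c :: "'a \<Rightarrow> nat" where c: "\<nu> - \<mu> = (\<Sum>\<alpha>\<in>Sp. real (c \<alpha>) *\<^sub>R \<alpha>)" using assms by (auto simp: root_le_def)
  have "\<exists>\<alpha>\<in>Sp. c \<alpha> \<noteq> 0"
  proof (rule ccontr)
    assume "\<not> ?thesis"
    then have "\<nu> - \<mu> = 0" unfolding c by (intro sum.neutral) auto
    then show False using assms(3) by simp
  qed
  then obtain \<beta> where "\<beta> \<in> Sp" "c \<beta> \<noteq> 0" by blast
  then have "(\<Sum>\<alpha>\<in>Sp. real (c \<alpha>) * (\<alpha> \<bullet> \<eta>)) > 0"
    using assms(2) by (intro sum_pos2[OF finite_Sp \<open>\<beta> \<in> Sp\<close>]) (auto simp: less_imp_le)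
  then have "(\<nu> - \<mu>) \<bullet> \<eta> > 0" unfolding c by (simp add: inner_sum_left)
  then show ?thesis by (simp add: inner_diff_left)
qed

text \<open>Reflecting in a positive root that is negative on the weight adds a positive even
  multiple of that root and raises the \<open>xi\<close>-height, which can happen only finitely
  often within the orbit.\<close>

lemma root_le_orb:
  assumes "\<mu> \<in> Dom" "\<nu> \<in> orb \<mu>"
  shows "root_le Sp \<nu> \<mu>"
  using assms(2)
proof (induction "card {\<kappa>\<in>orb \<mu>. \<kappa> \<bullet> xi > \<nu> \<bullet> xi}" arbitrary: \<nu> rule: less_induct)
  case less
  have L: "\<nu> \<in> Lam" using less.prems assms orb_Lam dom_Lam by blast
  show ?case
  proof (cases "dominant \<nu>")
    case True
    then have "\<nu> = \<mu>" using dom_unique[OF assms(1)] L less.prems by (auto simp: dom_iff)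
    then show ?thesis using root_le_refl by simp
  next
    case False
    then obtain \<alpha> where a: "\<alpha> \<in> Sp" "\<alpha> \<bullet> \<nu> < 0" by (auto simp: dominant_def not_le)
    have aS: "\<alpha> \<in> S" using a Sp_S by blast
    have "of_int (lev \<nu> \<alpha>) * (\<alpha> \<bullet> \<alpha>) < 0" using a(2) lev[OF L aS] by (simp add: inner_commute)
    then have k: "lev \<nu> \<alpha> < 0" using inner_ge_zero[of \<alpha>] by (auto simp: mult_less_0_iff simp del: inner_ge_zero)
    define n where "n = nat (- lev \<nu> \<alpha>)"
    have r: "refl_root \<alpha> \<nu> = \<nu> + real (2 * n) *\<^sub>R \<alpha>"
      unfolding refl_string[OF L aS] using k by (simp add: n_def)
    let ?\<kappa> = "refl_root \<alpha> \<nu>"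
    have ko: "?\<kappa> \<in> orb \<mu>" using weyl_orb weyl_refl aS less.prems by blast
    have "n > 0" using k by (simp add: n_def)
    then have "?\<kappa> \<bullet> xi > \<nu> \<bullet> xi" unfolding r using Sp_xi[OF a(1)] by (simp add: inner_add_left)
    then have "{\<kappa>'\<in>orb \<mu>. \<kappa>' \<bullet> xi > ?\<kappa> \<bullet> xi} \<subset> {\<kappa>\<in>orb \<mu>. \<kappa> \<bullet> xi > \<nu> \<bullet> xi}" using ko by auto
    then have "card {\<kappa>'\<in>orb \<mu>. \<kappa>' \<bullet> xi > ?\<kappa> \<bullet> xi} < card {\<kappa>\<in>orb \<mu>. \<kappa> \<bullet> xi > \<nu> \<bullet> xi}"
      by (rule psubset_card_mono[rotated]) (simp add: finite_orb)
    then have "root_le Sp ?\<kappa> \<mu>" using less.hyps[of ?\<kappa>] ko by blast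
    then show ?thesis using root_le_trans root_le_add[OF a(1), of \<nu> "2 * n"] r by metis
  qed
qed

definition low :: "'a \<Rightarrow> 'a set" where "low l = {\<mu>\<in>Dom. root_le Sp \<mu> l}"

lemma low_dom: "\<mu> \<in> low l \<Longrightarrow> \<mu> \<in> Dom" by (simp add: low_def)

lemma low_self: "l \<in> Dom \<Longrightarrow> l \<in> low l" by (simp add: low_def root_le_refl)

lemma low_trans: "\<mu> \<in> low \<kappa> \<Longrightarrow> \<kappa> \<in> low l \<Longrightarrow> \<mu> \<in> low l" using root_le_trans by (auto simp: low_def)

text \<open>Dominance of \<mu> gives \<mu> . \<mu> <= l . \<mu>, and positivity of the squared norm
  of l - \<mu> does the rest. This makes the norm a rank function for the triangular
  systems.\<close>

lemma low_norm: assumes "\<mu> \<in> low l" "\<mu> \<noteq> l" shows "norm \<mu> < norm l"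
proof -
  have "\<mu> \<bullet> \<mu> \<le> l \<bullet> \<mu>"
    using assms by (intro root_le_inner) (auto simp: low_def dom_iff dominant_def)
  moreover have "(l - \<mu>) \<bullet> (l - \<mu>) > 0" using assms(2) by simp
  ultimately have "\<mu> \<bullet> \<mu> < l \<bullet> l" by (simp add: inner_diff_left inner_diff_right inner_commute)
  then show ?thesis by (simp add: norm_lt)
qed

lemma finite_low: "finite (low l)"
proof (rule finite_subset)
  show "low l \<subseteq> {x. norm x \<le> norm l \<and> (\<forall>\<alpha>\<in>Sp. (x \<bullet> \<alpha>) / (\<alpha> \<bullet> \<alpha>) \<in> \<int>)}"
  proof
    fix \<mu> assume m: "\<mu> \<in> low l"
    then have "norm \<mu> \<le> norm l" using low_norm[OF m] by (cases "\<mu> = l") auto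
    then show "\<mu> \<in> {x. norm x \<le> norm l \<and> (\<forall>\<alpha>\<in>Sp. (x \<bullet> \<alpha>) / (\<alpha> \<bullet> \<alpha>) \<in> \<int>)}"
      using m Sp_S by (auto simp: low_def dom_iff Lam_def)
  qed
  show "finite {x. norm x \<le> norm l \<and> (\<forall>\<alpha>\<in>Sp. (x \<bullet> \<alpha>) / (\<alpha> \<bullet> \<alpha>) \<in> \<int>)}"
    by (rule finite_lattice_bounded) (simp add: Sp_nz)
qed

text \<open>Reflecting \<open>xi\<close> can only lower its pairing with \<rho>: the multiplicities
  are invariant and all positive roots are already positive on \<open>xi\<close>. The loss is a
  positive multiple of \<alpha> . \<rho>.\<close>

lemma rho_dominant: "\<alpha> \<in> Sp \<Longrightarrow> 0 \<le> \<alpha> \<bullet> rho Sp m"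
proof -
  assume a: "\<alpha> \<in> Sp"
  let ?r = "rho Sp m"
  have aS: "\<alpha> \<in> S" and rW: "refl_root \<alpha> \<in> W" using a Sp_S weyl_refl by auto
  have r: "2 * (x \<bullet> ?r) = (\<Sum>\<beta>\<in>Sp. m \<beta> * (\<beta> \<bullet> x))" for x
    by (simp add: rho_def inner_sum_right inner_commute)
  have "2 * (refl_root \<alpha> xi \<bullet> ?r) = (\<Sum>\<beta>\<in>Sp. m \<beta> * (refl_root \<alpha> \<beta> \<bullet> xi))"
    unfolding r by (simp add: refl_root_inner_commute)
  also have "\<dots> \<le> (\<Sum>\<beta>\<in>Sp. (\<lambda>\<beta>. m \<beta> * \<bar>\<beta> \<bullet> xi\<bar>) (refl_root \<alpha> \<beta>))"
    using m_invar rW Sp_S m_nonneg by (intro sum_mono) (auto intro!: mult_left_mono)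
  also have "\<dots> = (\<Sum>\<beta>\<in>Sp. m \<beta> * \<bar>\<beta> \<bullet> xi\<bar>)" by (rule sum_Sp_weyl[OF rW]) (simp add: m_uminus)
  also have "\<dots> = 2 * (xi \<bullet> ?r)" unfolding r using Sp_xi by (intro sum.cong) (auto simp: abs_of_pos)
  finally have "(xi \<bullet> coroot \<alpha>) * (\<alpha> \<bullet> ?r) \<ge> 0" by (simp add: refl_root_eq inner_diff_left mult.commute)
  then show ?thesis using coroot_xi[OF a] by (simp add: zero_le_mult_iff inner_commute)
qed

abbreviation "theta \<equiv> HO_theta Sp m"

lemma theta_eq: "theta l = (norm l)\<^sup>2 + 2 * (l \<bullet> rho Sp m)"
  by (simp add: HO_theta_def inner_add_right power2_norm_eq_inner)

lemma theta_strict: assumes "\<mu> \<in> low l" "\<mu> \<noteq> l" shows "theta \<mu> < theta l"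
proof -
  have "(norm \<mu>)\<^sup>2 < (norm l)\<^sup>2" using low_norm[OF assms] by (simp add: power_strict_mono)
  moreover have "\<mu> \<bullet> rho Sp m \<le> l \<bullet> rho Sp m" using assms rho_dominant by (intro root_le_inner) (auto simp: low_def)
  ultimately show ?thesis by (simp add: theta_eq)
qed

lemma theta_ge: assumes "l \<in> Dom" shows "(norm l)\<^sup>2 \<le> theta l"
proof -
  have "2 * (l \<bullet> rho Sp m) = (\<Sum>\<alpha>\<in>Sp. m \<alpha> * (l \<bullet> \<alpha>))" by (simp add: rho_def inner_sum_right)
  also have "\<dots> \<ge> 0" using assms m_nonneg Sp_S
    by (intro sum_nonneg mult_nonneg_nonneg) (auto simp: dom_iff dominant_def inner_commute)
  finally show ?thesis by (simp add: theta_eq)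
qed

text \<open>The saturated weight set with highest weight \<open>l\<close>; by
  \<open>string_X\<close> it is closed under root strings, so the operators act on the span of its
  characters.\<close>

definition X :: "'a \<Rightarrow> 'a set" where "X l = (\<Union>\<mu>\<in>low l. orb \<mu>)"

lemma finite_X: "finite (X l)" using finite_low finite_orb by (simp add: X_def)

lemma X_Lam: "\<nu> \<in> X l \<Longrightarrow> \<nu> \<in> Lam" unfolding X_def using orb_Lam dom_Lam low_dom by blast

lemma X_weyl: "w \<in> W \<Longrightarrow> \<nu> \<in> X l \<Longrightarrow> w \<nu> \<in> X l" using weyl_orb by (auto simp: X_def)

text \<open>Along a string the squared norm is a convex parabola in \<open>j\<close> with equal
  values at 0 and \<open>lev \<nu> \<alpha>\<close>, so interior points are strictly
  shorter.\<close>

lemma string_norm: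
  assumes "\<nu> \<in> Lam" "\<alpha> \<in> S"
  shows "(norm (str \<nu> \<alpha> j))\<^sup>2 = (norm \<nu>)\<^sup>2 - 4 * of_int (j * (lev \<nu> \<alpha> - j)) * (\<alpha> \<bullet> \<alpha>)"
  by (simp add: power2_norm_eq_inner inner_diff_left inner_diff_right inner_commute[of \<alpha> \<nu>] lev[OF assms] algebra_simps)

lemma string_norm_less:
  assumes "\<nu> \<in> Lam" "\<alpha> \<in> S" "0 < j \<and> j < lev \<nu> \<alpha> \<or> lev \<nu> \<alpha> < j \<and> j < 0"
  shows "norm (str \<nu> \<alpha> j) < norm \<nu>"
proof -
  have "j * (lev \<nu> \<alpha> - j) > 0" using assms(3) by (auto intro: mult_pos_pos mult_neg_neg)
  then have "4 * of_int (j * (lev \<nu> \<alpha> - j)) * (\<alpha> \<bullet> \<alpha>) > 0" using S_nz[OF assms(2)]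
    by (intro mult_pos_pos) (auto simp del: of_int_mult)
  then have "(norm (str \<nu> \<alpha> j))\<^sup>2 < (norm \<nu>)\<^sup>2" unfolding string_norm[OF assms(1,2)] by linarith
  then show ?thesis by (simp add: power_less_imp_less_base)
qed

text \<open>Let \<open>u\<close> make the interior string point dominant. According to the sign of
  the root \<open>u \<alpha>\<close>, the result lies below \<open>u \<nu>\<close> or below the
  image under \<open>u\<close> of the reflected weight, and both are below \<mu> as members of its
  orbit. Negative strings are positive ones for -\<alpha>.\<close>

lemma string_low:
  assumes \<mu>: "\<mu> \<in> Dom" "\<nu> \<in> orb \<mu>" "\<alpha> \<in> S" "0 < j \<and> j < lev \<nu> \<alpha> \<or> lev \<nu> \<alpha> < j \<and> j < 0"
  shows "\<exists>\<mu>'\<in>low \<mu>. str \<nu> \<alpha> j \<in> orb \<mu>'"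
proof -
  have L: "\<nu> \<in> Lam" using \<mu> orb_Lam dom_Lam by blast
  have pos: "\<exists>\<mu>'\<in>low \<mu>. str \<nu> \<alpha> j \<in> orb \<mu>'" if a: "\<alpha> \<in> S" "0 < j" "j < lev \<nu> \<alpha>" for \<alpha> j
  proof -
    let ?k = "str \<nu> \<alpha> j"
    obtain \<mu>' where m': "\<mu>' \<in> Dom" "?k \<in> orb \<mu>'" using ex_dom Lam_string[OF L a(1)] by blast
    then obtain u where u: "u \<in> W" "\<mu>' = u ?k" using orb_weyl[OF m'(2)] orb_self[of \<mu>'] by (auto simp: orb_def)
    have lin: "linear u" using u weyl_linear by blast
    have uaS: "u \<alpha> \<in> S" using u a weyl_S by blast
    then have "root_le Sp \<mu>' \<mu>"
    proof (cases rule: S_cases)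
      case 1
      have "u \<nu> = \<mu>' + real (nat (2 * j)) *\<^sub>R u \<alpha>"
        using a(2) u(2) by (simp add: linear_diff[OF lin] linear_scale[OF lin])
      then have "root_le Sp \<mu>' (u \<nu>)" using root_le_add[OF 1(1)] by metis
      moreover have "root_le Sp (u \<nu>) \<mu>" using root_le_orb \<mu> weyl_orb u by blast
      ultimately show ?thesis using root_le_trans by blast
    next
      case 2
      let ?r = "refl_root \<alpha> \<nu>"
      have "u ?r = \<mu>' + real (nat (2 * (lev \<nu> \<alpha> - j))) *\<^sub>R (- u \<alpha>)"
        using a(3) u(2) unfolding refl_string[OF L a(1)]
        by (simp add: linear_diff[OF lin] linear_scale[OF lin] algebra_simps)
      then have "root_le Sp \<mu>' (u ?r)" using root_le_add[OF 2(1)] by metis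
      moreover have "root_le Sp (u ?r) \<mu>" using root_le_orb \<mu> weyl_orb u weyl_refl a(1) by blast
      ultimately show ?thesis using root_le_trans by blast
    qed
    then show ?thesis using m' by (auto simp: low_def)
  qed
  show ?thesis
  proof (cases "0 < j")
    case True
    then show ?thesis using pos[of \<alpha> j] \<mu> by auto
  next
    case False
    have "lev \<nu> (- \<alpha>) = - lev \<nu> \<alpha>"
      using lev[OF L \<mu>(3)] by (intro lev_unique) (auto simp: uminus_S \<mu>)
    then show ?thesis using pos[of "- \<alpha>" "- j"] False \<mu> uminus_S by auto
  qed
qed

lemma string_X:
  assumes "\<nu> \<in> X l" "\<alpha> \<in> S" "0 \<le> j \<and> j \<le> lev \<nu> \<alpha> \<or> lev \<nu> \<alpha> \<le> j \<and> j \<le> 0"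
  shows "str \<nu> \<alpha> j \<in> X l"
proof -
  obtain \<mu> where mu: "\<mu> \<in> low l" "\<nu> \<in> orb \<mu>" using assms by (auto simp: X_def)
  consider "j = 0" | "j = lev \<nu> \<alpha>" | "0 < j \<and> j < lev \<nu> \<alpha> \<or> lev \<nu> \<alpha> < j \<and> j < 0" using assms(3) by linarith
  then show ?thesis
  proof cases
    case 1
    then show ?thesis using assms by simp
  next
    case 2
    then show ?thesis using refl_string[OF X_Lam[OF assms(1)] assms(2)] X_weyl[OF weyl_refl[OF assms(2)] assms(1)] by simp
  next
    case 3
    then show ?thesis using string_low[OF low_dom[OF mu(1)] mu(2) assms(2) 3] low_trans mu(1) by (auto simp: X_def)
  qed
qed

end

section \<open>Triangular matrices\<close>

text \<open>Back substitution from \<open>l\<close> downwards, written as a well-founded recursion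
  along \<open>R\<close>. It is a left eigenvector because \<open>c\<close> is the coefficient
  vector of a function expanded in the basis on which the operator acts by rows.\<close>

lemma triangular_eigenvector:
  fixes A :: "'b \<Rightarrow> 'b \<Rightarrow> real"
  assumes fin: "finite X" and lX: "l \<in> X"
    and irr: "\<And>x. \<not> lt x x" and tr: "\<And>x y z. lt x y \<Longrightarrow> lt y z \<Longrightarrow> lt x z"
    and tri: "\<And>x y. x \<in> X \<Longrightarrow> y \<in> X \<Longrightarrow> x \<noteq> y \<Longrightarrow> A x y \<noteq> 0 \<Longrightarrow> lt y x"
    and ne: "\<And>y. y \<in> X \<Longrightarrow> lt y l \<Longrightarrow> A y y \<noteq> A l l"
  obtains c where "c l = 1" "\<And>y. y \<in> X \<Longrightarrow> (\<Sum>x\<in>X. c x * A x y) = A l l * c y"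
    "\<And>y. c y \<noteq> 0 \<Longrightarrow> y = l \<or> lt y l"
proof -
  define R where "R = {(x, y). x \<in> X \<and> y \<in> X \<and> lt y x}"
  have "wf R"
  proof (rule finite_acyclic_wf)
    show "finite R" by (rule finite_subset[of _ "X \<times> X"]) (use fin in \<open>auto simp: R_def\<close>)
    have "(x, y) \<in> R\<^sup>+ \<Longrightarrow> lt y x" for x y
      by (induction rule: trancl_induct) (auto simp: R_def intro: tr)
    then show "acyclic R" using irr by (auto simp: acyclic_def)
  qed
  define H where "H f y = (if y = l then 1 else if y \<in> X \<and> lt y l
     then (\<Sum>x\<in>{x\<in>X. lt y x}. f x * A x y) / (A l l - A y y) else 0)" for f y
  define c where "c = wfrec R H"
  have c: "c y = H c y" for y
  proof -
    have "c y = H (cut c R y) y" unfolding c_def by (rule wfrec[OF \<open>wf R\<close>])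
    also have "\<dots> = H c y"
      unfolding H_def by (auto intro!: arg_cong2[where f = "(/)"] sum.cong simp: cut_apply R_def)
    finally show ?thesis .
  qed
  have supp: "y = l \<or> lt y l" if "c y \<noteq> 0" for y
    using that unfolding c[of y] H_def by (auto split: if_splits)
  show ?thesis
  proof
    show "c l = 1" by (simp add: c[of l] H_def)
    show "c y \<noteq> 0 \<Longrightarrow> y = l \<or> lt y l" for y by (rule supp)
    fix y assume y: "y \<in> X"
    let ?U = "{x\<in>X. lt y x}"
    have "(\<Sum>x\<in>X. c x * A x y) = (\<Sum>x\<in>insert y ?U. c x * A x y)"
      by (rule sum.mono_neutral_right) (use fin y tri in auto)
    also have "\<dots> = c y * A y y + (\<Sum>x\<in>?U. c x * A x y)"
      using fin irr by (subst sum.insert) auto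
    also have "\<dots> = A l l * c y"
    proof -
      consider "y = l" | "y \<noteq> l" "lt y l" | "y \<noteq> l" "\<not> lt y l" by blast
      then show ?thesis
      proof cases
        case 1
        have "c x = 0" if "x \<in> ?U" for x using supp[of x] that 1 tr irr by blast
        then show ?thesis using 1 by simp
      next
        case 2
        then have "c y * (A l l - A y y) = (\<Sum>x\<in>?U. c x * A x y)"
          using c[of y] ne[OF y] y by (simp add: H_def)
        then show ?thesis by (simp add: algebra_simps)
      next
        case 3
        have "c x = 0" if "x \<in> ?U" for x using supp[of x] that 3 tr by blast
        moreover have "c y = 0" using supp 3 by blast
        ultimately show ?thesis by simp
      qed
    qed
    finally show "(\<Sum>x\<in>X. c x * A x y) = A l l * c y" .
  qed
qed

text \<open>The counterpart for right eigenvectors, solved upwards from the minimal indices: at each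
  stage only the diagonal term is left, and the diagonal avoids \<open>a\<close>. It is applied to
  vectors of inner products.\<close>

lemma triangular_kernel:
  fixes A :: "'b \<Rightarrow> 'b \<Rightarrow> real" and g :: "'b \<Rightarrow> complex"
  assumes fin: "finite Y"
    and irr: "\<And>x. \<not> lt x x" and tr: "\<And>x y z. lt x y \<Longrightarrow> lt y z \<Longrightarrow> lt x z"
    and tri: "\<And>x y. x \<in> Y \<Longrightarrow> y \<in> Y \<Longrightarrow> x \<noteq> y \<Longrightarrow> A x y \<noteq> 0 \<Longrightarrow> lt y x"
    and ne: "\<And>y. y \<in> Y \<Longrightarrow> A y y \<noteq> a"
    and eq: "\<And>x. x \<in> Y \<Longrightarrow> of_real a * g x = (\<Sum>y\<in>Y. of_real (A x y) * g y)"
    and x: "x \<in> Y"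
  shows "g x = 0"
  using x
proof (induction "card {y\<in>Y. lt y x}" arbitrary: x rule: less_induct)
  case less
  have z: "of_real (A x y) * g y = 0" if y: "y \<in> Y - {x}" for y
  proof (cases "A x y = 0")
    case False
    then have l: "lt y x" using tri[of x y] y less.prems by auto
    then have "{z\<in>Y. lt z y} \<subset> {z\<in>Y. lt z x}" using y tr irr by blast
    then have "card {z\<in>Y. lt z y} < card {z\<in>Y. lt z x}" using fin by (intro psubset_card_mono) auto
    then show ?thesis using less.hyps y by simp
  qed simp
  have "of_real a * g x = of_real (A x x) * g x"
    unfolding eq[OF less.prems] sum.remove[OF fin less.prems] by (subst sum.neutral) (use z in auto)
  then show ?case using ne[OF less.prems] by auto
qed

lemma ssum_expand:
  fixes f :: "'b \<Rightarrow> complex"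
  assumes "finite X" "\<And>j. a \<le> j \<and> j < b \<or> b \<le> j \<and> j < a \<Longrightarrow> s j \<in> X"
  shows "ssum (\<lambda>j. f (s j)) a b = (\<Sum>\<kappa>\<in>X. of_real (ssum (\<lambda>j. of_bool (\<kappa> = s j)) a b) * f \<kappa>)"
proof -
  have *: "(\<Sum>j\<in>J. f (s j)) = (\<Sum>\<kappa>\<in>X. of_real (\<Sum>j\<in>J. of_bool (\<kappa> = s j)) * f \<kappa>)" if J: "\<And>j. j \<in> J \<Longrightarrow> s j \<in> X" for J :: "int set"
  proof -
    have "f (s j) = (\<Sum>\<kappa>\<in>X. of_bool (\<kappa> = s j) * f \<kappa>)" if "j \<in> J" for j
      using J[OF that] assms(1) by (simp add: sum.remove[of X "s j"])
    then have "(\<Sum>j\<in>J. f (s j)) = (\<Sum>j\<in>J. \<Sum>\<kappa>\<in>X. of_bool (\<kappa> = s j) * f \<kappa>)" by simp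
    also have "\<dots> = (\<Sum>\<kappa>\<in>X. \<Sum>j\<in>J. of_bool (\<kappa> = s j) * f \<kappa>)" by (rule sum.swap)
    also have "\<dots> = (\<Sum>\<kappa>\<in>X. of_real (\<Sum>j\<in>J. of_bool (\<kappa> = s j)) * f \<kappa>)"
      by (auto simp: sum_distrib_right of_bool_def intro!: sum.cong)
    finally show ?thesis .
  qed
  show ?thesis
    using *[of "{a..<b}"] *[of "{b..<a}"] assms(2) by (auto simp: ssum_def sum_negf)
qed

context root_data
begin

section \<open>Symmetry of the Cherednik operators and of the Laplacian\<close>

lemma ip_add_left:
  assumes "continuous_on UNIV f" "continuous_on UNIV g" "continuous_on UNIV h"
  shows "ip (\<lambda>x. f x + g x) h = ip f h + ip g h"
proof -
  have "ip (\<lambda>x. f x + g x) h = (LINT x:K|lborel. f x * cnj (h x) * of_real (wt x) + g x * cnj (h x) * of_real (wt x))"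
    by (simp add: ip_def algebra_simps)
  also have "\<dots> = ip f h + ip g h" unfolding ip_def by (intro set_integral_add ip_integrable assms)
  finally show ?thesis .
qed

lemma ip_cmult_left: "ip (\<lambda>x. c * f x) h = c * ip f h"
proof -
  have "c * f x * cnj (h x) * of_real (wt x) = c * (f x * cnj (h x) * of_real (wt x))" for x by (simp add: mult_ac)
  then show ?thesis by (simp only: ip_def set_integral_mult_right)
qed

lemma ip_add_right:
  assumes "continuous_on UNIV f" "continuous_on UNIV g" "continuous_on UNIV h"
  shows "ip h (\<lambda>x. f x + g x) = ip h f + ip h g"
  unfolding ip_cnj[of h] ip_add_left[OF assms] by simp

lemma ip_cmult_right: "ip h (\<lambda>x. c * f x) = cnj c * ip h f"
  unfolding ip_cnj[of h] ip_cmult_left by simp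

lemma ip_ssum_left: "ip (\<lambda>x. ssum (\<lambda>j. chr (s j) x) a b) (chr \<kappa>) = ssum (\<lambda>j. I (s j - \<kappa>)) a b"
proof -
  have "ssum (\<lambda>j. chr (s j) x) a b * cnj (chr \<kappa> x) * of_real (wt x) = ssum (\<lambda>j. chr (s j - \<kappa>) x * of_real (wt x)) a b" for x
    using ssum_hom[of "\<lambda>z. z * cnj (chr \<kappa> x) * of_real (wt x)" "\<lambda>j. chr (s j) x" a b]
    by (simp add: distrib_right chr_mult_cnj)
  then show ?thesis unfolding I_def ip_def
    by (simp add: set_integral_ssum set_integrable_K continuous_intros continuous_chr continuous_wt)
qed

lemma cnj_I: "cnj (I \<nu>) = I (- \<nu>)"
  using ip_cnj[of "chr 0" "chr \<nu>"] ip_chr[of \<nu> 0] ip_chr[of 0 \<nu>] by simp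

lemma ip_ssum_right: "ip (chr \<kappa>) (\<lambda>x. ssum (\<lambda>j. chr (s j) x) a b) = ssum (\<lambda>j. I (\<kappa> - s j)) a b"
  unfolding ip_cnj[of "chr \<kappa>"] ip_ssum_left by (simp add: ssum_hom[of cnj] cnj_I)

text \<open>Reflecting the argument of \<open>I\<close> carries the \<kappa>-string to the part of
  the string of \<nu> - \<kappa> beyond its own far end. Thus the \<nu>-string is the string of the
  difference followed by the \<kappa>-string.\<close>

lemma I_shift:
  assumes "\<nu> \<in> Lam" "\<kappa> \<in> Lam" "\<alpha> \<in> S"
  shows "ssum (\<lambda>j. I (str (\<nu> - \<kappa>) \<alpha> j)) (lev (\<nu> - \<kappa>) \<alpha> + 1) (lev \<nu> \<alpha> + 1)
    = ssum (\<lambda>j. I (\<nu> - str \<kappa> \<alpha> j)) 1 (lev \<kappa> \<alpha> + 1)"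
proof -
  let ?t = "\<nu> - \<kappa>"
  have t: "?t \<in> Lam" using assms Lam_diff by blast
  have "I (\<nu> - str \<kappa> \<alpha> j) = I (str ?t \<alpha> (j + lev ?t \<alpha>))" for j
  proof -
    have "refl_root \<alpha> (\<nu> - str \<kappa> \<alpha> j) = refl_root \<alpha> (?t + (2 * of_int j) *\<^sub>R \<alpha>)" by (simp add: algebra_simps)
    also have "\<dots> = refl_root \<alpha> ?t - (2 * of_int j) *\<^sub>R \<alpha>"
      using refl_root_self[OF S_nz[OF assms(3)]]
      by (simp add: linear_add[OF linear_refl_root] linear_scale[OF linear_refl_root])
    also have "\<dots> = str ?t \<alpha> (j + lev ?t \<alpha>)"
      unfolding refl_string[OF t assms(3)] by (simp add: algebra_simps)
    finally show ?thesis using I_weyl[OF weyl_refl[OF assms(3)], of "\<nu> - str \<kappa> \<alpha> j"] by simp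
  qed
  then have "ssum (\<lambda>j. I (\<nu> - str \<kappa> \<alpha> j)) 1 (lev \<kappa> \<alpha> + 1)
    = ssum (\<lambda>j. I (str ?t \<alpha> j)) (1 + lev ?t \<alpha>) (lev \<kappa> \<alpha> + 1 + lev ?t \<alpha>)"
    using ssum_shift[of "\<lambda>j. I (str ?t \<alpha> j)" "lev ?t \<alpha>" 1 "lev \<kappa> \<alpha> + 1"] by simp
  then show ?thesis using lev_diff[OF assms] by (simp add: add.commute)
qed

text \<open>The Cherednik operator in direction \<eta> on a character, without its constant shift by
  \<rho>. Since strings start at \<open>j = 1\<close>, the diagonal entry at a dominant weight is
  its pairing with \<eta>.\<close>

definition Tc :: "'a \<Rightarrow> 'a \<Rightarrow> 'a \<Rightarrow> complex" where
  "Tc \<eta> \<nu> x = of_real (\<nu> \<bullet> \<eta>) * chr \<nu> x + (\<Sum>\<alpha>\<in>Sp. of_real (m \<alpha> * (\<alpha> \<bullet> \<eta>)) * Cs \<alpha> \<nu> x)"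

lemma continuous_Tc: "continuous_on A (Tc \<eta> \<nu>)"
  unfolding Tc_def[abs_def] by (intro continuous_intros continuous_chr continuous_Cs)

text \<open>By \<open>I_shift\<close> the two sides differ exactly by the relation
  \<open>integration_by_parts\<close> at \<nu> - \<kappa>.\<close>

lemma Tc_symmetric:
  assumes "\<nu> \<in> Lam" "\<kappa> \<in> Lam"
  shows "ip (Tc \<eta> \<nu>) (chr \<kappa>) = ip (chr \<nu>) (Tc \<eta> \<kappa>)"
proof -
  let ?t = "\<nu> - \<kappa>"
  let ?J = "\<lambda>\<alpha> j. I (str ?t \<alpha> j)"
  have t: "?t \<in> Lam" using assms Lam_diff by blast
  have str: "str \<nu> \<alpha> j - \<kappa> = str ?t \<alpha> j" for \<alpha> j by (simp add: algebra_simps)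
  have l: "ip (Tc \<eta> \<nu>) (chr \<kappa>) = of_real (\<nu> \<bullet> \<eta>) * I ?t
     + (\<Sum>\<alpha>\<in>Sp. of_real (m \<alpha> * (\<alpha> \<bullet> \<eta>)) * ssum (?J \<alpha>) 1 (lev \<nu> \<alpha> + 1))"
    unfolding Tc_def
    by (subst ip_add_left)
       (auto intro!: continuous_intros continuous_chr continuous_Cs
         simp: ip_cmult_left ip_chr ip_sum_left continuous_Cs continuous_chr Cs_def[abs_def] ip_ssum_left str ssum_continuous)
  have r: "ip (chr \<nu>) (Tc \<eta> \<kappa>) = of_real (\<kappa> \<bullet> \<eta>) * I ?t
     + (\<Sum>\<alpha>\<in>Sp. of_real (m \<alpha> * (\<alpha> \<bullet> \<eta>)) * ssum (\<lambda>j. I (\<nu> - str \<kappa> \<alpha> j)) 1 (lev \<kappa> \<alpha> + 1))"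
    unfolding Tc_def
    by (subst ip_add_right)
       (auto intro!: continuous_intros continuous_chr continuous_Cs
         simp: ip_cmult_right ip_chr ip_sum_right continuous_Cs continuous_chr Cs_def[abs_def] ip_ssum_right ssum_continuous)
  have "ssum (?J \<alpha>) 1 (lev \<nu> \<alpha> + 1) = ssum (?J \<alpha>) 1 (lev ?t \<alpha> + 1) + ssum (\<lambda>j. I (\<nu> - str \<kappa> \<alpha> j)) 1 (lev \<kappa> \<alpha> + 1)"
    if "\<alpha> \<in> Sp" for \<alpha>
    unfolding I_shift[OF assms Sp_S[OF that], symmetric] by (simp add: ssum_add)
  then have "ip (Tc \<eta> \<nu>) (chr \<kappa>) - ip (chr \<nu>) (Tc \<eta> \<kappa>) = of_real (?t \<bullet> \<eta>) * I ?t
     + (\<Sum>\<alpha>\<in>Sp. of_real (m \<alpha> * (\<alpha> \<bullet> \<eta>)) * ssum (?J \<alpha>) 1 (lev ?t \<alpha> + 1))"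
    unfolding l r by (simp add: inner_diff_left algebra_simps sum.distrib)
  also have "\<dots> = 0" by (rule integration_by_parts[OF t])
  finally show ?thesis by simp
qed

text \<open>Not \<open>L_m\<close> of a character, which would be singular on walls: only the orbit
  sum \<open>LM\<close> is \<open>L_m\<close> of the orbit sum, by \<open>LM_regular\<close>. The
  strings here include \<open>j = 0\<close>.\<close>

definition Le :: "'a \<Rightarrow> 'a \<Rightarrow> complex" where
  "Le \<nu> x = - of_real ((norm \<nu>)\<^sup>2) * chr \<nu> x - (\<Sum>\<alpha>\<in>Sp. of_real (m \<alpha> * (\<nu> \<bullet> \<alpha>)) * (Cs \<alpha> \<nu> x + chr \<nu> x))"

definition LM :: "'a \<Rightarrow> 'a \<Rightarrow> complex" where "LM l x = (\<Sum>\<nu>\<in>orb l. Le \<nu> x)"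

lemma continuous_Le: "continuous_on A (Le \<nu>)"
  unfolding Le_def[abs_def] by (intro continuous_intros continuous_chr continuous_Cs)

lemma continuous_LM: "continuous_on A (LM l)"
  unfolding LM_def[abs_def] by (intro continuous_intros continuous_Le)

lemma Cs_plus_chr: "Cs \<alpha> \<nu> x + chr \<nu> x = ssum (\<lambda>j. chr (str \<nu> \<alpha> j) x) 0 (lev \<nu> \<alpha> + 1)"
  using ssum_add[of "\<lambda>j. chr (str \<nu> \<alpha> j) x" 0 1 "lev \<nu> \<alpha> + 1"] ssum_Suc[of "\<lambda>j. chr (str \<nu> \<alpha> j) x" 0 0]
  by (simp add: Cs_def ssum_def[of _ 0 0] add.commute)

text \<open>The right side is minus the Dirichlet form, the weighted integral of products of
  gradients. With direction \<nu> in \<open>integration_by_parts\<close> there remain the sums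
  \<open>U\<close>, which are even under the reflection in \<alpha> while \<nu> . \<alpha> is odd,
  so they cancel over the orbit.\<close>

lemma LM_form:
  assumes "l \<in> Lam" "\<mu> \<in> Lam"
  shows "ip (LM l) (M \<mu>) = - (\<Sum>\<kappa>\<in>orb \<mu>. \<Sum>\<nu>\<in>orb l. of_real (\<nu> \<bullet> \<kappa>) * I (\<nu> - \<kappa>))"
proof -
  have key: "(\<Sum>\<nu>\<in>orb l. ip (Le \<nu>) (chr \<kappa>) + of_real (\<nu> \<bullet> \<kappa>) * I (\<nu> - \<kappa>)) = 0" if "\<kappa> \<in> orb \<mu>" for \<kappa>
  proof -
    have k: "\<kappa> \<in> Lam" using that orb_Lam assms by blast
    define U where "U \<alpha> \<nu> = ssum (\<lambda>j. I (\<nu> - str \<kappa> \<alpha> j)) 0 (lev \<kappa> \<alpha> + 1)" for \<alpha> \<nu>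
    have "ip (Le \<nu>) (chr \<kappa>) + of_real (\<nu> \<bullet> \<kappa>) * I (\<nu> - \<kappa>)
        = - (\<Sum>\<alpha>\<in>Sp. of_real (m \<alpha> * (\<nu> \<bullet> \<alpha>)) * U \<alpha> \<nu>)" if "\<nu> \<in> orb l" for \<nu>
    proof -
      have n: "\<nu> \<in> Lam" using that orb_Lam assms by blast
      let ?t = "\<nu> - \<kappa>"
      let ?J = "\<lambda>\<alpha> j. I (str ?t \<alpha> j)"
      have str: "str \<nu> \<alpha> j - \<kappa> = str ?t \<alpha> j" for \<alpha> j by (simp add: algebra_simps)
      have "Le \<nu> = (\<lambda>x. (- of_real ((norm \<nu>)\<^sup>2)) * chr \<nu> x
          + (\<Sum>\<alpha>\<in>Sp. (- of_real (m \<alpha> * (\<nu> \<bullet> \<alpha>))) * ssum (\<lambda>j. chr (str \<nu> \<alpha> j) x) 0 (lev \<nu> \<alpha> + 1)))"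
        by (simp add: fun_eq_iff Le_def Cs_plus_chr sum_negf)
      then have e1: "ip (Le \<nu>) (chr \<kappa>) = - of_real ((norm \<nu>)\<^sup>2) * I ?t
         + (\<Sum>\<alpha>\<in>Sp. - of_real (m \<alpha> * (\<nu> \<bullet> \<alpha>)) * ssum (?J \<alpha>) 0 (lev \<nu> \<alpha> + 1))"
        by (simp only:) (subst ip_add_left,
           auto intro!: continuous_intros continuous_chr ssum_continuous
             simp only: ip_cmult_left ip_chr ip_sum_left continuous_chr ip_ssum_left str ssum_continuous)
      have e2: "ssum (?J \<alpha>) 0 (lev \<nu> \<alpha> + 1) = ssum (?J \<alpha>) 1 (lev ?t \<alpha> + 1) + U \<alpha> \<nu>" if "\<alpha> \<in> Sp" for \<alpha>
      proof -
        have "U \<alpha> \<nu> = I ?t + ssum (\<lambda>j. I (\<nu> - str \<kappa> \<alpha> j)) 1 (lev \<kappa> \<alpha> + 1)"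
          unfolding U_def using ssum_add[of "\<lambda>j. I (\<nu> - str \<kappa> \<alpha> j)" 0 1 "lev \<kappa> \<alpha> + 1"]
            ssum_Suc[of "\<lambda>j. I (\<nu> - str \<kappa> \<alpha> j)" 0 0] by (simp add: ssum_def[of _ 0 0])
        moreover have "ssum (?J \<alpha>) 0 (lev \<nu> \<alpha> + 1) = I ?t + ssum (?J \<alpha>) 1 (lev \<nu> \<alpha> + 1)"
          using ssum_add[of "?J \<alpha>" 0 1 "lev \<nu> \<alpha> + 1"] ssum_Suc[of "?J \<alpha>" 0 0] by (simp add: ssum_def[of _ 0 0])
        ultimately show ?thesis
          unfolding I_shift[OF n k Sp_S[OF that], symmetric]
          using ssum_add[of "?J \<alpha>" 1 "lev ?t \<alpha> + 1" "lev \<nu> \<alpha> + 1"] by simp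
      qed
      have e3: "of_real (?t \<bullet> \<nu>) * I ?t
        + (\<Sum>\<alpha>\<in>Sp. of_real (m \<alpha> * (\<alpha> \<bullet> \<nu>)) * ssum (?J \<alpha>) 1 (lev ?t \<alpha> + 1)) = 0"
        by (rule integration_by_parts) (use n k Lam_diff in blast)
      define b where "b = (\<Sum>\<alpha>\<in>Sp. of_real (m \<alpha> * (\<alpha> \<bullet> \<nu>)) * ssum (?J \<alpha>) 1 (lev ?t \<alpha> + 1))"
      have "(\<Sum>\<alpha>\<in>Sp. - of_real (m \<alpha> * (\<nu> \<bullet> \<alpha>)) * ssum (?J \<alpha>) 0 (lev \<nu> \<alpha> + 1))
         = (\<Sum>\<alpha>\<in>Sp. - (of_real (m \<alpha> * (\<nu> \<bullet> \<alpha>)) * U \<alpha> \<nu>) - of_real (m \<alpha> * (\<alpha> \<bullet> \<nu>)) * ssum (?J \<alpha>) 1 (lev ?t \<alpha> + 1))"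
        by (rule sum.cong[OF refl]) (simp only: e2 inner_commute[of \<nu>] ring_distribs, simp)
      then have e4: "(\<Sum>\<alpha>\<in>Sp. - of_real (m \<alpha> * (\<nu> \<bullet> \<alpha>)) * ssum (?J \<alpha>) 0 (lev \<nu> \<alpha> + 1))
         = - (\<Sum>\<alpha>\<in>Sp. of_real (m \<alpha> * (\<nu> \<bullet> \<alpha>)) * U \<alpha> \<nu>) - b"
        unfolding b_def sum_subtractf sum_negf .
      have t: "?t \<bullet> \<nu> = (norm \<nu>)\<^sup>2 - \<nu> \<bullet> \<kappa>"
        by (simp add: inner_diff_left inner_diff_right power2_norm_eq_inner inner_commute)
      show ?thesis using e3 unfolding e1 e4 b_def[symmetric] t by (simp add: algebra_simps)
    qed
    then have "(\<Sum>\<nu>\<in>orb l. ip (Le \<nu>) (chr \<kappa>) + of_real (\<nu> \<bullet> \<kappa>) * I (\<nu> - \<kappa>))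
       = - (\<Sum>\<alpha>\<in>Sp. of_real (m \<alpha>) * (\<Sum>\<nu>\<in>orb l. of_real (\<nu> \<bullet> \<alpha>) * U \<alpha> \<nu>))"
      by (simp add: sum_negf sum_distrib_left mult.assoc) (rule sum.swap)
    moreover have "(\<Sum>\<nu>\<in>orb l. of_real (\<nu> \<bullet> \<alpha>) * U \<alpha> \<nu>) = 0" if a: "\<alpha> \<in> Sp" for \<alpha>
    proof -
      have aS: "\<alpha> \<in> S" using a Sp_S by blast
      have U: "U \<alpha> (refl_root \<alpha> \<nu>) = U \<alpha> \<nu>" for \<nu>
      proof -
        have "I (refl_root \<alpha> \<nu> - str \<kappa> \<alpha> j) = I (\<nu> - str \<kappa> \<alpha> (lev \<kappa> \<alpha> - j))" for j
        proof -
          have "refl_root \<alpha> (refl_root \<alpha> \<nu> - str \<kappa> \<alpha> j) = \<nu> - (refl_root \<alpha> \<kappa> + (2 * of_int j) *\<^sub>R \<alpha>)"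
            using refl_root_self[OF S_nz[OF aS]]
            by (simp add: linear_diff[OF linear_refl_root] linear_scale[OF linear_refl_root])
          also have "\<dots> = \<nu> - str \<kappa> \<alpha> (lev \<kappa> \<alpha> - j)"
            unfolding refl_string[OF k aS] by (simp add: algebra_simps)
          finally show ?thesis using I_weyl[OF weyl_refl[OF aS], of "refl_root \<alpha> \<nu> - str \<kappa> \<alpha> j"] by simp
        qed
        then show ?thesis unfolding U_def
          using ssum_reflect[of "\<lambda>j. I (\<nu> - str \<kappa> \<alpha> j)" "lev \<kappa> \<alpha>" 0 "lev \<kappa> \<alpha> + 1"] by simp
      qed
      have "(\<Sum>\<nu>\<in>orb l. of_real (\<nu> \<bullet> \<alpha>) * U \<alpha> \<nu>) = (\<Sum>\<nu>\<in>orb l. of_real (refl_root \<alpha> \<nu> \<bullet> \<alpha>) * U \<alpha> (refl_root \<alpha> \<nu>))"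
        by (rule sum_orb_weyl[OF weyl_refl[OF aS], symmetric])
      also have "\<dots> = - (\<Sum>\<nu>\<in>orb l. of_real (\<nu> \<bullet> \<alpha>) * U \<alpha> \<nu>)"
        using refl_root_self[OF S_nz[OF aS]] by (simp add: U refl_root_inner_commute sum_negf)
      finally show ?thesis by simp
    qed
    ultimately show ?thesis by simp
  qed
  have "M \<mu> = (\<lambda>x. \<Sum>\<kappa>\<in>orb \<mu>. 1 * chr \<kappa> x)" by (simp add: fun_eq_iff M_eq)
  then have "ip (LM l) (M \<mu>) = (\<Sum>\<kappa>\<in>orb \<mu>. ip (LM l) (chr \<kappa>))"
    using ip_sum_right[of "orb \<mu>" chr "LM l" "\<lambda>_. 1", OF continuous_chr continuous_LM] by simp
  also have "\<dots> = (\<Sum>\<kappa>\<in>orb \<mu>. \<Sum>\<nu>\<in>orb l. ip (Le \<nu>) (chr \<kappa>))"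
    using ip_sum_left[of "orb l" Le _ "\<lambda>_. 1", OF continuous_Le continuous_chr] by (simp add: LM_def[abs_def])
  also have "\<dots> = (\<Sum>\<kappa>\<in>orb \<mu>. - (\<Sum>\<nu>\<in>orb l. of_real (\<nu> \<bullet> \<kappa>) * I (\<nu> - \<kappa>)))"
    using key by (intro sum.cong refl) (simp add: sum.distrib eq_neg_iff_add_eq_0)
  finally show ?thesis by (simp add: sum_negf)
qed

lemma LM_symmetric:
  assumes "l \<in> Lam" "\<mu> \<in> Lam"
  shows "ip (LM l) (M \<mu>) = ip (M l) (LM \<mu>)"
proof -
  have "ip (M l) (LM \<mu>) = cnj (ip (LM \<mu>) (M l))" by (rule ip_cnj)
  also have "\<dots> = - (\<Sum>\<nu>\<in>orb l. \<Sum>\<kappa>\<in>orb \<mu>. of_real (\<nu> \<bullet> \<kappa>) * I (\<nu> - \<kappa>))"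
    unfolding LM_form[OF assms(2,1)] by (simp add: cnj_I inner_commute)
  also have "\<dots> = ip (LM l) (M \<mu>)" unfolding LM_form[OF assms] by (subst sum.swap) simp
  finally show ?thesis ..
qed

section \<open>Triangularity of the Laplacian\<close>

text \<open>Shows that the pole of the cotangent term is removable on orbit sums: as \<nu> .
  \<alpha> changes sign under the reflection, pairing \<nu> with its reflection brings in
  \<open>Cs_identity\<close>.\<close>

lemma wall_identity:
  assumes "l \<in> Lam" "\<alpha> \<in> S"
  shows "of_real (cos (\<alpha> \<bullet> x)) * (\<Sum>\<nu>\<in>orb l. \<i> * of_real (\<nu> \<bullet> \<alpha>) * chr \<nu> x)
    = - of_real (sin (\<alpha> \<bullet> x)) * (\<Sum>\<nu>\<in>orb l. of_real (\<nu> \<bullet> \<alpha>) * (Cs \<alpha> \<nu> x + chr \<nu> x))"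
proof -
  define s where "s = (\<Sum>\<nu>\<in>orb l. of_real (\<nu> \<bullet> \<alpha>) * chr \<nu> x)"
  define d where "d = (\<Sum>\<nu>\<in>orb l. of_real (\<nu> \<bullet> \<alpha>) * Cs \<alpha> \<nu> x)"
  define t where "t = (\<Sum>\<nu>\<in>orb l. of_real (\<nu> \<bullet> \<alpha>) * chr (refl_root \<alpha> \<nu>) x)"
  have "(\<Sum>\<nu>\<in>orb l. of_real (refl_root \<alpha> \<nu> \<bullet> \<alpha>) * chr (refl_root \<alpha> \<nu>) x) = s"
    unfolding s_def by (rule sum_orb_weyl[OF weyl_refl[OF assms(2)]])
  then have t: "- t = s"
    using refl_root_self[OF S_nz[OF assms(2)]] by (simp add: t_def refl_root_inner_commute sum_negf)
  have "of_real (cos (\<alpha> \<bullet> x)) * (s - t)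
    = (\<Sum>\<nu>\<in>orb l. of_real (\<nu> \<bullet> \<alpha>) * (of_real (cos (\<alpha> \<bullet> x)) * (chr \<nu> x - chr (refl_root \<alpha> \<nu>) x)))"
    unfolding t_def s_def by (simp add: sum_distrib_left sum_subtractf algebra_simps)
  also have "\<dots> = (\<Sum>\<nu>\<in>orb l. of_real (\<nu> \<bullet> \<alpha>) * (\<i> * of_real (sin (\<alpha> \<bullet> x)) * (2 * Cs \<alpha> \<nu> x + chr \<nu> x - chr (refl_root \<alpha> \<nu>) x)))"
    using Cs_identity[OF _ assms(2)] orb_Lam[OF assms(1)] by (intro sum.cong refl) simp
  also have "\<dots> = \<i> * of_real (sin (\<alpha> \<bullet> x)) * (2 * d + s - t)"
    unfolding t_def s_def d_def by (simp add: sum_distrib_left sum.distrib sum_subtractf algebra_simps)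
  also have "t = - s" using t by auto
  finally have "2 * (of_real (cos (\<alpha> \<bullet> x)) * s) = 2 * (\<i> * of_real (sin (\<alpha> \<bullet> x)) * (d + s))"
    by (simp add: algebra_simps)
  then have "of_real (cos (\<alpha> \<bullet> x)) * s = \<i> * of_real (sin (\<alpha> \<bullet> x)) * (d + s)"
    by (simp only: mult_cancel_left) simp
  then have "\<i> * (of_real (cos (\<alpha> \<bullet> x)) * s) = - of_real (sin (\<alpha> \<bullet> x)) * (d + s)" by (simp add: algebra_simps)
  moreover have "(\<Sum>\<nu>\<in>orb l. \<i> * of_real (\<nu> \<bullet> \<alpha>) * chr \<nu> x) = \<i> * s"
    by (simp add: s_def sum_distrib_left mult.assoc)
  moreover have "(\<Sum>\<nu>\<in>orb l. of_real (\<nu> \<bullet> \<alpha>) * (Cs \<alpha> \<nu> x + chr \<nu> x)) = d + s"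
    by (simp add: s_def d_def distrib_left sum.distrib)
  ultimately show ?thesis by (simp add: algebra_simps)
qed

lemma LM_alt:
  "LM l x = - of_real ((norm l)\<^sup>2) * M l x
     - (\<Sum>\<alpha>\<in>Sp. of_real (m \<alpha>) * (\<Sum>\<nu>\<in>orb l. of_real (\<nu> \<bullet> \<alpha>) * (Cs \<alpha> \<nu> x + chr \<nu> x)))"
proof -
  have "(\<Sum>\<nu>\<in>orb l. - of_real ((norm \<nu>)\<^sup>2) * chr \<nu> x) = - of_real ((norm l)\<^sup>2) * M l x"
    unfolding M_eq sum_distrib_left by (intro sum.cong refl) (simp add: orb_norm)
  moreover have "(\<Sum>\<nu>\<in>orb l. \<Sum>\<alpha>\<in>Sp. of_real (m \<alpha> * (\<nu> \<bullet> \<alpha>)) * (Cs \<alpha> \<nu> x + chr \<nu> x))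
     = (\<Sum>\<alpha>\<in>Sp. of_real (m \<alpha>) * (\<Sum>\<nu>\<in>orb l. of_real (\<nu> \<bullet> \<alpha>) * (Cs \<alpha> \<nu> x + chr \<nu> x)))"
    by (subst sum.swap) (simp add: sum_distrib_left mult.assoc)
  ultimately show ?thesis unfolding LM_def Le_def sum_subtractf by simp
qed

lemma LM_regular:
  assumes "l \<in> Lam" "regular x"
  shows "LM l x = - of_real ((norm l)\<^sup>2) * M l x
     + (\<Sum>\<alpha>\<in>Sp. of_real (m \<alpha> * cot (\<alpha> \<bullet> x)) * (\<Sum>\<nu>\<in>orb l. \<i> * of_real (\<nu> \<bullet> \<alpha>) * chr \<nu> x))"
proof -
  have "of_real (m \<alpha>) * (\<Sum>\<nu>\<in>orb l. of_real (\<nu> \<bullet> \<alpha>) * (Cs \<alpha> \<nu> x + chr \<nu> x))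
    = - (of_real (m \<alpha> * cot (\<alpha> \<bullet> x)) * (\<Sum>\<nu>\<in>orb l. \<i> * of_real (\<nu> \<bullet> \<alpha>) * chr \<nu> x))" if a: "\<alpha> \<in> Sp" for \<alpha>
  proof -
    have nz: "sin (\<alpha> \<bullet> x) \<noteq> 0" using assms(2) Sp_S[OF a] by (auto simp: regular_def)
    have "of_real (cot (\<alpha> \<bullet> x)) * (\<Sum>\<nu>\<in>orb l. \<i> * of_real (\<nu> \<bullet> \<alpha>) * chr \<nu> x)
      = (of_real (cos (\<alpha> \<bullet> x)) * (\<Sum>\<nu>\<in>orb l. \<i> * of_real (\<nu> \<bullet> \<alpha>) * chr \<nu> x)) / of_real (sin (\<alpha> \<bullet> x))"
      by (simp add: cot_def)
    also have "\<dots> = - (\<Sum>\<nu>\<in>orb l. of_real (\<nu> \<bullet> \<alpha>) * (Cs \<alpha> \<nu> x + chr \<nu> x))"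
      unfolding wall_identity[OF assms(1) Sp_S[OF a]] using nz by simp
    finally show ?thesis by (simp add: mult.assoc)
  qed
  then show ?thesis unfolding LM_alt by (simp add: sum_negf)
qed

text \<open>At regular points \<open>LM\<close> is the cotangent expression, where invariance is a
  reindexing; continuity covers the walls.\<close>

lemma LM_weyl: assumes "l \<in> Lam" "w \<in> W" shows "LM l (w x) = LM l x"
proof -
  have "LM l (w x) - LM l x = 0"
  proof (rule continuous_eq_0_if_regular)
    have "continuous_on UNIV w" using weyl_linear[OF assms(2)] linear_continuous_on linear_conv_bounded_linear by blast
    then show "continuous_on UNIV (\<lambda>x. LM l (w x) - LM l x)"
      by (intro continuous_intros continuous_LM continuous_on_compose2[OF continuous_LM[of UNIV l]]) auto
    fix x assume r: "regular x"
    define g where "g \<alpha> \<nu> = of_real (m \<alpha> * cot (\<alpha> \<bullet> x)) * (\<i> * of_real (\<nu> \<bullet> \<alpha>) * chr \<nu> x)" for \<alpha> \<nu>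
    have iw: "inv w \<in> W" using assms(2) weyl_inv by blast
    have "(\<Sum>\<alpha>\<in>Sp. of_real (m \<alpha> * cot (\<alpha> \<bullet> w x)) * (\<Sum>\<nu>\<in>orb l. \<i> * of_real (\<nu> \<bullet> \<alpha>) * chr \<nu> (w x)))
      = (\<Sum>\<alpha>\<in>Sp. \<Sum>\<nu>\<in>orb l. g (inv w \<alpha>) (inv w \<nu>))"
      unfolding sum_distrib_left
    proof (intro sum.cong refl)
      fix \<alpha> \<nu> assume "\<alpha> \<in> Sp"
      then have "m (inv w \<alpha>) = m \<alpha>" using m_invar iw Sp_S by auto
      then show "of_real (m \<alpha> * cot (\<alpha> \<bullet> w x)) * (\<i> * of_real (\<nu> \<bullet> \<alpha>) * chr \<nu> (w x)) = g (inv w \<alpha>) (inv w \<nu>)"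
        by (simp add: g_def chr_weyl[OF assms(2)] inner_weyl_right[OF assms(2)] weyl_inner[OF iw])
    qed
    also have "\<dots> = (\<Sum>\<alpha>\<in>Sp. (\<lambda>\<alpha>. \<Sum>\<nu>\<in>orb l. g \<alpha> \<nu>) (inv w \<alpha>))" by (simp add: sum_orb_weyl[OF iw])
    also have "\<dots> = (\<Sum>\<alpha>\<in>Sp. \<Sum>\<nu>\<in>orb l. g \<alpha> \<nu>)"
      by (rule sum_Sp_weyl[OF iw]) (simp add: g_def m_uminus cot_def)
    finally show "LM l (w x) - LM l x = 0"
      unfolding LM_regular[OF assms(1) r] LM_regular[OF assms(1) regular_weyl[OF r assms(2)]]
      by (simp add: M_weyl[OF assms(2)] g_def sum_distrib_left)
  qed
  then show ?thesis by simp
qed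

definition Al :: "'a \<Rightarrow> 'a \<Rightarrow> real" where
  "Al \<nu> \<kappa> = - (if \<kappa> = \<nu> then (norm \<nu>)\<^sup>2 else 0)
    - (\<Sum>\<alpha>\<in>Sp. m \<alpha> * (\<nu> \<bullet> \<alpha>) * ssum (\<lambda>j. of_bool (\<kappa> = str \<nu> \<alpha> j)) 0 (lev \<nu> \<alpha> + 1))"

lemma sum_delta_chr: "finite Y \<Longrightarrow> \<nu> \<in> Y \<Longrightarrow> (\<Sum>\<kappa>\<in>Y. of_real (if \<kappa> = \<nu> then a else 0) * f \<kappa>) = of_real a * (f \<nu> :: complex)"
  by (simp add: sum.remove[of Y \<nu>])

lemma Le_expand:
  assumes "\<nu> \<in> X l"
  shows "Le \<nu> x = (\<Sum>\<kappa>\<in>X l. of_real (Al \<nu> \<kappa>) * chr \<kappa> x)"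
proof -
  have c: "Cs \<alpha> \<nu> x + chr \<nu> x
     = (\<Sum>\<kappa>\<in>X l. of_real (ssum (\<lambda>j. of_bool (\<kappa> = str \<nu> \<alpha> j)) 0 (lev \<nu> \<alpha> + 1)) * chr \<kappa> x)" if a: "\<alpha> \<in> Sp" for \<alpha>
    unfolding Cs_plus_chr
    by (rule ssum_expand[OF finite_X, of _ _ "str \<nu> \<alpha>"], rule string_X[OF assms Sp_S[OF a]]) auto
  have "(\<Sum>\<kappa>\<in>X l. of_real (Al \<nu> \<kappa>) * chr \<kappa> x)
    = - (\<Sum>\<kappa>\<in>X l. of_real (if \<kappa> = \<nu> then (norm \<nu>)\<^sup>2 else 0) * chr \<kappa> x)
      - (\<Sum>\<kappa>\<in>X l. \<Sum>\<alpha>\<in>Sp. of_real (m \<alpha> * (\<nu> \<bullet> \<alpha>)) * (of_real (ssum (\<lambda>j. of_bool (\<kappa> = str \<nu> \<alpha> j)) 0 (lev \<nu> \<alpha> + 1)) * chr \<kappa> x))"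
    unfolding sum_negf[symmetric] sum_subtractf[symmetric]
    by (intro sum.cong refl) (simp only: Al_def of_real_diff of_real_minus of_real_sum of_real_mult left_diff_distrib sum_distrib_right mult_minus_left mult.assoc)
  also have "(\<Sum>\<kappa>\<in>X l. of_real (if \<kappa> = \<nu> then (norm \<nu>)\<^sup>2 else 0) * chr \<kappa> x) = of_real ((norm \<nu>)\<^sup>2) * chr \<nu> x"
    by (rule sum_delta_chr[OF finite_X assms])
  also have "(\<Sum>\<kappa>\<in>X l. \<Sum>\<alpha>\<in>Sp. of_real (m \<alpha> * (\<nu> \<bullet> \<alpha>)) * (of_real (ssum (\<lambda>j. of_bool (\<kappa> = str \<nu> \<alpha> j)) 0 (lev \<nu> \<alpha> + 1)) * chr \<kappa> x))
    = (\<Sum>\<alpha>\<in>Sp. of_real (m \<alpha> * (\<nu> \<bullet> \<alpha>)) * (Cs \<alpha> \<nu> x + chr \<nu> x))"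
    by (subst sum.swap) (simp only: sum_distrib_left[symmetric] c cong: sum.cong)
  finally show ?thesis by (simp add: Le_def)
qed

text \<open>Matrix of \<open>LM\<close> on orbit sums. A single \<open>Le \<nu>\<close> is not
  invariant, but \<open>LM l\<close> is, which justifies averaging its coefficients over each target
  orbit.\<close>

definition Bl :: "'a \<Rightarrow> 'a \<Rightarrow> real" where
  "Bl l \<mu> = (\<Sum>\<kappa>\<in>orb \<mu>. \<Sum>\<nu>\<in>orb l. Al \<nu> \<kappa>) / of_nat (card (orb \<mu>))"

lemma sum_X: "(\<Sum>\<kappa>\<in>X l. f \<kappa>) = (\<Sum>\<mu>\<in>low l. \<Sum>\<kappa>\<in>orb \<mu>. f \<kappa>)"
  unfolding X_def
proof (rule sum.UNION_disjoint)
  show "\<forall>i\<in>low l. \<forall>j\<in>low l. i \<noteq> j \<longrightarrow> orb i \<inter> orb j = {}"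
    using orb_disjoint low_dom by blast
qed (simp_all add: finite_low finite_orb)

lemma orb_X: "l \<in> Dom \<Longrightarrow> orb l \<subseteq> X l" using low_self by (auto simp: X_def)

lemma average_X:
  "(\<Sum>w\<in>W. \<Sum>\<kappa>\<in>X l. of_real (a \<kappa>) * chr \<kappa> (w x)) / of_nat (card W)
    = (\<Sum>\<mu>\<in>low l. of_real ((\<Sum>\<kappa>\<in>orb \<mu>. a \<kappa>) / of_nat (card (orb \<mu>))) * M \<mu> x)"
proof -
  have "(\<Sum>w\<in>W. \<Sum>\<kappa>\<in>X l. of_real (a \<kappa>) * chr \<kappa> (w x)) / of_nat (card W)
    = (\<Sum>\<kappa>\<in>X l. of_real (a \<kappa>) * ((\<Sum>w\<in>W. chr \<kappa> (w x)) / of_nat (card W)))"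
    by (subst sum.swap) (simp add: sum_divide_distrib sum_distrib_left)
  also have "\<dots> = (\<Sum>\<mu>\<in>low l. \<Sum>\<kappa>\<in>orb \<mu>. of_real (a \<kappa>) * (M \<kappa> x / of_nat (card (orb \<kappa>))))"
    unfolding average_chr sum_X ..
  also have "\<dots> = (\<Sum>\<mu>\<in>low l. of_real ((\<Sum>\<kappa>\<in>orb \<mu>. a \<kappa>) / of_nat (card (orb \<mu>))) * M \<mu> x)"
  proof (rule sum.cong[OF refl])
    fix \<mu>
    have "(\<Sum>\<kappa>\<in>orb \<mu>. of_real (a \<kappa>) * (M \<kappa> x / of_nat (card (orb \<kappa>))))
       = (\<Sum>\<kappa>\<in>orb \<mu>. of_real (a \<kappa>) * (M \<mu> x / of_nat (card (orb \<mu>))))"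
      by (rule sum.cong[OF refl]) (simp add: M_orb orb_weyl)
    then show "(\<Sum>\<kappa>\<in>orb \<mu>. of_real (a \<kappa>) * (M \<kappa> x / of_nat (card (orb \<kappa>))))
       = of_real ((\<Sum>\<kappa>\<in>orb \<mu>. a \<kappa>) / of_nat (card (orb \<mu>))) * M \<mu> x"
      by (simp add: sum_distrib_right sum_divide_distrib)
  qed
  finally show ?thesis .
qed

lemma card_W_nonzero: "card W \<noteq> 0" using finite_W W_nonempty by simp

lemma LM_expand:
  assumes l: "l \<in> Dom"
  shows "LM l x = (\<Sum>\<mu>\<in>low l. of_real (Bl l \<mu>) * M \<mu> x)"
proof -
  have "LM l y = (\<Sum>\<kappa>\<in>X l. of_real (\<Sum>\<nu>\<in>orb l. Al \<nu> \<kappa>) * chr \<kappa> y)" for y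
  proof -
    have "LM l y = (\<Sum>\<nu>\<in>orb l. \<Sum>\<kappa>\<in>X l. of_real (Al \<nu> \<kappa>) * chr \<kappa> y)"
      unfolding LM_def using orb_X[OF l] Le_expand by (intro sum.cong refl) auto
    then show ?thesis by (subst (asm) sum.swap) (simp add: sum_distrib_right)
  qed
  note e = this
  have "LM l x = (\<Sum>w\<in>W. LM l (w x)) / of_nat (card W)"
    using LM_weyl[OF dom_Lam[OF l]] card_W_nonzero by simp
  also have "\<dots> = (\<Sum>\<mu>\<in>low l. of_real (Bl l \<mu>) * M \<mu> x)"
    unfolding e average_X Bl_def ..
  finally show ?thesis .
qed

lemma ssum_swap: "(\<Sum>\<kappa>\<in>Y. ssum (f \<kappa>) a b) = ssum (\<lambda>j. \<Sum>\<kappa>\<in>Y. f \<kappa> j) a b"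
  by (auto simp: ssum_def sum_negf intro: sum.swap)

lemma ssum_of_bool_nonneg: "a \<le> b \<Longrightarrow> 0 \<le> ssum (\<lambda>j. of_bool (P j) :: real) a b"
  by (auto simp: ssum_def intro: sum_nonneg)

lemma ssum_of_bool_nonpos: "b \<le> a \<Longrightarrow> ssum (\<lambda>j. of_bool (P j) :: real) a b \<le> 0"
  by (auto simp: ssum_def intro!: sum_nonneg)

lemma lev_sign: assumes "\<nu> \<in> Lam" "\<alpha> \<in> S" shows "0 \<le> lev \<nu> \<alpha> \<longleftrightarrow> 0 \<le> \<nu> \<bullet> \<alpha>"
proof -
  have "\<alpha> \<bullet> \<alpha> > 0" using S_nz[OF assms(2)] by simp
  then show ?thesis unfolding lev[OF assms] by (auto simp: zero_le_mult_iff not_le[symmetric])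
qed

text \<open>The sign of \<nu> . \<alpha> agrees with the orientation of the string sum, so every
  product is nonnegative before the leading minus. All positivity of coefficients below rests on
  this.\<close>

lemma Al_nonpos: assumes "\<nu> \<in> Lam" "\<kappa> \<noteq> \<nu>" shows "Al \<nu> \<kappa> \<le> 0"
proof -
  have "0 \<le> m \<alpha> * (\<nu> \<bullet> \<alpha>) * ssum (\<lambda>j. of_bool (\<kappa> = str \<nu> \<alpha> j)) 0 (lev \<nu> \<alpha> + 1)" if a: "\<alpha> \<in> Sp" for \<alpha>
  proof -
    have m0: "m \<alpha> \<ge> 0" using m_nonneg Sp_S a by auto
    have "0 \<le> (\<nu> \<bullet> \<alpha>) * ssum (\<lambda>j. of_bool (\<kappa> = str \<nu> \<alpha> j)) 0 (lev \<nu> \<alpha> + 1)"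
    proof (cases "0 \<le> lev \<nu> \<alpha>")
      case True
      then show ?thesis using lev_sign[OF assms(1) Sp_S[OF a]] by (intro mult_nonneg_nonneg ssum_of_bool_nonneg) auto
    next
      case False
      then show ?thesis using lev_sign[OF assms(1) Sp_S[OF a]] by (intro mult_nonpos_nonpos ssum_of_bool_nonpos) auto
    qed
    then show ?thesis using m0 by (simp add: mult.assoc)
  qed
  then show ?thesis using assms(2) by (simp add: Al_def sum_nonneg)
qed

lemma Bl_nonpos: assumes "l \<in> Dom" "\<mu> \<in> Dom" "\<mu> \<noteq> l" shows "Bl l \<mu> \<le> 0"
proof -
  have "Al \<nu> \<kappa> \<le> 0" if "\<kappa> \<in> orb \<mu>" "\<nu> \<in> orb l" for \<kappa> \<nu>
    using Al_nonpos[of \<nu> \<kappa>] orb_disjoint[OF assms(1,2), of \<kappa>] that assms orb_Lam[OF dom_Lam] by metis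
  then show ?thesis unfolding Bl_def by (intro divide_nonpos_nonneg sum_nonpos) auto
qed

lemma string_orb_iff:
  assumes "\<nu> \<in> Lam" "\<nu> \<in> orb l" "\<alpha> \<in> S" "0 \<le> j \<and> j \<le> lev \<nu> \<alpha> \<or> lev \<nu> \<alpha> \<le> j \<and> j \<le> 0"
  shows "str \<nu> \<alpha> j \<in> orb l \<longleftrightarrow> j = 0 \<or> j = lev \<nu> \<alpha>"
proof
  assume "str \<nu> \<alpha> j \<in> orb l"
  then have "norm (str \<nu> \<alpha> j) = norm \<nu>" using assms(2) orb_norm by metis
  then show "j = 0 \<or> j = lev \<nu> \<alpha>" using string_norm_less[OF assms(1,3), of j] assms(4) by force
next
  assume "j = 0 \<or> j = lev \<nu> \<alpha>"
  then show "str \<nu> \<alpha> j \<in> orb l"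
    using assms refl_string[OF assms(1,3)] weyl_orb[OF weyl_refl[OF assms(3)] assms(2)] by auto
qed

text \<open>Only the ends of a string stay in the orbit. A positive string contains both ends; a
  negative one, read from \<open>lev \<nu> \<alpha> + 1\<close> to -1, contains neither. Both cases
  give \<nu> . \<alpha> + |\<nu> . \<alpha>|.\<close>

lemma Al_row_sum:
  assumes "\<nu> \<in> Lam" "\<nu> \<in> orb l"
  shows "(\<Sum>\<kappa>\<in>orb l. Al \<nu> \<kappa>) = - (norm \<nu>)\<^sup>2 - (\<Sum>\<alpha>\<in>Sp. m \<alpha> * (\<nu> \<bullet> \<alpha> + \<bar>\<nu> \<bullet> \<alpha>\<bar>))"
proof -
  have s: "(\<nu> \<bullet> \<alpha>) * (\<Sum>\<kappa>\<in>orb l. ssum (\<lambda>j. of_bool (\<kappa> = str \<nu> \<alpha> j)) 0 (lev \<nu> \<alpha> + 1)) = \<nu> \<bullet> \<alpha> + \<bar>\<nu> \<bullet> \<alpha>\<bar>"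
    if a: "\<alpha> \<in> Sp" for \<alpha>
  proof -
    have aS: "\<alpha> \<in> S" using a Sp_S by blast
    have one: "(\<Sum>\<kappa>\<in>orb l. of_bool (\<kappa> = str \<nu> \<alpha> j)) = (of_bool (str \<nu> \<alpha> j \<in> orb l) :: real)" for j
    proof (cases "str \<nu> \<alpha> j \<in> orb l")
      case True
      then show ?thesis using finite_orb by (simp add: sum.remove)
    next
      case False
      then show ?thesis by (auto intro!: sum.neutral)
    qed
    have "(\<Sum>\<kappa>\<in>orb l. ssum (\<lambda>j. of_bool (\<kappa> = str \<nu> \<alpha> j)) 0 (lev \<nu> \<alpha> + 1))
       = ssum (\<lambda>j. of_bool (str \<nu> \<alpha> j \<in> orb l) :: real) 0 (lev \<nu> \<alpha> + 1)"
      unfolding one[symmetric] by (rule ssum_swap)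
    moreover consider "lev \<nu> \<alpha> = 0" | "lev \<nu> \<alpha> > 0" | "lev \<nu> \<alpha> < 0" by linarith
    then have "(\<nu> \<bullet> \<alpha>) * ssum (\<lambda>j. of_bool (str \<nu> \<alpha> j \<in> orb l) :: real) 0 (lev \<nu> \<alpha> + 1) = \<nu> \<bullet> \<alpha> + \<bar>\<nu> \<bullet> \<alpha>\<bar>"
    proof cases
      case 1
      then show ?thesis using lev[OF assms(1) aS] by simp
    next
      case 2
      have "(\<Sum>j\<in>{0..<lev \<nu> \<alpha> + 1}. of_bool (str \<nu> \<alpha> j \<in> orb l) :: real) = (\<Sum>j\<in>{0, lev \<nu> \<alpha>}. 1)"
        using 2 string_orb_iff[OF assms aS] assms(2) by (intro sum.mono_neutral_cong_right) auto
      then have "ssum (\<lambda>j. of_bool (str \<nu> \<alpha> j \<in> orb l) :: real) 0 (lev \<nu> \<alpha> + 1) = 2"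
        using 2 by (simp add: ssum_def)
      moreover have "\<nu> \<bullet> \<alpha> \<ge> 0" using lev_sign[OF assms(1) aS] 2 by simp
      ultimately show ?thesis by simp
    next
      case 3
      have "(\<Sum>j\<in>{lev \<nu> \<alpha> + 1..<0}. of_bool (str \<nu> \<alpha> j \<in> orb l) :: real) = 0"
        using 3 string_orb_iff[OF assms aS] by (intro sum.neutral) auto
      then have "ssum (\<lambda>j. of_bool (str \<nu> \<alpha> j \<in> orb l) :: real) 0 (lev \<nu> \<alpha> + 1) = 0"
        using 3 by (auto simp: ssum_def)
      moreover have "\<nu> \<bullet> \<alpha> < 0" using lev_sign[OF assms(1) aS] 3 by simp
      ultimately show ?thesis by simp
    qed
    ultimately show ?thesis by simp
  qed
  have "(\<Sum>\<kappa>\<in>orb l. Al \<nu> \<kappa>) = - (\<Sum>\<kappa>\<in>orb l. if \<kappa> = \<nu> then (norm \<nu>)\<^sup>2 else 0)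
     - (\<Sum>\<alpha>\<in>Sp. m \<alpha> * ((\<nu> \<bullet> \<alpha>) * (\<Sum>\<kappa>\<in>orb l. ssum (\<lambda>j. of_bool (\<kappa> = str \<nu> \<alpha> j)) 0 (lev \<nu> \<alpha> + 1))))"
    unfolding Al_def sum_subtractf sum_negf
    by (subst sum.swap) (simp add: sum_distrib_left mult.assoc)
  then show ?thesis using assms(2) finite_orb by (simp add: s)
qed

text \<open>Average of the row sums over the orbit: the absolute values add up to 2 (l . \<rho>) for
  every \<nu> by invariance of \<open>m\<close>, and the linear terms cancel under
  reflections.\<close>

lemma Bl_diag: assumes "l \<in> Dom" shows "Bl l l = - theta l"
proof -
  have L: "\<nu> \<in> Lam" if "\<nu> \<in> orb l" for \<nu> using that orb_Lam dom_Lam assms by blast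
  have abs: "(\<Sum>\<alpha>\<in>Sp. m \<alpha> * \<bar>\<nu> \<bullet> \<alpha>\<bar>) = 2 * (l \<bullet> rho Sp m)" if n: "\<nu> \<in> orb l" for \<nu>
  proof -
    obtain w where w: "w \<in> W" "\<nu> = w l" using n unfolding orb_def by blast
    have iw: "inv w \<in> W" using w weyl_inv by blast
    have "(\<Sum>\<alpha>\<in>Sp. m \<alpha> * \<bar>\<nu> \<bullet> \<alpha>\<bar>) = (\<Sum>\<alpha>\<in>Sp. (\<lambda>\<alpha>. m \<alpha> * \<bar>l \<bullet> \<alpha>\<bar>) (inv w \<alpha>))"
      using m_invar iw Sp_S by (intro sum.cong) (auto simp: w(2) weyl_inner_inv[OF w(1)])
    also have "\<dots> = (\<Sum>\<alpha>\<in>Sp. m \<alpha> * \<bar>l \<bullet> \<alpha>\<bar>)" by (rule sum_Sp_weyl[OF iw]) (simp add: m_uminus)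
    also have "\<dots> = (\<Sum>\<alpha>\<in>Sp. m \<alpha> * (l \<bullet> \<alpha>))"
      using dom_dominant[OF assms] by (intro sum.cong refl) (auto simp: dominant_def inner_commute)
    finally show ?thesis by (simp add: rho_def inner_sum_right)
  qed
  have zero: "(\<Sum>\<nu>\<in>orb l. \<nu> \<bullet> \<alpha>) = 0" if a: "\<alpha> \<in> Sp" for \<alpha>
  proof -
    have "(\<Sum>\<nu>\<in>orb l. \<nu> \<bullet> \<alpha>) = (\<Sum>\<nu>\<in>orb l. refl_root \<alpha> \<nu> \<bullet> \<alpha>)"
      by (rule sum_orb_weyl[symmetric]) (rule weyl_refl[OF Sp_S[OF a]])
    also have "\<dots> = - (\<Sum>\<nu>\<in>orb l. \<nu> \<bullet> \<alpha>)"
      using refl_root_self[OF Sp_nz[OF a]] by (simp add: refl_root_inner_commute sum_negf)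
    finally show ?thesis by simp
  qed
  have "(\<Sum>\<kappa>\<in>orb l. \<Sum>\<nu>\<in>orb l. Al \<nu> \<kappa>) = (\<Sum>\<nu>\<in>orb l. \<Sum>\<kappa>\<in>orb l. Al \<nu> \<kappa>)" by (rule sum.swap)
  also have "\<dots> = (\<Sum>\<nu>\<in>orb l. - theta l - (\<Sum>\<alpha>\<in>Sp. m \<alpha> * (\<nu> \<bullet> \<alpha>)))"
    using abs by (intro sum.cong refl) (simp add: Al_row_sum L theta_eq orb_norm distrib_left sum.distrib)
  also have "\<dots> = of_nat (card (orb l)) * (- theta l) - (\<Sum>\<alpha>\<in>Sp. m \<alpha> * (\<Sum>\<nu>\<in>orb l. \<nu> \<bullet> \<alpha>))"
  proof -
    have "(\<Sum>\<nu>\<in>orb l. \<Sum>\<alpha>\<in>Sp. m \<alpha> * (\<nu> \<bullet> \<alpha>)) = (\<Sum>\<alpha>\<in>Sp. m \<alpha> * (\<Sum>\<nu>\<in>orb l. \<nu> \<bullet> \<alpha>))"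
      by (subst sum.swap) (simp add: sum_distrib_left)
    then show ?thesis by (simp add: sum_subtractf)
  qed
  also have "\<dots> = of_nat (card (orb l)) * (- theta l)" by (simp add: zero)
  finally show ?thesis using card_orb_pos[of l] by (simp add: Bl_def)
qed

section \<open>The Heckman--Opdam polynomials as eigenfunctions\<close>

definition Pprop :: "'a \<Rightarrow> ('a \<Rightarrow> real) \<Rightarrow> bool" where
  "Pprop l c \<longleftrightarrow> c l = 1 \<and> (\<forall>\<mu>\<in>low l. 0 \<le> c \<mu>)
     \<and> (\<forall>x. (\<Sum>\<mu>\<in>low l. of_real (c \<mu>) * LM \<mu> x) = - of_real (theta l) * (\<Sum>\<mu>\<in>low l. of_real (c \<mu>) * M \<mu> x))"

definition Bl' :: "'a \<Rightarrow> 'a \<Rightarrow> real" where "Bl' \<mu> \<kappa> = (if \<kappa> \<in> low \<mu> then Bl \<mu> \<kappa> else 0)"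

lemma low_mono: "\<mu> \<in> low l \<Longrightarrow> low \<mu> \<subseteq> low l" using low_trans by blast

lemma LM_expand': assumes "\<mu> \<in> low l" shows "LM \<mu> x = (\<Sum>\<kappa>\<in>low l. of_real (Bl' \<mu> \<kappa>) * M \<kappa> x)"
  unfolding LM_expand[OF low_dom[OF assms]]
  by (rule sum.mono_neutral_cong_left) (use finite_low low_mono[OF assms] in \<open>auto simp: Bl'_def\<close>)

lemma Bl'_tri: "\<mu> \<noteq> \<kappa> \<Longrightarrow> Bl' \<mu> \<kappa> \<noteq> 0 \<Longrightarrow> norm \<kappa> < norm \<mu>"
  by (metis Bl'_def low_norm)

lemma Bl'_diag: "\<mu> \<in> Dom \<Longrightarrow> Bl' \<mu> \<mu> = - theta \<mu>"
  by (simp add: Bl'_def low_self Bl_diag)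

text \<open>The eigenvector comes from back substitution. Nonnegativity descends from the
  coefficient 1 at \<open>l\<close>: the positive number \<open>theta l - theta \<kappa>\<close>
  times the coefficient at \<kappa> is a sum of nonnegative terms, as the off-diagonal entries are
  nonpositive.\<close>

lemma Pprop_exists: assumes l: "l \<in> Dom" shows "\<exists>c. Pprop l c"
proof -
  have lt_theta: "theta \<mu> < theta l" if "\<mu> \<in> low l" "\<mu> \<noteq> l" for \<mu> using theta_strict that by blast
  have tri: "norm y < norm x" if "x \<in> low l" "y \<in> low l" "x \<noteq> y" "Bl' x y \<noteq> 0" for x y
    using Bl'_tri that by blast
  have ne: "Bl' \<mu> \<mu> \<noteq> Bl' l l" if "\<mu> \<in> low l" "norm \<mu> < norm l" for \<mu>
    using lt_theta[OF that(1)] that(2) Bl'_diag[OF l] Bl'_diag[OF low_dom[OF that(1)]]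
    by (cases "\<mu> = l") auto
  have "\<exists>c. c l = 1 \<and> (\<forall>\<kappa>\<in>low l. (\<Sum>\<mu>\<in>low l. c \<mu> * Bl' \<mu> \<kappa>) = Bl' l l * c \<kappa>)"
  proof (rule triangular_eigenvector[of "low l" l "\<lambda>x y. norm x < norm y" Bl'])
    fix c assume "c l = 1" "\<And>y. y \<in> low l \<Longrightarrow> (\<Sum>x\<in>low l. c x * Bl' x y) = Bl' l l * c y"
    then show ?thesis by blast
  qed (use finite_low low_self[OF l] tri ne in auto)
  then obtain c where c: "c l = 1" "\<And>\<kappa>. \<kappa> \<in> low l \<Longrightarrow> (\<Sum>\<mu>\<in>low l. c \<mu> * Bl' \<mu> \<kappa>) = Bl' l l * c \<kappa>"
    by blast
  have "0 \<le> c \<kappa>" if "\<kappa> \<in> low l" for \<kappa>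
    using that
  proof (induction "card {\<mu>\<in>low l. norm \<mu> > norm \<kappa>}" arbitrary: \<kappa> rule: less_induct)
    case less
    show ?case
    proof (cases "\<kappa> = l")
      case False
      have "c \<mu> * Bl' \<mu> \<kappa> \<le> 0" if m: "\<mu> \<in> low l - {\<kappa>}" for \<mu>
      proof (cases "Bl' \<mu> \<kappa> = 0")
        case False
        then have n: "norm \<kappa> < norm \<mu>" using Bl'_tri m by blast
        then have "{\<mu>'\<in>low l. norm \<mu>' > norm \<mu>} \<subset> {\<mu>\<in>low l. norm \<mu> > norm \<kappa>}" using m by auto
        then have "card {\<mu>'\<in>low l. norm \<mu>' > norm \<mu>} < card {\<mu>\<in>low l. norm \<mu> > norm \<kappa>}"
          by (rule psubset_card_mono[rotated]) (simp add: finite_low)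
        then have "0 \<le> c \<mu>" using less.hyps m by blast
        moreover have "Bl' \<mu> \<kappa> \<le> 0" using Bl_nonpos[of \<mu> \<kappa>] m low_dom by (auto simp: Bl'_def)
        ultimately show ?thesis by (rule mult_nonneg_nonpos)
      qed simp
      then have "(\<Sum>\<mu>\<in>low l - {\<kappa>}. c \<mu> * Bl' \<mu> \<kappa>) \<le> 0" by (intro sum_nonpos) auto
      moreover have "c \<kappa> * Bl' \<kappa> \<kappa> + (\<Sum>\<mu>\<in>low l - {\<kappa>}. c \<mu> * Bl' \<mu> \<kappa>) = Bl' l l * c \<kappa>"
        using c(2)[OF less.prems] finite_low less.prems by (simp add: sum.remove)
      ultimately have "(theta l - theta \<kappa>) * c \<kappa> \<ge> 0"
        using Bl'_diag[OF l] Bl'_diag[OF low_dom[OF less.prems]] by (simp add: algebra_simps)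
      then show ?thesis using lt_theta[OF less.prems False] by (simp add: zero_le_mult_iff)
    qed (simp add: c)
  qed
  moreover have "(\<Sum>\<mu>\<in>low l. of_real (c \<mu>) * LM \<mu> x) = - of_real (theta l) * (\<Sum>\<mu>\<in>low l. of_real (c \<mu>) * M \<mu> x)" for x
  proof -
    have "(\<Sum>\<mu>\<in>low l. of_real (c \<mu>) * LM \<mu> x) = (\<Sum>\<mu>\<in>low l. \<Sum>\<kappa>\<in>low l. of_real (c \<mu> * Bl' \<mu> \<kappa>) * M \<kappa> x)"
      by (intro sum.cong refl) (simp add: LM_expand'[of _ l] sum_distrib_left mult.assoc)
    also have "\<dots> = (\<Sum>\<kappa>\<in>low l. of_real (\<Sum>\<mu>\<in>low l. c \<mu> * Bl' \<mu> \<kappa>) * M \<kappa> x)"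
      by (subst sum.swap) (simp add: sum_distrib_right)
    also have "\<dots> = - of_real (theta l) * (\<Sum>\<mu>\<in>low l. of_real (c \<mu>) * M \<mu> x)"
      unfolding sum_distrib_left by (intro sum.cong refl) (simp add: c(2) Bl'_diag[OF l] mult.assoc)
    finally show ?thesis .
  qed
  ultimately show ?thesis using c(1) unfolding Pprop_def by blast
qed

definition Pc :: "'a \<Rightarrow> 'a \<Rightarrow> real" where "Pc l = (SOME c. Pprop l c)"

definition PP :: "'a \<Rightarrow> 'a \<Rightarrow> complex" where "PP l x = (\<Sum>\<mu>\<in>low l. of_real (Pc l \<mu>) * M \<mu> x)"

lemma Pc: assumes "l \<in> Dom"
  shows "Pc l l = 1" "\<mu> \<in> low l \<Longrightarrow> 0 \<le> Pc l \<mu>"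
    and PP_eigen: "(\<Sum>\<mu>\<in>low l. of_real (Pc l \<mu>) * LM \<mu> x) = - of_real (theta l) * PP l x"
proof -
  have "Pprop l (Pc l)" unfolding Pc_def by (rule someI_ex[OF Pprop_exists[OF assms]])
  then show "Pc l l = 1" "\<mu> \<in> low l \<Longrightarrow> 0 \<le> Pc l \<mu>"
    "(\<Sum>\<mu>\<in>low l. of_real (Pc l \<mu>) * LM \<mu> x) = - of_real (theta l) * PP l x"
    unfolding Pprop_def PP_def by auto
qed

lemma continuous_PP: "continuous_on A (PP l)"
  unfolding PP_def[abs_def] by (intro continuous_intros continuous_M)

lemma PP_weyl: "w \<in> W \<Longrightarrow> PP l (w x) = PP l x" by (simp add: PP_def M_weyl)

text \<open>By symmetry the pairings with lower orbit sums form a right eigenvector of the lower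
  block for \<open>- theta l\<close>, a value that its diagonal avoids.\<close>

lemma PP_orthogonal_M:
  assumes l: "l \<in> Dom" and mu: "\<mu> \<in> low l" "\<mu> \<noteq> l"
  shows "ip (PP l) (M \<mu>) = 0"
proof (rule triangular_kernel[of "low l - {l}" "\<lambda>x y. norm x < norm y" Bl' "- theta l" "\<lambda>\<mu>. ip (PP l) (M \<mu>)"])
  show "Bl' \<kappa> \<kappa> \<noteq> - theta l" if "\<kappa> \<in> low l - {l}" for \<kappa>
    using theta_strict[of \<kappa> l] that Bl'_diag[OF low_dom[of \<kappa> l]] by auto
  fix \<nu> assume n: "\<nu> \<in> low l - {l}"
  have L: "\<kappa> \<in> Lam" if "\<kappa> \<in> low l" for \<kappa> using that low_dom dom_Lam by blast
  have "of_real (- theta l) * ip (PP l) (M \<nu>) = ip (\<lambda>x. \<Sum>\<mu>\<in>low l. of_real (Pc l \<mu>) * LM \<mu> x) (M \<nu>)"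
    unfolding PP_eigen[OF l] by (simp add: ip_cmult_left[of "- of_real (theta l)", simplified])
  also have "\<dots> = (\<Sum>\<mu>\<in>low l. of_real (Pc l \<mu>) * ip (LM \<mu>) (M \<nu>))"
    by (rule ip_sum_left) (auto intro: continuous_LM continuous_M)
  also have "\<dots> = (\<Sum>\<mu>\<in>low l. of_real (Pc l \<mu>) * ip (M \<mu>) (LM \<nu>))"
    using L n by (intro sum.cong refl) (auto simp: LM_symmetric)
  also have "\<dots> = ip (PP l) (LM \<nu>)"
    unfolding PP_def[abs_def] by (rule ip_sum_left[symmetric]) (auto intro: continuous_LM continuous_M)
  also have "LM \<nu> = (\<lambda>x. \<Sum>\<kappa>\<in>low l. of_real (Bl' \<nu> \<kappa>) * M \<kappa> x)"
    using LM_expand'[of \<nu> l] n by auto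
  also have "ip (PP l) \<dots> = (\<Sum>\<kappa>\<in>low l. of_real (Bl' \<nu> \<kappa>) * ip (PP l) (M \<kappa>))"
    by (subst ip_sum_right) (auto intro: continuous_PP continuous_M)
  also have "\<dots> = (\<Sum>\<kappa>\<in>low l - {l}. of_real (Bl' \<nu> \<kappa>) * ip (PP l) (M \<kappa>))"
  proof (rule sum.mono_neutral_right)
    have "Bl' \<nu> l = 0" using Bl'_tri[of \<nu> l] low_norm[of \<nu> l] n by force
    then show "\<forall>i\<in>low l - (low l - {l}). of_real (Bl' \<nu> i) * ip (PP l) (M i) = 0" by auto
  qed (auto simp: finite_low)
  finally show "of_real (- theta l) * ip (PP l) (M \<nu>) = (\<Sum>\<kappa>\<in>low l - {l}. of_real (Bl' \<nu> \<kappa>) * ip (PP l) (M \<kappa>))" .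
qed (use Bl'_tri mu finite_low in auto)

text \<open>\<open>D\<close> is orthogonal to its own expansion. This is the uniqueness that makes
  the description in \<open>HO_poly\<close> definite.\<close>

lemma lower_orthogonal_zero:
  assumes l: "l \<in> Dom" and D: "\<And>x. D x = (\<Sum>\<kappa>\<in>low l - {l}. b \<kappa> * M \<kappa> x)"
    and orth: "\<And>\<kappa>. \<kappa> \<in> low l - {l} \<Longrightarrow> ip D (M \<kappa>) = 0"
  shows "D x = 0"
proof -
  have D': "D = (\<lambda>x. \<Sum>\<kappa>\<in>low l - {l}. b \<kappa> * M \<kappa> x)" using D by auto
  have c: "continuous_on UNIV D" unfolding D' by (intro continuous_intros continuous_M)
  show ?thesis
  proof (rule ip_self_eq_0[OF c])
    show "D (x + pi *\<^sub>R v) = D x" if "v \<in> Q" for x v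
      unfolding D using that low_dom dom_Lam by (intro sum.cong refl) (auto simp: M_periodic)
    have "ip D D = (\<Sum>\<kappa>\<in>low l - {l}. cnj (b \<kappa>) * ip D (M \<kappa>))"
      by (subst (2) D') (rule ip_sum_right, auto intro: c continuous_M)
    then show "ip D D = 0" using orth by simp
  qed
qed

end

lemma ssum_nonzero_ex:
  "ssum f a b \<noteq> 0 \<Longrightarrow> \<exists>j. (a \<le> j \<and> j < b \<or> b \<le> j \<and> j < a) \<and> f j \<noteq> 0"
  unfolding ssum_def by (auto split: if_splits elim!: sum.not_neutral_contains_not_neutral simp: not_le)

lemma ssum_of_bool_ex:
  "ssum (\<lambda>j. of_bool (P j) :: real) a b \<noteq> 0 \<Longrightarrow> \<exists>j. (a \<le> j \<and> j < b \<or> b \<le> j \<and> j < a) \<and> P j"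
  by (drule ssum_nonzero_ex) auto

context root_data
begin

section \<open>Orthogonality\<close>

text \<open>Cherednik operators, unlike the Laplacian on orbit sums, also couple weights of one
  orbit; the \<open>xi\<close>-height breaks these ties.\<close>

definition lt :: "'a \<Rightarrow> 'a \<Rightarrow> bool" where
  "lt \<kappa> \<nu> \<longleftrightarrow> norm \<kappa> < norm \<nu> \<or> norm \<kappa> = norm \<nu> \<and> \<kappa> \<bullet> xi < \<nu> \<bullet> xi"

lemma lt_irrefl: "\<not> lt x x" and lt_trans: "lt x y \<Longrightarrow> lt y z \<Longrightarrow> lt x z"
  by (auto simp: lt_def)

definition At :: "'a \<Rightarrow> 'a \<Rightarrow> 'a \<Rightarrow> real" where
  "At \<eta> \<nu> \<kappa> = (if \<kappa> = \<nu> then \<nu> \<bullet> \<eta> else 0)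
    + (\<Sum>\<alpha>\<in>Sp. m \<alpha> * (\<alpha> \<bullet> \<eta>) * ssum (\<lambda>j. of_bool (\<kappa> = str \<nu> \<alpha> j)) 1 (lev \<nu> \<alpha> + 1))"

lemma Tc_expand:
  assumes "\<nu> \<in> X l"
  shows "Tc \<eta> \<nu> x = (\<Sum>\<kappa>\<in>X l. of_real (At \<eta> \<nu> \<kappa>) * chr \<kappa> x)"
proof -
  have c: "Cs \<alpha> \<nu> x
     = (\<Sum>\<kappa>\<in>X l. of_real (ssum (\<lambda>j. of_bool (\<kappa> = str \<nu> \<alpha> j)) 1 (lev \<nu> \<alpha> + 1)) * chr \<kappa> x)" if a: "\<alpha> \<in> Sp" for \<alpha>
    unfolding Cs_def
    by (rule ssum_expand[OF finite_X, of _ _ "str \<nu> \<alpha>"], rule string_X[OF assms Sp_S[OF a]]) auto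
  have "(\<Sum>\<kappa>\<in>X l. of_real (At \<eta> \<nu> \<kappa>) * chr \<kappa> x)
    = (\<Sum>\<kappa>\<in>X l. of_real (if \<kappa> = \<nu> then \<nu> \<bullet> \<eta> else 0) * chr \<kappa> x)
      + (\<Sum>\<kappa>\<in>X l. \<Sum>\<alpha>\<in>Sp. of_real (m \<alpha> * (\<alpha> \<bullet> \<eta>)) * (of_real (ssum (\<lambda>j. of_bool (\<kappa> = str \<nu> \<alpha> j)) 1 (lev \<nu> \<alpha> + 1)) * chr \<kappa> x))"
    unfolding sum.distrib[symmetric]
    by (intro sum.cong refl) (simp only: At_def of_real_add of_real_sum of_real_mult distrib_right sum_distrib_right mult.assoc)
  also have "(\<Sum>\<kappa>\<in>X l. of_real (if \<kappa> = \<nu> then \<nu> \<bullet> \<eta> else 0) * chr \<kappa> x) = of_real (\<nu> \<bullet> \<eta>) * chr \<nu> x"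
    by (rule sum_delta_chr[OF finite_X assms])
  also have "(\<Sum>\<kappa>\<in>X l. \<Sum>\<alpha>\<in>Sp. of_real (m \<alpha> * (\<alpha> \<bullet> \<eta>)) * (of_real (ssum (\<lambda>j. of_bool (\<kappa> = str \<nu> \<alpha> j)) 1 (lev \<nu> \<alpha> + 1)) * chr \<kappa> x))
    = (\<Sum>\<alpha>\<in>Sp. of_real (m \<alpha> * (\<alpha> \<bullet> \<eta>)) * Cs \<alpha> \<nu> x)"
    by (subst sum.swap) (simp only: sum_distrib_left[symmetric] c cong: sum.cong)
  finally show ?thesis by (simp add: Tc_def)
qed

text \<open>A positive string reaches another weight of equal norm only at its far end, after
  subtracting a positive multiple of a positive root. Negative strings stop one step before their
  far end.\<close>

lemma At_tri:
  assumes n: "\<nu> \<in> Lam" and ne: "\<nu> \<noteq> \<kappa>" and nz: "At \<eta> \<nu> \<kappa> \<noteq> 0"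
  shows "lt \<kappa> \<nu>"
proof -
  have "(\<Sum>\<alpha>\<in>Sp. m \<alpha> * (\<alpha> \<bullet> \<eta>) * ssum (\<lambda>j. of_bool (\<kappa> = str \<nu> \<alpha> j)) 1 (lev \<nu> \<alpha> + 1)) \<noteq> 0"
    using nz ne by (simp add: At_def)
  then obtain \<alpha> where a: "\<alpha> \<in> Sp" "ssum (\<lambda>j. of_bool (\<kappa> = str \<nu> \<alpha> j) :: real) 1 (lev \<nu> \<alpha> + 1) \<noteq> 0"
    by (rule sum.not_neutral_contains_not_neutral) auto
  then obtain j where j: "1 \<le> j \<and> j < lev \<nu> \<alpha> + 1 \<or> lev \<nu> \<alpha> + 1 \<le> j \<and> j < 1" "\<kappa> = str \<nu> \<alpha> j"
    using ssum_of_bool_ex[OF a(2)] by blast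
  have aS: "\<alpha> \<in> S" using a Sp_S by blast
  have "j \<noteq> 0" using j(2) ne by auto
  then consider "j = lev \<nu> \<alpha>" "j > 0" | "0 < j \<and> j < lev \<nu> \<alpha> \<or> lev \<nu> \<alpha> < j \<and> j < 0" using j(1) by linarith
  then show ?thesis
  proof cases
    case 1
    have "\<kappa> = refl_root \<alpha> \<nu>" unfolding j(2) 1(1) refl_string[OF n aS] ..
    then have "norm \<kappa> = norm \<nu>" using weyl_norm[OF weyl_refl[OF aS]] by simp
    moreover have "\<kappa> \<bullet> xi < \<nu> \<bullet> xi" unfolding j(2) using 1(2) Sp_xi[OF a(1)] by (simp add: inner_diff_left)
    ultimately show ?thesis by (simp add: lt_def)
  next
    case 2
    then show ?thesis using string_norm_less[OF n aS 2] by (simp add: lt_def j(2))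
  qed
qed

text \<open>For negative \<open>lev \<nu> \<alpha>\<close> the string passes through
  \<open>j = 0\<close> with a minus sign; otherwise it misses it.\<close>

lemma At_diag_le:
  assumes "\<nu> \<in> Lam" "\<And>\<alpha>. \<alpha> \<in> Sp \<Longrightarrow> 0 < \<alpha> \<bullet> \<eta>"
  shows "At \<eta> \<nu> \<nu> \<le> \<nu> \<bullet> \<eta>"
proof -
  have "m \<alpha> * (\<alpha> \<bullet> \<eta>) * ssum (\<lambda>j. of_bool (\<nu> = str \<nu> \<alpha> j)) 1 (lev \<nu> \<alpha> + 1) \<le> 0" if a: "\<alpha> \<in> Sp" for \<alpha>
  proof (rule mult_nonneg_nonpos)
    show "0 \<le> m \<alpha> * (\<alpha> \<bullet> \<eta>)" using m_nonneg Sp_S[OF a] assms(2)[OF a] by simp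
    show "ssum (\<lambda>j. of_bool (\<nu> = str \<nu> \<alpha> j) :: real) 1 (lev \<nu> \<alpha> + 1) \<le> 0"
    proof (cases "lev \<nu> \<alpha> \<ge> 0")
      case True
      have "ssum (\<lambda>j. of_bool (\<nu> = str \<nu> \<alpha> j) :: real) 1 (lev \<nu> \<alpha> + 1) = 0"
      proof (rule ccontr)
        assume "\<not> ?thesis"
        from ssum_of_bool_ex[OF this] obtain j where "1 \<le> j \<or> lev \<nu> \<alpha> + 1 \<le> j" "\<nu> = str \<nu> \<alpha> j" by blast
        then show False using True Sp_nz[OF a] by auto
      qed
      then show ?thesis by simp
    next
      case False
      then show ?thesis by (intro ssum_of_bool_nonpos) auto
    qed
  qed
  then show ?thesis by (simp add: At_def sum_nonpos)
qed

lemma At_diag_dom: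
  assumes "l \<in> Dom"
  shows "At \<eta> l l = l \<bullet> \<eta>"
proof -
  have "ssum (\<lambda>j. of_bool (l = str l \<alpha> j) :: real) 1 (lev l \<alpha> + 1) = 0" if a: "\<alpha> \<in> Sp" for \<alpha>
  proof (rule ccontr)
    assume "\<not> ?thesis"
    from ssum_of_bool_ex[OF this] obtain j where "1 \<le> j \<or> lev l \<alpha> + 1 \<le> j" "l = str l \<alpha> j" by blast
    moreover have "lev l \<alpha> \<ge> 0"
      using lev_sign[OF dom_Lam[OF assms] Sp_S[OF a]] dom_dominant[OF assms] a by (simp add: dominant_def inner_commute)
    ultimately show False using Sp_nz[OF a] by auto
  qed
  then show ?thesis by (simp add: At_def)
qed

lemma X_root_le: assumes "\<nu> \<in> X l" shows "root_le Sp \<nu> l"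
proof -
  obtain \<mu> where "\<mu> \<in> low l" "\<nu> \<in> orb \<mu>" using assms by (auto simp: X_def)
  then show ?thesis using root_le_orb[of \<mu> \<nu>] root_le_trans by (auto simp: low_def)
qed

lemma X_norm_max: assumes "\<nu> \<in> X l" shows "norm \<nu> \<le> norm l" "norm \<nu> = norm l \<Longrightarrow> \<nu> \<in> orb l"
proof -
  obtain \<mu> where m: "\<mu> \<in> low l" "\<nu> \<in> orb \<mu>" using assms by (auto simp: X_def)
  then have "norm \<nu> = norm \<mu>" using orb_norm by blast
  then show "norm \<nu> \<le> norm l" "norm \<nu> = norm l \<Longrightarrow> \<nu> \<in> orb l"
    using low_norm[OF m(1)] m by (cases "\<mu> = l"; force)+
qed

text \<open>Within the orbit a negative string meets only \<nu> itself, so off-diagonal entries come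
  from the far ends of positive strings, which count with a plus sign.\<close>

lemma At_orb_nonneg:
  assumes "\<nu> \<in> orb l" "\<kappa> \<in> orb l" "\<nu> \<in> Lam" "\<nu> \<noteq> \<kappa>" "\<And>\<alpha>. \<alpha> \<in> Sp \<Longrightarrow> 0 < \<alpha> \<bullet> \<eta>"
  shows "0 \<le> At \<eta> \<nu> \<kappa>"
proof -
  have "0 \<le> m \<alpha> * (\<alpha> \<bullet> \<eta>) * ssum (\<lambda>j. of_bool (\<kappa> = str \<nu> \<alpha> j)) 1 (lev \<nu> \<alpha> + 1)" if a: "\<alpha> \<in> Sp" for \<alpha>
  proof (rule mult_nonneg_nonneg)
    show "0 \<le> m \<alpha> * (\<alpha> \<bullet> \<eta>)" using m_nonneg Sp_S[OF a] assms(5)[OF a] by simp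
    show "0 \<le> ssum (\<lambda>j. of_bool (\<kappa> = str \<nu> \<alpha> j) :: real) 1 (lev \<nu> \<alpha> + 1)"
    proof (cases "lev \<nu> \<alpha> \<ge> 0")
      case True
      then show ?thesis by (intro ssum_of_bool_nonneg) auto
    next
      case False
      have "ssum (\<lambda>j. of_bool (\<kappa> = str \<nu> \<alpha> j) :: real) 1 (lev \<nu> \<alpha> + 1) = 0"
      proof (rule ccontr)
        assume "\<not> ?thesis"
        from ssum_of_bool_ex[OF this] obtain j where
          j: "1 \<le> j \<and> j < lev \<nu> \<alpha> + 1 \<or> lev \<nu> \<alpha> + 1 \<le> j \<and> j < 1" "\<kappa> = str \<nu> \<alpha> j" by blast
        then have "lev \<nu> \<alpha> < j" "j \<le> 0" using False by auto
        then show False using string_orb_iff[OF assms(3,1) Sp_S[OF a], of j] assms(2,4) j(2) by auto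
      qed
      then show ?thesis by simp
    qed
  qed
  then show ?thesis using assms(4) by (simp add: At_def sum_nonneg)
qed

text \<open>As \<eta> is strictly dominant, \<open>l \<bullet> \<eta>\<close> is strictly the
  largest diagonal entry on \<open>X l\<close>. Nonnegativity on the orbit of \<open>l\<close>
  guarantees that symmetrising does not kill the leading term.\<close>

lemma top_eigenvector:
  assumes l: "l \<in> Dom" and eta: "\<And>\<alpha>. \<alpha> \<in> Sp \<Longrightarrow> 0 < \<alpha> \<bullet> \<eta>"
  obtains c where "c l = 1" "\<And>\<kappa>. \<kappa> \<in> orb l \<Longrightarrow> 0 \<le> c \<kappa>"
    "\<And>\<kappa>. \<kappa> \<in> X l \<Longrightarrow> (\<Sum>\<nu>\<in>X l. c \<nu> * At \<eta> \<nu> \<kappa>) = (l \<bullet> \<eta>) * c \<kappa>"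
proof -
  have lX: "l \<in> X l" using orb_X[OF l] orb_self by blast
  have less: "At \<eta> \<kappa> \<kappa> < l \<bullet> \<eta>" if "\<kappa> \<in> X l" "\<kappa> \<noteq> l" for \<kappa>
    using At_diag_le[OF X_Lam[OF that(1)] eta] root_le_inner_strict[OF X_root_le[OF that(1)] eta that(2)] by simp
  have ne: "At \<eta> \<kappa> \<kappa> \<noteq> At \<eta> l l" if "\<kappa> \<in> X l" "lt \<kappa> l" for \<kappa>
    using less[OF that(1)] that(2) lt_irrefl At_diag_dom[OF l] by force
  have tri: "lt y x" if "x \<in> X l" "y \<in> X l" "x \<noteq> y" "At \<eta> x y \<noteq> 0" for x y
    using At_tri X_Lam that by blast
  have "\<exists>c. c l = 1 \<and> (\<forall>\<kappa>\<in>X l. (\<Sum>\<nu>\<in>X l. c \<nu> * At \<eta> \<nu> \<kappa>) = At \<eta> l l * c \<kappa>)"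
  proof (rule triangular_eigenvector[of "X l" l lt "At \<eta>"])
    fix c assume "c l = 1" "\<And>y. y \<in> X l \<Longrightarrow> (\<Sum>x\<in>X l. c x * At \<eta> x y) = At \<eta> l l * c y"
    then show ?thesis by blast
  qed (use finite_X lX lt_irrefl lt_trans tri ne in auto)
  then obtain c where c: "c l = 1" "\<And>\<kappa>. \<kappa> \<in> X l \<Longrightarrow> (\<Sum>\<nu>\<in>X l. c \<nu> * At \<eta> \<nu> \<kappa>) = At \<eta> l l * c \<kappa>"
    by blast
  have "0 \<le> c \<kappa>" if "\<kappa> \<in> orb l" for \<kappa>
    using that
  proof (induction "card {\<nu>\<in>X l. lt \<kappa> \<nu>}" arbitrary: \<kappa> rule: less_induct)
    case less': less
    have kX: "\<kappa> \<in> X l" using less'.prems orb_X[OF l] by blast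
    show ?case
    proof (cases "\<kappa> = l")
      case False
      have "0 \<le> c \<nu> * At \<eta> \<nu> \<kappa>" if n: "\<nu> \<in> X l - {\<kappa>}" for \<nu>
      proof (cases "At \<eta> \<nu> \<kappa> = 0")
        case False
        then have lt: "lt \<kappa> \<nu>" using At_tri[OF X_Lam] n by blast
        then have "norm \<nu> = norm l" using X_norm_max(1)[of \<nu> l] n orb_norm[OF less'.prems] by (auto simp: lt_def)
        then have no: "\<nu> \<in> orb l" using X_norm_max(2) n by blast
        have "{z\<in>X l. lt \<nu> z} \<subset> {z\<in>X l. lt \<kappa> z}" using lt n lt_trans lt_irrefl by blast
        then have "card {z\<in>X l. lt \<nu> z} < card {z\<in>X l. lt \<kappa> z}"
          by (rule psubset_card_mono[rotated]) (simp add: finite_X)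
        then have "0 \<le> c \<nu>" using less'.hyps no by blast
        moreover have "0 \<le> At \<eta> \<nu> \<kappa>" using At_orb_nonneg[OF no less'.prems X_Lam _ eta] n by blast
        ultimately show ?thesis by simp
      qed simp
      then have "0 \<le> (\<Sum>\<nu>\<in>X l - {\<kappa>}. c \<nu> * At \<eta> \<nu> \<kappa>)" by (intro sum_nonneg) auto
      moreover have "c \<kappa> * At \<eta> \<kappa> \<kappa> + (\<Sum>\<nu>\<in>X l - {\<kappa>}. c \<nu> * At \<eta> \<nu> \<kappa>) = (l \<bullet> \<eta>) * c \<kappa>"
        using c(2)[OF kX] kX At_diag_dom[OF l] by (simp add: sum.remove[OF finite_X])
      ultimately have "0 \<le> (l \<bullet> \<eta> - At \<eta> \<kappa> \<kappa>) * c \<kappa>" by (simp add: algebra_simps)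
      then show ?thesis using less[OF kX False] by (simp add: zero_le_mult_iff)
    qed (simp add: c)
  qed
  then show ?thesis using c At_diag_dom[OF l] that by metis
qed

text \<open>The top eigenvector \<open>F\<close> of one Cherednik operator symmetrises to a multiple of \<open>PP l\<close>, and its
  eigenvalue exceeds every eigenvalue on the characters below \<open>\<mu>\<close>. This separates \<open>l\<close> and \<open>\<mu>\<close>
  even when the Laplacian has the same eigenvalue on both.\<close>

lemma PP_orthogonal_strict:
  assumes l: "l \<in> Dom" and mu: "\<mu> \<in> Dom" and eta: "\<And>\<alpha>. \<alpha> \<in> Sp \<Longrightarrow> 0 < \<alpha> \<bullet> \<eta>"
    and less: "\<mu> \<bullet> \<eta> < l \<bullet> \<eta>"
  shows "ip (PP l) (PP \<mu>) = 0"
proof -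
  obtain c where c: "c l = 1" "\<And>\<kappa>. \<kappa> \<in> orb l \<Longrightarrow> 0 \<le> c \<kappa>"
    "\<And>\<kappa>. \<kappa> \<in> X l \<Longrightarrow> (\<Sum>\<nu>\<in>X l. c \<nu> * At \<eta> \<nu> \<kappa>) = (l \<bullet> \<eta>) * c \<kappa>"
    using top_eigenvector[OF l eta] by blast
  define F where "F x = (\<Sum>\<nu>\<in>X l. of_real (c \<nu>) * chr \<nu> x)" for x
  have contF: "continuous_on A F" for A unfolding F_def[abs_def] by (intro continuous_intros continuous_chr)
  have TF: "(\<Sum>\<nu>\<in>X l. of_real (c \<nu>) * Tc \<eta> \<nu> x) = of_real (l \<bullet> \<eta>) * F x" for x
  proof -
    have "(\<Sum>\<nu>\<in>X l. of_real (c \<nu>) * Tc \<eta> \<nu> x) = (\<Sum>\<nu>\<in>X l. \<Sum>\<kappa>\<in>X l. of_real (c \<nu> * At \<eta> \<nu> \<kappa>) * chr \<kappa> x)"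
      by (intro sum.cong refl) (simp add: Tc_expand[of _ l] sum_distrib_left mult.assoc)
    also have "\<dots> = (\<Sum>\<kappa>\<in>X l. of_real (\<Sum>\<nu>\<in>X l. c \<nu> * At \<eta> \<nu> \<kappa>) * chr \<kappa> x)"
      by (subst sum.swap) (simp add: sum_distrib_right)
    also have "\<dots> = of_real (l \<bullet> \<eta>) * F x"
      unfolding F_def sum_distrib_left by (intro sum.cong refl) (simp add: c(3) mult.assoc)
    finally show ?thesis .
  qed
  \<comment> \<open>Below a \<kappa> of smaller \<eta>-height all diagonal entries stay under the
    eigenvalue of \<open>F\<close>, so symmetry and \<open>triangular_kernel\<close> make
    \<open>F\<close> orthogonal to each character there.\<close>
  have F_orth: "ip F (chr \<nu>) = 0" if k: "\<kappa> \<in> Dom" "\<kappa> \<bullet> \<eta> < l \<bullet> \<eta>" "\<nu> \<in> X \<kappa>" for \<kappa> \<nu>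
  proof (rule triangular_kernel[of "X \<kappa>" lt "At \<eta>" "l \<bullet> \<eta>" "\<lambda>\<nu>. ip F (chr \<nu>)"])
    show "At \<eta> y y \<noteq> l \<bullet> \<eta>" if "y \<in> X \<kappa>" for y
    proof -
      have "At \<eta> y y \<le> y \<bullet> \<eta>" by (rule At_diag_le[OF X_Lam[OF that] eta])
      also have "\<dots> \<le> \<kappa> \<bullet> \<eta>" using X_root_le[OF that] eta by (intro root_le_inner) (auto intro: less_imp_le)
      finally show ?thesis using k(2) by simp
    qed
    fix y assume y: "y \<in> X \<kappa>"
    have "of_real (l \<bullet> \<eta>) * ip F (chr y) = ip (\<lambda>x. \<Sum>\<nu>\<in>X l. of_real (c \<nu>) * Tc \<eta> \<nu> x) (chr y)"
      unfolding TF ip_cmult_left ..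
    also have "\<dots> = (\<Sum>\<nu>\<in>X l. of_real (c \<nu>) * ip (Tc \<eta> \<nu>) (chr y))"
      by (rule ip_sum_left) (auto intro: continuous_Tc continuous_chr)
    also have "\<dots> = (\<Sum>\<nu>\<in>X l. of_real (c \<nu>) * ip (chr \<nu>) (Tc \<eta> y))"
      using X_Lam[OF y] by (intro sum.cong refl) (simp add: Tc_symmetric X_Lam)
    also have "\<dots> = ip F (Tc \<eta> y)"
      unfolding F_def[abs_def] by (rule ip_sum_left[symmetric]) (auto intro: continuous_Tc continuous_chr)
    also have "Tc \<eta> y = (\<lambda>x. \<Sum>\<kappa>\<in>X \<kappa>. of_real (At \<eta> y \<kappa>) * chr \<kappa> x)"
      using Tc_expand[OF y] by auto
    also have "ip F \<dots> = (\<Sum>z\<in>X \<kappa>. of_real (At \<eta> y z) * ip F (chr z))"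
      by (subst ip_sum_right) (auto intro: contF continuous_chr)
    finally show "of_real (l \<bullet> \<eta>) * ip F (chr y) = (\<Sum>z\<in>X \<kappa>. of_real (At \<eta> y z) * ip F (chr z))" .
  qed (use finite_X lt_irrefl lt_trans At_tri[OF X_Lam] k in auto)
  define d where "d \<kappa> = (\<Sum>\<nu>\<in>orb \<kappa>. c \<nu>) / of_nat (card (orb \<kappa>))" for \<kappa>
  define SF where "SF x = (\<Sum>w\<in>W. F (w x)) / of_nat (card W)" for x
  have SF: "SF x = (\<Sum>\<kappa>\<in>low l. of_real (d \<kappa>) * M \<kappa> x)" for x
    unfolding SF_def F_def average_X d_def ..
  have "(\<Sum>\<nu>\<in>orb l. c \<nu>) \<ge> c l" using c(2) finite_orb orb_self by (intro member_le_sum) auto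
  then have dpos: "d l > 0" unfolding d_def using c(1) card_orb_pos[of l] by (intro divide_pos_pos) auto
  have contw: "continuous_on A (\<lambda>x. F (w x))" if "w \<in> W" for w A
    using weyl_linear[OF that] linear_continuous_on linear_conv_bounded_linear
    by (intro continuous_on_compose2[OF contF[of UNIV]]) blast+
  have ipSF: "ip SF g = ip F g" if g: "continuous_on UNIV g" "\<And>w x. w \<in> W \<Longrightarrow> g (w x) = g x" for g
  proof -
    have "SF = (\<lambda>x. \<Sum>w\<in>W. (1 / of_nat (card W)) * F (w x))" by (simp add: SF_def fun_eq_iff sum_divide_distrib)
    then have "ip SF g = (\<Sum>w\<in>W. (1 / of_nat (card W)) * ip (\<lambda>x. F (w x)) g)"
      using ip_sum_left[of W "\<lambda>w x. F (w x)" g "\<lambda>_. 1 / of_nat (card W)", OF contw g(1)] by simp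
    also have "\<dots> = (\<Sum>w\<in>W. (1 / of_nat (card W)) * ip F g)"
      by (intro sum.cong refl) (simp add: ip_weyl[OF _ contF g(1)] g(2))
    finally show ?thesis using card_W_nonzero by simp
  qed
  have ipF: "ip F (M \<kappa>) = 0" if "\<kappa> \<in> Dom" "\<kappa> \<bullet> \<eta> < l \<bullet> \<eta>" for \<kappa>
  proof -
    have "ip F (M \<kappa>) = (\<Sum>\<nu>\<in>orb \<kappa>. ip F (chr \<nu>))"
      using ip_sum_right[of "orb \<kappa>" chr F "\<lambda>_. 1", OF continuous_chr contF] by (simp add: M_eq[abs_def])
    then show ?thesis using F_orth[OF that] orb_X[OF that(1)] by (simp add: subset_iff)
  qed
  have ipSFM: "ip SF (M \<kappa>) = ip F (M \<kappa>)" for \<kappa> by (rule ipSF[OF continuous_M]) (rule M_weyl)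
  have lowless: "\<kappa> \<bullet> \<eta> < l \<bullet> \<eta>" if "\<kappa> \<in> low l - {l}" for \<kappa>
    using that eta by (intro root_le_inner_strict) (auto simp: low_def)
  have contSF: "continuous_on UNIV SF" unfolding SF[abs_def] by (intro continuous_intros continuous_M)
  \<comment> \<open>Both terms are orthogonal to all lower orbit sums and have the same leading
    coefficient.\<close>
  have eq: "SF x - of_real (d l) * PP l x = 0" for x
  proof (rule lower_orthogonal_zero[OF l, of _ "\<lambda>\<kappa>. of_real (d \<kappa> - d l * Pc l \<kappa>)"])
    show "SF x - of_real (d l) * PP l x = (\<Sum>\<kappa>\<in>low l - {l}. of_real (d \<kappa> - d l * Pc l \<kappa>) * M \<kappa> x)" for x
    proof -
      have "SF x - of_real (d l) * PP l x = (\<Sum>\<kappa>\<in>low l. of_real (d \<kappa> - d l * Pc l \<kappa>) * M \<kappa> x)"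
        unfolding SF PP_def sum_distrib_left sum_subtractf[symmetric] by (simp add: algebra_simps)
      then show ?thesis using Pc(1)[OF l] by (simp add: sum.remove[OF finite_low low_self[OF l]])
    qed
    fix \<kappa> assume k: "\<kappa> \<in> low l - {l}"
    have "ip (\<lambda>x. SF x + (- of_real (d l)) * PP l x) (M \<kappa>) = ip SF (M \<kappa>) + (- of_real (d l)) * ip (PP l) (M \<kappa>)"
      by (subst ip_add_left) (auto intro!: contSF continuous_intros continuous_PP continuous_M simp only: ip_cmult_left)
    also have "\<dots> = 0"
      using ipSFM ipF[OF low_dom[of \<kappa> l] lowless] PP_orthogonal_M[OF l, of \<kappa>] k by simp
    finally show "ip (\<lambda>x. SF x - of_real (d l) * PP l x) (M \<kappa>) = 0" by simp
  qed
  have "PP l = (\<lambda>x. (1 / of_real (d l)) * SF x)" using eq dpos by (auto simp: fun_eq_iff field_simps)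
  then have "ip (PP l) (PP \<mu>) = (1 / of_real (d l)) * ip SF (PP \<mu>)" by (simp only: ip_cmult_left)
  also have "ip SF (PP \<mu>) = ip F (PP \<mu>)" by (rule ipSF[OF continuous_PP]) (rule PP_weyl)
  also have "\<dots> = (\<Sum>\<kappa>\<in>low \<mu>. of_real (Pc \<mu> \<kappa>) * ip F (M \<kappa>))"
    unfolding PP_def[abs_def] by (subst ip_sum_right) (auto intro: contF continuous_M)
  also have "\<dots> = 0"
  proof (intro sum.neutral ballI)
    fix \<kappa> assume k: "\<kappa> \<in> low \<mu>"
    have "\<kappa> \<bullet> \<eta> \<le> \<mu> \<bullet> \<eta>" using k eta by (intro root_le_inner) (auto simp: low_def intro: less_imp_le)
    then show "of_real (Pc \<mu> \<kappa>) * ip F (M \<kappa>) = 0" using ipF[OF low_dom[OF k]] less by simp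
  qed
  finally show ?thesis by simp
qed

text \<open>\<open>xi\<close> may fail to separate the two weights; a small push in the direction of
  their difference keeps it strictly dominant and makes the heights differ.\<close>

lemma PP_orthogonal:
  assumes l: "l \<in> Dom" and mu: "\<mu> \<in> Dom" and ne: "l \<noteq> \<mu>"
  shows "ip (PP l) (PP \<mu>) = 0"
proof -
  define d where "d = l - \<mu>"
  have "\<exists>\<eta>. (\<forall>\<alpha>\<in>Sp. 0 < \<alpha> \<bullet> \<eta>) \<and> d \<bullet> \<eta> \<noteq> 0"
  proof (cases "d \<bullet> xi = 0")
    case False
    then show ?thesis using Sp_xi by blast
  next
    case True
    have "\<forall>\<^sub>F s in at_right 0. 0 < \<alpha> \<bullet> (xi + s *\<^sub>R d)" if "\<alpha> \<in> Sp" for \<alpha>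
    proof -
      have "((\<lambda>s. \<alpha> \<bullet> (xi + s *\<^sub>R d)) \<longlongrightarrow> \<alpha> \<bullet> (xi + 0 *\<^sub>R d)) (at_right 0)" by (intro tendsto_intros)
      then show ?thesis using Sp_xi[OF that] by (intro order_tendstoD(1)) auto
    qed
    then have "\<forall>\<^sub>F s in at_right 0. (\<forall>\<alpha>\<in>Sp. 0 < \<alpha> \<bullet> (xi + s *\<^sub>R d)) \<and> s > (0::real)"
      using finite_Sp by (intro eventually_conj eventually_ball_finite) (auto simp: eventually_at_right_less)
    then obtain s where s: "\<forall>\<alpha>\<in>Sp. 0 < \<alpha> \<bullet> (xi + s *\<^sub>R d)" "s > (0::real)"
      using eventually_happens'[OF trivial_limit_at_right_real] by blast
    have "d \<bullet> (xi + s *\<^sub>R d) = s * (d \<bullet> d)" using True by (simp add: inner_add_right)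
    moreover have "d \<bullet> d \<noteq> 0" using ne by (simp add: d_def)
    ultimately show ?thesis using s by (intro exI[of _ "xi + s *\<^sub>R d"]) auto
  qed
  then obtain \<eta> where e: "\<And>\<alpha>. \<alpha> \<in> Sp \<Longrightarrow> 0 < \<alpha> \<bullet> \<eta>" "l \<bullet> \<eta> \<noteq> \<mu> \<bullet> \<eta>"
    by (auto simp: d_def inner_diff_left)
  show ?thesis
  proof (cases "\<mu> \<bullet> \<eta> < l \<bullet> \<eta>")
    case True
    then show ?thesis using PP_orthogonal_strict[OF l mu e(1)] by blast
  next
    case False
    then have "ip (PP \<mu>) (PP l) = 0" using PP_orthogonal_strict[OF mu l e(1)] e(2) by simp
    then show ?thesis using ip_cnj[of "PP l" "PP \<mu>"] by simp
  qed
qed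

lemma HO_poly_eq: assumes l: "l \<in> Dom" shows "HO_poly S Sp m l = PP l"
  unfolding HO_poly_def low_def[symmetric]
proof (rule the_equality)
  show "\<exists>c. PP l = (\<lambda>x. \<Sum>\<mu>\<in>low l. c \<mu> * M \<mu> x) \<and> c l = 1 \<and>
      (\<forall>\<mu>\<in>Dom. root_le Sp \<mu> l \<and> \<mu> \<noteq> l \<longrightarrow> ip_m Sp m (PP l) (M \<mu>) = 0)"
  proof (intro exI[of _ "\<lambda>\<mu>. of_real (Pc l \<mu>)"] conjI ballI impI)
    show "PP l = (\<lambda>x. \<Sum>\<mu>\<in>low l. of_real (Pc l \<mu>) * M \<mu> x)" by (simp add: PP_def fun_eq_iff)
    show "of_real (Pc l l) = (1::complex)" using Pc(1)[OF l] by simp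
    fix \<mu> assume "\<mu> \<in> Dom" "root_le Sp \<mu> l \<and> \<mu> \<noteq> l"
    then have "ip (PP l) (M \<mu>) = 0" using PP_orthogonal_M[OF l] by (auto simp: low_def)
    then show "ip_m Sp m (PP l) (M \<mu>) = 0"
      using ip_eq_ip_m[of "PP l" "M \<mu>"] continuous_PP continuous_M PP_weyl M_weyl card_W_nonzero by simp
  qed
next
  fix P assume "\<exists>c. P = (\<lambda>x. \<Sum>\<mu>\<in>low l. c \<mu> * M \<mu> x) \<and> c l = 1 \<and>
      (\<forall>\<mu>\<in>Dom. root_le Sp \<mu> l \<and> \<mu> \<noteq> l \<longrightarrow> ip_m Sp m P (M \<mu>) = 0)"
  then obtain c where c: "P = (\<lambda>x. \<Sum>\<mu>\<in>low l. c \<mu> * M \<mu> x)" "c l = 1"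
      "\<And>\<mu>. \<mu> \<in> low l - {l} \<Longrightarrow> ip_m Sp m P (M \<mu>) = 0" by (auto simp: low_def)
  have contP: "continuous_on UNIV P" unfolding c(1) by (intro continuous_intros continuous_M)
  have "P x - PP l x = 0" for x
  proof (rule lower_orthogonal_zero[OF l, of _ "\<lambda>\<kappa>. c \<kappa> - of_real (Pc l \<kappa>)"])
    show "P x - PP l x = (\<Sum>\<kappa>\<in>low l - {l}. (c \<kappa> - of_real (Pc l \<kappa>)) * M \<kappa> x)" for x
    proof -
      have "P x - PP l x = (\<Sum>\<kappa>\<in>low l. (c \<kappa> - of_real (Pc l \<kappa>)) * M \<kappa> x)"
        unfolding c(1) PP_def sum_subtractf[symmetric] by (simp add: algebra_simps)
      then show ?thesis using Pc(1)[OF l] c(2) by (simp add: sum.remove[OF finite_low low_self[OF l]])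
    qed
    fix \<kappa> assume k: "\<kappa> \<in> low l - {l}"
    have "ip (\<lambda>x. P x + (-1) * PP l x) (M \<kappa>) = ip P (M \<kappa>) + (-1) * ip (PP l) (M \<kappa>)"
      by (subst ip_add_left) (auto intro!: contP continuous_intros continuous_PP continuous_M simp only: ip_cmult_left)
    also have "ip P (M \<kappa>) = of_nat (card W) * ip_m Sp m P (M \<kappa>)"
    proof (rule ip_eq_ip_m[OF contP continuous_M])
      show "w \<in> W \<Longrightarrow> P (w x) = P x" for w x by (simp add: c(1) M_weyl)
    qed (rule M_weyl)
    finally show "ip (\<lambda>x. P x - PP l x) (M \<kappa>) = 0" using c(3)[OF k] PP_orthogonal_M[OF l] k by simp
  qed
  then show "P = PP l" by (auto simp: fun_eq_iff)
qed

end

lemma second_derivative_at_max: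
  fixes h h' :: "real \<Rightarrow> real"
  assumes d: "\<And>s. (h has_real_derivative h' s) (at s)" and d2: "(h' has_real_derivative h2) (at 0)"
    and max: "\<And>s. h s \<le> h 0"
  shows "h' 0 = 0" "h2 \<le> 0"
proof -
  show 0: "h' 0 = 0" using DERIV_local_max[OF d[of 0], of 1] max by simp
  show "h2 \<le> 0"
  proof (rule ccontr)
    assume "\<not> h2 \<le> 0"
    then obtain e where e: "e > 0" "\<And>s. 0 < s \<Longrightarrow> s < e \<Longrightarrow> h' 0 < h' (0 + s)"
      using DERIV_pos_inc_right[OF d2] by auto
    have "\<exists>z. 0 < z \<and> z < e / 2 \<and> h (e / 2) - h 0 = (e / 2 - 0) * h' z"
      by (rule MVT2) (use e d in auto)
    then obtain z where "0 < z" "z < e / 2" "h (e / 2) - h 0 = e / 2 * h' z" by auto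
    moreover have "h' z > 0" using e(2)[of z] calculation e(1) 0 by simp
    ultimately show False using max[of "e / 2"] e(1) by (smt (verit) mult_pos_pos half_gt_zero)
  qed
qed

context root_data
begin

section \<open>Invariant trigonometric polynomials\<close>

text \<open>Finite linear combinations of an indexed family, so that the bases \<open>M\<close> and
  \<open>PP\<close> and the span of all characters can be treated alike.\<close>

definition fsp :: "'a set \<Rightarrow> ('a \<Rightarrow> 'a \<Rightarrow> complex) \<Rightarrow> ('a \<Rightarrow> complex) set" where
  "fsp D v = {f. \<exists>F c. finite F \<and> F \<subseteq> D \<and> f = (\<lambda>x. \<Sum>l\<in>F. c l * v l x)}"

lemma trig_W_fsp: "trig_W S Sp = fsp Dom M" by (simp add: trig_W_def fsp_def)

lemma fspI: "finite F \<Longrightarrow> F \<subseteq> D \<Longrightarrow> (\<lambda>x. \<Sum>l\<in>F. c l * v l x) \<in> fsp D v"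
  unfolding fsp_def by blast

lemma fsp_base: assumes "l \<in> D" shows "v l \<in> fsp D v"
  using fspI[of "{l}" D "\<lambda>_. 1" v] assms by (simp add: eta_contract_eq)

lemma fsp_scale: assumes "f \<in> fsp D v" shows "(\<lambda>x. a * f x) \<in> fsp D v"
proof -
  obtain F c where "finite F" "F \<subseteq> D" "f = (\<lambda>x. \<Sum>l\<in>F. c l * v l x)" using assms by (auto simp: fsp_def)
  then show ?thesis using fspI[of F D "\<lambda>l. a * c l" v] by (simp add: sum_distrib_left mult.assoc)
qed

lemma fsp_add: assumes "f \<in> fsp D v" "g \<in> fsp D v" shows "(\<lambda>x. f x + g x) \<in> fsp D v"
proof -
  obtain F c where F: "finite F" "F \<subseteq> D" "f = (\<lambda>x. \<Sum>l\<in>F. c l * v l x)" using assms by (auto simp: fsp_def)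
  obtain G d where G: "finite G" "G \<subseteq> D" "g = (\<lambda>x. \<Sum>l\<in>G. d l * v l x)" using assms by (auto simp: fsp_def)
  have "f x = (\<Sum>l\<in>F \<union> G. (if l \<in> F then c l else 0) * v l x)" for x
    unfolding F(3) using F G by (intro sum.mono_neutral_cong_left) auto
  moreover have "g x = (\<Sum>l\<in>F \<union> G. (if l \<in> G then d l else 0) * v l x)" for x
    unfolding G(3) using F G by (intro sum.mono_neutral_cong_left) auto
  ultimately have "(\<lambda>x. f x + g x) = (\<lambda>x. \<Sum>l\<in>F \<union> G. ((if l \<in> F then c l else 0) + (if l \<in> G then d l else 0)) * v l x)"
    by (simp add: sum.distrib[symmetric] distrib_right)
  then show ?thesis using fspI[of "F \<union> G" D] F G by simp
qed

lemma fsp_0: "(\<lambda>x. 0) \<in> fsp D v" using fspI[of "{}" D undefined v] by simp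

lemma fsp_sum: "finite J \<Longrightarrow> (\<And>j. j \<in> J \<Longrightarrow> g j \<in> fsp D v) \<Longrightarrow> (\<lambda>x. \<Sum>j\<in>J. c j * g j x) \<in> fsp D v"
  by (induction J rule: finite_induct) (auto intro!: fsp_0 fsp_add fsp_scale)

lemma fsp_mono: assumes "\<And>l. l \<in> D \<Longrightarrow> u l \<in> fsp E v" shows "fsp D u \<subseteq> fsp E v"
  using fsp_sum[of _ u E v] assms by (auto simp: fsp_def[of D u] subset_iff)

lemma fsp_PP: "fsp Dom PP = fsp Dom M"
proof
  show "fsp Dom PP \<subseteq> fsp Dom M"
  proof (rule fsp_mono)
    fix l assume "l \<in> Dom"
    have "(\<lambda>x. \<Sum>\<mu>\<in>low l. of_real (Pc l \<mu>) * M \<mu> x) \<in> fsp Dom M"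
      by (rule fspI) (auto simp: finite_low low_dom)
    then show "PP l \<in> fsp Dom M" by (simp add: PP_def[abs_def])
  qed
  show "fsp Dom M \<subseteq> fsp Dom PP"
  proof (rule fsp_mono)
    fix l assume "l \<in> Dom"
    then show "M l \<in> fsp Dom PP"
    proof (induction "card (low l)" arbitrary: l rule: less_induct)
      case less
      have IH: "M \<mu> \<in> fsp Dom PP" if m: "\<mu> \<in> low l - {l}" for \<mu>
      proof (rule less.hyps)
        have "l \<notin> low \<mu>" using low_norm[of \<mu> l] low_norm[of l \<mu>] m by auto
        then have "low \<mu> \<subset> low l" using low_mono[of \<mu> l] m low_self[OF less.prems] by auto
        then show "card (low \<mu>) < card (low l)" by (rule psubset_card_mono[OF finite_low])
        show "\<mu> \<in> Dom" using m low_dom by blast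
      qed
      have "M l = (\<lambda>x. PP l x + (-1) * (\<Sum>\<mu>\<in>low l - {l}. of_real (Pc l \<mu>) * M \<mu> x))"
        by (simp add: fun_eq_iff PP_def sum.remove[OF finite_low low_self[OF less.prems]] Pc(1)[OF less.prems])
      moreover have "(\<lambda>x. \<Sum>\<mu>\<in>low l - {l}. of_real (Pc l \<mu>) * M \<mu> x) \<in> fsp Dom PP"
        by (rule fsp_sum) (use finite_low IH in auto)
      then have "(\<lambda>x. PP l x + (-1) * (\<Sum>\<mu>\<in>low l - {l}. of_real (Pc l \<mu>) * M \<mu> x)) \<in> fsp Dom PP"
        by (intro fsp_add fsp_base fsp_scale less.prems)
      ultimately show ?case by (simp only:)
    qed
  qed
qed

definition DM :: "'a \<Rightarrow> 'a \<Rightarrow> 'a \<Rightarrow> complex" where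
  "DM l v x = (\<Sum>\<nu>\<in>orb l. \<i> * of_real (\<nu> \<bullet> v) * chr \<nu> x)"

definition D2M :: "'a \<Rightarrow> 'a \<Rightarrow> 'a \<Rightarrow> complex" where
  "D2M l v x = (\<Sum>\<nu>\<in>orb l. - of_real ((\<nu> \<bullet> v)\<^sup>2) * chr \<nu> x)"

lemma M_derivative:
  "((\<lambda>s. M l (x + s *\<^sub>R v)) has_vector_derivative DM l v (x + s *\<^sub>R v)) (at s)"
  unfolding M_eq DM_def by (intro has_vector_derivative_sum chr_has_vector_derivative)

lemma DM_derivative:
  "((\<lambda>s. DM l v (x + s *\<^sub>R v)) has_vector_derivative D2M l v (x + s *\<^sub>R v)) (at s)"
proof -
  have "((\<lambda>s. DM l v (x + s *\<^sub>R v)) has_vector_derivative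
     (\<Sum>\<nu>\<in>orb l. \<i> * of_real (\<nu> \<bullet> v) * (\<i> * of_real (\<nu> \<bullet> v) * chr \<nu> (x + s *\<^sub>R v)))) (at s)"
    unfolding DM_def
    by (intro has_vector_derivative_sum has_vector_derivative_mult_right chr_has_vector_derivative)
  moreover have "(\<Sum>\<nu>\<in>orb l. \<i> * of_real (\<nu> \<bullet> v) * (\<i> * of_real (\<nu> \<bullet> v) * chr \<nu> y)) = D2M l v y" for y
    unfolding D2M_def by (intro sum.cong refl) (simp add: power2_eq_square algebra_simps)
  ultimately show ?thesis by simp
qed

lemma sum_derivative:
  fixes c g' :: "'a \<Rightarrow> complex"
  assumes "\<And>l. l \<in> F \<Longrightarrow> (g l has_vector_derivative g' l) (at s)"
  shows "((\<lambda>s. \<Sum>l\<in>F. c l * g l s) has_vector_derivative (\<Sum>l\<in>F. c l * g' l)) (at s)"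
  using assms by (intro has_vector_derivative_sum has_vector_derivative_mult_right) auto

lemma dir_deriv_M: "dir_deriv (\<lambda>x. \<Sum>l\<in>F. c l * M l x) v x = (\<Sum>l\<in>F. c l * DM l v x)"
proof -
  have "((\<lambda>s. \<Sum>l\<in>F. c l * M l (x + s *\<^sub>R v)) has_vector_derivative (\<Sum>l\<in>F. c l * DM l v (x + 0 *\<^sub>R v))) (at 0)"
    by (rule sum_derivative) (rule M_derivative)
  then show ?thesis by (simp add: dir_deriv_def vector_derivative_at)
qed

lemma dir_deriv_DM: "dir_deriv (\<lambda>x. \<Sum>l\<in>F. c l * DM l v x) v x = (\<Sum>l\<in>F. c l * D2M l v x)"
proof -
  have "((\<lambda>s. \<Sum>l\<in>F. c l * DM l v (x + s *\<^sub>R v)) has_vector_derivative (\<Sum>l\<in>F. c l * D2M l v (x + 0 *\<^sub>R v))) (at 0)"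
    by (rule sum_derivative) (rule DM_derivative)
  then show ?thesis by (simp add: dir_deriv_def vector_derivative_at)
qed

lemma sum_D2M: "(\<Sum>b\<in>Basis. D2M l b x) = - of_real ((norm l)\<^sup>2) * M l x"
proof -
  have "(\<Sum>b\<in>Basis. D2M l b x) = (\<Sum>\<nu>\<in>orb l. \<Sum>b\<in>Basis. - of_real ((\<nu> \<bullet> b)\<^sup>2) * chr \<nu> x)"
    unfolding D2M_def by (rule sum.swap)
  also have "\<dots> = (\<Sum>\<nu>\<in>orb l. - of_real ((norm l)\<^sup>2) * chr \<nu> x)"
  proof (rule sum.cong[OF refl])
    fix \<nu> assume n: "\<nu> \<in> orb l"
    have "(\<Sum>b\<in>Basis. (\<nu> \<bullet> b)\<^sup>2) = (norm l)\<^sup>2"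
      using euclidean_inner[of \<nu> \<nu>] orb_norm[OF n] by (simp add: power2_norm_eq_inner[symmetric] power2_eq_square)
    then show "(\<Sum>b\<in>Basis. - of_real ((\<nu> \<bullet> b)\<^sup>2) * chr \<nu> x) = - of_real ((norm l)\<^sup>2) * chr \<nu> x"
      by (simp add: sum_negf sum_distrib_right[symmetric] flip: of_real_power of_real_sum)
  qed
  finally show ?thesis by (simp add: M_eq sum_distrib_left)
qed

lemma HO_laplacian_regular:
  assumes "F \<subseteq> Dom" "regular x"
  shows "HO_laplacian Sp m (\<lambda>x. \<Sum>l\<in>F. c l * M l x) x = (\<Sum>l\<in>F. c l * LM l x)"
proof -
  have "laplacian (\<lambda>x. \<Sum>l\<in>F. c l * M l x) x = (\<Sum>b\<in>Basis. \<Sum>l\<in>F. c l * D2M l b x)"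
    unfolding laplacian_def dir_deriv_M by (intro sum.cong refl) (rule dir_deriv_DM)
  also have "\<dots> = (\<Sum>l\<in>F. c l * (- of_real ((norm l)\<^sup>2) * M l x))"
    by (subst sum.swap) (simp add: sum_distrib_left[symmetric] sum_D2M)
  finally have 1: "laplacian (\<lambda>x. \<Sum>l\<in>F. c l * M l x) x = (\<Sum>l\<in>F. c l * (- of_real ((norm l)\<^sup>2) * M l x))" .
  have 2: "(\<Sum>\<alpha>\<in>Sp. of_real (m \<alpha> * cot (\<alpha> \<bullet> x)) * dir_deriv (\<lambda>x. \<Sum>l\<in>F. c l * M l x) \<alpha> x)
     = (\<Sum>l\<in>F. c l * (\<Sum>\<alpha>\<in>Sp. of_real (m \<alpha> * cot (\<alpha> \<bullet> x)) * DM l \<alpha> x))"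
    unfolding dir_deriv_M sum_distrib_left by (subst sum.swap) (simp add: mult_ac)
  show ?thesis
    unfolding HO_laplacian_def 1 2 sum.distrib[symmetric]
  proof (rule sum.cong[OF refl])
    fix l assume "l \<in> F"
    then have "l \<in> Lam" using assms(1) dom_Lam by blast
    then show "c l * (- of_real ((norm l)\<^sup>2) * M l x) + c l * (\<Sum>\<alpha>\<in>Sp. of_real (m \<alpha> * cot (\<alpha> \<bullet> x)) * DM l \<alpha> x)
        = c l * LM l x"
      by (simp only: LM_regular[OF _ assms(2)] DM_def distrib_left)
  qed
qed

lemma interior_alcove_subset: assumes "x \<in> interior (alcove Sp)" "\<alpha> \<in> Sp" shows "0 < \<alpha> \<bullet> x" "\<alpha> \<bullet> x < pi"
proof -
  obtain e where e: "e > 0" "ball x e \<subseteq> alcove Sp" using assms(1) by (auto simp: mem_interior)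
  define t where "t = e / (2 * norm \<alpha>)"
  have nz: "norm \<alpha> > 0" using Sp_nz[OF assms(2)] by simp
  have t: "t > 0" using e nz by (simp add: t_def)
  have "norm (t *\<^sub>R \<alpha>) < e" using e nz by (simp add: t_def)
  then have "x - t *\<^sub>R \<alpha> \<in> alcove Sp" "x + t *\<^sub>R \<alpha> \<in> alcove Sp"
    using e(2) by (auto simp: subset_iff dist_norm)
  then have "0 \<le> \<alpha> \<bullet> (x - t *\<^sub>R \<alpha>)" "\<alpha> \<bullet> (x + t *\<^sub>R \<alpha>) \<le> pi" using assms(2) by (auto simp: alcove_def)
  moreover have "t * (\<alpha> \<bullet> \<alpha>) > 0" using t nz by simp
  ultimately show "0 < \<alpha> \<bullet> x" "\<alpha> \<bullet> x < pi" by (auto simp: inner_diff_right inner_add_right)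
qed

lemma interior_alcove_regular: assumes "x \<in> interior (alcove Sp)" shows "regular x"
  unfolding regular_def
proof
  fix \<alpha> assume "\<alpha> \<in> S"
  then show "sin (\<alpha> \<bullet> x) \<noteq> 0"
  proof (cases rule: S_cases)
    case 1
    then show ?thesis using sin_gt_zero[of "\<alpha> \<bullet> x"] interior_alcove_subset[OF assms] by force
  next
    case 2
    then show ?thesis using sin_gt_zero[of "- \<alpha> \<bullet> x"] interior_alcove_subset[OF assms, of "- \<alpha>"] by force
  qed
qed

text \<open>The bound \<pi>/4 leaves room for a neighbourhood within the range up to \<pi>/2, where
  \<open>nr_lower_bound\<close> puts the sine above its chord.\<close>

lemma ex_strict_alcove: "\<exists>p. \<forall>\<alpha>\<in>Sp. 0 < \<alpha> \<bullet> p \<and> \<alpha> \<bullet> p \<le> pi / 4"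
proof -
  define b where "b = Max ((\<lambda>\<alpha>. \<alpha> \<bullet> xi) ` Sp)"
  have le: "\<alpha> \<bullet> xi \<le> b" if "\<alpha> \<in> Sp" for \<alpha> unfolding b_def using that finite_Sp by (intro Max_ge) auto
  obtain \<beta> where "\<beta> \<in> Sp" using Sp_nonempty by blast
  then have bp: "b > 0" using le[of \<beta>] Sp_xi[of \<beta>] by linarith
  show ?thesis
  proof (intro exI[of _ "(pi / (4 * b)) *\<^sub>R xi"] ballI conjI)
    fix \<alpha> assume a: "\<alpha> \<in> Sp"
    show "0 < \<alpha> \<bullet> ((pi / (4 * b)) *\<^sub>R xi)" using bp Sp_xi[OF a] by simp
    show "\<alpha> \<bullet> ((pi / (4 * b)) *\<^sub>R xi) \<le> pi / 4" using bp le[OF a] by (simp add: field_simps)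
  qed
qed

lemma open_strict_alcove: "open {x. \<forall>\<alpha>\<in>Sp. 0 < \<alpha> \<bullet> x \<and> \<alpha> \<bullet> x < pi}"
proof -
  have "{x. \<forall>\<alpha>\<in>Sp. 0 < \<alpha> \<bullet> x \<and> \<alpha> \<bullet> x < pi} = (\<Inter>\<alpha>\<in>Sp. {x. 0 < \<alpha> \<bullet> x} \<inter> {x. \<alpha> \<bullet> x < pi})" by auto
  also have "open \<dots>" using finite_Sp by (intro open_INT ballI open_Int open_Collect_less continuous_intros)
  finally show ?thesis .
qed

lemma strict_alcove_interior: "(\<And>\<alpha>. \<alpha> \<in> Sp \<Longrightarrow> 0 < \<alpha> \<bullet> x \<and> \<alpha> \<bullet> x < pi) \<Longrightarrow> x \<in> interior (alcove Sp)"
  by (rule interiorI[OF open_strict_alcove]) (auto simp: alcove_def intro: less_imp_le)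

text \<open>Makes the limit in \<open>HO_laplacian_A0\<close> meaningful at the walls: a segment
  towards a strictly interior point leaves all walls at once.\<close>

lemma alcove_islimpt_interior: assumes "x \<in> alcove Sp" shows "x islimpt interior (alcove Sp)"
proof (cases "x \<in> interior (alcove Sp)")
  case True
  then show ?thesis by (metis open_interior interior_limit_point interior_open)
next
  case False
  obtain p where p: "\<And>\<alpha>. \<alpha> \<in> Sp \<Longrightarrow> 0 < \<alpha> \<bullet> p \<and> \<alpha> \<bullet> p \<le> pi / 4" using ex_strict_alcove by blast
  have in_int: "x + s *\<^sub>R (p - x) \<in> interior (alcove Sp)" if s: "0 < s" "s \<le> 1" for s
  proof (rule strict_alcove_interior)
    fix \<alpha> assume a: "\<alpha> \<in> Sp"
    have x: "0 \<le> \<alpha> \<bullet> x" "\<alpha> \<bullet> x \<le> pi" using assms a by (auto simp: alcove_def)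
    have e: "\<alpha> \<bullet> (x + s *\<^sub>R (p - x)) = (1 - s) * (\<alpha> \<bullet> x) + s * (\<alpha> \<bullet> p)"
      by (simp add: inner_add_right inner_diff_right algebra_simps)
    have "0 < s * (\<alpha> \<bullet> p)" "s * (\<alpha> \<bullet> p) < s * pi" using p[OF a] s pi_gt_zero by (auto intro!: mult_strict_left_mono)
    moreover have "0 \<le> (1 - s) * (\<alpha> \<bullet> x)" "(1 - s) * (\<alpha> \<bullet> x) \<le> (1 - s) * pi" using x s by (auto intro!: mult_left_mono)
    ultimately show "0 < \<alpha> \<bullet> (x + s *\<^sub>R (p - x)) \<and> \<alpha> \<bullet> (x + s *\<^sub>R (p - x)) < pi"
      unfolding e by (auto simp: algebra_simps)
  qed
  have px: "p \<noteq> x" using False in_int[of 1] by auto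
  show ?thesis unfolding islimpt_approachable
  proof (intro allI impI)
    fix e :: real assume "e > 0"
    define s where "s = min 1 (e / (2 * norm (p - x)))"
    have s: "0 < s" "s \<le> 1" using \<open>e > 0\<close> px by (auto simp: s_def)
    have "s * norm (p - x) \<le> e / (2 * norm (p - x)) * norm (p - x)" by (intro mult_right_mono) (auto simp: s_def)
    also have "\<dots> < e" using px \<open>e > 0\<close> by simp
    finally show "\<exists>x'\<in>interior (alcove Sp). x' \<noteq> x \<and> dist x' x < e"
      using in_int[OF s] s px by (intro bexI[of _ "x + s *\<^sub>R (p - x)"]) (auto simp: dist_norm)
  qed
qed

lemma HO_laplacian_A0_M:
  assumes "F \<subseteq> Dom" "x \<in> alcove Sp"
  shows "HO_laplacian_A0 Sp m (\<lambda>x. \<Sum>l\<in>F. c l * M l x) x = (\<Sum>l\<in>F. c l * LM l x)"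
  unfolding HO_laplacian_A0_def
proof (rule tendsto_Lim)
  show "\<not> trivial_limit (at x within interior (alcove Sp))"
    using alcove_islimpt_interior[OF assms(2)] trivial_limit_within by blast
  have "continuous_on UNIV (\<lambda>x. \<Sum>l\<in>F. c l * LM l x)" by (intro continuous_intros continuous_LM)
  then have "isCont (\<lambda>x. \<Sum>l\<in>F. c l * LM l x) x" by (simp add: continuous_on_eq_continuous_at)
  then have "((\<lambda>x. \<Sum>l\<in>F. c l * LM l x) \<longlongrightarrow> (\<Sum>l\<in>F. c l * LM l x)) (at x within interior (alcove Sp))"
    using tendsto_within_subset[OF _ subset_UNIV] unfolding isCont_def by blast
  then show "(HO_laplacian Sp m (\<lambda>x. \<Sum>l\<in>F. c l * M l x) \<longlongrightarrow> (\<Sum>l\<in>F. c l * LM l x)) (at x within interior (alcove Sp))"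
    by (rule Lim_transform_eventually)
       (auto simp: eventually_at_filter HO_laplacian_regular[OF assms(1) interior_alcove_regular] intro!: always_eventually)
qed

lemma HO_laplacian_A0_PP:
  assumes "finite F" "F \<subseteq> Dom" "x \<in> alcove Sp"
  shows "HO_laplacian_A0 Sp m (\<lambda>x. \<Sum>l\<in>F. c l * PP l x) x = (\<Sum>l\<in>F. - (of_real (theta l) * (c l * PP l x)))"
proof -
  define G where "G = (\<Union>l\<in>F. low l)"
  define a where "a \<mu> = (\<Sum>l\<in>F. c l * (if \<mu> \<in> low l then of_real (Pc l \<mu>) else 0))" for \<mu>
  have G: "finite G" "G \<subseteq> Dom" using assms finite_low low_dom by (auto simp: G_def)
  have key: "(\<Sum>l\<in>F. c l * (\<Sum>\<mu>\<in>low l. of_real (Pc l \<mu>) * u \<mu>)) = (\<Sum>\<mu>\<in>G. a \<mu> * u \<mu>)" for u :: "'a \<Rightarrow> complex"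
  proof -
    have "(\<Sum>\<mu>\<in>low l. of_real (Pc l \<mu>) * u \<mu>) = (\<Sum>\<mu>\<in>G. (if \<mu> \<in> low l then of_real (Pc l \<mu>) else 0) * u \<mu>)" if "l \<in> F" for l
      using G(1) that by (intro sum.mono_neutral_cong_left) (auto simp: G_def)
    then have "(\<Sum>l\<in>F. c l * (\<Sum>\<mu>\<in>low l. of_real (Pc l \<mu>) * u \<mu>))
       = (\<Sum>l\<in>F. \<Sum>\<mu>\<in>G. c l * (if \<mu> \<in> low l then of_real (Pc l \<mu>) else 0) * u \<mu>)"
      by (simp add: sum_distrib_left mult.assoc)
    also have "\<dots> = (\<Sum>\<mu>\<in>G. a \<mu> * u \<mu>)" by (subst sum.swap) (simp add: a_def sum_distrib_right)
    finally show ?thesis .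
  qed
  have "(\<lambda>x. \<Sum>l\<in>F. c l * PP l x) = (\<lambda>x. \<Sum>\<mu>\<in>G. a \<mu> * M \<mu> x)" by (simp add: fun_eq_iff PP_def key)
  then have "HO_laplacian_A0 Sp m (\<lambda>x. \<Sum>l\<in>F. c l * PP l x) x = (\<Sum>\<mu>\<in>G. a \<mu> * LM \<mu> x)"
    using HO_laplacian_A0_M[OF G(2) assms(3)] by simp
  also have "\<dots> = (\<Sum>l\<in>F. c l * (\<Sum>\<mu>\<in>low l. of_real (Pc l \<mu>) * LM \<mu> x))" by (rule key[symmetric])
  also have "\<dots> = (\<Sum>l\<in>F. - (of_real (theta l) * (c l * PP l x)))"
    using assms(2) by (intro sum.cong refl) (auto simp: PP_eigen subset_iff)
  finally show ?thesis .
qed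

section \<open>The maximum principle\<close>

text \<open>A maximum over the alcove is thereby one over the whole space, so two-sided derivative
  tests apply even at boundary points.\<close>

lemma fsp_M_extend:
  assumes "F \<subseteq> Dom" "f = (\<lambda>x. \<Sum>l\<in>F. c l * M l x)"
  shows "\<exists>x\<in>alcove Sp. f y = f x"
proof -
  obtain w v where wv: "w \<in> W" "v \<in> Q" "w (y - pi *\<^sub>R v) \<in> alcove Sp" using ex_alcove by blast
  have "M l (w (y - pi *\<^sub>R v)) = M l y" if "l \<in> F" for l
    using M_weyl[OF wv(1)] M_periodic[OF dom_Lam wv(2), of l "y - pi *\<^sub>R v"] that assms(1) by auto
  then have "f y = f (w (y - pi *\<^sub>R v))" unfolding assms(2) by simp
  then show ?thesis using wv(3) by blast
qed

text \<open>At the maximum the gradient of the real part vanishes and its second derivatives are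
  nonpositive. The cotangent term \<open>Qf \<alpha>\<close> is zero off its walls by the first
  fact; on a wall it is, by l'Hopital, the second derivative along \<alpha> divided by \<alpha> .
  \<alpha>.\<close>

lemma maximum_principle_M:
  assumes F: "F \<subseteq> Dom" and f: "f = (\<lambda>x. \<Sum>l\<in>F. c l * M l x)"
    and x0: "x0 \<in> alcove Sp" and max: "\<And>x. x \<in> alcove Sp \<Longrightarrow> Re (f x) \<le> Re (f x0)"
  shows "Re (\<Sum>l\<in>F. c l * LM l x0) \<le> 0"
proof -
  have glob: "Re (f y) \<le> Re (f x0)" for y using fsp_M_extend[OF F f, of y] max by auto
  define D D2 Qf where "D v x = (\<Sum>l\<in>F. c l * DM l v x)" and "D2 v x = (\<Sum>l\<in>F. c l * D2M l v x)"
    and "Qf \<alpha> x = (\<Sum>l\<in>F. c l * - (\<Sum>\<nu>\<in>orb l. of_real (\<nu> \<bullet> \<alpha>) * (Cs \<alpha> \<nu> x + chr \<nu> x)))" for v \<alpha> x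
  have d1: "((\<lambda>s. f (x0 + s *\<^sub>R v)) has_vector_derivative D v (x0 + s *\<^sub>R v)) (at s)" for v s
    unfolding f D_def by (rule sum_derivative[OF M_derivative])
  have d2: "((\<lambda>s. D v (x0 + s *\<^sub>R v)) has_vector_derivative D2 v (x0 + s *\<^sub>R v)) (at s)" for v s
    unfolding D_def D2_def by (rule sum_derivative[OF DM_derivative])
  have crit: "Re (D v x0) = 0" "Re (D2 v x0) \<le> 0" for v
  proof -
    have 1: "((\<lambda>s. Re (f (x0 + s *\<^sub>R v))) has_real_derivative Re (D v (x0 + s *\<^sub>R v))) (at s)" for s
      using d1[of v s] by (simp add: has_vector_derivative_complex_iff)
    have 2: "((\<lambda>s. Re (D v (x0 + s *\<^sub>R v))) has_real_derivative Re (D2 v x0)) (at 0)"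
      using d2[of v 0] by (simp add: has_vector_derivative_complex_iff)
    show "Re (D v x0) = 0" "Re (D2 v x0) \<le> 0"
      using second_derivative_at_max[OF 1 2] glob by auto
  qed
  have wall: "of_real (cos (\<alpha> \<bullet> x)) * D \<alpha> x = of_real (sin (\<alpha> \<bullet> x)) * Qf \<alpha> x" if "\<alpha> \<in> S" for \<alpha> x
  proof -
    have "of_real (cos (\<alpha> \<bullet> x)) * D \<alpha> x = (\<Sum>l\<in>F. c l * (of_real (cos (\<alpha> \<bullet> x)) * DM l \<alpha> x))"
      by (simp add: D_def sum_distrib_left mult.left_commute)
    also have "\<dots> = of_real (sin (\<alpha> \<bullet> x)) * Qf \<alpha> x"
      unfolding Qf_def sum_distrib_left[of "of_real (sin (\<alpha> \<bullet> x))"]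
    proof (intro sum.cong refl)
      fix l assume "l \<in> F"
      then have "l \<in> Lam" using F dom_Lam by blast
      then show "c l * (of_real (cos (\<alpha> \<bullet> x)) * DM l \<alpha> x)
        = of_real (sin (\<alpha> \<bullet> x)) * (c l * - (\<Sum>\<nu>\<in>orb l. of_real (\<nu> \<bullet> \<alpha>) * (Cs \<alpha> \<nu> x + chr \<nu> x)))"
        unfolding DM_def using wall_identity[OF _ that, of l x] by (simp add: mult_ac)
    qed
    finally show ?thesis .
  qed
  have contQ: "continuous_on UNIV (Qf \<alpha>)" for \<alpha>
    unfolding Qf_def by (intro continuous_intros continuous_Cs continuous_chr)
  have Q: "Re (Qf \<alpha> x0) \<le> 0" if a: "\<alpha> \<in> Sp" for \<alpha>
  proof (cases "sin (\<alpha> \<bullet> x0) = 0")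
    case False
    have "of_real (cos (\<alpha> \<bullet> x0)) * D \<alpha> x0 = of_real (sin (\<alpha> \<bullet> x0)) * Qf \<alpha> x0" using wall[OF Sp_S[OF a]] .
    from arg_cong[OF this, of Re] have "cos (\<alpha> \<bullet> x0) * Re (D \<alpha> x0) = sin (\<alpha> \<bullet> x0) * Re (Qf \<alpha> x0)"
      by simp
    then show ?thesis using crit(1)[of \<alpha>] False by simp
  next
    case True
    have nz: "\<alpha> \<bullet> \<alpha> > 0" using Sp_nz[OF a] by simp
    have cnz: "cos (\<alpha> \<bullet> x0) \<noteq> 0" using True sin_cos_squared_add[of "\<alpha> \<bullet> x0"] by auto
    \<comment> \<open>On the wall the full complex derivative vanishes, not only its real part, so
      both sides of \<open>wall\<close> can be divided by the step along \<alpha>.\<close>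
    have D0: "D \<alpha> x0 = 0" using wall[OF Sp_S[OF a], of x0] True cnz by simp
    let ?g = "\<lambda>s. sin (\<alpha> \<bullet> x0 + s * (\<alpha> \<bullet> \<alpha>))"
    let ?k = "\<lambda>s. of_real (cos (\<alpha> \<bullet> x0 + s * (\<alpha> \<bullet> \<alpha>))) * D \<alpha> (x0 + s *\<^sub>R \<alpha>)"
    have "((\<lambda>s. complex_of_real (cos (\<alpha> \<bullet> x0 + s * (\<alpha> \<bullet> \<alpha>)))) has_vector_derivative
        of_real (- sin (\<alpha> \<bullet> x0) * (\<alpha> \<bullet> \<alpha>))) (at 0)"
      by (intro has_vector_derivative_of_real) (auto intro!: derivative_eq_intros simp: has_real_derivative_iff_has_vector_derivative[symmetric])
    from has_vector_derivative_mult[OF this d2[of \<alpha> 0]]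
    have "(?k has_vector_derivative of_real (cos (\<alpha> \<bullet> x0)) * D2 \<alpha> x0) (at 0)"
      using D0 by simp
    from has_vector_derivative_quotient[OF this]
    have lim1: "((\<lambda>s. ?k s /\<^sub>R s) \<longlongrightarrow> of_real (cos (\<alpha> \<bullet> x0)) * D2 \<alpha> x0) (at 0)" using D0 by simp
    have "(?g has_real_derivative cos (\<alpha> \<bullet> x0) * (\<alpha> \<bullet> \<alpha>)) (at 0)" by (auto intro!: derivative_eq_intros)
    then have "((\<lambda>s. ?g s / s) \<longlongrightarrow> cos (\<alpha> \<bullet> x0) * (\<alpha> \<bullet> \<alpha>)) (at 0)" using True by (simp add: DERIV_def)
    moreover have "((\<lambda>s. Qf \<alpha> (x0 + s *\<^sub>R \<alpha>)) \<longlongrightarrow> Qf \<alpha> (x0 + 0 *\<^sub>R \<alpha>)) (at 0)"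
    proof (rule isCont_tendsto_compose[where g = "Qf \<alpha>"])
      show "isCont (Qf \<alpha>) (x0 + 0 *\<^sub>R \<alpha>)" using contQ continuous_on_eq_continuous_at by blast
      show "((\<lambda>s. x0 + s *\<^sub>R \<alpha>) \<longlongrightarrow> x0 + 0 *\<^sub>R \<alpha>) (at 0)" by (intro tendsto_intros)
    qed
    ultimately have "((\<lambda>s. of_real (?g s / s) * Qf \<alpha> (x0 + s *\<^sub>R \<alpha>)) \<longlongrightarrow> of_real (cos (\<alpha> \<bullet> x0) * (\<alpha> \<bullet> \<alpha>)) * Qf \<alpha> x0) (at 0)"
      by (intro tendsto_mult tendsto_of_real) auto
    moreover have "(\<lambda>s. of_real (?g s / s) * Qf \<alpha> (x0 + s *\<^sub>R \<alpha>)) = (\<lambda>s. ?k s /\<^sub>R s)"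
    proof
      fix s
      have "?k s = of_real (?g s) * Qf \<alpha> (x0 + s *\<^sub>R \<alpha>)"
        using wall[OF Sp_S[OF a], of "x0 + s *\<^sub>R \<alpha>"] by (simp add: inner_add_right)
      then show "of_real (?g s / s) * Qf \<alpha> (x0 + s *\<^sub>R \<alpha>) = ?k s /\<^sub>R s"
        by (simp add: scaleR_conv_of_real divide_inverse mult_ac)
    qed
    ultimately have "of_real (cos (\<alpha> \<bullet> x0) * (\<alpha> \<bullet> \<alpha>)) * Qf \<alpha> x0 = of_real (cos (\<alpha> \<bullet> x0)) * D2 \<alpha> x0"
      using tendsto_unique[OF _ _ lim1] by auto
    then have "of_real (\<alpha> \<bullet> \<alpha>) * Qf \<alpha> x0 = D2 \<alpha> x0" using cnz by (simp add: mult.assoc)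
    from arg_cong[OF this, of Re] have "(\<alpha> \<bullet> \<alpha>) * Re (Qf \<alpha> x0) = Re (D2 \<alpha> x0)" by simp
    then have "(\<alpha> \<bullet> \<alpha>) * Re (Qf \<alpha> x0) \<le> 0" using crit(2)[of \<alpha>] by simp
    then show ?thesis using mult_le_cancel_left_pos[OF nz, of "Re (Qf \<alpha> x0)" 0] by (simp only: mult_zero_right)
  qed
  have "(\<Sum>l\<in>F. c l * LM l x0) = (\<Sum>b\<in>Basis. D2 b x0) + (\<Sum>\<alpha>\<in>Sp. of_real (m \<alpha>) * Qf \<alpha> x0)"
  proof -
    have "(\<Sum>b\<in>Basis. D2 b x0) = (\<Sum>l\<in>F. c l * (- of_real ((norm l)\<^sup>2) * M l x0))"
      unfolding D2_def by (subst sum.swap) (simp add: sum_distrib_left[symmetric] sum_D2M)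
    moreover have "(\<Sum>\<alpha>\<in>Sp. of_real (m \<alpha>) * Qf \<alpha> x0)
      = (\<Sum>l\<in>F. c l * - (\<Sum>\<alpha>\<in>Sp. of_real (m \<alpha>) * (\<Sum>\<nu>\<in>orb l. of_real (\<nu> \<bullet> \<alpha>) * (Cs \<alpha> \<nu> x0 + chr \<nu> x0))))"
      unfolding Qf_def sum_distrib_left[of "of_real (m _)" _ F] sum_negf[symmetric] sum_distrib_left[of "c _" _ Sp]
      by (subst sum.swap) (simp add: mult.left_commute sum_negf)
    ultimately show ?thesis unfolding LM_alt by (simp add: right_diff_distrib sum_subtractf sum_negf)
  qed
  then have "Re (\<Sum>l\<in>F. c l * LM l x0) = (\<Sum>b\<in>Basis. Re (D2 b x0)) + (\<Sum>\<alpha>\<in>Sp. m \<alpha> * Re (Qf \<alpha> x0))" by simp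
  also have "\<dots> \<le> 0 + 0"
    using crit(2) Q m_nonneg Sp_S by (intro add_mono sum_nonpos mult_nonneg_nonpos) auto
  finally show ?thesis by simp
qed

lemma maximum_principle_PP:
  assumes "finite F" "F \<subseteq> Dom" "f = (\<lambda>x. \<Sum>l\<in>F. c l * PP l x)"
    and "x0 \<in> alcove Sp" "\<And>x. x \<in> alcove Sp \<Longrightarrow> Re (f x) \<le> Re (f x0)"
  shows "Re (\<Sum>l\<in>F. - (of_real (theta l) * (c l * PP l x0))) \<le> 0"
proof -
  have "f \<in> fsp Dom M" using assms(1-3) fsp_PP fspI[of F Dom c PP] by simp
  then obtain G a where G: "finite G" "G \<subseteq> Dom" "f = (\<lambda>x. \<Sum>l\<in>G. a l * M l x)" by (auto simp: fsp_def)
  have "(\<Sum>l\<in>F. - (of_real (theta l) * (c l * PP l x0))) = HO_laplacian_A0 Sp m f x0"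
    unfolding assms(3) using HO_laplacian_A0_PP[OF assms(1,2,4)] by simp
  also have "\<dots> = (\<Sum>l\<in>G. a l * LM l x0)" unfolding G(3) by (rule HO_laplacian_A0_M[OF G(2) assms(4)])
  finally show ?thesis using maximum_principle_M[OF G(2,3) assms(4,5)] by simp
qed

lemma alcove_nonempty: "0 \<in> alcove Sp" by (simp add: alcove_def)

text \<open>At a maximum point of the real part of \<open>f\<close>, the term -s \<open>L_m\<close>
  f has nonnegative real part, so the value there is bounded by that of f - s \<open>L_m\<close>
  f.\<close>

lemma resolvent_bound:
  assumes F: "finite F" "F \<subseteq> Dom" and s: "s \<ge> 0"
    and B: "\<And>x. x \<in> alcove Sp \<Longrightarrow> Re (\<Sum>l\<in>F. c l * of_real (1 + s * theta l) * PP l x) \<le> B"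
    and x: "x \<in> alcove Sp"
  shows "Re (\<Sum>l\<in>F. c l * PP l x) \<le> B"
proof -
  let ?f = "\<lambda>x. \<Sum>l\<in>F. c l * PP l x"
  have "continuous_on (alcove Sp) (\<lambda>x. Re (?f x))" by (intro continuous_intros continuous_PP)
  then obtain x0 where x0: "x0 \<in> alcove Sp" "\<And>x. x \<in> alcove Sp \<Longrightarrow> Re (?f x) \<le> Re (?f x0)"
    using continuous_attains_sup[OF compact_alcove] alcove_nonempty by blast
  have "Re (\<Sum>l\<in>F. - (of_real (theta l) * (c l * PP l x0))) \<le> 0"
    by (rule maximum_principle_PP[OF F refl x0])
  then have "s * Re (\<Sum>l\<in>F. - (of_real (theta l) * (c l * PP l x0))) \<le> 0" using s by (rule mult_nonneg_nonpos[rotated])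
  moreover have "(\<Sum>l\<in>F. c l * of_real (1 + s * theta l) * PP l x0)
     = ?f x0 - of_real s * (\<Sum>l\<in>F. - (of_real (theta l) * (c l * PP l x0)))"
    unfolding sum_distrib_left sum_subtractf[symmetric] by (intro sum.cong refl) (simp add: algebra_simps)
  then have "Re (\<Sum>l\<in>F. c l * of_real (1 + s * theta l) * PP l x0)
     = Re (?f x0) - s * Re (\<Sum>l\<in>F. - (of_real (theta l) * (c l * PP l x0)))" by simp
  ultimately have "Re (?f x0) \<le> B" using B[OF x0(1)] by linarith
  then show ?thesis using x0(2)[OF x] by linarith
qed

text \<open>The semigroup is the limit of powers of the resolvent, each of which obeys the bound.\<close>

lemma semigroup_bound:
  assumes F: "finite F" "F \<subseteq> Dom" and t: "t \<ge> 0"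
    and B: "\<And>x. x \<in> alcove Sp \<Longrightarrow> Re (\<Sum>l\<in>F. c l * PP l x) \<le> B"
    and x: "x \<in> alcove Sp"
  shows "Re (\<Sum>l\<in>F. c l * of_real (exp (- theta l * t)) * PP l x) \<le> B"
proof -
  have th: "theta l \<ge> 0" if "l \<in> F" for l using theta_ge[of l] that F by (meson order_trans subsetD zero_le_power2)
  have pw: "(\<forall>x\<in>alcove Sp. Re (\<Sum>l\<in>F. c l * of_real ((1 + s * theta l) ^ n) * PP l x) \<le> B) \<Longrightarrow>
      \<forall>x\<in>alcove Sp. Re (\<Sum>l\<in>F. c l * PP l x) \<le> B" if "s \<ge> 0" for s n and c :: "'a \<Rightarrow> complex"
  proof (induction n)
    case (Suc n)
    have "\<forall>x\<in>alcove Sp. Re (\<Sum>l\<in>F. c l * of_real ((1 + s * theta l) ^ n) * PP l x) \<le> B"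
    proof
      fix x assume x: "x \<in> alcove Sp"
      show "Re (\<Sum>l\<in>F. c l * of_real ((1 + s * theta l) ^ n) * PP l x) \<le> B"
      proof (rule resolvent_bound[OF F that _ x])
        fix y assume "y \<in> alcove Sp"
        moreover have "c l * of_real ((1 + s * theta l) ^ n) * of_real (1 + s * theta l) * PP l y
          = c l * of_real ((1 + s * theta l) ^ Suc n) * PP l y" for l by simp
        ultimately show "Re (\<Sum>l\<in>F. c l * of_real ((1 + s * theta l) ^ n) * of_real (1 + s * theta l) * PP l y) \<le> B"
          using Suc.prems by (simp only:)
      qed
    qed
    then show ?case by (rule Suc.IH)
  qed simp
  \<comment> \<open>At \<open>n = 0\<close> division by zero yields 0 and the statement is the
    hypothesis itself.\<close>
  have step: "Re (\<Sum>l\<in>F. (c l / of_real ((1 + t / real n * theta l) ^ n)) * PP l x) \<le> B" for n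
  proof -
    have nz: "1 + t / real n * theta l \<noteq> 0" if "l \<in> F" for l
    proof -
      have "0 \<le> t / real n * theta l" using th[OF that] t by simp
      then show ?thesis by linarith
    qed
    have "(\<Sum>l\<in>F. (c l / of_real ((1 + t / real n * theta l) ^ n)) * of_real ((1 + t / real n * theta l) ^ n) * PP l y)
        = (\<Sum>l\<in>F. c l * PP l y)" for y
    proof (rule sum.cong[OF refl])
      fix l assume "l \<in> F"
      then have "complex_of_real ((1 + t / real n * theta l) ^ n) \<noteq> 0" using nz by (simp del: of_real_add of_real_power of_real_mult)
      then show "(c l / of_real ((1 + t / real n * theta l) ^ n)) * of_real ((1 + t / real n * theta l) ^ n) * PP l y = c l * PP l y"
        by (simp del: of_real_add of_real_power of_real_mult)
    qed
    then have "\<forall>x\<in>alcove Sp. Re (\<Sum>l\<in>F. (c l / of_real ((1 + t / real n * theta l) ^ n)) * of_real ((1 + t / real n * theta l) ^ n) * PP l x) \<le> B"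
      using B by (simp only:) blast
    from pw[OF _ this] show ?thesis using t x by simp
  qed
  have "(\<lambda>n. Re (\<Sum>l\<in>F. (c l / of_real ((1 + t / real n * theta l) ^ n)) * PP l x))
     \<longlonglongrightarrow> Re (\<Sum>l\<in>F. (c l / of_real (exp (theta l * t))) * PP l x)"
  proof (intro tendsto_intros)
    fix l
    have "(\<lambda>n. (1 + (theta l * t) / real n) ^ n) \<longlonglongrightarrow> exp (theta l * t)" by (rule tendsto_exp_limit_sequentially)
    then show "(\<lambda>n. (1 + t / real n * theta l) ^ n) \<longlonglongrightarrow> exp (theta l * t)" by (simp add: mult_ac)
  qed auto
  then have "Re (\<Sum>l\<in>F. (c l / of_real (exp (theta l * t))) * PP l x) \<le> B"
    by (rule LIMSEQ_le_const2) (use step in blast)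
  then show ?thesis by (simp add: exp_minus divide_inverse)
qed

end

lemma norm_cis_diff_1: "norm (cis t - 1) \<le> \<bar>t\<bar>"
proof -
  have "cis t - 1 = cis (t / 2) * (cis (t / 2) - cis (- (t / 2)))" by (simp add: right_diff_distrib cis_mult)
  also have "cis (t / 2) - cis (- (t / 2)) = Complex 0 (2 * sin (t / 2))" by (simp add: complex_eq_iff)
  finally have "norm (cis t - 1) = 2 * \<bar>sin (t / 2)\<bar>" by (simp add: norm_mult complex_norm real_sqrt_mult)
  then show ?thesis using abs_sin_x_le_abs_x[of "t / 2"] by simp
qed

text \<open>Rounds the exponent up to a natural number, so that the factors of the weight multiply
  to one integer power; a base of at most 1 makes the rounding go the right way.\<close>

lemma pow0_ge: assumes "0 < c" "c \<le> 1" "c \<le> b" "0 \<le> e" shows "c ^ nat \<lceil>e\<rceil> \<le> pow0 b e"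
proof (cases "e = 0")
  case False
  have "c ^ nat \<lceil>e\<rceil> = c powr real (nat \<lceil>e\<rceil>)" by (rule powr_realpow[OF assms(1), symmetric])
  also have "\<dots> \<le> c powr e" using assms by (intro powr_mono') auto
  also have "\<dots> \<le> b powr e" using assms by (intro powr_mono2) auto
  finally show ?thesis using False by (simp add: pow0_def)
qed (simp add: pow0_def)

context root_data
begin

section \<open>Normalised polynomials\<close>

definition p0 :: "'a \<Rightarrow> real" where "p0 l = (\<Sum>\<mu>\<in>low l. Pc l \<mu> * card (orb \<mu>))"

lemma PP_0: "PP l 0 = of_real (p0 l)"
  by (simp add: PP_def M_eq p0_def)

lemma p0_ge_1: assumes "l \<in> Dom" shows "p0 l \<ge> 1"
proof -
  have "Pc l l * card (orb l) \<le> p0 l"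
    unfolding p0_def using Pc(2)[OF assms] by (intro member_le_sum low_self[OF assms] finite_low) auto
  then show ?thesis using Pc(1)[OF assms] card_orb_pos[of l] by simp
qed

lemma PP_minus: "PP l (- x) = cnj (PP l x)"
  by (simp add: PP_def M_eq chr_minus)

text \<open>\<open>PP l\<close> divided by \<open>p0 l\<close> is a convex combination of characters
  of frequency at most that of \<open>l\<close>, so estimates on characters pass to it:
  \<open>z = 0\<close> gives \<open>|R| <= 1\<close>, and \<open>z = 1\<close> gives a lower bound
  near the origin.\<close>

lemma norm_PP_diff_le:
  assumes "l \<in> Dom" "\<And>\<kappa>. norm \<kappa> \<le> norm l \<Longrightarrow> norm (chr \<kappa> x - z) \<le> b"
  shows "norm (PP l x - of_real (p0 l) * z) \<le> p0 l * b"
proof -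
  have "PP l x - of_real (p0 l) * z = (\<Sum>\<mu>\<in>low l. of_real (Pc l \<mu>) * (\<Sum>\<kappa>\<in>orb \<mu>. chr \<kappa> x - z))"
    by (simp add: PP_def M_eq p0_def sum_subtractf right_diff_distrib sum_distrib_right mult.assoc)
  also have "norm \<dots> \<le> (\<Sum>\<mu>\<in>low l. Pc l \<mu> * (card (orb \<mu>) * b))"
  proof (rule sum_norm_le)
    fix \<mu> assume m: "\<mu> \<in> low l"
    have "norm (chr \<kappa> x - z) \<le> b" if "\<kappa> \<in> orb \<mu>" for \<kappa>
      using assms(2)[of \<kappa>] orb_norm[OF that] low_norm[OF m] by (cases "\<mu> = l") auto
    then have "norm (\<Sum>\<kappa>\<in>orb \<mu>. chr \<kappa> x - z) \<le> card (orb \<mu>) * b" by (intro sum_norm_bound) auto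
    then show "norm (of_real (Pc l \<mu>) * (\<Sum>\<kappa>\<in>orb \<mu>. chr \<kappa> x - z)) \<le> Pc l \<mu> * (card (orb \<mu>) * b)"
      using Pc(2)[OF assms(1) m] by (simp add: norm_mult mult_left_mono)
  qed
  also have "\<dots> = p0 l * b" by (simp add: p0_def sum_distrib_right mult.assoc)
  finally show ?thesis .
qed

abbreviation "R \<equiv> HO_R S Sp m"

lemma R_eq: "l \<in> Dom \<Longrightarrow> R l x = PP l x / of_real (p0 l)"
  by (simp add: HO_R_def HO_poly_eq PP_0)

lemma norm_R_le: assumes "l \<in> Dom" shows "norm (R l x) \<le> 1"
  using norm_PP_diff_le[OF assms, of x 0 1] p0_ge_1[OF assms] by (simp add: R_eq assms norm_divide)

lemma R_minus: "l \<in> Dom \<Longrightarrow> R l (- x) = cnj (R l x)" by (simp add: R_eq PP_minus)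

lemma continuous_R: "l \<in> Dom \<Longrightarrow> continuous_on A (R l)"
  using p0_ge_1[of l] by (subst continuous_on_cong[OF refl R_eq]) (auto intro!: continuous_intros continuous_PP)

lemma norm_R_near_0: assumes "l \<in> Dom" "norm l * norm x \<le> 1 / 2" shows "norm (R l x) \<ge> 1 / 2"
proof -
  have "norm (chr \<kappa> x - 1) \<le> 1 / 2" if "norm \<kappa> \<le> norm l" for \<kappa>
  proof -
    have "norm (chr \<kappa> x - 1) \<le> \<bar>\<kappa> \<bullet> x\<bar>" unfolding chr_def by (rule norm_cis_diff_1)
    also have "\<dots> \<le> norm \<kappa> * norm x" by (rule Cauchy_Schwarz_ineq2)
    also have "\<dots> \<le> norm l * norm x" using that by (intro mult_right_mono) auto
    finally show ?thesis using assms(2) by linarith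
  qed
  then have "norm (PP l x - of_real (p0 l) * 1) \<le> p0 l * (1 / 2)" by (rule norm_PP_diff_le[OF assms(1)])
  then have "norm (PP l x) \<ge> p0 l / 2"
    using norm_triangle_ineq2[of "of_real (p0 l)" "PP l x"] p0_ge_1[OF assms(1)] by (simp add: norm_minus_commute)
  then show ?thesis using p0_ge_1[OF assms(1)] by (simp add: R_eq assms(1) norm_divide field_simps)
qed

definition nr :: "'a \<Rightarrow> real" where "nr l = (LINT x:alcove Sp|lborel. (norm (R l x))\<^sup>2 * wt x)"

lemma set_integrable_alcove:
  fixes f :: "'a \<Rightarrow> 'b::{banach, second_countable_topology}"
  assumes "continuous_on (alcove Sp) f" shows "set_integrable lborel (alcove Sp) f"
  unfolding set_integrable_def by (rule borel_integrable_compact[OF compact_alcove assms])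

lemma ip_m_R: "ip_m Sp m (R l) (R l) = of_real (nr l)"
proof -
  have sq: "z * cnj z = of_real ((norm z)\<^sup>2)" for z using complex_norm_square[of z] by simp
  have "ip_m Sp m (R l) (R l) = (LINT x:alcove Sp|lborel. complex_of_real ((norm (R l x))\<^sup>2 * wt x))"
    unfolding ip_m_def sq by simp
  then show ?thesis unfolding nr_def by (simp only: set_integral_complex_of_real)
qed

lemma HO_r_eq: "HO_r S Sp m l = of_real (1 / nr l)"
  by (simp add: HO_r_def ip_m_R)

text \<open>By \<open>norm_R_near_0\<close> the modulus stays above 1/2 up to a distance of order
  \<open>1 / (1 + norm l)\<close> from the origin. A ball of that scale around a shrunken interior
  point lies in the alcove, and there the weight is at least a fixed power of the scale.\<close>

lemma nr_lower_bound: "\<exists>C>0. \<exists>D::nat. \<forall>l\<in>Dom. C / (1 + norm l) ^ D \<le> nr l"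
proof -
  obtain p where p: "\<And>\<alpha>. \<alpha> \<in> Sp \<Longrightarrow> 0 < \<alpha> \<bullet> p \<and> \<alpha> \<bullet> p \<le> pi / 4" using ex_strict_alcove by blast
  define \<delta> where "\<delta> = Min ((\<lambda>\<alpha>. \<alpha> \<bullet> p) ` Sp)"
  have d: "\<delta> \<le> \<alpha> \<bullet> p" if "\<alpha> \<in> Sp" for \<alpha> unfolding \<delta>_def using that finite_Sp by (intro Min_le) auto
  have dp: "\<delta> > 0" unfolding \<delta>_def using finite_Sp Sp_nonempty p by (subst Min_gr_iff) auto
  have dpi: "\<delta> \<le> pi / 4" using Sp_nonempty d p by fastforce
  define b where "b = 1 + (\<Sum>\<alpha>\<in>Sp. norm \<alpha>)"
  have b: "norm \<alpha> \<le> b" if "\<alpha> \<in> Sp" for \<alpha>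
    using member_le_sum[OF that, of norm] finite_Sp by (simp add: b_def)
  have bp: "b > 0" unfolding b_def by (intro add_pos_nonneg sum_nonneg) auto
  \<comment> \<open>Moving \<open>p\<close> by less than \<epsilon> changes each pairing with a
    positive root by at most \<delta>/2.\<close>
  define \<epsilon> where "\<epsilon> = \<delta> / (2 * b)"
  have ep: "\<epsilon> > 0" using dp bp by (simp add: \<epsilon>_def)
  define \<rho> where "\<rho> = norm p + \<epsilon>"
  have rp: "\<rho> \<ge> 0" using ep by (simp add: \<rho>_def)
  \<comment> \<open>\<open>2 * \<delta> / pi\<close> is what the chord bound for the sine gives for
    each factor of the weight at scale 1; the cap at 1 is what \<open>pow0_ge\<close> asks
    for.\<close>
  define q where "q = min 1 (2 * \<delta> / pi)"
  have q: "0 < q" "q \<le> 1" "q \<le> 2 * \<delta> / pi" using dp by (auto simp: q_def)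
  define D1 where "D1 = (\<Sum>\<alpha>\<in>Sp. nat \<lceil>m \<alpha>\<rceil>)"
  define V where "V = unit_ball_vol (real DIM('a))"
  have Vp: "V > 0" by (simp add: V_def)
  have pt: "s *\<^sub>R p + s *\<^sub>R y \<in> alcove Sp \<and> (q * s) ^ D1 \<le> wt (s *\<^sub>R p + s *\<^sub>R y)" if s: "0 < s" "s \<le> 1" and y: "norm y < \<epsilon>" for s y
  proof
    let ?x = "s *\<^sub>R p + s *\<^sub>R y"
    have in1: "s * (\<delta> / 2) \<le> \<alpha> \<bullet> ?x \<and> \<alpha> \<bullet> ?x \<le> pi / 2" if a: "\<alpha> \<in> Sp" for \<alpha>
    proof -
      have "\<bar>\<alpha> \<bullet> y\<bar> \<le> norm \<alpha> * norm y" by (rule Cauchy_Schwarz_ineq2)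
      also have "\<dots> \<le> b * \<epsilon>" using b[OF a] y bp by (intro mult_mono) auto
      also have "\<dots> = \<delta> / 2" using bp by (simp add: \<epsilon>_def)
      finally have "\<delta> / 2 \<le> \<alpha> \<bullet> (p + y)" "\<alpha> \<bullet> (p + y) \<le> pi / 2"
        using d[OF a] p[OF a] dpi by (auto simp: inner_add_right abs_le_iff)
      moreover have "\<alpha> \<bullet> ?x = s * (\<alpha> \<bullet> (p + y))" by (simp add: inner_add_right algebra_simps)
      moreover have "s * (\<alpha> \<bullet> (p + y)) \<le> 1 * (pi / 2)" using calculation s dp by (intro mult_mono) auto
      ultimately show ?thesis using s by (simp add: mult_left_mono)
    qed
    have pos: "0 < s * (\<delta> / 2)" using s dp by simp
    show "?x \<in> alcove Sp"
      unfolding alcove_def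
    proof safe
      fix \<alpha> assume "\<alpha> \<in> Sp"
      then show "0 \<le> \<alpha> \<bullet> ?x" "\<alpha> \<bullet> ?x \<le> pi" using in1[of \<alpha>] pos pi_gt_zero by linarith+
    qed
    have "(q * s) ^ D1 = (\<Prod>\<alpha>\<in>Sp. (q * s) ^ nat \<lceil>m \<alpha>\<rceil>)" by (simp add: D1_def power_sum)
    also have "\<dots> \<le> wt ?x" unfolding wt_eq
    proof (intro prod_mono conjI pow0_ge)
      fix \<alpha> assume a: "\<alpha> \<in> Sp"
      have "q * s \<le> 2 * \<delta> / pi * s" using q s by (intro mult_right_mono) auto
      also have "\<dots> = 2 * (2 / pi * (s * (\<delta> / 2)))" by simp
      also have "2 / pi * (s * (\<delta> / 2)) \<le> 2 / pi * (\<alpha> \<bullet> ?x)" using in1[OF a] by (intro mult_left_mono) auto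
      also have "\<dots> \<le> sin (\<alpha> \<bullet> ?x)"
      proof -
        \<comment> \<open>Jordan's inequality from concavity of the sine.\<close>
        have "convex_on {0..pi} (\<lambda>t. - sin t)"
        proof (rule f''_ge0_imp_convex)
          show "((\<lambda>t. - sin t) has_real_derivative - cos t) (at t)" for t :: real by (auto intro!: derivative_eq_intros)
          show "((\<lambda>t. - cos t) has_real_derivative sin t) (at t)" for t :: real by (auto intro!: derivative_eq_intros)
        qed (auto intro: sin_ge_zero)
        define z where "z = \<alpha> \<bullet> ?x"
        have z: "0 \<le> z" "z \<le> pi / 2" using in1[OF a] pos by (auto simp: z_def)
        have "- sin ((1 - 2 * z / pi) *\<^sub>R 0 + (2 * z / pi) *\<^sub>R (pi / 2)) \<le> (1 - 2 * z / pi) * (- sin 0) + (2 * z / pi) * (- sin (pi / 2))"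
          by (rule convex_onD[OF \<open>convex_on {0..pi} (\<lambda>t. - sin t)\<close>]) (use z in \<open>auto simp: field_simps\<close>)
        then show ?thesis unfolding z_def[symmetric] by simp
      qed
      finally show "q * s \<le> 2 * \<bar>sin (\<alpha> \<bullet> ?x)\<bar>" by linarith
      show "0 \<le> m \<alpha>" using m_nonneg Sp_S[OF a] by blast
      show "q * s \<le> 1" using q s by (simp add: mult_le_one)
      show "0 \<le> (q * s) ^ nat \<lceil>m \<alpha>\<rceil>" using q s by simp
    qed (use q s in simp)
    finally show "(q * s) ^ D1 \<le> wt ?x" .
  qed
  \<comment> \<open>1/4 bounds \<open>|R|^2\<close>, \<open>q ^ D1\<close> the weight and
    \<open>V * \<epsilon> ^ DIM('a)\<close> the volume of the ball, up to powers of
    \<open>s\<close>, which the last factor accounts for.\<close>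
  define C where "C = 1 / 4 * q ^ D1 * V * \<epsilon> ^ DIM('a) * (1 / (2 * \<rho> + 1)) ^ (D1 + DIM('a))"
  show ?thesis
  proof (intro exI[of _ C] conjI exI[of _ "D1 + DIM('a)"] ballI)
    show "C > 0" unfolding C_def using q Vp ep rp by (intro mult_pos_pos zero_less_power) auto
    fix l assume l: "l \<in> Dom"
    \<comment> \<open>Points of \<open>U\<close> have norm at most \<open>s * \<rho>\<close>, and
      this choice of \<open>s\<close> makes \<open>norm l\<close> times that at most 1/2.\<close>
    define s where "s = 1 / ((2 * \<rho> + 1) * (1 + norm l))"
    have den: "(2 * \<rho> + 1) * (1 + norm l) \<ge> 1 * 1" using rp by (intro mult_mono) auto
    have s: "0 < s" "s \<le> 1" using den by (auto simp: s_def)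
    define U where "U = ball (s *\<^sub>R p) (s * \<epsilon>)"
    have Ux: "x \<in> alcove Sp \<and> (q * s) ^ D1 \<le> wt x \<and> norm (R l x) \<ge> 1 / 2" if x: "x \<in> U" for x
    proof -
      define y where "y = (1 / s) *\<^sub>R x - p"
      have xy: "x = s *\<^sub>R p + s *\<^sub>R y" using s by (simp add: y_def algebra_simps)
      have "norm (s *\<^sub>R y) < s * \<epsilon>" using x unfolding U_def by (simp add: xy dist_norm)
      then have y: "norm y < \<epsilon>" using s by simp
      have "norm x = s * norm (p + y)" using s by (simp add: xy flip: scaleR_add_right)
      also have "\<dots> \<le> s * \<rho>" using y norm_triangle_ineq[of p y] s by (intro mult_left_mono) (auto simp: \<rho>_def)
      finally have "norm l * norm x \<le> norm l * (s * \<rho>)" by (intro mult_left_mono) auto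
      also have "\<dots> \<le> 1 / 2"
      proof -
        have "2 * (norm l * \<rho>) \<le> (2 * \<rho> + 1) * (1 + norm l)" using rp by (simp add: algebra_simps)
        then show ?thesis unfolding s_def using den by (simp add: field_simps)
      qed
      finally have "norm l * norm x \<le> 1 / 2" .
      then show ?thesis using pt[OF s y] norm_R_near_0[OF l] by (simp add: xy)
    qed
    have ind: "integrable lborel (indicator U :: 'a \<Rightarrow> real)"
      using emeasure_lborel_ball_finite[of "s *\<^sub>R p" "s * \<epsilon>"] by (auto simp: U_def)
    have iU: "integrable lborel (\<lambda>x. indicator U x *\<^sub>R (1 / 4 * (q * s) ^ D1))"
      by (rule integrable_scaleR_left) (rule ind)
    have "C / (1 + norm l) ^ (D1 + DIM('a)) = 1 / 4 * (q * s) ^ D1 * (V * (s * \<epsilon>) ^ DIM('a))"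
      by (simp add: C_def s_def power_mult_distrib power_add power_divide divide_simps)
    also have "V * (s * \<epsilon>) ^ DIM('a) = measure lborel U"
      unfolding U_def V_def using s ep by (simp add: content_ball)
    also have "1 / 4 * (q * s) ^ D1 * measure lborel U = (LINT x|lborel. indicator U x *\<^sub>R (1 / 4 * (q * s) ^ D1))"
      by (subst integral_scaleR_left) (use ind in \<open>auto simp: U_def\<close>)
    also have "\<dots> \<le> nr l" unfolding nr_def set_lebesgue_integral_def
    proof (rule integral_mono[OF iU])
      have "set_integrable lborel (alcove Sp) (\<lambda>x. (norm (R l x))\<^sup>2 * wt x)"
        by (intro set_integrable_alcove continuous_intros continuous_R[OF l] continuous_wt)
      then show "integrable lborel (\<lambda>x. indicator (alcove Sp) x *\<^sub>R ((norm (R l x))\<^sup>2 * wt x))"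
        by (simp add: set_integrable_def)
      fix x
      show "indicator U x *\<^sub>R (1 / 4 * (q * s) ^ D1) \<le> indicator (alcove Sp) x *\<^sub>R ((norm (R l x))\<^sup>2 * wt x)"
      proof (cases "x \<in> U")
        case True
        have "(1 / 2)\<^sup>2 * (q * s) ^ D1 \<le> (norm (R l x))\<^sup>2 * wt x"
          using Ux[OF True] q s by (intro mult_mono power_mono) auto
        then show ?thesis using True Ux[OF True] by (simp add: power2_eq_square)
      next
        case False
        then show ?thesis using wt_nonneg by (simp add: indicator_def)
      qed
    qed
    finally show "C / (1 + norm l) ^ (D1 + DIM('a)) \<le> nr l" .
  qed
qed

lemma nr_pos: "l \<in> Dom \<Longrightarrow> nr l > 0"
proof -
  assume l: "l \<in> Dom"
  obtain C D where "C > 0" "\<forall>l\<in>Dom. C / (1 + norm l) ^ D \<le> nr l" using nr_lower_bound by blast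
  moreover have "(1 + norm l) ^ D > 0" by (simp add: add_pos_nonneg)
  ultimately show ?thesis using l by (metis divide_pos_pos less_le_trans)
qed

text \<open>A dominant weight is determined by its levels on \<open>Sp\<close>, and its norm
  dominates a multiple of their sum, so partial sums are bounded by a product of geometric
  series.\<close>

lemma summable_exp_norm: "(\<lambda>l. exp (- norm l)) summable_on Dom"
proof -
  define b where "b = (\<Sum>\<alpha>\<in>Sp. 1 / norm \<alpha>)"
  have bp: "b > 0" unfolding b_def using finite_Sp Sp_nonempty Sp_nz by (intro sum_pos) auto
  define q where "q = exp (- 1 / b)"
  have q: "0 < q" "q < 1" using bp by (auto simp: q_def)
  define n where "n l = restrict (\<lambda>\<alpha>. nat (lev l \<alpha>)) Sp" for l
  have lev_eq: "real (n l \<alpha>) * (\<alpha> \<bullet> \<alpha>) = l \<bullet> \<alpha>" if "l \<in> Dom" "\<alpha> \<in> Sp" for l \<alpha>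
  proof -
    have "l \<bullet> \<alpha> \<ge> 0" using dom_dominant[OF that(1)] that(2) by (simp add: dominant_def inner_commute)
    then have "lev l \<alpha> \<ge> 0" using lev_sign[OF dom_Lam[OF that(1)] Sp_S[OF that(2)]] by simp
    then show ?thesis using lev[OF dom_Lam[OF that(1)] Sp_S[OF that(2)]] that(2) by (simp add: n_def)
  qed
  have inj: "inj_on n Dom"
  proof (rule inj_onI, rule eq_if_inner_eq)
    fix l l' \<alpha> assume "l \<in> Dom" "l' \<in> Dom" "n l = n l'" "\<alpha> \<in> Sp"
    then show "l \<bullet> \<alpha> = l' \<bullet> \<alpha>" using lev_eq[of l \<alpha>] lev_eq[of l' \<alpha>] by simp
  qed
  have le: "exp (- norm l) \<le> (\<Prod>\<alpha>\<in>Sp. q ^ n l \<alpha>)" if l: "l \<in> Dom" for l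
  proof -
    have "(\<Sum>\<alpha>\<in>Sp. real (n l \<alpha>)) \<le> (\<Sum>\<alpha>\<in>Sp. norm l * (1 / norm \<alpha>))"
    proof (rule sum_mono)
      fix \<alpha> assume a: "\<alpha> \<in> Sp"
      have "real (n l \<alpha>) * (norm \<alpha> * norm \<alpha>) \<le> norm l * norm \<alpha>"
        using lev_eq[OF l a] norm_cauchy_schwarz[of l \<alpha>] by (simp add: dot_square_norm power2_eq_square)
      then show "real (n l \<alpha>) \<le> norm l * (1 / norm \<alpha>)" using Sp_nz[OF a] by (simp add: field_simps)
    qed
    also have "\<dots> = norm l * b" by (simp add: b_def sum_distrib_left)
    finally have "(\<Sum>\<alpha>\<in>Sp. real (n l \<alpha>)) / b \<le> norm l" using bp by (simp add: field_simps)
    then have "exp (- norm l) \<le> exp (- ((\<Sum>\<alpha>\<in>Sp. real (n l \<alpha>)) / b))" by simp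
    also have "\<dots> = (\<Prod>\<alpha>\<in>Sp. q ^ n l \<alpha>)"
      by (simp add: q_def exp_of_nat_mult[symmetric] exp_sum[OF finite_Sp, symmetric] sum_divide_distrib sum_negf)
    finally show ?thesis .
  qed
  show ?thesis
  proof (rule nonneg_bdd_above_summable_on)
    show "bdd_above (sum (\<lambda>l. exp (- norm l)) ` {F. F \<subseteq> Dom \<and> finite F})"
    proof (rule bdd_aboveI2[where M = "\<Prod>\<alpha>\<in>Sp. 1 / (1 - q)"])
      fix F assume "F \<in> {F. F \<subseteq> Dom \<and> finite F}"
      then have F: "F \<subseteq> Dom" "finite F" by auto
      define N where "N = Max (insert 0 ((\<lambda>(l, \<alpha>). n l \<alpha>) ` (F \<times> Sp)))"
      have N: "n l \<alpha> \<le> N" if "l \<in> F" "\<alpha> \<in> Sp" for l \<alpha>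
        unfolding N_def using F finite_Sp that by (intro Max_ge) (auto intro!: image_eqI[of _ _ "(l, \<alpha>)"])
      have "sum (\<lambda>l. exp (- norm l)) F \<le> (\<Sum>l\<in>F. \<Prod>\<alpha>\<in>Sp. q ^ n l \<alpha>)" using le F by (intro sum_mono) auto
      also have "\<dots> = (\<Sum>k\<in>n ` F. \<Prod>\<alpha>\<in>Sp. q ^ k \<alpha>)"
        by (subst sum.reindex) (use inj F inj_on_subset in \<open>auto simp: comp_def\<close>)
      also have "\<dots> \<le> (\<Sum>k\<in>Sp \<rightarrow>\<^sub>E {..N}. \<Prod>\<alpha>\<in>Sp. q ^ k \<alpha>)"
        using N q finite_Sp by (intro sum_mono2 finite_PiE prod_nonneg) (auto simp: n_def)
      also have "\<dots> = (\<Prod>\<alpha>\<in>Sp. \<Sum>k\<le>N. q ^ k)" by (rule prod_sum_PiE[symmetric]) (auto simp: finite_Sp)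
      also have "\<dots> \<le> (\<Prod>\<alpha>\<in>Sp. 1 / (1 - q))"
      proof (intro prod_mono conjI)
        have "(\<Sum>k<Suc N. q ^ k) \<le> (\<Sum>k. q ^ k)" using q by (intro sum_le_suminf summable_geometric) auto
        then show "(\<Sum>k\<le>N. q ^ k) \<le> 1 / (1 - q)" using q by (simp add: suminf_geometric lessThan_Suc_atMost)
        show "0 \<le> (\<Sum>k\<le>N. q ^ k)" using q by (intro sum_nonneg) auto
      qed
      finally show "sum (\<lambda>l. exp (- norm l)) F \<le> (\<Prod>\<alpha>\<in>Sp. 1 / (1 - q))" .
    qed
  qed simp
qed

definition bnd :: "real \<Rightarrow> 'a \<Rightarrow> real" where "bnd t l = 1 / nr l * exp (- theta l * t)"

lemma bnd_nonneg: "l \<in> Dom \<Longrightarrow> bnd t l \<ge> 0" using nr_pos[of l] by (simp add: bnd_def)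

text \<open>Since \<open>theta l\<close> is at least the squared norm, the exponential is Gaussian
  and beats the polynomial growth of \<open>1 / nr l\<close>.\<close>

lemma summable_bnd: assumes t: "t > 0" shows "bnd t summable_on Dom"
proof -
  obtain C D where C: "C > 0" "\<And>l. l \<in> Dom \<Longrightarrow> C / (1 + norm l) ^ D \<le> nr l" using nr_lower_bound by blast
  define A where "A = fact D * exp (1 + 1 / t) / C"
  have le: "bnd t l \<le> A * exp (- norm l)" if l: "l \<in> Dom" for l
  proof -
    define u where "u = norm l"
    have u: "u \<ge> 0" by (simp add: u_def)
    have "(1 + u) ^ D / fact D \<le> exp (1 + u)"
    proof -
      have "(\<lambda>n. (1 + u) ^ n /\<^sub>R fact n) sums exp (1 + u)" by (rule exp_converges)
      then have s: "summable (\<lambda>n. (1 + u) ^ n /\<^sub>R fact n)" "suminf (\<lambda>n. (1 + u) ^ n /\<^sub>R fact n) = exp (1 + u)"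
        by (auto simp: sums_iff)
      have "sum (\<lambda>n. (1 + u) ^ n /\<^sub>R fact n) {D} \<le> suminf (\<lambda>n. (1 + u) ^ n /\<^sub>R fact n)"
        using s(1) u by (intro sum_le_suminf) auto
      then show ?thesis using s(2) by (simp add: divide_inverse mult.commute)
    qed
    then have pw: "(1 + u) ^ D \<le> fact D * exp (1 + u)" by (simp add: field_simps)
    have th: "exp (- theta l * t) \<le> exp (- u\<^sup>2 * t)"
      using theta_ge[OF l] t by (simp add: u_def mult_right_mono)
    have "C / (1 + u) ^ D > 0" using C(1) u by (intro divide_pos_pos zero_less_power) auto
    then have "1 / nr l \<le> 1 / (C / (1 + u) ^ D)"
      using C(2)[OF l] by (intro frac_le) (auto simp: u_def)
    also have "\<dots> = (1 + u) ^ D / C" by simp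
    also have "\<dots> \<le> fact D * exp (1 + u) / C" using pw C(1) by (simp add: divide_right_mono)
    finally have "bnd t l \<le> fact D * exp (1 + u) / C * exp (- u\<^sup>2 * t)"
      unfolding bnd_def using th C(1) by (intro mult_mono) auto
    also have "\<dots> = fact D / C * exp (1 + u - u\<^sup>2 * t)" by (simp add: exp_diff exp_minus divide_inverse)
    also have "\<dots> \<le> fact D / C * exp (1 + 1 / t - u)"
    proof -
      \<comment> \<open>Completing the square at \<open>1 / t\<close> trades the Gaussian for plain
        exponential decay.\<close>
      have "0 \<le> t * (u - 1 / t)\<^sup>2" using t by simp
      also have "\<dots> = u\<^sup>2 * t - 2 * u + 1 / t" using t by (simp add: power2_eq_square field_simps)
      finally show ?thesis using C(1) by (intro mult_left_mono) auto
    qed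
    also have "\<dots> = A * exp (- norm l)" by (simp add: A_def u_def exp_diff exp_minus divide_inverse)
    finally show ?thesis .
  qed
  have "(\<lambda>l. A * exp (- norm l)) summable_on Dom" by (rule summable_on_cmult_right[OF summable_exp_norm])
  then show ?thesis by (rule summable_on_comparison_test) (use le bnd_nonneg in auto)
qed

section \<open>The heat kernel\<close>

definition kt :: "real \<Rightarrow> 'a \<Rightarrow> 'a \<Rightarrow> 'a \<Rightarrow> complex" where
  "kt t l x y = HO_r S Sp m l * of_real (exp (- theta l * t)) * R l x * R l (- y)"

abbreviation "ker t x y \<equiv> heat_kernel S Sp m x y t"

lemma ker_eq: "ker t x y = infsum (\<lambda>l. kt t l x y) Dom"
  by (simp add: heat_kernel_def kt_def)

lemma norm_kt: assumes "l \<in> Dom" shows "norm (kt t l x y) \<le> bnd t l"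
proof -
  have "norm (kt t l x y) = bnd t l * (norm (R l x) * norm (R l (- y)))"
    using nr_pos[OF assms] by (simp add: kt_def bnd_def HO_r_eq norm_mult norm_divide)
  also have "\<dots> \<le> bnd t l * (1 * 1)"
    using norm_R_le[OF assms] bnd_nonneg[OF assms] by (intro mult_left_mono mult_mono) auto
  finally show ?thesis by simp
qed

lemma continuous_kt: assumes "l \<in> Dom" shows "continuous_on A (kt t l x)"
  unfolding kt_def R_minus[OF assms] by (intro continuous_intros continuous_R[OF assms])

text \<open>Uniform in both variables, by the Weierstrass test. It is stated for all larger finite
  sets so that \<open>H_PP\<close> can add a prescribed weight.\<close>

lemma ker_approx:
  assumes "t > 0" "e > 0"
  obtains F where "finite F" "F \<subseteq> Dom"
    "\<And>F' x y. finite F' \<Longrightarrow> F \<subseteq> F' \<Longrightarrow> F' \<subseteq> Dom \<Longrightarrow> norm ((\<Sum>l\<in>F'. kt t l x y) - ker t x y) < e"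
proof -
  have "uniform_limit UNIV (\<lambda>X p. \<Sum>l\<in>X. kt t l (fst p) (snd p)) (\<lambda>p. \<Sum>\<^sub>\<infinity>l\<in>Dom. kt t l (fst p) (snd p)) (finite_subsets_at_top Dom)"
    by (rule Weierstrass_m_test_general[where M = "bnd t"]) (use norm_kt summable_bnd[OF assms(1)] in auto)
  then have "\<forall>\<^sub>F X in finite_subsets_at_top Dom. \<forall>p\<in>UNIV. dist (\<Sum>l\<in>X. kt t l (fst p) (snd p)) (\<Sum>\<^sub>\<infinity>l\<in>Dom. kt t l (fst p) (snd p)) < e"
    by (rule uniform_limitD) (rule assms(2))
  then obtain F where F: "finite F" "F \<subseteq> Dom" "\<And>F'. finite F' \<and> F \<subseteq> F' \<and> F' \<subseteq> Dom \<Longrightarrow>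
     \<forall>p\<in>UNIV. dist (\<Sum>l\<in>F'. kt t l (fst p) (snd p)) (\<Sum>\<^sub>\<infinity>l\<in>Dom. kt t l (fst p) (snd p)) < e"
    unfolding eventually_finite_subsets_at_top by blast
  show ?thesis
  proof (rule that[OF F(1,2)])
    fix F' x y assume "finite F'" "F \<subseteq> F'" "F' \<subseteq> Dom"
    then have "\<forall>p\<in>UNIV. dist (\<Sum>l\<in>F'. kt t l (fst p) (snd p)) (\<Sum>\<^sub>\<infinity>l\<in>Dom. kt t l (fst p) (snd p)) < e"
      using F(3) by blast
    from bspec[OF this, of "(x, y)"] show "norm ((\<Sum>l\<in>F'. kt t l x y) - ker t x y) < e"
      by (simp add: ker_eq dist_norm)
  qed
qed

lemma continuous_ker: assumes t: "t > 0" shows "continuous_on A (ker t x)"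
proof -
  have ul: "uniform_limit A (\<lambda>X y. \<Sum>l\<in>X. kt t l x y) (\<lambda>y. \<Sum>\<^sub>\<infinity>l\<in>Dom. kt t l x y) (finite_subsets_at_top Dom)"
    by (rule Weierstrass_m_test_general[where M = "bnd t"]) (use norm_kt summable_bnd[OF t] in auto)
  have "\<forall>\<^sub>F X in finite_subsets_at_top Dom. continuous_on A (\<lambda>y. \<Sum>l\<in>X. kt t l x y)"
    by (rule eventually_finite_subsets_at_top_weakI) (auto intro!: continuous_intros continuous_kt)
  from uniform_limit_theorem[OF this ul] have "continuous_on A (\<lambda>y. \<Sum>\<^sub>\<infinity>l\<in>Dom. kt t l x y)" by simp
  then show ?thesis by (simp add: ker_eq[abs_def])
qed

lemma ker_bound: assumes t: "t > 0" shows "\<exists>B\<ge>0. \<forall>x y. norm (ker t x y) \<le> B"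
proof -
  obtain F where F: "finite F" "F \<subseteq> Dom" "\<And>x y. norm ((\<Sum>l\<in>F. kt t l x y) - ker t x y) < 1"
    using ker_approx[OF t zero_less_one] by (metis order_refl)
  have "norm (ker t x y) \<le> (\<Sum>l\<in>F. bnd t l) + 1" for x y
  proof -
    have "norm (\<Sum>l\<in>F. kt t l x y) \<le> (\<Sum>l\<in>F. bnd t l)" using F(2) norm_kt by (intro sum_norm_le) auto
    then show ?thesis
      using F(3)[of x y] norm_triangle_sub[of "ker t x y" "\<Sum>l\<in>F. kt t l x y"] by (simp add: norm_minus_commute)
  qed
  moreover have "(\<Sum>l\<in>F. bnd t l) + 1 \<ge> 0" using F(2) bnd_nonneg by (intro add_nonneg_nonneg sum_nonneg) auto
  ultimately show ?thesis by blast
qed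

abbreviation "H \<equiv> heat_sg S Sp m"

lemma H_integrable:
  assumes "t > 0" "continuous_on (alcove Sp) f"
  shows "set_integrable lborel (alcove Sp) (\<lambda>y. ker t x y * f y * of_real (wt y))"
  by (intro set_integrable_alcove continuous_intros continuous_ker assms continuous_wt)

lemma H_pos: "t > 0 \<Longrightarrow> H t f x = (LINT y:alcove Sp|lborel. ker t x y * f y * of_real (wt y))"
  by (simp add: heat_sg_def)

lemma H_0: "H 0 f x = f x" by (simp add: heat_sg_def)

lemma H_linear:
  assumes "t \<ge> 0" "continuous_on (alcove Sp) f" "continuous_on (alcove Sp) g"
  shows "H t (\<lambda>y. a * f y + b * g y) x = a * H t f x + b * H t g x"
proof (cases "t = 0")
  case False
  then have t: "t > 0" using assms by simp
  have "(LINT y:alcove Sp|lborel. ker t x y * (a * f y + b * g y) * of_real (wt y))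
    = (LINT y:alcove Sp|lborel. a * (ker t x y * f y * of_real (wt y)) + b * (ker t x y * g y * of_real (wt y)))"
    by (simp add: algebra_simps)
  also have "\<dots> = a * (LINT y:alcove Sp|lborel. ker t x y * f y * of_real (wt y)) + b * (LINT y:alcove Sp|lborel. ker t x y * g y * of_real (wt y))"
    using H_integrable[OF t assms(2)] H_integrable[OF t assms(3)]
    by (subst set_integral_add) (auto intro: set_integrable_mult_right)
  finally show ?thesis by (simp add: H_pos[OF t])
qed (simp add: H_0)

lemma integral_alcove_bound:
  fixes g :: "'a \<Rightarrow> complex"
  assumes g: "continuous_on (alcove Sp) g" and b: "\<And>y. y \<in> alcove Sp \<Longrightarrow> norm (g y) \<le> b"
  shows "norm (LINT y:alcove Sp|lborel. g y * of_real (wt y)) \<le> b * (LINT y:alcove Sp|lborel. wt y)"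
proof -
  have i: "set_integrable lborel (alcove Sp) (\<lambda>y. g y * of_real (wt y))"
    by (intro set_integrable_alcove continuous_intros g continuous_wt)
  have iw: "set_integrable lborel (alcove Sp) wt" by (intro set_integrable_alcove continuous_wt)
  have "norm (LINT y:alcove Sp|lborel. g y * of_real (wt y)) \<le> (LINT y:alcove Sp|lborel. norm (g y * of_real (wt y)))"
    by (rule set_integral_norm_bound[OF i])
  also have "\<dots> \<le> (LINT y:alcove Sp|lborel. b * wt y)"
  proof (rule set_integral_mono)
    show "set_integrable lborel (alcove Sp) (\<lambda>y. norm (g y * of_real (wt y)))" by (rule set_integrable_norm[OF i])
    show "set_integrable lborel (alcove Sp) (\<lambda>y. b * wt y)" by (rule set_integrable_mult_right) (rule iw)
    show "norm (g y * of_real (wt y)) \<le> b * wt y" if "y \<in> alcove Sp" for y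
      using b[OF that] wt_nonneg[of y] by (simp add: norm_mult mult_right_mono)
  qed
  finally show ?thesis by simp
qed

lemma wt_integral_nonneg: "(LINT y:alcove Sp|lborel. wt y) \<ge> 0"
  unfolding set_lebesgue_integral_def by (rule integral_nonneg_AE) (auto simp: wt_nonneg)

text \<open>Crude Lipschitz bound from the supremum of the kernel. It serves to pass to limits of
  polynomials in \<open>H_Re_le\<close>, before contractivity is known.\<close>

lemma H_bound:
  assumes t: "t \<ge> 0"
  shows "\<exists>B\<ge>0. \<forall>(f :: 'a \<Rightarrow> complex) (g :: 'a \<Rightarrow> complex) \<delta>. continuous_on (alcove Sp) f \<longrightarrow> continuous_on (alcove Sp) g \<longrightarrow>
    (\<forall>y\<in>alcove Sp. norm (f y - g y) \<le> \<delta>) \<longrightarrow> (\<forall>x\<in>alcove Sp. norm (H t f x - H t g x) \<le> B * \<delta>)"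
proof (cases "t = 0")
  case True
  then show ?thesis by (intro exI[of _ 1]) (auto simp: H_0)
next
  case False
  then have tp: "t > 0" using t by simp
  obtain B where B: "B \<ge> 0" "\<And>x y. norm (ker t x y) \<le> B" using ker_bound[OF tp] by blast
  let ?I = "LINT y:alcove Sp|lborel. wt y"
  show ?thesis
  proof (intro exI[of _ "B * ?I"] conjI allI impI ballI)
    show "0 \<le> B * ?I" using B(1) wt_integral_nonneg by simp
    fix f g :: "'a \<Rightarrow> complex" and \<delta> x
    assume f: "continuous_on (alcove Sp) f" and g: "continuous_on (alcove Sp) g"
      and d: "\<forall>y\<in>alcove Sp. norm (f y - g y) \<le> \<delta>"
    have "H t f x - H t g x = (LINT y:alcove Sp|lborel. ker t x y * f y * of_real (wt y) - ker t x y * g y * of_real (wt y))"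
      unfolding H_pos[OF tp] using H_integrable[OF tp f] H_integrable[OF tp g] by (subst set_integral_diff(2)) auto
    also have "\<dots> = (LINT y:alcove Sp|lborel. (ker t x y * (f y - g y)) * of_real (wt y))" by (simp add: algebra_simps)
    also have "norm \<dots> \<le> (B * \<delta>) * ?I"
    proof (rule integral_alcove_bound)
      show "continuous_on (alcove Sp) (\<lambda>y. ker t x y * (f y - g y))" by (intro continuous_intros continuous_ker tp f g)
      show "norm (ker t x y * (f y - g y)) \<le> B * \<delta>" if "y \<in> alcove Sp" for y
        unfolding norm_mult using B d that by (intro mult_mono) auto
    qed
    finally show "norm (H t f x - H t g x) \<le> B * ?I * \<delta>" by (simp add: mult_ac)
  qed
qed

lemma ip_m_PP: assumes "l \<in> Dom" "\<mu> \<in> Dom"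
  shows "ip_m Sp m (PP \<mu>) (PP l) = (if l = \<mu> then of_real (nr l * (p0 l)\<^sup>2) else 0)"
proof (cases "l = \<mu>")
  case True
  have p: "p0 l \<noteq> 0" using p0_ge_1[OF assms(1)] by auto
  have "ip_m Sp m (R l) (R l) = (LINT x:alcove Sp|lborel. (1 / of_real ((p0 l)\<^sup>2)) * (PP l x * cnj (PP l x) * of_real (wt x)))"
    unfolding ip_m_def R_eq[OF assms(1)] by (simp add: power2_eq_square)
  also have "\<dots> = (1 / of_real ((p0 l)\<^sup>2)) * ip_m Sp m (PP l) (PP l)"
    unfolding ip_m_def by (rule set_integral_mult_right)
  finally have "of_real (nr l) = (1 / of_real ((p0 l)\<^sup>2)) * ip_m Sp m (PP l) (PP l)" by (simp add: ip_m_R)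
  then show ?thesis using True p by (simp add: field_simps)
next
  case False
  have "ip (PP \<mu>) (PP l) = of_nat (card W) * ip_m Sp m (PP \<mu>) (PP l)"
    by (rule ip_eq_ip_m) (auto simp: PP_weyl intro: continuous_PP)
  then show ?thesis using PP_orthogonal[OF assms(2,1)] False card_W_nonzero by auto
qed

text \<open>In a finite partial sum of the kernel only the term \<mu> survives orthogonality; the
  remaining tail is uniformly small.\<close>

lemma H_PP:
  assumes mu: "\<mu> \<in> Dom" and t: "t \<ge> 0"
  shows "H t (PP \<mu>) x = of_real (exp (- theta \<mu> * t)) * PP \<mu> x"
proof (cases "t = 0")
  case False
  then have tp: "t > 0" using t by simp
  let ?I = "LINT y:alcove Sp|lborel. wt y"
  let ?z = "of_real (exp (- theta \<mu> * t)) * PP \<mu> x"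
  have trm: "(LINT y:alcove Sp|lborel. kt t l x y * PP \<mu> y * of_real (wt y)) = (if l = \<mu> then ?z else 0)" if l: "l \<in> Dom" for l
  proof -
    have "(LINT y:alcove Sp|lborel. kt t l x y * PP \<mu> y * of_real (wt y))
      = (LINT y:alcove Sp|lborel. (HO_r S Sp m l * of_real (exp (- theta l * t)) * R l x / of_real (p0 l)) * (PP \<mu> y * cnj (PP l y) * of_real (wt y)))"
      by (simp add: kt_def R_eq[OF l] PP_minus mult_ac)
    also have "\<dots> = (HO_r S Sp m l * of_real (exp (- theta l * t)) * R l x / of_real (p0 l)) * ip_m Sp m (PP \<mu>) (PP l)"
      unfolding ip_m_def by (rule set_integral_mult_right)
    also have "\<dots> = (if l = \<mu> then ?z else 0)"
      unfolding ip_m_PP[OF l mu] using nr_pos[OF mu] p0_ge_1[OF mu]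
      by (auto simp: HO_r_eq R_eq[OF mu] power2_eq_square)
    finally show ?thesis .
  qed
  obtain B where B: "\<And>y. y \<in> alcove Sp \<Longrightarrow> norm (PP \<mu> y) \<le> B"
    using compact_imp_bounded[OF compact_continuous_image[OF continuous_PP[of "alcove Sp" \<mu>] compact_alcove]]
    unfolding bounded_iff by blast
  have close: "norm (H t (PP \<mu>) x - ?z) \<le> e * (B * ?I)" if e: "e > 0" for e
  proof -
    obtain F where F: "finite F" "F \<subseteq> Dom"
      "\<And>F' x y. finite F' \<Longrightarrow> F \<subseteq> F' \<Longrightarrow> F' \<subseteq> Dom \<Longrightarrow> norm ((\<Sum>l\<in>F'. kt t l x y) - ker t x y) < e"
      using ker_approx[OF tp e] by blast
    let ?F = "insert \<mu> F"
    have F': "finite ?F" "?F \<subseteq> Dom" using F mu by auto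
    have ci: "set_integrable lborel (alcove Sp) (\<lambda>y. kt t l x y * PP \<mu> y * of_real (wt y))" if "l \<in> ?F" for l
      using that F'(2) by (intro set_integrable_alcove continuous_intros continuous_kt continuous_PP continuous_wt) auto
    have "(LINT y:alcove Sp|lborel. (\<Sum>l\<in>?F. kt t l x y * PP \<mu> y * of_real (wt y)))
       = (\<Sum>l\<in>?F. LINT y:alcove Sp|lborel. kt t l x y * PP \<mu> y * of_real (wt y))"
      unfolding set_lebesgue_integral_def scaleR_sum_right
      by (rule Bochner_Integration.integral_sum) (use ci in \<open>simp add: set_integrable_def\<close>)
    also have "\<dots> = (\<Sum>l\<in>?F. if l = \<mu> then ?z else 0)"
      using F'(2) trm by (intro sum.cong refl) (auto simp del: insert_subset)
    also have "\<dots> = ?z" using F'(1) by simp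
    finally have z: "?z = (LINT y:alcove Sp|lborel. (\<Sum>l\<in>?F. kt t l x y * PP \<mu> y * of_real (wt y)))" ..
    have si: "set_integrable lborel (alcove Sp) (\<lambda>y. \<Sum>l\<in>?F. kt t l x y * PP \<mu> y * of_real (wt y))"
      using F'(2) by (intro set_integrable_alcove continuous_intros continuous_kt continuous_PP continuous_wt) auto
    have "H t (PP \<mu>) x - ?z = (LINT y:alcove Sp|lborel. ker t x y * PP \<mu> y * of_real (wt y) - (\<Sum>l\<in>?F. kt t l x y * PP \<mu> y * of_real (wt y)))"
      unfolding H_pos[OF tp] z using H_integrable[OF tp continuous_PP] si by (subst set_integral_diff(2)) auto
    also have "\<dots> = (LINT y:alcove Sp|lborel. ((ker t x y - (\<Sum>l\<in>?F. kt t l x y)) * PP \<mu> y) * of_real (wt y))"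
      by (simp only: sum_distrib_right[symmetric] left_diff_distrib)
    also have "norm \<dots> \<le> (e * B) * ?I"
    proof (rule integral_alcove_bound)
      show "continuous_on (alcove Sp) (\<lambda>y. (ker t x y - (\<Sum>l\<in>?F. kt t l x y)) * PP \<mu> y)"
        using F'(2) by (intro continuous_intros continuous_ker[OF tp] continuous_kt continuous_PP) auto
      show "norm ((ker t x y - (\<Sum>l\<in>?F. kt t l x y)) * PP \<mu> y) \<le> e * B" if "y \<in> alcove Sp" for y
        unfolding norm_mult using F(3)[OF F'(1) subset_insertI F'(2), of x y] B[OF that] e
        by (intro mult_mono) (auto simp: norm_minus_commute)
    qed
    finally show ?thesis by (simp add: mult.assoc)
  qed
  have "norm (H t (PP \<mu>) x - ?z) \<le> 0"
  proof (rule field_le_epsilon)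
    fix e :: real assume e: "e > 0"
    have B0: "0 \<le> B * ?I" using B[OF alcove_nonempty] wt_integral_nonneg by (meson mult_nonneg_nonneg norm_ge_zero order_trans)
    have "norm (H t (PP \<mu>) x - ?z) \<le> e / (B * ?I + 1) * (B * ?I)" using e B0 by (intro close) auto
    also have "\<dots> \<le> e"
    proof -
      have "e * (B * ?I) \<le> e * (B * ?I + 1)" using e by (intro mult_left_mono) auto
      then show ?thesis using B0 by (simp add: divide_le_eq)
    qed
    finally show "norm (H t (PP \<mu>) x - ?z) \<le> 0 + e" by simp
  qed
  then show ?thesis by simp
qed (simp add: H_0)

lemma H_sum:
  assumes "finite F" "F \<subseteq> Dom" "t \<ge> 0"
  shows "H t (\<lambda>x. \<Sum>l\<in>F. c l * PP l x) x = (\<Sum>l\<in>F. c l * of_real (exp (- theta l * t)) * PP l x)"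
  using assms(1,2)
proof (induction F rule: finite_induct)
  case empty
  have "H t (\<lambda>x. 0 * PP 0 x + 0 * PP 0 x) x = 0" by (subst H_linear[OF assms(3) continuous_PP continuous_PP]) simp
  then show ?case by simp
next
  case (insert l F)
  have "H t (\<lambda>x. c l * PP l x + 1 * (\<Sum>l\<in>F. c l * PP l x)) x = c l * H t (PP l) x + 1 * H t (\<lambda>x. \<Sum>l\<in>F. c l * PP l x) x"
    by (rule H_linear[OF assms(3)]) (intro continuous_intros continuous_PP)+
  then show ?case using insert H_PP[OF _ assms(3), of l x] by (simp add: mult.assoc)
qed

end

section \<open>Density of the invariant trigonometric polynomials\<close>

text \<open>Dedekind's independence of characters, for maps that are multiplicative on a submonoid
  \<open>L\<close> only.\<close>

lemma characters_independent:
  fixes C :: "('g::comm_monoid_add \<Rightarrow> complex) set"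
  assumes "finite C" and L0: "0 \<in> L" and Ladd: "\<And>g h. g \<in> L \<Longrightarrow> h \<in> L \<Longrightarrow> g + h \<in> L"
    and "\<And>\<phi>. \<phi> \<in> C \<Longrightarrow> \<phi> 0 = 1"
    and "\<And>\<phi> g h. \<phi> \<in> C \<Longrightarrow> g \<in> L \<Longrightarrow> h \<in> L \<Longrightarrow> \<phi> (g + h) = \<phi> g * \<phi> h"
    and "\<And>\<phi> \<phi>'. \<phi> \<in> C \<Longrightarrow> \<phi>' \<in> C \<Longrightarrow> \<phi> \<noteq> \<phi>' \<Longrightarrow> \<exists>g\<in>L. \<phi> g \<noteq> \<phi>' g"
    and "\<And>g. g \<in> L \<Longrightarrow> (\<Sum>\<phi>\<in>C. a \<phi> * \<phi> g) = 0"
  shows "\<forall>\<phi>\<in>C. a \<phi> = 0"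
  using assms(1,4-)
proof (induction C arbitrary: a rule: finite_induct)
  case (insert \<psi> C)
  have zero: "a \<phi> = 0" if x: "\<phi> \<in> C" for \<phi>
  proof -
    obtain h where h: "h \<in> L" "\<phi> h \<noteq> \<psi> h" using insert.prems(3)[of \<phi> \<psi>] insert.hyps(2) x by auto
    have "\<forall>\<phi>\<in>C. a \<phi> * (\<phi> h - \<psi> h) = 0"
    proof (rule insert.IH)
      fix g assume g: "g \<in> L"
      have 1: "a \<psi> * \<psi> g + (\<Sum>\<phi>\<in>C. a \<phi> * \<phi> g) = 0"
        using insert.prems(4)[OF g] insert.hyps by simp
      have "a \<psi> * \<psi> (g + h) + (\<Sum>\<phi>\<in>C. a \<phi> * \<phi> (g + h)) = 0"
        using insert.prems(4)[OF Ladd[OF g h(1)]] insert.hyps by simp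
      then have 2: "a \<psi> * (\<psi> g * \<psi> h) + (\<Sum>\<phi>\<in>C. a \<phi> * (\<phi> g * \<phi> h)) = 0"
        using insert.prems(2)[OF _ g h(1)] by simp
      have "(\<Sum>\<phi>\<in>C. a \<phi> * (\<phi> h - \<psi> h) * \<phi> g) = (\<Sum>\<phi>\<in>C. a \<phi> * (\<phi> g * \<phi> h)) - \<psi> h * (\<Sum>\<phi>\<in>C. a \<phi> * \<phi> g)"
        by (simp add: sum_distrib_left sum_subtractf algebra_simps)
      also have "\<dots> = - (a \<psi> * (\<psi> g * \<psi> h)) - \<psi> h * (- (a \<psi> * \<psi> g))"
        using 1 2 by (simp add: add_eq_0_iff)
      finally show "(\<Sum>\<phi>\<in>C. a \<phi> * (\<phi> h - \<psi> h) * \<phi> g) = 0" by (simp add: algebra_simps)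
    qed (use insert.prems in auto)
    then show ?thesis using x h(2) by auto
  qed
  have "a \<psi> * \<psi> 0 + (\<Sum>\<phi>\<in>C. a \<phi> * \<phi> 0) = 0" using insert.prems(4)[OF L0] insert.hyps by simp
  then have "a \<psi> = 0" using zero insert.prems(1)[of \<psi>] by simp
  then show ?case using zero by simp
qed simp

context root_data
begin

section \<open>The coroot lattice as a dual lattice, and the alcove as an orbit space\<close>

lemma Q_sum: "(\<And>i. i \<in> J \<Longrightarrow> f i \<in> Q) \<Longrightarrow> sum f J \<in> Q"
  by (induction J rule: infinite_finite_induct) (auto intro: Q_0 Q_add)

lemma Q_scale_int: assumes "v \<in> Q" shows "of_int k *\<^sub>R v \<in> Q"
proof (induction k rule: int_induct[where k = 0])
  case base
  show ?case using Q_0 by simp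
next
  case (step1 i)
  then show ?case using Q_add[OF _ assms] by (simp add: scaleR_add_left)
next
  case (step2 i)
  then show ?case using Q_add[OF _ Q_uminus[OF assms]] by (simp add: scaleR_diff_left)
qed

lemma span_simple_coroots: "span (coroot ` simple) = UNIV"
proof -
  have "Sp \<subseteq> span (coroot ` simple)"
  proof
    fix \<beta> assume "\<beta> \<in> Sp"
    then obtain c :: "'a \<Rightarrow> nat" where "coroot \<beta> = (\<Sum>\<gamma>\<in>simple. real (c \<gamma>) *\<^sub>R coroot \<gamma>)"
      using coroot_nat_combination by blast
    then have "coroot \<beta> \<in> span (coroot ` simple)" using span_sum[of simple "\<lambda>\<gamma>. real (c \<gamma>) *\<^sub>R coroot \<gamma>" "coroot ` simple"]
      by (simp add: span_scale span_base)
    then show "\<beta> \<in> span (coroot ` simple)" by (subst root_coroot_scale) (rule span_scale)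
  qed
  then show ?thesis using span_Sp span_mono span_span by (metis subset_antisym top_greatest)
qed

text \<open>The dual of the weight lattice is the coroot lattice, because the simple coroots are a lattice basis.\<close>

lemma Q_dual:
  assumes z: "\<And>\<nu>. \<nu> \<in> Lam \<Longrightarrow> \<exists>k::int. \<nu> \<bullet> z = 2 * pi * of_int k"
  shows "\<exists>v\<in>Q. z = pi *\<^sub>R v"
proof -
  let ?B = "coroot ` simple"
  have finB: "finite ?B" using finite_simple by simp
  have "z \<in> span ?B" by (simp add: span_simple_coroots)
  then obtain u where u: "z = (\<Sum>b\<in>?B. u b *\<^sub>R b)" using span_finite[OF finB] by auto
  have "\<exists>k::int. u b = pi * of_int k" if b: "b \<in> ?B" for b
  proof -
    \<comment> \<open>The value 2 makes the dual basis vector pair evenly with all coroots, as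
      weights do.\<close>
    obtain g :: "'a \<Rightarrow> real" where g: "linear g" "\<And>x. x \<in> ?B \<Longrightarrow> g x = (if x = b then 2 else 0)"
      using linear_independent_extend[OF independent_simple_coroots, of "\<lambda>x. if x = b then 2 else 0"] by blast
    define l where "l = (\<Sum>i\<in>Basis. g i *\<^sub>R i)"
    have lg: "l \<bullet> x = g x" for x
    proof -
      have "g x = g (\<Sum>i\<in>Basis. (x \<bullet> i) *\<^sub>R i)" by (simp add: euclidean_representation)
      also have "\<dots> = (\<Sum>i\<in>Basis. (x \<bullet> i) * g i)" by (simp add: linear_sum[OF g(1)] linear_scale[OF g(1)])
      also have "\<dots> = l \<bullet> x" unfolding l_def inner_sum_left by (intro sum.cong refl) (simp add: inner_commute)
      finally show ?thesis ..
    qed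
    have pos: "\<exists>k::int. l \<bullet> \<alpha> = of_int k * (\<alpha> \<bullet> \<alpha>)" if a: "\<alpha> \<in> Sp" for \<alpha>
    proof -
      obtain c :: "'a \<Rightarrow> nat" where c: "coroot \<alpha> = (\<Sum>\<gamma>\<in>simple. real (c \<gamma>) *\<^sub>R coroot \<gamma>)"
        using coroot_nat_combination[OF a] by blast
      have "g (coroot \<alpha>) = (\<Sum>\<gamma>\<in>simple. real (c \<gamma>) * (if coroot \<gamma> = b then 2 else 0))"
        unfolding c by (simp add: linear_sum[OF g(1)] linear_scale[OF g(1)] g(2))
      also have "\<dots> = 2 * of_int (\<Sum>\<gamma>\<in>simple. int (c \<gamma>) * (if coroot \<gamma> = b then 1 else 0))"
        by (simp add: sum_distrib_left mult.commute if_distrib cong: if_cong)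
      finally obtain k :: int where k: "g (coroot \<alpha>) = 2 * of_int k" by blast
      have "l \<bullet> \<alpha> = (\<alpha> \<bullet> \<alpha>) / 2 * (l \<bullet> coroot \<alpha>)"
        by (subst (1) root_coroot_scale) simp
      then show ?thesis using k lg by (intro exI[of _ k]) simp
    qed
    have "l \<in> Lam"
    proof (rule LamI)
      fix \<alpha> assume "\<alpha> \<in> S"
      then show "\<exists>k::int. l \<bullet> \<alpha> = of_int k * (\<alpha> \<bullet> \<alpha>)"
      proof (cases rule: S_cases)
        case 1
        then show ?thesis using pos by blast
      next
        case 2
        then obtain k :: int where "l \<bullet> (- \<alpha>) = of_int k * (\<alpha> \<bullet> \<alpha>)" using pos[of "- \<alpha>"] by auto
        then show ?thesis by (intro exI[of _ "- k"]) simp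
      qed
    qed
    then obtain k :: int where "l \<bullet> z = 2 * pi * of_int k" using z by blast
    moreover have "l \<bullet> z = 2 * u b"
    proof -
      have "g z = (\<Sum>x\<in>?B. u x * (if x = b then 2 else 0))"
        unfolding u linear_sum[OF g(1)] by (intro sum.cong refl) (simp add: linear_scale[OF g(1)] g(2))
      also have "\<dots> = 2 * u b" using b finB by (simp add: if_distrib cong: if_cong)
      finally show ?thesis by (simp add: lg)
    qed
    ultimately show ?thesis by auto
  qed
  then obtain k :: "'a \<Rightarrow> int" where k: "\<And>b. b \<in> ?B \<Longrightarrow> u b = pi * of_int (k b)" by metis
  have "z = pi *\<^sub>R (\<Sum>b\<in>?B. of_int (k b) *\<^sub>R b)"
    unfolding u scaleR_sum_right by (intro sum.cong refl) (simp add: k)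
  moreover have "(\<Sum>b\<in>?B. of_int (k b) *\<^sub>R b) \<in> Q"
    using simple_subset_S by (intro Q_sum Q_scale_int) (auto intro: Q_coroot)
  ultimately show ?thesis by blast
qed

lemma alcove_abs_le: assumes "x \<in> alcove Sp" "\<beta> \<in> S" shows "\<bar>\<beta> \<bullet> x\<bar> \<le> pi"
  using assms(2)
proof (cases rule: S_cases)
  case 1
  then show ?thesis using assms(1) by (force simp: alcove_def)
next
  case 2
  then have "0 \<le> - \<beta> \<bullet> x" "- \<beta> \<bullet> x \<le> pi" using assms(1) by (auto simp: alcove_def)
  then show ?thesis by (auto simp: abs_if)
qed

text \<open>Among the Weyl elements taking \<open>x\<close> to \<open>y\<close> modulo \<pi>
  \<open>Q\<close>, one minimising the distance leaves a lattice vector whose pairings with positive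
  roots lie between -2 and 1. Minimality excludes -2, so \<open>Q_minuscule\<close> gives
  \<open>w x = y\<close>, and both points are dominant.\<close>

lemma alcove_unique:
  assumes x: "x \<in> alcove Sp" and y: "y \<in> alcove Sp" and u: "u \<in> W" "u x - y = pi *\<^sub>R v0" "v0 \<in> Q"
  shows "x = y"
proof -
  define B where "B = {w\<in>W. \<exists>v\<in>Q. w x - y = pi *\<^sub>R v}"
  have "finite B" "B \<noteq> {}" using finite_W u by (auto simp: B_def)
  then obtain w where w: "w \<in> B" "\<And>w'. w' \<in> B \<Longrightarrow> norm (w x - y) \<le> norm (w' x - y)"
    using arg_min_if_finite[of B "\<lambda>w. norm (w x - y)"] by (metis not_le)
  then obtain v where v: "w \<in> W" "v \<in> Q" "w x - y = pi *\<^sub>R v" by (auto simp: B_def)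
  have bd: "\<bar>\<alpha> \<bullet> v\<bar> \<le> 1" if a: "\<alpha> \<in> Sp" for \<alpha>
  proof -
    have aS: "\<alpha> \<in> S" using a Sp_S by blast
    have "\<alpha> \<bullet> v \<in> \<int>" by (rule Q_int[OF v(2) aS])
    then obtain k where k: "\<alpha> \<bullet> v = of_int k" using Ints_cases by metis
    have "inv w \<alpha> \<in> S" using weyl_S weyl_inv v(1) aS by blast
    then have wx: "\<bar>\<alpha> \<bullet> w x\<bar> \<le> pi" using alcove_abs_le[OF x] inner_weyl_right[OF v(1)] by simp
    have ya: "0 \<le> \<alpha> \<bullet> y" "\<alpha> \<bullet> y \<le> pi" using y a by (auto simp: alcove_def)
    have e: "\<alpha> \<bullet> w x - \<alpha> \<bullet> y = pi * of_int k"
      using arg_cong[OF v(3), of "\<lambda>z. \<alpha> \<bullet> z"] k by (simp add: inner_diff_right)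
    have "pi * of_int k \<le> pi * 1" "pi * (-2) \<le> pi * of_int k" using wx ya unfolding e[symmetric] by auto
    then have "of_int k \<le> (1::real)" "-2 \<le> (of_int k :: real)"
      using pi_gt_zero by (simp_all only: mult_le_cancel_left_pos)
    then have kk: "k \<le> 1" "-2 \<le> k" by linarith+
    have "k \<noteq> -2"
    proof
      \<comment> \<open>Here \<alpha> . (w x) = -\<pi>, so reflecting acts as the translation by
        \<pi> \<open>coroot \<alpha>\<close>, which would shorten the remaining lattice
        vector.\<close>
      assume k2: "k = -2"
      then have wa: "\<alpha> \<bullet> w x = - pi" using e wx ya by auto
      define w' where "w' = refl_root \<alpha> \<circ> w"
      have "w' x = w x + pi *\<^sub>R coroot \<alpha>" using wa by (simp add: w'_def refl_root_eq' inner_commute)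
      then have w'x: "w' x - y = pi *\<^sub>R (v + coroot \<alpha>)" using v(3) by (simp add: scaleR_add_right algebra_simps)
      have "w' \<in> B" using w'x v(1,2) aS Q_add[OF v(2) Q_coroot[OF aS]]
        by (auto simp: B_def w'_def intro: weyl_step)
      then have "norm (pi *\<^sub>R v) \<le> norm (pi *\<^sub>R (v + coroot \<alpha>))" using w(2) w'x v(3) by metis
      then have "norm v \<le> norm (v + coroot \<alpha>)" by simp
      then have "v \<bullet> v \<le> (v + coroot \<alpha>) \<bullet> (v + coroot \<alpha>)" by (simp add: norm_le)
      then have "0 \<le> 2 * (v \<bullet> coroot \<alpha>) + coroot \<alpha> \<bullet> coroot \<alpha>"
        by (simp add: inner_add_left inner_add_right inner_commute)
      moreover have "v \<bullet> coroot \<alpha> = - 4 / (\<alpha> \<bullet> \<alpha>)" using k k2 by (simp add: coroot_def inner_commute)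
      moreover have "coroot \<alpha> \<bullet> coroot \<alpha> = 4 / (\<alpha> \<bullet> \<alpha>)" using S_nz[OF aS] by (simp add: coroot_def)
      moreover have "4 / (\<alpha> \<bullet> \<alpha>) > 0" using S_nz[OF aS] by (intro divide_pos_pos) auto
      ultimately show False by linarith
    qed
    then have "\<bar>k\<bar> \<le> 1" using kk by linarith
    then show ?thesis unfolding k by simp
  qed
  have "v = 0"
  proof (rule Q_minuscule[OF v(2)])
    fix \<beta> assume "\<beta> \<in> S"
    then show "\<bar>\<beta> \<bullet> v\<bar> \<le> 1" by (cases rule: S_cases) (use bd[of \<beta>] bd[of "- \<beta>"] in auto)
  qed
  then have wxy: "w x = y" using v(3) by simp
  have "dominant x" "dominant y" using x y by (auto simp: dominant_def alcove_def)
  then show ?thesis using dominant_unique[OF v(1), of x] wxy by simp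
qed

lemma M_in_fsp: assumes "\<nu> \<in> Lam" shows "M \<nu> \<in> fsp Dom M"
proof -
  obtain \<mu> where "\<mu> \<in> Dom" "\<nu> \<in> orb \<mu>" using ex_dom[OF assms] by blast
  then show ?thesis using M_orb fsp_base[of \<mu> Dom M] by metis
qed

lemma fsp_M_chr: "fsp Dom M \<subseteq> fsp Lam chr"
proof (rule fsp_mono)
  fix l assume l: "l \<in> Dom"
  have "(\<lambda>x. \<Sum>\<kappa>\<in>orb l. 1 * chr \<kappa> x) \<in> fsp Lam chr"
    by (rule fspI) (use finite_orb orb_Lam dom_Lam[OF l] in auto)
  then show "M l \<in> fsp Lam chr" by (simp add: M_eq[abs_def])
qed

text \<open>Averaging over \<open>W\<close> rewrites an invariant combination of characters in orbit
  sums, so closure under products and conjugation can be checked on characters.\<close>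

lemma fsp_M_iff: "f \<in> fsp Dom M \<longleftrightarrow> f \<in> fsp Lam chr \<and> (\<forall>w\<in>W. \<forall>x. f (w x) = f x)"
proof safe
  assume f: "f \<in> fsp Dom M"
  then show "f \<in> fsp Lam chr" using fsp_M_chr by blast
  show "f (w x) = f x" if "w \<in> W" for w x using f M_weyl[OF that] by (auto simp: fsp_def)
next
  assume f: "f \<in> fsp Lam chr" and inv: "\<forall>w\<in>W. \<forall>x. f (w x) = f x"
  then obtain G c where G: "finite G" "G \<subseteq> Lam" "f = (\<lambda>x. \<Sum>\<nu>\<in>G. c \<nu> * chr \<nu> x)" by (auto simp: fsp_def)
  have "f x = (\<Sum>\<nu>\<in>G. (c \<nu> / of_nat (card (orb \<nu>))) * M \<nu> x)" for x
  proof -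
    have "f x = (\<Sum>w\<in>W. f (w x)) / of_nat (card W)" using inv card_W_nonzero by simp
    also have "\<dots> = (\<Sum>\<nu>\<in>G. c \<nu> * ((\<Sum>w\<in>W. chr \<nu> (w x)) / of_nat (card W)))"
      unfolding G(3) by (subst sum.swap) (simp add: sum_divide_distrib sum_distrib_left)
    finally show ?thesis unfolding average_chr by simp
  qed
  then have "f = (\<lambda>x. \<Sum>\<nu>\<in>G. (c \<nu> / of_nat (card (orb \<nu>))) * M \<nu> x)" by auto
  also have "\<dots> \<in> fsp Dom M" by (rule fsp_sum) (use G M_in_fsp in auto)
  finally show "f \<in> fsp Dom M" .
qed

lemma fsp_chr_cnj: assumes "f \<in> fsp Lam chr" shows "(\<lambda>x. cnj (f x)) \<in> fsp Lam chr"
proof -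
  obtain G c where G: "finite G" "G \<subseteq> Lam" "f = (\<lambda>x. \<Sum>\<nu>\<in>G. c \<nu> * chr \<nu> x)" using assms by (auto simp: fsp_def)
  have "(\<lambda>x. \<Sum>\<nu>\<in>G. cnj (c \<nu>) * chr (- \<nu>) x) \<in> fsp Lam chr"
    by (rule fsp_sum) (use G Lam_uminus fsp_base in auto)
  then show ?thesis unfolding G(3) by (simp add: cnj_chr)
qed

lemma fsp_chr_mult: assumes "f \<in> fsp Lam chr" "g \<in> fsp Lam chr" shows "(\<lambda>x. f x * g x) \<in> fsp Lam chr"
proof -
  obtain G c where G: "finite G" "G \<subseteq> Lam" "f = (\<lambda>x. \<Sum>\<nu>\<in>G. c \<nu> * chr \<nu> x)" using assms by (auto simp: fsp_def)
  obtain J d where J: "finite J" "J \<subseteq> Lam" "g = (\<lambda>x. \<Sum>\<nu>\<in>J. d \<nu> * chr \<nu> x)" using assms by (auto simp: fsp_def)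
  have "(\<lambda>x. \<Sum>\<kappa>\<in>J. d \<kappa> * chr (\<nu> + \<kappa>) x) \<in> fsp Lam chr" if "\<nu> \<in> G" for \<nu>
  proof (rule fsp_sum[OF J(1)])
    fix \<kappa> assume "\<kappa> \<in> J"
    then have "\<nu> + \<kappa> \<in> Lam" using that G J Lam_add by blast
    then show "chr (\<nu> + \<kappa>) \<in> fsp Lam chr" by (rule fsp_base)
  qed
  then have "(\<lambda>x. \<Sum>\<nu>\<in>G. c \<nu> * (\<Sum>\<kappa>\<in>J. d \<kappa> * chr (\<nu> + \<kappa>) x)) \<in> fsp Lam chr"
    by (rule fsp_sum[OF G(1)])
  moreover have "(\<lambda>x. f x * g x) = (\<lambda>x. \<Sum>\<nu>\<in>G. c \<nu> * (\<Sum>\<kappa>\<in>J. d \<kappa> * chr (\<nu> + \<kappa>) x))"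
    unfolding G(3) J(3) sum_product by (simp add: fun_eq_iff sum_distrib_left chr_add mult_ac)
  ultimately show ?thesis by simp
qed

text \<open>If all orbit sums agree at both points, the characters of \<open>Lam\<close> given by
  the two Weyl orbits, counted with multiplicity, satisfy a linear relation, which independence
  makes trivial. So some \<open>w x\<close> and \<open>y\<close> define the same character, hence
  differ by \<pi> \<open>Q\<close>, and \<open>alcove_unique\<close> applies.\<close>

lemma fsp_M_separates:
  assumes x: "x \<in> alcove Sp" and y: "y \<in> alcove Sp" and eq: "\<And>f. f \<in> fsp Dom M \<Longrightarrow> f x = f y"
  shows "x = y"
proof -
  \<comment> \<open>Restriction to \<open>Lam\<close> turns agreement on all weights into equality
    of functions.\<close>
  define r where "r z = restrict (\<lambda>\<nu>. chr \<nu> z) Lam" for z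
  define C where "C = (\<lambda>w. r (w x)) ` W \<union> (\<lambda>w. r (w y)) ` W"
  have finC: "finite C" using finite_W by (simp add: C_def)
  define a where "a \<phi> = (of_nat (card {w\<in>W. r (w x) = \<phi>}) :: complex) - of_nat (card {w\<in>W. r (w y) = \<phi>})" for \<phi>
  have grp: "(\<Sum>\<phi>\<in>C. of_nat (card {w\<in>W. r (w z) = \<phi>}) * \<phi> \<nu>) = (\<Sum>w\<in>W. chr \<nu> (w z))"
    if "(\<lambda>w. r (w z)) ` W \<subseteq> C" "\<nu> \<in> Lam" for z \<nu>
  proof -
    have "(\<Sum>w\<in>W. chr \<nu> (w z)) = (\<Sum>w\<in>W. r (w z) \<nu>)" using that(2) by (simp add: r_def)
    also have "\<dots> = (\<Sum>\<phi>\<in>C. \<Sum>w\<in>{w\<in>W. r (w z) = \<phi>}. r (w z) \<nu>)"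
      by (rule sum.group[symmetric]) (use finite_W finC that in auto)
    also have "\<dots> = (\<Sum>\<phi>\<in>C. \<Sum>w\<in>{w\<in>W. r (w z) = \<phi>}. \<phi> \<nu>)" by (intro sum.cong) auto
    finally show ?thesis by simp
  qed
  have "\<forall>\<phi>\<in>C. a \<phi> = 0"
  proof (rule characters_independent[where L = Lam])
    show "\<phi> 0 = 1" if "\<phi> \<in> C" for \<phi> using that Lam_0 by (auto simp: C_def r_def)
    show "\<phi> (g + h) = \<phi> g * \<phi> h" if "\<phi> \<in> C" "g \<in> Lam" "h \<in> Lam" for \<phi> g h
      using that Lam_add by (auto simp: C_def r_def chr_add)
    show "\<exists>g\<in>Lam. \<phi> g \<noteq> \<phi>' g" if c: "\<phi> \<in> C" "\<phi>' \<in> C" "\<phi> \<noteq> \<phi>'" for \<phi> \<phi>'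
    proof (rule ccontr)
      assume "\<not> ?thesis"
      moreover have "\<phi> \<in> extensional Lam" "\<phi>' \<in> extensional Lam" using c by (auto simp: C_def r_def)
      ultimately show False using c(3) by (metis extensionalityI)
    qed
    fix \<nu> assume n: "\<nu> \<in> Lam"
    have "(\<Sum>w\<in>W. chr \<nu> (w x)) / of_nat (card W) = (\<Sum>w\<in>W. chr \<nu> (w y)) / of_nat (card W)"
      unfolding average_chr using eq[OF M_in_fsp[OF n]] by simp
    then have "(\<Sum>w\<in>W. chr \<nu> (w x)) = (\<Sum>w\<in>W. chr \<nu> (w y))" using card_W_nonzero by simp
    moreover have "(\<lambda>w. r (w x)) ` W \<subseteq> C" "(\<lambda>w. r (w y)) ` W \<subseteq> C" by (auto simp: C_def)
    ultimately show "(\<Sum>\<phi>\<in>C. a \<phi> * \<phi> \<nu>) = 0"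
      using grp[of x \<nu>] grp[of y \<nu>] n by (simp add: a_def left_diff_distrib sum_subtractf)
  qed (use finC Lam_0 Lam_add in auto)
  moreover have "r y \<in> C" using weyl_id[of S] by (force simp: C_def image_iff)
  ultimately have "card {w\<in>W. r (w x) = r y} = card {w\<in>W. r (w y) = r y}" by (auto simp: a_def)
  moreover have "id \<in> {w\<in>W. r (w y) = r y}" using weyl_id by auto
  then have "card {w\<in>W. r (w y) = r y} \<noteq> 0" using finite_W by auto
  ultimately have "{w\<in>W. r (w x) = r y} \<noteq> {}" using card.empty by metis
  then obtain w where w: "w \<in> W" "r (w x) = r y" by blast
  have "\<exists>k::int. \<nu> \<bullet> (w x - y) = 2 * pi * of_int k" if "\<nu> \<in> Lam" for \<nu>
  proof -
    have "chr \<nu> (w x) = chr \<nu> y" using fun_cong[OF w(2), of \<nu>] that by (simp add: r_def)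
    then have "cis (\<nu> \<bullet> w x - \<nu> \<bullet> y) = 1" by (simp add: chr_def cis_divide[symmetric])
    then have "cos (\<nu> \<bullet> w x - \<nu> \<bullet> y) = 1" by (simp add: complex_eq_iff)
    then show ?thesis by (auto simp: cos_one_2pi_int inner_diff_right mult_ac)
  qed
  then obtain v where "v \<in> Q" "w x - y = pi *\<^sub>R v" using Q_dual by blast
  then show ?thesis using alcove_unique[OF x y w(1)] by blast
qed

lemma continuous_fsp_M: "f \<in> fsp Dom M \<Longrightarrow> continuous_on A f"
  by (auto simp: fsp_def intro!: continuous_intros continuous_M)

text \<open>The span is closed under conjugation, so real and imaginary parts of its members stay in
  it, and Stone-Weierstrass is applied to the two parts of \<open>f\<close> separately.\<close>

lemma fsp_M_dense:
  assumes f: "continuous_on (alcove Sp) f" and e: "e > 0"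
  shows "\<exists>p\<in>fsp Dom M. \<forall>x\<in>alcove Sp. norm (p x - f x) \<le> e"
proof -
  define RR where "RR = {h. (\<lambda>x. complex_of_real (h x)) \<in> fsp Dom M}"
  have Re_RR: "(\<lambda>x. Re (g x)) \<in> RR" "(\<lambda>x. Im (g x)) \<in> RR" if g: "g \<in> fsp Dom M" for g
  proof -
    have gc: "(\<lambda>x. cnj (g x)) \<in> fsp Dom M" using g fsp_chr_cnj by (auto simp: fsp_M_iff)
    have "(\<lambda>x. (1/2) * (g x + cnj (g x))) \<in> fsp Dom M" by (intro fsp_scale fsp_add g gc)
    moreover have "complex_of_real (Re (g x)) = (1/2) * (g x + cnj (g x))" for x by (simp add: complex_add_cnj)
    ultimately show "(\<lambda>x. Re (g x)) \<in> RR" unfolding RR_def by (simp only: mem_Collect_eq)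
    have "(\<lambda>x. (- \<i> / 2) * (g x + (-1) * cnj (g x))) \<in> fsp Dom M" by (intro fsp_scale fsp_add g gc)
    moreover have "complex_of_real (Im (g x)) = (- \<i> / 2) * (g x + (-1) * cnj (g x))" for x
      by (simp add: complex_eq_iff)
    ultimately show "(\<lambda>x. Im (g x)) \<in> RR" unfolding RR_def by (simp only: mem_Collect_eq)
  qed
  have one: "(\<lambda>x. 1) \<in> fsp Dom M"
  proof -
    have "orb 0 = {0}" using W_nonempty weyl_linear by (auto simp: orb_def linear_0)
    then have "M 0 = (\<lambda>x. 1)" by (simp add: M_eq fun_eq_iff)
    then show ?thesis using M_in_fsp[OF Lam_0] by simp
  qed
  interpret function_ring_on RR "alcove Sp"
  proof
    show "compact (alcove Sp)" by (rule compact_alcove)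
    show "continuous_on (alcove Sp) h" if "h \<in> RR" for h
    proof -
      have "continuous_on (alcove Sp) (\<lambda>x. Re (complex_of_real (h x)))"
        using that by (intro continuous_intros continuous_fsp_M) (simp add: RR_def)
      then show ?thesis by simp
    qed
    show "(\<lambda>x. h x + k x) \<in> RR" if "h \<in> RR" "k \<in> RR" for h k
      using fsp_add[of "\<lambda>x. of_real (h x)" Dom M "\<lambda>x. of_real (k x)"] that by (simp add: RR_def)
    show "(\<lambda>x. h x * k x) \<in> RR" if "h \<in> RR" "k \<in> RR" for h k
      using fsp_chr_mult[of "\<lambda>x. of_real (h x)" "\<lambda>x. of_real (k x)"] that by (simp add: RR_def fsp_M_iff)
    show "(\<lambda>_. c) \<in> RR" for c using fsp_scale[OF one, of "of_real c"] by (simp add: RR_def)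
    show "\<exists>f\<in>RR. f x \<noteq> f y" if xy: "x \<in> alcove Sp" "y \<in> alcove Sp" "x \<noteq> y" for x y
    proof -
      obtain g where g: "g \<in> fsp Dom M" "g x \<noteq> g y" using fsp_M_separates xy by blast
      then have "Re (g x) \<noteq> Re (g y) \<or> Im (g x) \<noteq> Im (g y)" by (auto simp: complex_eq_iff)
      then show ?thesis
        using bexI[OF _ Re_RR(1)[OF g(1)], of "\<lambda>f. f x \<noteq> f y"] bexI[OF _ Re_RR(2)[OF g(1)], of "\<lambda>f. f x \<noteq> f y"] by auto
    qed
  qed
  have "continuous_on (alcove Sp) (\<lambda>x. Re (f x))" by (intro continuous_intros f)
  from Stone_Weierstrass_basic[OF this half_gt_zero[OF e]]
  obtain h where h: "h \<in> RR" "\<forall>x\<in>alcove Sp. \<bar>Re (f x) - h x\<bar> < e / 2" by blast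
  have "continuous_on (alcove Sp) (\<lambda>x. Im (f x))" by (intro continuous_intros f)
  from Stone_Weierstrass_basic[OF this half_gt_zero[OF e]]
  obtain k where k: "k \<in> RR" "\<forall>x\<in>alcove Sp. \<bar>Im (f x) - k x\<bar> < e / 2" by blast
  let ?p = "\<lambda>x. complex_of_real (h x) + \<i> * complex_of_real (k x)"
  have "?p \<in> fsp Dom M" using h k by (intro fsp_add fsp_scale) (auto simp: RR_def)
  moreover have "norm (?p x - f x) \<le> e" if "x \<in> alcove Sp" for x
  proof -
    have "norm (?p x - f x) \<le> \<bar>Re (?p x - f x)\<bar> + \<bar>Im (?p x - f x)\<bar>" by (rule cmod_le)
    also have "\<dots> \<le> e / 2 + e / 2" using bspec[OF h(2) that] bspec[OF k(2) that] by (simp add: abs_minus_commute)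
    finally show ?thesis by simp
  qed
  ultimately show ?thesis by (intro bexI[of _ ?p] ballI)
qed

end

section \<open>The Feller semigroup and its generator\<close>

lemma supn_le: "A \<noteq> {} \<Longrightarrow> (\<And>x. x \<in> A \<Longrightarrow> norm (g x) \<le> B) \<Longrightarrow> supn A g \<le> B"
  unfolding supn_def by (rule cSUP_least)

lemma norm_le_supn:
  assumes "compact A" "continuous_on A g" "x \<in> A"
  shows "norm (g x) \<le> supn A g"
  unfolding supn_def
proof (rule cSUP_upper[OF assms(3)])
  have "compact ((\<lambda>x. norm (g x)) ` A)" by (intro compact_continuous_image continuous_intros assms)
  then show "bdd_above ((\<lambda>x. norm (g x)) ` A)" by (intro bounded_imp_bdd_above compact_imp_bounded)
qed

text \<open>Continuity on the compact set bounds the supremum; on an unbounded set of reals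
  \<open>SUP\<close> would carry no information.\<close>

lemma supn_tendsto_0_iff:
  assumes A: "compact A" "A \<noteq> {}" and g: "\<forall>\<^sub>F i in F. continuous_on A (g i)"
  shows "((\<lambda>i. supn A (g i)) \<longlongrightarrow> 0) F \<longleftrightarrow> (\<forall>e>0. \<forall>\<^sub>F i in F. \<forall>x\<in>A. norm (g i x) \<le> e)"
proof safe
  fix e :: real assume "((\<lambda>i. supn A (g i)) \<longlongrightarrow> 0) F" "e > 0"
  then have "\<forall>\<^sub>F i in F. dist (supn A (g i)) 0 < e" by (rule tendstoD)
  with g show "\<forall>\<^sub>F i in F. \<forall>x\<in>A. norm (g i x) \<le> e"
  proof eventually_elim
    case (elim i)
    show ?case
    proof
      fix x assume "x \<in> A"
      then have "norm (g i x) \<le> supn A (g i)" using norm_le_supn A(1) elim(1) by blast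
      then show "norm (g i x) \<le> e" using elim(2) by simp
    qed
  qed
next
  assume *: "\<forall>e>0. \<forall>\<^sub>F i in F. \<forall>x\<in>A. norm (g i x) \<le> e"
  show "((\<lambda>i. supn A (g i)) \<longlongrightarrow> 0) F"
  proof (rule tendstoI)
    fix e :: real assume e: "e > 0"
    have "\<forall>\<^sub>F i in F. \<forall>x\<in>A. norm (g i x) \<le> e / 2" using * half_gt_zero[OF e] by blast
    with g show "\<forall>\<^sub>F i in F. dist (supn A (g i)) 0 < e"
    proof eventually_elim
      case (elim i)
      have "supn A (g i) \<le> e / 2" by (rule supn_le[OF A(2)]) (use elim in auto)
      moreover obtain x where "x \<in> A" using A(2) by blast
      then have "norm (g i x) \<le> supn A (g i)" using norm_le_supn A(1) elim(1) by blast
      then have "0 \<le> supn A (g i)" using norm_ge_zero order_trans by blast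
      ultimately show ?case using e by simp
    qed
  qed
qed

lemma continuous_on_uniform_approx:
  fixes f :: "'b::topological_space \<Rightarrow> 'c::metric_space"
  assumes "\<And>e. e > 0 \<Longrightarrow> \<exists>g. continuous_on A g \<and> (\<forall>x\<in>A. dist (g x) (f x) \<le> e)"
  shows "continuous_on A f"
proof -
  have "\<exists>g. continuous_on A g \<and> (\<forall>x\<in>A. dist (g x) (f x) \<le> 1 / real (Suc n))" for n by (rule assms) simp
  then obtain g where g: "\<And>n. continuous_on A (g n)" "\<And>n x. x \<in> A \<Longrightarrow> dist (g n x) (f x) \<le> 1 / real (Suc n)" by metis
  have "uniform_limit A g f sequentially"
  proof (rule uniform_limitI)
    fix e :: real assume e: "e > 0"
    have "\<forall>\<^sub>F n in sequentially. 1 / real (Suc n) < e"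
      using tendstoD[OF LIMSEQ_inverse_real_of_nat e] by (simp add: inverse_eq_divide)
    then show "\<forall>\<^sub>F n in sequentially. \<forall>x\<in>A. dist (g n x) (f x) < e"
      by eventually_elim (use g(2) le_less_trans in blast)
  qed
  then show ?thesis by (rule uniform_limit_theorem[rotated]) (simp_all add: g)
qed

context root_data
begin

abbreviation L :: "('a \<Rightarrow> complex) \<Rightarrow> 'a \<Rightarrow> complex" where "L \<equiv> HO_laplacian_A0 Sp m"

lemma trig_W_PP: "trig_W S Sp = fsp Dom PP" by (simp add: trig_W_fsp fsp_PP)

lemma trig_W_cases:
  assumes "p \<in> trig_W S Sp"
  obtains F c where "finite F" "F \<subseteq> Dom" "p = (\<lambda>x. \<Sum>l\<in>F. c l * PP l x)"
  using assms by (auto simp: trig_W_PP fsp_def)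

lemma trig_W_dense:
  assumes "continuous_on (alcove Sp) f" "e > 0"
  obtains p where "p \<in> trig_W S Sp" "\<And>x. x \<in> alcove Sp \<Longrightarrow> norm (p x - f x) \<le> e"
  using fsp_M_dense[OF assms] by (auto simp: trig_W_fsp)

lemma continuous_trig_W: "p \<in> trig_W S Sp \<Longrightarrow> continuous_on A p"
  by (auto simp: trig_W_fsp intro: continuous_fsp_M)

lemma H_trig_W: assumes "p \<in> trig_W S Sp" "t \<ge> 0" shows "H t p \<in> trig_W S Sp"
  using assms(1)
proof (cases rule: trig_W_cases)
  case (1 F c)
  have "H t p = (\<lambda>x. \<Sum>l\<in>F. (c l * of_real (exp (- theta l * t))) * PP l x)"
    unfolding 1(3) by (rule ext) (rule H_sum[OF 1(1,2) assms(2)])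
  then show ?thesis using fspI[OF 1(1,2)] by (simp add: trig_W_PP)
qed

text \<open>A polynomial within \<open>d\<close> of \<open>f\<close> loses \<open>d\<close> in the
  bound, and returning to \<open>f\<close> by \<open>H_bound\<close> loses \<open>C * d\<close>;
  \<open>d\<close> is chosen so that both add up to \<open>e\<close>.\<close>

lemma H_Re_le:
  assumes t: "t \<ge> 0" and f: "continuous_on (alcove Sp) f" and B: "\<And>x. x \<in> alcove Sp \<Longrightarrow> Re (f x) \<le> B"
    and x: "x \<in> alcove Sp"
  shows "Re (H t f x) \<le> B"
proof (rule field_le_epsilon)
  fix e :: real assume e: "e > 0"
  obtain C where C: "C \<ge> 0" "\<And>(f :: 'a \<Rightarrow> complex) (g :: 'a \<Rightarrow> complex) \<delta> x. continuous_on (alcove Sp) f \<Longrightarrow> continuous_on (alcove Sp) g \<Longrightarrow>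
    (\<And>y. y \<in> alcove Sp \<Longrightarrow> norm (f y - g y) \<le> \<delta>) \<Longrightarrow> x \<in> alcove Sp \<Longrightarrow> norm (H t f x - H t g x) \<le> C * \<delta>"
    using H_bound[OF t] by blast
  define d where "d = e / (C + 1)"
  have d: "d > 0" "d + C * d = e" using e C(1) by (auto simp: d_def divide_simps add_pos_nonneg) (simp add: algebra_simps)
  obtain p where p: "p \<in> trig_W S Sp" "\<And>x. x \<in> alcove Sp \<Longrightarrow> norm (p x - f x) \<le> d"
    using trig_W_dense[OF f d(1)] by blast
  from p(1) obtain F c where F: "finite F" "F \<subseteq> Dom" "p = (\<lambda>x. \<Sum>l\<in>F. c l * PP l x)" by (rule trig_W_cases)
  have "Re (p y) \<le> B + d" if "y \<in> alcove Sp" for y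
    using B[OF that] p(2)[OF that] abs_Re_le_cmod[of "p y - f y"] by simp
  then have "Re (H t p x) \<le> B + d"
    using semigroup_bound[OF F(1,2) t _ x, of c "B + d"] H_sum[OF F(1,2) t, of c x] F(3) by simp
  moreover have "norm (H t p x - H t f x) \<le> C * d"
    by (rule C(2)) (use p f x continuous_trig_W in auto)
  then have "Re (H t f x) \<le> Re (H t p x) + C * d"
    using abs_Re_le_cmod[of "H t p x - H t f x"] by simp
  ultimately show "Re (H t f x) \<le> B + e" using d(2) by linarith
qed

lemma H_scale:
  assumes "t \<ge> 0" "continuous_on (alcove Sp) f"
  shows "H t (\<lambda>y. a * f y) x = a * H t f x"
  using H_linear[OF assms assms(2), of a 0] by simp

lemma H_diff:
  assumes "t \<ge> 0" "continuous_on (alcove Sp) f" "continuous_on (alcove Sp) g"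
  shows "H t (\<lambda>y. f y - g y) x = H t f x - H t g x"
  using H_linear[OF assms, of 1 "-1"] by simp

text \<open>Rotating \<open>f\<close> by the conjugate phase of \<open>H t f x\<close> turns the
  modulus into a real part.\<close>

lemma H_norm_le:
  assumes t: "t \<ge> 0" and f: "continuous_on (alcove Sp) f" and B: "\<And>x. x \<in> alcove Sp \<Longrightarrow> norm (f x) \<le> B"
    and x: "x \<in> alcove Sp"
  shows "norm (H t f x) \<le> B"
proof (cases "H t f x = 0")
  case True
  then show ?thesis using order_trans[OF norm_ge_zero B[OF x]] by simp
next
  case False
  define u where "u = cnj (sgn (H t f x))"
  have nu: "norm u = 1" using False by (simp add: u_def norm_sgn)
  have "u * H t f x = of_real (norm (H t f x))"
    using False by (simp add: u_def sgn_eq complex_norm_square[symmetric] mult.commute power2_eq_square)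
  then have "H t (\<lambda>y. u * f y) x = of_real (norm (H t f x))" by (simp add: H_scale[OF t f])
  moreover have "Re (H t (\<lambda>y. u * f y) x) \<le> B"
  proof (rule H_Re_le[OF t _ _ x])
    show "continuous_on (alcove Sp) (\<lambda>y. u * f y)" by (intro continuous_intros f)
    show "Re (u * f y) \<le> B" if "y \<in> alcove Sp" for y
      using complex_Re_le_cmod[of "u * f y"] B[OF that] nu by (simp add: norm_mult)
  qed
  ultimately show ?thesis by simp
qed

lemma H_dist_le:
  assumes t: "t \<ge> 0" and f: "continuous_on (alcove Sp) f" "continuous_on (alcove Sp) g"
    and B: "\<And>x. x \<in> alcove Sp \<Longrightarrow> norm (f x - g x) \<le> B" and x: "x \<in> alcove Sp"
  shows "norm (H t f x - H t g x) \<le> B"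
  using H_norm_le[OF t continuous_on_diff[OF f] B x] by (simp add: H_diff[OF t f])

lemma continuous_H:
  assumes t: "t \<ge> 0" and f: "continuous_on (alcove Sp) f"
  shows "continuous_on (alcove Sp) (H t f)"
proof (rule continuous_on_uniform_approx)
  fix e :: real assume "e > 0"
  then obtain p where p: "p \<in> trig_W S Sp" "\<And>x. x \<in> alcove Sp \<Longrightarrow> norm (p x - f x) \<le> e"
    using trig_W_dense[OF f] by blast
  have "norm (H t p x - H t f x) \<le> e" if "x \<in> alcove Sp" for x
    by (rule H_dist_le[OF t continuous_trig_W[OF p(1)] f p(2) that])
  then show "\<exists>g. continuous_on (alcove Sp) g \<and> (\<forall>x\<in>alcove Sp. dist (g x) (H t f x) \<le> e)"
    using continuous_trig_W[OF H_trig_W[OF p(1) t]] by (auto simp: dist_norm)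
qed

lemma H_semigroup:
  assumes s: "s \<ge> 0" and t: "t \<ge> 0" and f: "continuous_on (alcove Sp) f" and x: "x \<in> alcove Sp"
  shows "H (s + t) f x = H s (H t f) x"
proof -
  have "norm (H (s + t) f x - H s (H t f) x) \<le> 0"
  proof (rule field_le_epsilon)
    fix e :: real assume "e > 0"
    then obtain p where p: "p \<in> trig_W S Sp" "\<And>x. x \<in> alcove Sp \<Longrightarrow> norm (p x - f x) \<le> e / 2"
      using trig_W_dense[OF f, of "e / 2"] by auto
    from p(1) obtain F c where F: "finite F" "F \<subseteq> Dom" "p = (\<lambda>x. \<Sum>l\<in>F. c l * PP l x)" by (rule trig_W_cases)
    have "H t p = (\<lambda>x. \<Sum>l\<in>F. (c l * of_real (exp (- theta l * t))) * PP l x)"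
      unfolding F(3) by (rule ext) (rule H_sum[OF F(1,2) t])
    then have "H s (H t p) x = (\<Sum>l\<in>F. (c l * of_real (exp (- theta l * t))) * of_real (exp (- theta l * s)) * PP l x)"
      by (simp only: H_sum[OF F(1,2) s])
    also have "\<dots> = H (s + t) p x"
      unfolding F(3) using s t by (subst H_sum[OF F(1,2)])
        (auto simp: exp_add[symmetric] of_real_mult[symmetric] algebra_simps simp del: of_real_mult intro!: sum.cong)
    finally have eq: "H s (H t p) x = H (s + t) p x" .
    have cp: "continuous_on (alcove Sp) p" by (rule continuous_trig_W[OF p(1)])
    have "norm (H (s + t) p x - H (s + t) f x) \<le> e / 2"
      by (rule H_dist_le[OF _ cp f p(2) x]) (use s t in auto)
    moreover have "norm (H s (H t p) x - H s (H t f) x) \<le> e / 2"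
      by (rule H_dist_le[OF s continuous_H[OF t cp] continuous_H[OF t f] H_dist_le[OF t cp f p(2)] x])
    ultimately show "norm (H (s + t) f x - H s (H t f) x) \<le> 0 + e"
      unfolding eq using norm_triangle_ineq4[of "H (s + t) p x - H s (H t f) x" "H (s + t) p x - H (s + t) f x"] by simp
  qed
  then show ?thesis by simp
qed

text \<open>\<open>H_Re_le\<close> with bound 0, applied to \<open>f\<close> multiplied by
  \<open>\<i>\<close>, \<open>- \<i>\<close> and \<open>-1\<close>.\<close>

lemma H_real_nonneg:
  assumes t: "t \<ge> 0" and f: "continuous_on (alcove Sp) f"
    and B: "\<And>x. x \<in> alcove Sp \<Longrightarrow> f x \<in> \<real> \<and> 0 \<le> Re (f x)" and x: "x \<in> alcove Sp"
  shows "H t f x \<in> \<real> \<and> 0 \<le> Re (H t f x)"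
proof -
  have z: "Re (a * H t f x) \<le> 0" if "\<And>y. y \<in> alcove Sp \<Longrightarrow> Re (a * f y) \<le> 0" for a
    using H_Re_le[OF t continuous_on_mult_left[OF f, of a] that x] unfolding H_scale[OF t f] by simp
  have Im: "Im (f y) = 0" if "y \<in> alcove Sp" for y using B[OF that] by (simp add: complex_is_Real_iff)
  have "Re (\<i> * H t f x) \<le> 0" "Re (- \<i> * H t f x) \<le> 0" "Re (-1 * H t f x) \<le> 0"
    using z[of \<i>] z[of "- \<i>"] z[of "-1"] Im B by auto
  then show ?thesis by (simp add: complex_is_Real_iff)
qed

text \<open>On the alcove \<open>L p\<close> agrees with an honest polynomial \<open>q\<close>, and
  it is \<open>q\<close> that is differentiated along the semigroup; the limit defining
  \<open>L\<close> is controlled there only.\<close>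

lemma L_trig_W:
  assumes "p \<in> trig_W S Sp"
  obtains q where "q \<in> trig_W S Sp" "\<And>x. x \<in> alcove Sp \<Longrightarrow> L p x = q x"
    "\<And>x s. s \<ge> 0 \<Longrightarrow> ((\<lambda>t. H t p x) has_vector_derivative H s q x) (at s within {0..})"
proof -
  from assms obtain F c where F: "finite F" "F \<subseteq> Dom" "p = (\<lambda>x. \<Sum>l\<in>F. c l * PP l x)" by (rule trig_W_cases)
  define q where "q = (\<lambda>x. \<Sum>l\<in>F. (- (of_real (theta l) * c l)) * PP l x)"
  show ?thesis
  proof (rule that)
    show "q \<in> trig_W S Sp" unfolding q_def trig_W_PP by (rule fspI[OF F(1,2)])
    show "L p x = q x" if "x \<in> alcove Sp" for x
      unfolding F(3) HO_laplacian_A0_PP[OF F(1,2) that] by (simp add: q_def mult.assoc)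
    show "((\<lambda>t. H t p x) has_vector_derivative H s q x) (at s within {0..})" if s: "s \<ge> 0" for x s
    proof -
      have "((\<lambda>t. \<Sum>l\<in>F. c l * of_real (exp (- theta l * t)) * PP l x) has_vector_derivative
         (\<Sum>l\<in>F. c l * of_real (exp (- theta l * s) * (- theta l)) * PP l x)) (at s within {0..})"
        by (rule has_vector_derivative_sum) (auto intro!: derivative_eq_intros has_vector_derivative_mult_left has_vector_derivative_mult_right has_vector_derivative_of_real simp: has_real_derivative_iff_has_vector_derivative[symmetric])
      moreover have "(\<Sum>l\<in>F. c l * of_real (exp (- theta l * s) * (- theta l)) * PP l x) = H s q x"
        unfolding q_def H_sum[OF F(1,2) s] by (intro sum.cong refl) simp
      ultimately have "((\<lambda>t. \<Sum>l\<in>F. c l * of_real (exp (- theta l * t)) * PP l x) has_vector_derivative H s q x) (at s within {0..})"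
        by simp
      then show ?thesis
        by (rule has_vector_derivative_transform[rotated 2]) (use s in \<open>simp_all add: F(3) H_sum[OF F(1,2)]\<close>)
    qed
  qed
qed

lemma continuous_L: assumes "p \<in> trig_W S Sp" shows "continuous_on (alcove Sp) (L p)"
proof -
  obtain q where "q \<in> trig_W S Sp" "\<And>x. x \<in> alcove Sp \<Longrightarrow> L p x = q x" using L_trig_W[OF assms] by metis
  then show ?thesis using continuous_trig_W continuous_on_cong by metis
qed

lemma H_cong:
  assumes "t \<ge> 0" "continuous_on (alcove Sp) f" "continuous_on (alcove Sp) g"
    and "\<And>x. x \<in> alcove Sp \<Longrightarrow> f x = g x" and "x \<in> alcove Sp"
  shows "H t f x = H t g x"
  using H_dist_le[OF assms(1-3) _ assms(5), of 0] assms(4) by simp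

text \<open>A mean value estimate for \<open>s \<mapsto> H s p x - s v\<close>, whose derivative is \<open>H s (L p) x - v\<close>.\<close>

lemma H_increment_trig_W:
  assumes p: "p \<in> trig_W S Sp" and t: "t \<ge> 0" and x: "x \<in> alcove Sp"
    and B: "\<And>s. 0 \<le> s \<Longrightarrow> s \<le> t \<Longrightarrow> norm (H s (L p) x - v) \<le> B"
  shows "norm (H t p x - p x - of_real t * v) \<le> B * t"
proof -
  obtain q where q: "q \<in> trig_W S Sp" "\<And>x. x \<in> alcove Sp \<Longrightarrow> L p x = q x"
    "\<And>x s. s \<ge> 0 \<Longrightarrow> ((\<lambda>t. H t p x) has_vector_derivative H s q x) (at s within {0..})"
    using L_trig_W[OF p] by metis
  have Hq: "H s (L p) x = H s q x" if "s \<ge> 0" for s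
    by (rule H_cong[OF that continuous_L[OF p] continuous_trig_W[OF q(1)] q(2) x])
  let ?\<phi> = "\<lambda>s. H s p x - of_real s * v"
  have "norm (?\<phi> t - ?\<phi> 0) \<le> B * norm (t - 0)"
  proof (rule differentiable_bound)
    fix s assume s: "s \<in> {0..t}"
    have "((\<lambda>t. H t p x) has_vector_derivative H s q x) (at s within {0..t})"
      by (rule has_vector_derivative_within_subset[OF q(3)]) (use s in auto)
    moreover have "((\<lambda>s. of_real s * v) has_vector_derivative (of_real 1 * v)) (at s within {0..t})"
      by (intro has_vector_derivative_mult_left has_vector_derivative_of_real DERIV_ident)
    ultimately have "(?\<phi> has_vector_derivative (H s q x - v)) (at s within {0..t})"
      by (auto intro: has_vector_derivative_diff)
    then show "(?\<phi> has_derivative (\<lambda>h. h *\<^sub>R (H s q x - v))) (at s within {0..t})"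
      by (simp add: has_vector_derivative_def)
    have "norm (H s q x - v) \<le> B" using B[of s] Hq[of s] s by simp
    then show "onorm (\<lambda>h. h *\<^sub>R (H s q x - v)) \<le> B"
      by (intro onorm_le) (simp add: mult.commute[of B] mult_left_mono)
  qed (use t in auto)
  then show ?thesis using t by (simp add: H_0 algebra_simps)
qed

lemma alcove_bounded:
  assumes "continuous_on (alcove Sp) (f :: 'a \<Rightarrow> complex)"
  obtains B where "B > 0" "\<And>x. x \<in> alcove Sp \<Longrightarrow> norm (f x) \<le> B"
proof -
  obtain B where "\<forall>x\<in>f ` alcove Sp. norm x \<le> B"
    using compact_imp_bounded[OF compact_continuous_image[OF assms compact_alcove]] unfolding bounded_iff by blast
  then show ?thesis using that[of "max B 1"] by (auto simp: le_max_iff_disj)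
qed

text \<open>For a polynomial the increment is at most \<open>t\<close> times the supremum of its
  Laplacian; density and contractivity pay for the rest.\<close>

lemma H_strongly_continuous:
  assumes f: "continuous_on (alcove Sp) f" and e: "e > 0"
  obtains d where "d > 0" "\<And>t x. 0 \<le> t \<Longrightarrow> t \<le> d \<Longrightarrow> x \<in> alcove Sp \<Longrightarrow> norm (H t f x - f x) \<le> e"
proof -
  obtain p where p: "p \<in> trig_W S Sp" "\<And>x. x \<in> alcove Sp \<Longrightarrow> norm (p x - f x) \<le> e / 3"
    using trig_W_dense[OF f, of "e / 3"] e by auto
  have cp: "continuous_on (alcove Sp) p" by (rule continuous_trig_W[OF p(1)])
  obtain B where B: "B > 0" "\<And>x. x \<in> alcove Sp \<Longrightarrow> norm (L p x) \<le> B"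
    using alcove_bounded[OF continuous_L[OF p(1)]] by blast
  show ?thesis
  proof (rule that[of "e / (3 * B)"])
    show "e / (3 * B) > 0" using e B by simp
    fix t x assume t: "0 \<le> t" "t \<le> e / (3 * B)" and x: "x \<in> alcove Sp"
    have "norm (H t p x - p x - of_real t * 0) \<le> B * t"
      by (rule H_increment_trig_W[OF p(1) t(1) x]) (use H_norm_le[OF _ continuous_L[OF p(1)] B(2) x] in simp)
    moreover have "B * t \<le> e / 3" using t B by (simp add: field_simps)
    ultimately have "norm (H t p x - p x) \<le> e / 3" by simp
    moreover have "norm (H t p x - H t f x) \<le> e / 3" by (rule H_dist_le[OF t(1) cp f p(2) x])
    moreover have "norm (p x - f x) \<le> e / 3" by (rule p(2)[OF x])
    moreover have "H t f x - f x = (H t p x - p x) + (p x - f x) - (H t p x - H t f x)" by simp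
    ultimately show "norm (H t f x - f x) \<le> e"
      using norm_triangle_ineq4[of "(H t p x - p x) + (p x - f x)" "H t p x - H t f x"]
        norm_triangle_ineq[of "H t p x - p x" "p x - f x"] by simp
  qed
qed

lemma supn_H_tendsto_0:
  assumes f: "continuous_on (alcove Sp) f"
  shows "((\<lambda>t. supn (alcove Sp) (\<lambda>x. H t f x - f x)) \<longlongrightarrow> 0) (at_right 0)"
proof (subst supn_tendsto_0_iff[OF compact_alcove])
  show "\<forall>\<^sub>F t in at_right 0. continuous_on (alcove Sp) (\<lambda>x. H t f x - f x)"
    using eventually_at_right_less[of 0] by eventually_elim (intro continuous_intros continuous_H f, simp)
  show "\<forall>e>0. \<forall>\<^sub>F t in at_right 0. \<forall>x\<in>alcove Sp. norm (H t f x - f x) \<le> e"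
  proof safe
    fix e :: real assume "e > 0"
    then obtain d where "d > 0" "\<And>t x. 0 \<le> t \<Longrightarrow> t \<le> d \<Longrightarrow> x \<in> alcove Sp \<Longrightarrow> norm (H t f x - f x) \<le> e"
      using H_strongly_continuous[OF f] by metis
    then show "\<forall>\<^sub>F t in at_right 0. \<forall>x\<in>alcove Sp. norm (H t f x - f x) \<le> e"
      unfolding eventually_at_right_field by (intro exI[of _ d]) auto
  qed
qed (use alcove_nonempty in auto)

section \<open>The generator and the core property\<close>

lemma generator_graph_iff:
  "(f, g) \<in> generator_graph (alcove Sp) H \<longleftrightarrow> continuous_on (alcove Sp) f \<and> continuous_on (alcove Sp) g \<and>
    (\<forall>e>0. \<forall>\<^sub>F t in at_right 0. \<forall>x\<in>alcove Sp. norm (H t f x - f x - of_real t * g x) \<le> e * t)"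
proof -
  have "((\<lambda>t. supn (alcove Sp) (\<lambda>x. (H t f x - f x) / of_real t - g x)) \<longlongrightarrow> 0) (at_right 0) \<longleftrightarrow>
    (\<forall>e>0. \<forall>\<^sub>F t in at_right 0. \<forall>x\<in>alcove Sp. norm (H t f x - f x - of_real t * g x) \<le> e * t)"
    if c: "continuous_on (alcove Sp) f" "continuous_on (alcove Sp) g"
  proof (subst supn_tendsto_0_iff[OF compact_alcove])
    show "\<forall>\<^sub>F t in at_right 0. continuous_on (alcove Sp) (\<lambda>x. (H t f x - f x) / of_real t - g x)"
      using eventually_at_right_less[of 0]
      by eventually_elim (intro continuous_intros continuous_H c, auto)
    have n: "norm ((H t f x - f x) / of_real t - g x) \<le> e \<longleftrightarrow> norm (H t f x - f x - of_real t * g x) \<le> e * t"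
      if t: "t > 0" for t x e
    proof -
      have "(H t f x - f x) / of_real t - g x = (H t f x - f x - of_real t * g x) / of_real t"
        using t by (simp add: diff_divide_distrib)
      then show ?thesis using t by (simp add: norm_divide divide_le_eq)
    qed
    have "(\<forall>\<^sub>F t in at_right 0. \<forall>x\<in>alcove Sp. norm ((H t f x - f x) / of_real t - g x) \<le> e)
      \<longleftrightarrow> (\<forall>\<^sub>F t in at_right 0. \<forall>x\<in>alcove Sp. norm (H t f x - f x - of_real t * g x) \<le> e * t)" for e
      by (rule eventually_cong) (use eventually_at_right_less[of 0] n in \<open>auto elim!: eventually_mono\<close>)
    then show "(\<forall>e>0. \<forall>\<^sub>F t in at_right 0. \<forall>x\<in>alcove Sp. norm ((H t f x - f x) / of_real t - g x) \<le> e)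
      \<longleftrightarrow> (\<forall>e>0. \<forall>\<^sub>F t in at_right 0. \<forall>x\<in>alcove Sp. norm (H t f x - f x - of_real t * g x) \<le> e * t)" by simp
  qed (use alcove_nonempty in auto)
  then show ?thesis by (auto simp: generator_graph_def)
qed

lemma closure_graph_iff:
  "(f, g) \<in> closure_graph (alcove Sp) (trig_W S Sp) L \<longleftrightarrow> continuous_on (alcove Sp) f \<and> continuous_on (alcove Sp) g \<and>
    (\<forall>e>0. \<exists>p\<in>trig_W S Sp. \<forall>x\<in>alcove Sp. norm (p x - f x) \<le> e \<and> norm (L p x - g x) \<le> e)"
proof -
  have "(\<exists>F. (\<forall>n. F n \<in> trig_W S Sp) \<and> (\<lambda>n. supn (alcove Sp) (\<lambda>x. F n x - f x)) \<longlonglongrightarrow> 0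
           \<and> (\<lambda>n. supn (alcove Sp) (\<lambda>x. L (F n) x - g x)) \<longlonglongrightarrow> 0) \<longleftrightarrow>
    (\<forall>e>0. \<exists>p\<in>trig_W S Sp. \<forall>x\<in>alcove Sp. norm (p x - f x) \<le> e \<and> norm (L p x - g x) \<le> e)" (is "?l \<longleftrightarrow> ?r")
    if c: "continuous_on (alcove Sp) f" "continuous_on (alcove Sp) g"
  proof -
    have ne: "alcove Sp \<noteq> {}" using alcove_nonempty by auto
    have 1: "(\<lambda>n. supn (alcove Sp) (\<lambda>x. F n x - f x)) \<longlonglongrightarrow> 0 \<longleftrightarrow>
        (\<forall>e>0. \<forall>\<^sub>F n in sequentially. \<forall>x\<in>alcove Sp. norm (F n x - f x) \<le> e)"
      "(\<lambda>n. supn (alcove Sp) (\<lambda>x. L (F n) x - g x)) \<longlonglongrightarrow> 0 \<longleftrightarrow>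
        (\<forall>e>0. \<forall>\<^sub>F n in sequentially. \<forall>x\<in>alcove Sp. norm (L (F n) x - g x) \<le> e)"
      if "\<forall>n. F n \<in> trig_W S Sp" for F
      by (rule supn_tendsto_0_iff[OF compact_alcove ne],
          intro always_eventually allI continuous_on_diff continuous_trig_W continuous_L c that[rule_format])+
    show ?thesis
    proof
      assume ?l
      then obtain F where F: "\<forall>n. F n \<in> trig_W S Sp" "(\<lambda>n. supn (alcove Sp) (\<lambda>x. F n x - f x)) \<longlonglongrightarrow> 0"
        "(\<lambda>n. supn (alcove Sp) (\<lambda>x. L (F n) x - g x)) \<longlonglongrightarrow> 0" by blast
      show ?r
      proof safe
        fix e :: real assume "e > 0"
        then have "\<forall>\<^sub>F n in sequentially. (\<forall>x\<in>alcove Sp. norm (F n x - f x) \<le> e) \<and> (\<forall>x\<in>alcove Sp. norm (L (F n) x - g x) \<le> e)"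
          using 1[OF F(1)] F(2,3) by (simp add: eventually_conj_iff)
        then obtain n where "(\<forall>x\<in>alcove Sp. norm (F n x - f x) \<le> e) \<and> (\<forall>x\<in>alcove Sp. norm (L (F n) x - g x) \<le> e)"
          using eventually_happens by fastforce
        then show "\<exists>p\<in>trig_W S Sp. \<forall>x\<in>alcove Sp. norm (p x - f x) \<le> e \<and> norm (L p x - g x) \<le> e"
          using F(1) by blast
      qed
    next
      assume ?r
      then have "\<exists>p\<in>trig_W S Sp. \<forall>x\<in>alcove Sp. norm (p x - f x) \<le> 1 / real (Suc n) \<and> norm (L p x - g x) \<le> 1 / real (Suc n)" for n
        by simp
      then obtain F where F: "\<forall>n. F n \<in> trig_W S Sp"
        "\<And>n x. x \<in> alcove Sp \<Longrightarrow> norm (F n x - f x) \<le> 1 / real (Suc n)"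
        "\<And>n x. x \<in> alcove Sp \<Longrightarrow> norm (L (F n) x - g x) \<le> 1 / real (Suc n)" by metis
      have "\<forall>\<^sub>F n in sequentially. 1 / real (Suc n) < e" if "e > 0" for e
        using tendstoD[OF LIMSEQ_inverse_real_of_nat that] by (simp add: inverse_eq_divide)
      then have "\<forall>e>0. \<forall>\<^sub>F n in sequentially. \<forall>x\<in>alcove Sp. norm (F n x - f x) \<le> e"
        "\<forall>e>0. \<forall>\<^sub>F n in sequentially. \<forall>x\<in>alcove Sp. norm (L (F n) x - g x) \<le> e"
        by (blast intro: eventually_mono order_trans[OF F(2)] order_trans[OF F(3)] less_imp_le)+
      then show ?l using 1[OF F(1)] F(1) by blast
    qed
  qed
  then show ?thesis by (auto simp: closure_graph_def)
qed

text \<open>Strong continuity at \<open>g\<close> fixes the range of \<open>t\<close>. For each such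
  \<open>t\<close> the approximating polynomial obeys the mean value estimate with
  \<open>v = g x\<close>, and its error is sent to 0 afterwards, which leaves the rate
  \<open>e * t\<close>.\<close>

lemma closure_subset_generator:
  assumes "(f, g) \<in> closure_graph (alcove Sp) (trig_W S Sp) L"
  shows "(f, g) \<in> generator_graph (alcove Sp) H"
  unfolding generator_graph_iff
proof safe
  show f: "continuous_on (alcove Sp) f" and g: "continuous_on (alcove Sp) g" using assms by (auto simp: closure_graph_iff)
  fix e :: real assume "e > 0"
  then obtain d where d: "d > 0" "\<And>t x. 0 \<le> t \<Longrightarrow> t \<le> d \<Longrightarrow> x \<in> alcove Sp \<Longrightarrow> norm (H t g x - g x) \<le> e"
    using H_strongly_continuous[OF g] by metis
  have "norm (H t f x - f x - of_real t * g x) \<le> e * t" if t: "0 < t" "t < d" and x: "x \<in> alcove Sp" for t x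
  proof (rule field_le_epsilon)
    fix \<eta> :: real assume eta: "\<eta> > 0"
    define \<delta> where "\<delta> = \<eta> / (2 + t)"
    have delta: "\<delta> > 0" "2 * \<delta> + \<delta> * t = \<eta>" using eta t by (auto simp: \<delta>_def divide_simps) (simp add: algebra_simps)
    then obtain p where p: "p \<in> trig_W S Sp" "\<And>x. x \<in> alcove Sp \<Longrightarrow> norm (p x - f x) \<le> \<delta>"
      "\<And>x. x \<in> alcove Sp \<Longrightarrow> norm (L p x - g x) \<le> \<delta>"
      using assms unfolding closure_graph_iff by meson
    have "norm (H t p x - p x - of_real t * g x) \<le> (e + \<delta>) * t"
    proof (rule H_increment_trig_W[OF p(1) less_imp_le[OF t(1)] x])
      fix s assume s: "0 \<le> s" "s \<le> t"
      have "norm (H s (L p) x - H s g x) \<le> \<delta>" by (rule H_dist_le[OF s(1) continuous_L[OF p(1)] g p(3) x])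
      moreover have "norm (H s g x - g x) \<le> e" by (rule d(2)[OF s(1) _ x]) (use s t in simp)
      ultimately show "norm (H s (L p) x - g x) \<le> e + \<delta>"
        using norm_triangle_ineq[of "H s (L p) x - H s g x" "H s g x - g x"] by simp
    qed
    moreover have "norm (H t p x - H t f x) \<le> \<delta>"
      by (rule H_dist_le[OF less_imp_le[OF t(1)] continuous_trig_W[OF p(1)] f p(2) x])
    moreover have "norm (p x - f x) \<le> \<delta>" by (rule p(2)[OF x])
    moreover have eq: "H t f x - f x - of_real t * g x = (H t p x - p x - of_real t * g x) + (p x - f x) - (H t p x - H t f x)" by simp
    ultimately have "norm (H t f x - f x - of_real t * g x) \<le> (e + \<delta>) * t + \<delta> + \<delta>"
      unfolding eq using norm_triangle_ineq4[of "(H t p x - p x - of_real t * g x) + (p x - f x)" "H t p x - H t f x"]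
        norm_triangle_ineq[of "H t p x - p x - of_real t * g x" "p x - f x"] by linarith
    also have "\<dots> = e * t + \<eta>" using delta(2) by (simp add: algebra_simps)
    finally show "norm (H t f x - f x - of_real t * g x) \<le> e * t + \<eta>" .
  qed
  then show "\<forall>\<^sub>F t in at_right 0. \<forall>x\<in>alcove Sp. norm (H t f x - f x - of_real t * g x) \<le> e * t"
    unfolding eventually_at_right_field using d(1) by blast
qed

text \<open>The generator of a contraction semigroup is dissipative: compare \<open>H t u\<close> with \<open>u\<close> at a maximum point of \<open>|u|\<close>.\<close>

lemma generator_dissipative:
  assumes "(u, w) \<in> generator_graph (alcove Sp) H" and B: "\<And>x. x \<in> alcove Sp \<Longrightarrow> norm (u x - w x) \<le> B"
    and x: "x \<in> alcove Sp"
  shows "norm (u x) \<le> B"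
proof -
  have u: "continuous_on (alcove Sp) u"
    and lim: "\<And>e. e > 0 \<Longrightarrow> \<forall>\<^sub>F t in at_right 0. \<forall>x\<in>alcove Sp. norm (H t u x - u x - of_real t * w x) \<le> e * t"
    using assms(1) by (auto simp: generator_graph_iff)
  obtain y where y: "y \<in> alcove Sp" "\<And>x. x \<in> alcove Sp \<Longrightarrow> norm (u x) \<le> norm (u y)"
    using continuous_attains_sup[OF compact_alcove, of "\<lambda>x. norm (u x)"] x continuous_on_norm[OF u] by blast
  have "norm (u y) \<le> B"
  proof (rule field_le_epsilon)
    fix e :: real assume "e > 0"
    then have "\<forall>\<^sub>F t in at_right 0. 0 < t \<and> (\<forall>x\<in>alcove Sp. norm (H t u x - u x - of_real t * w x) \<le> e * t)"
      using lim eventually_at_right_less[of 0] by (simp add: eventually_conj_iff)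
    then obtain t where t: "0 < t" "norm (H t u y - u y - of_real t * w y) \<le> e * t"
      using eventually_happens'[OF trivial_limit_at_right_real] y(1) by blast
    have h: "norm (H t u y) \<le> norm (u y)" by (rule H_norm_le[OF less_imp_le[OF t(1)] u y(2) y(1)])
    have "(1 + t) * norm (u y) = norm (of_real (1 + t) * u y)" using t by (simp only: norm_mult norm_of_real)
    also have "of_real (1 + t) * u y = H t u y - (H t u y - u y - of_real t * w y) + of_real t * (u y - w y)"
      by (simp add: algebra_simps)
    also have "norm \<dots> \<le> norm (H t u y) + norm (H t u y - u y - of_real t * w y) + norm (of_real t * (u y - w y))"
      using norm_triangle_ineq[of "H t u y - (H t u y - u y - of_real t * w y)" "of_real t * (u y - w y)"]
        norm_triangle_ineq4[of "H t u y" "H t u y - u y - of_real t * w y"] by linarith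
    also have "\<dots> \<le> norm (u y) + e * t + t * B"
      using h t B[OF y(1)] by (intro add_mono) (simp_all add: norm_mult)
    finally have "t * norm (u y) \<le> t * (B + e)" by (simp add: algebra_simps)
    then show "norm (u y) \<le> B + e" using t(1) by simp
  qed
  then show ?thesis using y(2)[OF x] by linarith
qed

lemma generator_diff:
  assumes "(f, g) \<in> generator_graph (alcove Sp) H" "(f', g') \<in> generator_graph (alcove Sp) H"
  shows "((\<lambda>x. f x - f' x), (\<lambda>x. g x - g' x)) \<in> generator_graph (alcove Sp) H"
  unfolding generator_graph_iff
proof safe
  have c: "continuous_on (alcove Sp) f" "continuous_on (alcove Sp) g" "continuous_on (alcove Sp) f'" "continuous_on (alcove Sp) g'"
    using assms by (auto simp: generator_graph_iff)
  then show "continuous_on (alcove Sp) (\<lambda>x. f x - f' x)" "continuous_on (alcove Sp) (\<lambda>x. g x - g' x)"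
    by (auto intro: continuous_on_diff)
  fix e :: real assume "e > 0"
  then have "\<forall>\<^sub>F t in at_right 0. \<forall>x\<in>alcove Sp. norm (H t f x - f x - of_real t * g x) \<le> e / 2 * t"
    "\<forall>\<^sub>F t in at_right 0. \<forall>x\<in>alcove Sp. norm (H t f' x - f' x - of_real t * g' x) \<le> e / 2 * t"
    using assms by (auto simp: generator_graph_iff dest!: spec[of _ "e / 2"])
  with eventually_at_right_less[of 0]
  show "\<forall>\<^sub>F t in at_right 0. \<forall>x\<in>alcove Sp. norm (H t (\<lambda>x. f x - f' x) x - (f x - f' x) - of_real t * (g x - g' x)) \<le> e * t"
  proof eventually_elim
    case (elim t)
    show ?case
    proof
      fix x assume x: "x \<in> alcove Sp"
      have "H t (\<lambda>x. f x - f' x) x - (f x - f' x) - of_real t * (g x - g' x)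
        = (H t f x - f x - of_real t * g x) - (H t f' x - f' x - of_real t * g' x)"
        using elim(1) by (simp add: H_diff c algebra_simps)
      also have "norm \<dots> \<le> e / 2 * t + e / 2 * t"
        using norm_triangle_ineq4[of "H t f x - f x - of_real t * g x" "H t f' x - f' x - of_real t * g' x"]
          bspec[OF elim(2) x] bspec[OF elim(3) x] by linarith
      finally show "norm (H t (\<lambda>x. f x - f' x) x - (f x - f' x) - of_real t * (g x - g' x)) \<le> e * t" by simp
    qed
  qed
qed

text \<open>The coefficient at \<open>l\<close> is divided by the eigenvalue
  \<open>1 + theta l\<close> of 1 - \<open>L_m\<close>, which is at least 1.\<close>

lemma ex_resolvent:
  assumes "h \<in> trig_W S Sp"
  obtains p where "p \<in> trig_W S Sp" "\<And>x. x \<in> alcove Sp \<Longrightarrow> L p x = p x - h x"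
proof -
  from assms obtain F c where F: "finite F" "F \<subseteq> Dom" "h = (\<lambda>x. \<Sum>l\<in>F. c l * PP l x)" by (rule trig_W_cases)
  define p where "p = (\<lambda>x. \<Sum>l\<in>F. (c l / of_real (1 + theta l)) * PP l x)"
  show ?thesis
  proof (rule that)
    show "p \<in> trig_W S Sp" unfolding p_def trig_W_PP by (rule fspI[OF F(1,2)])
    fix x assume x: "x \<in> alcove Sp"
    have "complex_of_real (1 + theta l) \<noteq> 0" if "l \<in> F" for l
      proof -
      have "0 \<le> theta l" using theta_ge[of l] that F(2) by (meson order_trans subsetD zero_le_power2)
      then show ?thesis unfolding of_real_eq_0_iff by simp
    qed
    then show "L p x = p x - h x"
      unfolding p_def HO_laplacian_A0_PP[OF F(1,2) x] F(3) sum_subtractf[symmetric]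
      by (intro sum.cong refl) (simp add: field_simps)
  qed
qed

text \<open>Approximate \<open>f - g\<close> by a polynomial \<open>h\<close> and solve p -
  \<open>L\<close> p = h. The pair of \<open>p\<close> lies in the generator, so dissipativity
  bounds \<open>p - f\<close> by the error of \<open>h\<close>, and \<open>L p - g\<close> is the
  difference of these two small terms.\<close>

lemma generator_subset_closure:
  assumes fg: "(f, g) \<in> generator_graph (alcove Sp) H"
  shows "(f, g) \<in> closure_graph (alcove Sp) (trig_W S Sp) L"
  unfolding closure_graph_iff
proof safe
  show c: "continuous_on (alcove Sp) f" "continuous_on (alcove Sp) g" using fg by (auto simp: generator_graph_iff)
  fix e :: real assume e: "e > 0"
  obtain h where h: "h \<in> trig_W S Sp" "\<And>x. x \<in> alcove Sp \<Longrightarrow> norm (h x - (f x - g x)) \<le> e / 2"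
    using trig_W_dense[OF continuous_on_diff[OF c], of "e / 2"] e by auto
  obtain p where p: "p \<in> trig_W S Sp" "\<And>x. x \<in> alcove Sp \<Longrightarrow> L p x = p x - h x" using ex_resolvent[OF h(1)] by blast
  have "(p, L p) \<in> closure_graph (alcove Sp) (trig_W S Sp) L"
    unfolding closure_graph_iff using continuous_trig_W[OF p(1)] continuous_L[OF p(1)] p(1) by force
  from generator_diff[OF closure_subset_generator[OF this] fg]
  have gd: "((\<lambda>x. p x - f x), (\<lambda>x. L p x - g x)) \<in> generator_graph (alcove Sp) H" .
  have pf: "norm (p x - f x) \<le> e / 2" if "x \<in> alcove Sp" for x
  proof (rule generator_dissipative[OF gd _ that])
    fix y assume y: "y \<in> alcove Sp"
    have "(p y - f y) - (L p y - g y) = h y - (f y - g y)" by (simp add: p(2)[OF y])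
    then show "norm ((p y - f y) - (L p y - g y)) \<le> e / 2" using h(2)[OF y] by (simp only:)
  qed
  show "\<exists>p\<in>trig_W S Sp. \<forall>x\<in>alcove Sp. norm (p x - f x) \<le> e \<and> norm (L p x - g x) \<le> e"
  proof (intro bexI[OF _ p(1)] ballI conjI)
    fix x assume x: "x \<in> alcove Sp"
    show "norm (p x - f x) \<le> e" using pf[OF x] e by simp
    have eq: "L p x - g x = (p x - f x) - (h x - (f x - g x))" by (simp add: p(2)[OF x])
    show "norm (L p x - g x) \<le> e"
      unfolding eq using norm_triangle_ineq4[of "p x - f x" "h x - (f x - g x)"] pf[OF x] h(2)[OF x] by linarith
  qed
qed

end

theorem theorem3p9:
  fixes S Sp :: "'a::euclidean_space set" and m :: "'a \<Rightarrow> real"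
  assumes "root_system S" and "positive_subsystem S Sp"
    and "\<forall>\<alpha>\<in>S. 0 \<le> m \<alpha>"
    and "\<forall>w\<in>weyl_group S. \<forall>\<alpha>\<in>S. m (w \<alpha>) = m \<alpha>"
  defines "A0 \<equiv> alcove Sp" and "H \<equiv> heat_sg S Sp m"
  shows
    \<comment> \<open>each H(t) is a linear operator on C(A0)\<close>
    "(\<forall>t\<ge>0. \<forall>f. continuous_on A0 f \<longrightarrow> continuous_on A0 (H t f))
   \<and> (\<forall>t\<ge>0. \<forall>f g a b. continuous_on A0 f \<longrightarrow> continuous_on A0 g \<longrightarrow>
        (\<forall>x\<in>A0. H t (\<lambda>y. a * f y + b * g y) x = a * H t f x + b * H t g x))
    \<comment> \<open>semigroup property\<close>
   \<and> (\<forall>s\<ge>0. \<forall>t\<ge>0. \<forall>f. continuous_on A0 f \<longrightarrow> (\<forall>x\<in>A0. H (s + t) f x = H s (H t f) x))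
    \<comment> \<open>strong continuity\<close>
   \<and> (\<forall>f. continuous_on A0 f \<longrightarrow>
        ((\<lambda>t. supn A0 (\<lambda>x. H t f x - f x)) \<longlongrightarrow> 0) (at_right 0))
    \<comment> \<open>contractivity\<close>
   \<and> (\<forall>t\<ge>0. \<forall>f. continuous_on A0 f \<longrightarrow> supn A0 (H t f) \<le> supn A0 f)
    \<comment> \<open>positivity\<close>
   \<and> (\<forall>t\<ge>0. \<forall>f. continuous_on A0 f \<longrightarrow> (\<forall>x\<in>A0. f x \<in> \<real> \<and> 0 \<le> Re (f x)) \<longrightarrow>
        (\<forall>x\<in>A0. H t f x \<in> \<real> \<and> 0 \<le> Re (H t f x)))
    \<comment> \<open>the generator is the closure of L_m with domain T^W\<close>
   \<and> generator_graph A0 H = closure_graph A0 (trig_W S Sp) (HO_laplacian_A0 Sp m)"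
proof -
  interpret rd: root_data S Sp m by (rule root_data.intro) (use assms(1-4) in auto)
  have contr: "supn (alcove Sp) (heat_sg S Sp m t f) \<le> supn (alcove Sp) f"
    if "t \<ge> 0" "continuous_on (alcove Sp) f" for t f
    by (rule supn_le) (use rd.alcove_nonempty rd.H_norm_le[OF that norm_le_supn[OF rd.compact_alcove that(2)]] in auto)
  have gen: "generator_graph (alcove Sp) (heat_sg S Sp m) = closure_graph (alcove Sp) (trig_W S Sp) (HO_laplacian_A0 Sp m)"
    using rd.closure_subset_generator rd.generator_subset_closure by (intro set_eqI iffI) (metis surj_pair)+
  show ?thesis
    unfolding A0_def H_def
    by (intro conjI allI impI ballI rd.continuous_H rd.H_linear rd.H_semigroup rd.supn_H_tendsto_0 contr gen
        rd.H_real_nonneg[THEN conjunct1] rd.H_real_nonneg[THEN conjunct2]) auto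
qed

end
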